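(* For every PPT state $\rho$, used both as the state $\rho_{C_AA}$ shared by Charlie and Alice and as the state $\rho_{C_BB}$ shared by Charlie and Bob, $$K_{A\leftarrow C\rightarrow B}(\rho\otimes\rho)\le4E_{sq}(\rho^\Gamma).$$
   Context: All systems are finite-dimensional; $\log$ is base 2. Charlie holds $C=C_AC_B$; $\Gamma$ is the partial transpose on Charlie's system. PPT means that the partial transpose is positive semidefinite. $\alpha\approx_\epsilon\beta$ means $\|\alpha-\beta\|_1\le\epsilon$. Private states: an $m$-bit private state $\gamma_m$ is a bipartite state (cut $AA':BB'$), with key systems $A,B$ of dimension $2^m$ and shield systems $A',B'$ of arbitrary finite dimension, of the form $\gamma_m=2^{-m}\sum_{i,j=0}^{2^m-1}|ii\rangle\langle jj|_{AB}\otimes U_i\,\sigma_{A'B'}\,U_j^\dagger$ with $\sigma_{A'B'}$ a state and $U_i$ unitaries. One-way quantum key repeater rate: $$K_{A\leftarrow C\rightarrow B}(\rho_{AC_A}\otimes\tilde\rho_{C_BB})=\inf_{\epsilon>0}\limsup_{n\to\infty}\sup_{\Lambda_n,\gamma_m}\Big\{\tfrac mn:\ \mathrm{Tr}_C\Lambda_n\big((\rho_{AC_A}\otimes\tilde\rho_{C_BB})^{\otimes n}\big)\approx_\epsilon\gamma_m\Big\},$$ with $\Lambda_n$ ranging over tripartite LOCC protocols in which all classical communication is one-way from Charlie to Alice and to Bob, and $\gamma_m$ over $m$-bit private states between Alice and Bob. Squashed entanglement: $E_{sq}(\rho_{AB})=\inf_{\rho_{ABE}}\frac12I(A:B|E)_{\rho_{ABE}}$,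 over all extensions $\rho_{ABE}$ of $\rho_{AB}$, where $I(A:B|E)$ is the quantum conditional mutual information. *)

theory Defs
  imports
    "HOL-Library.Extended_Real"
    "Jordan_Normal_Form.Schur_Decomposition"
    "Jordan_Normal_Form.Char_Poly"
begin

text \<open>
  An operator on a composite system with subsystem dimensions \<open>[d\<^sub>0, \<dots>, d\<^sub>k]\<close> is a complex
  matrix of size \<open>d\<^sub>0 \<cdots> d\<^sub>k\<close> whose rows and columns are numbered in mixed radix, the first
  subsystem being the most significant digit.  The dimensions are passed explicitly.
\<close>

section \<open>Tensor products and subsystems\<close>

fun index_enc :: "nat list \<Rightarrow> nat list \<Rightarrow> nat" where
  "index_enc (d # ds) (x # xs) = x * prod_list ds + index_enc ds xs"
| "index_enc _ _ = 0"

fun index_dec :: "nat list \<Rightarrow> nat \<Rightarrow> nat list" where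
  "index_dec [] i = []"
| "index_dec (d # ds) i = (i div prod_list ds) # index_dec ds (i mod prod_list ds)"

definition kron :: "complex mat \<Rightarrow> complex mat \<Rightarrow> complex mat" (infixr \<open>\<otimes>\<^sub>m\<close> 71) where
  "A \<otimes>\<^sub>m B = mat (dim_row A * dim_row B) (dim_col A * dim_col B)
     (\<lambda>(i, j). A $$ (i div dim_row B, j div dim_col B) * B $$ (i mod dim_row B, j mod dim_col B))"

definition kron_power :: "complex mat \<Rightarrow> nat \<Rightarrow> complex mat" where
  "kron_power A n = (((\<otimes>\<^sub>m) A) ^^ n) (1\<^sub>m 1)"

definition mat_sum :: "nat \<Rightarrow> complex mat list \<Rightarrow> complex mat" where
  "mat_sum n As = foldr (+) As (0\<^sub>m n n)"

text \<open>
  Here \<open>p\<close> lists the subsystems in their new order: position \<open>k\<close> of the result holds the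
  subsystem that was at position \<open>p ! k\<close>.
\<close>

definition permute_systems :: "nat list \<Rightarrow> nat list \<Rightarrow> complex mat \<Rightarrow> complex mat" where
  "permute_systems ds p M =
     (let old_index = (\<lambda>i.
        let ys = index_dec (map ((!) ds) p) i
        in index_enc ds (map (\<lambda>l. the (map_of (zip p ys) l)) [0..<length ds]))
      in mat (prod_list ds) (prod_list ds) (\<lambda>(i, j). M $$ (old_index i, old_index j)))"

definition trace_snd :: "nat \<Rightarrow> nat \<Rightarrow> complex mat \<Rightarrow> complex mat" where
  "trace_snd d e M = mat d d (\<lambda>(i, j). \<Sum>k<e. M $$ (i * e + k, j * e + k))"

text \<open>
  The subsystems in \<open>ks\<close> are kept, in the order listed; all others are traced out.
\<close>

definition marginal :: "nat list \<Rightarrow> nat list \<Rightarrow> complex mat \<Rightarrow> complex mat" where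
  "marginal ds ks M =
     (let rest = filter (\<lambda>l. l \<notin> set ks) [0..<length ds]
      in trace_snd (prod_list (map ((!) ds) ks)) (prod_list (map ((!) ds) rest))
           (permute_systems ds (ks @ rest) M))"

definition partial_transpose_fst :: "nat \<Rightarrow> nat \<Rightarrow> complex mat \<Rightarrow> complex mat" where
  "partial_transpose_fst d e M = mat (d * e) (d * e)
     (\<lambda>(i, j). M $$ ((j div e) * e + i mod e, (i div e) * e + j mod e))"


section \<open>States, entropy and trace norm\<close>

definition mat_trace :: "complex mat \<Rightarrow> complex" where
  "mat_trace A = (\<Sum>i<dim_row A. A $$ (i, i))"

definition psd :: "nat \<Rightarrow> complex mat \<Rightarrow> bool" where
  "psd d A \<longleftrightarrow> A \<in> carrier_mat d d \<and> mat_adjoint A = A \<and>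
     (\<forall>v \<in> carrier_vec d. 0 \<le> Re ((A *\<^sub>v v) \<bullet>c v))"

definition is_state :: "nat \<Rightarrow> complex mat \<Rightarrow> bool" where
  "is_state d \<rho> \<longleftrightarrow> psd d \<rho> \<and> mat_trace \<rho> = 1"

definition is_PPT_state :: "nat \<Rightarrow> nat \<Rightarrow> complex mat \<Rightarrow> bool" where
  "is_PPT_state d e \<rho> \<longleftrightarrow> is_state (d * e) \<rho> \<and> psd (d * e) (partial_transpose_fst d e \<rho>)"

definition is_unitary :: "nat \<Rightarrow> complex mat \<Rightarrow> bool" where
  "is_unitary d U \<longleftrightarrow> U \<in> carrier_mat d d \<and> mat_adjoint U * U = 1\<^sub>m d \<and> U * mat_adjoint U = 1\<^sub>m d"

text \<open>
  The multiset \<open>proots (char_poly A)\<close> consists of the eigenvalues of \<open>A\<close>, counted with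
  multiplicity.
\<close>

definition vn_entropy :: "complex mat \<Rightarrow> real" where
  "vn_entropy \<rho> = - (\<Sum>x \<in># proots (char_poly \<rho>). Re x * log 2 (Re x))"

definition trace_norm :: "complex mat \<Rightarrow> real" where
  "trace_norm A = (\<Sum>x \<in># proots (char_poly (mat_adjoint A * A)). sqrt (Re x))"


section \<open>Squashed entanglement\<close>

definition cond_mutual_info :: "nat \<Rightarrow> nat \<Rightarrow> nat \<Rightarrow> complex mat \<Rightarrow> real" where
  "cond_mutual_info dA dB dE \<rho> =
     vn_entropy (marginal [dA, dB, dE] [0, 2] \<rho>) + vn_entropy (marginal [dA, dB, dE] [1, 2] \<rho>)
     - vn_entropy \<rho> - vn_entropy (marginal [dA, dB, dE] [2] \<rho>)"

definition squashed_entanglement :: "nat \<Rightarrow> nat \<Rightarrow> complex mat \<Rightarrow> ereal" where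
  "squashed_entanglement dA dB \<rho> =
     Inf {ereal (1/2 * cond_mutual_info dA dB dE \<omega>) | dE \<omega>.
            is_state (dA * dB * dE) \<omega> \<and> marginal [dA, dB, dE] [0, 1] \<omega> = \<rho>}"


section \<open>Private states\<close>

definition ketbra :: "nat \<Rightarrow> nat \<Rightarrow> nat \<Rightarrow> complex mat" where
  "ketbra d i j = mat d d (\<lambda>(k, l). if k = i \<and> l = j then 1 else 0)"

text \<open>
  The defining formula is written on \<open>A B A' B'\<close> and then regrouped along the cut
  \<open>A A' : B B'\<close>.  The unitaries act jointly on both shield systems.
\<close>

definition is_private_state :: "nat \<Rightarrow> nat \<Rightarrow> nat \<Rightarrow> complex mat \<Rightarrow> bool" where
  "is_private_state m sA sB \<gamma> \<longleftrightarrow>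
     (\<exists>\<sigma> U. is_state (sA * sB) \<sigma> \<and> (\<forall>i<2 ^ m. is_unitary (sA * sB) (U i)) \<and>
        \<gamma> = permute_systems [2 ^ m, 2 ^ m, sA, sB] [0, 2, 1, 3]
              (1 / 2 ^ m \<cdot>\<^sub>m mat_sum (2 ^ m * 2 ^ m * (sA * sB))
                 [(ketbra (2 ^ m) i j \<otimes>\<^sub>m ketbra (2 ^ m) i j) \<otimes>\<^sub>m (U i * \<sigma> * mat_adjoint (U j)).
                    i \<leftarrow> [0..<2 ^ m], j \<leftarrow> [0..<2 ^ m]]))"


section \<open>One-way LOCC and the key repeater rate\<close>

text \<open>Completely positive maps are given by lists of Kraus operators.\<close>

definition kraus_map :: "nat \<Rightarrow> complex mat list \<Rightarrow> complex mat \<Rightarrow> complex mat" where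
  "kraus_map e Ks X = mat_sum e (map (\<lambda>K. K * X * mat_adjoint K) Ks)"

definition is_channel :: "nat \<Rightarrow> nat \<Rightarrow> complex mat list \<Rightarrow> bool" where
  "is_channel d e Ks \<longleftrightarrow> (\<forall>K \<in> set Ks. K \<in> carrier_mat e d) \<and>
     mat_sum d (map (\<lambda>K. mat_adjoint K * K) Ks) = 1\<^sub>m d"

text \<open>
  A protocol has one entry \<open>(As, Cs, Bs)\<close> for each classical message of Charlie: the branch
  \<open>Cs\<close> of Charlie's instrument that yields the message, and the channels \<open>As\<close> and \<open>Bs\<close> that
  Alice and Bob apply on receiving it.  Messages that differ for Alice and Bob are covered by
  taking the pair of them as the message.
\<close>

type_synonym protocol = "(complex mat list \<times> complex mat list \<times> complex mat list) list"

definition is_oneway_LOCC ::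
  "nat \<Rightarrow> nat \<Rightarrow> nat \<Rightarrow> nat \<Rightarrow> nat \<Rightarrow> nat \<Rightarrow> protocol \<Rightarrow> bool" where
  "is_oneway_LOCC dA dC dB eA eC eB P \<longleftrightarrow>
     (\<forall>(As, Cs, Bs) \<in> set P. is_channel dA eA As \<and> is_channel dB eB Bs) \<and>
     is_channel dC eC (concat (map (\<lambda>(As, Cs, Bs). Cs) P))"

definition apply_protocol ::
  "nat \<Rightarrow> nat \<Rightarrow> nat \<Rightarrow> protocol \<Rightarrow> complex mat \<Rightarrow> complex mat" where
  "apply_protocol eA eC eB P X =
     kraus_map (eA * eC * eB) [A \<otimes>\<^sub>m C \<otimes>\<^sub>m B. (As, Cs, Bs) \<leftarrow> P, A \<leftarrow> As, C \<leftarrow> Cs, B \<leftarrow> Bs] X"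

text \<open>
  The \<open>n\<close>-fold tensor power of an operator on \<open>A C B\<close>, regrouped as an operator on
  \<open>A\<^sup>n C\<^sup>n B\<^sup>n\<close>.
\<close>

definition tripartite_power ::
  "nat \<Rightarrow> nat \<Rightarrow> nat \<Rightarrow> complex mat \<Rightarrow> nat \<Rightarrow> complex mat" where
  "tripartite_power dA dC dB \<rho> n =
     permute_systems (concat (replicate n [dA, dC, dB]))
       (map (\<lambda>k. 3 * k) [0..<n] @ map (\<lambda>k. 3 * k + 1) [0..<n] @ map (\<lambda>k. 3 * k + 2) [0..<n])
       (kron_power \<rho> n)"

definition key_distillable ::
  "nat \<Rightarrow> nat \<Rightarrow> nat \<Rightarrow> complex mat \<Rightarrow> real \<Rightarrow> nat \<Rightarrow> nat \<Rightarrow> bool" where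
  "key_distillable dA dC dB \<rho> \<epsilon> n m \<longleftrightarrow>
     (\<exists>P \<gamma> sA sB eC.
        is_oneway_LOCC (dA ^ n) (dC ^ n) (dB ^ n) (2 ^ m * sA) eC (2 ^ m * sB) P \<and>
        is_private_state m sA sB \<gamma> \<and>
        trace_norm (marginal [2 ^ m * sA, eC, 2 ^ m * sB] [0, 2]
            (apply_protocol (2 ^ m * sA) eC (2 ^ m * sB) P (tripartite_power dA dC dB \<rho> n))
          - \<gamma>) \<le> \<epsilon>)"

definition key_repeater_rate :: "nat \<Rightarrow> nat \<Rightarrow> nat \<Rightarrow> complex mat \<Rightarrow> ereal" where
  "key_repeater_rate dA dC dB \<rho> =
     (INF \<epsilon> \<in> {0<..}. limsup (\<lambda>n.
        Sup {ereal (real m / real n) | m. key_distillable dA dC dB \<rho> \<epsilon> n m}))"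

end

theory Submission
  imports Defs
begin

text \<open>
  Once Charlie is traced out, the partial transpose on his side only replaces his Kraus operators
  by their complex conjugates.  A one-way protocol therefore distils from copies of
  \<open>\<rho>\<^sup>\<Gamma> \<otimes> \<rho>\<^sup>\<Gamma>\<close>, which is a state because \<open>\<rho>\<close> is PPT, the same key as from copies of
  \<open>\<rho> \<otimes> \<rho>\<close>.  Let \<open>\<omega>\<close> on \<open>C\<^sub>B B E\<close> extend \<open>\<rho>\<^sup>\<Gamma>\<close>.  By strong subadditivity, the information
  \<open>I(A C : B | E)\<close> of the \<open>n\<close>-fold joint state, which equals \<open>n I(C\<^sub>B : B | E)\<close> of \<open>\<omega>\<close> by additivity, does not
  increase when Charlie's message is handed to everybody and Alice and Bob measure.  If the output
  is \<open>\<epsilon>\<close>-close to a private state, then their key is almost uniform and almost perfectly correlated,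
  and untwisting the shield shows that its coherent version is close to a maximally entangled state
  and so nearly decoupled from \<open>E\<close>; hence the measured information is at least \<open>(1 - 7\<epsilon>) m - 4\<close>.
  In the limit the rate is at most \<open>I(C\<^sub>B : B | E)\<close>, which gives even
  \<open>2 E\<^sub>s\<^sub>q(\<rho>\<^sup>\<Gamma>)\<close> as an upper bound.
\<close>

section \<open>Spectral decomposition and entropy\<close>

text \<open>Operators are treated as kernels on arbitrary finite index sets: a composite system is a
  Cartesian product, regrouping is a bijection, and mixed-radix numbers occur only where matrices
  are converted. All entropy inequalities are reduced to strong subadditivity, which is itself
  derived from a variational formula for quadratic divergences whose weighted integral is the
  relative entropy. Two obstacles shape the key estimate. The dimensions of the shield and of
  \<open>E\<close> are not bounded in terms of the key, so continuity bounds for entropies on these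
  systems would be useless. Hence the trace distance is used only through expectations of
  projections, and the only entropies estimated numerically live on the key, where errors cost a
  multiple of \<open>log 2 N\<close> with \<open>N\<close> the key dimension. Secondly, untwisting
  is a joint unitary of Alice and Bob, which they cannot perform. But it is controlled by Alice's
  key, so it leaves the joint state of the measured keys and \<open>E\<close> unchanged and may be
  used in the analysis alone.\<close>

definition isometric :: "'a set \<Rightarrow> 'k set \<Rightarrow> ('a \<Rightarrow> 'k \<Rightarrow> complex) \<Rightarrow> bool" where
  "isometric I K u \<longleftrightarrow> (\<forall>k\<in>K. \<forall>l\<in>K. (\<Sum>i\<in>I. cnj (u i k) * u i l) = of_bool (k = l))"

definition unitary_on :: "'a set \<Rightarrow> 'k set \<Rightarrow> ('a \<Rightarrow> 'k \<Rightarrow> complex) \<Rightarrow> bool" where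
  "unitary_on I K u \<longleftrightarrow> isometric I K u \<and>
     (\<forall>i\<in>I. \<forall>j\<in>I. (\<Sum>k\<in>K. u i k * cnj (u j k)) = of_bool (i = j))"

definition spectral_form :: "'a set \<Rightarrow> 'k set \<Rightarrow> ('a \<Rightarrow> 'a \<Rightarrow> complex) \<Rightarrow> ('a \<Rightarrow> 'k \<Rightarrow> complex) \<Rightarrow> ('k \<Rightarrow> real) \<Rightarrow> bool" where
  "spectral_form I K \<rho> u d \<longleftrightarrow> (\<forall>i\<in>I. \<forall>j\<in>I. \<rho> i j = (\<Sum>k\<in>K. of_real (d k) * u i k * cnj (u j k)))"

definition hermitian_on :: "'a set \<Rightarrow> ('a \<Rightarrow> 'a \<Rightarrow> complex) \<Rightarrow> bool" where
  "hermitian_on I \<rho> \<longleftrightarrow> (\<forall>i\<in>I. \<forall>j\<in>I. \<rho> j i = cnj (\<rho> i j))"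

lemma sum_of_bool_mult [simp]:
  fixes f :: "'a \<Rightarrow> 'b::semiring_1"
  assumes "finite I"
  shows "(\<Sum>i\<in>I. of_bool (i = j) * f i) = (if j \<in> I then f j else 0)"
    "(\<Sum>i\<in>I. of_bool (j = i) * f i) = (if j \<in> I then f j else 0)"
    "(\<Sum>i\<in>I. f i * of_bool (i = j)) = (if j \<in> I then f j else 0)"
    "(\<Sum>i\<in>I. f i * of_bool (j = i)) = (if j \<in> I then f j else 0)"
  using assms by (auto simp: of_bool_def if_distrib if_distribR cong: if_cong)

lemma mat_adjoint_index [simp]:
  "i < dim_col A \<Longrightarrow> j < dim_row A \<Longrightarrow> mat_adjoint A $$ (i, j) = conjugate (A $$ (j, i))"
  "dim_row (mat_adjoint A) = dim_col A" "dim_col (mat_adjoint A) = dim_row A"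
  by (auto simp: mat_adjoint_def mat_of_rows_def)

definition spectral_sum :: "(real \<Rightarrow> real) \<Rightarrow> complex mat \<Rightarrow> real" where
  "spectral_sum f A = (\<Sum>x\<in>#proots (char_poly A). f (Re x))"

text \<open>The block matrices \<open>?M1\<close> and \<open>?M2\<close> are conjugate by the
  unipotent \<open>?P\<close>, and their characteristic polynomials split along the zero blocks. The
  two powers account for the different numbers of zero eigenvalues.\<close>

lemma char_poly_mult_swap:
  fixes A B :: "complex mat"
  assumes A: "A \<in> carrier_mat n m" and B: "B \<in> carrier_mat m n"
  shows "[:0, 1:] ^ m * char_poly (A * B) = [:0, 1:] ^ n * char_poly (B * A)"
proof -
  let ?M1 = "four_block_mat (A * B) (0\<^sub>m n m) B (0\<^sub>m m m)"
  let ?M2 = "four_block_mat (0\<^sub>m n n) (0\<^sub>m n m) B (B * A)"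
  let ?P = "four_block_mat (1\<^sub>m n) A (0\<^sub>m m n) (1\<^sub>m m)"
  let ?Q = "four_block_mat (1\<^sub>m n) (- A) (0\<^sub>m m n) (1\<^sub>m m)"
  have PQ: "?P * ?Q = 1\<^sub>m (n + m)" "?Q * ?P = 1\<^sub>m (n + m)"
  proof -
    have "?P * ?Q = four_block_mat (1\<^sub>m n * 1\<^sub>m n + A * 0\<^sub>m m n) (1\<^sub>m n * (- A) + A * 1\<^sub>m m)
        (0\<^sub>m m n * 1\<^sub>m n + 1\<^sub>m m * 0\<^sub>m m n) (0\<^sub>m m n * (- A) + 1\<^sub>m m * 1\<^sub>m m)"
      using A by (intro mult_four_block_mat) auto
    also have "\<dots> = 1\<^sub>m (n + m)" using A by (intro eq_matI) auto
    finally show "?P * ?Q = 1\<^sub>m (n + m)" .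
    have "?Q * ?P = four_block_mat (1\<^sub>m n * 1\<^sub>m n + - A * 0\<^sub>m m n) (1\<^sub>m n * A + - A * 1\<^sub>m m)
        (0\<^sub>m m n * 1\<^sub>m n + 1\<^sub>m m * 0\<^sub>m m n) (0\<^sub>m m n * A + 1\<^sub>m m * 1\<^sub>m m)"
      using A by (intro mult_four_block_mat) auto
    also have "\<dots> = 1\<^sub>m (n + m)" using A by (intro eq_matI) auto
    finally show "?Q * ?P = 1\<^sub>m (n + m)" .
  qed
  have 1: "?M1 * ?P = four_block_mat (A * B) (A * B * A) B (B * A)"
    using A B by (subst mult_four_block_mat[where ?nr1.0=n and ?n1.0=n and ?nr2.0=m and ?n2.0=m and ?nc1.0=n and ?nc2.0=m]; auto)
  have 2: "?P * ?M2 = four_block_mat (A * B) (A * B * A) B (B * A)"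
    using A B assoc_mult_mat[OF A B A] by (subst mult_four_block_mat[where ?nr1.0=n and ?n1.0=n and ?nr2.0=m and ?n2.0=m and ?nc1.0=n and ?nc2.0=m]; auto)
  have c: "?M1 \<in> carrier_mat (n+m) (n+m)" "?M2 \<in> carrier_mat (n+m) (n+m)"
     "?P \<in> carrier_mat (n+m) (n+m)" "?Q \<in> carrier_mat (n+m) (n+m)"
    using A B by auto
  have "?M1 = ?M1 * (?P * ?Q)" unfolding PQ by (rule right_mult_one_mat[OF c(1), symmetric])
  also have "\<dots> = ?M1 * ?P * ?Q" by (rule assoc_mult_mat[OF c(1,3,4), symmetric])
  also have "\<dots> = ?P * ?M2 * ?Q" unfolding 1 2 ..
  finally have "similar_mat ?M1 ?M2"
    unfolding similar_mat_def similar_mat_wit_def Let_def using c PQ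
    by (metis carrier_matD(1) insert_subset empty_subsetI)
  hence e: "char_poly ?M1 = char_poly ?M2" by (rule char_poly_similar)
  have z: "char_poly (0\<^sub>m k k :: complex mat) = [:0, 1:] ^ k" for k
    by (subst char_poly_upper_triangular[where n=k])
      (auto simp: diag_mat_def map_replicate_const[symmetric] map_replicate_trivial
        intro!: arg_cong[of _ _ prod_list] simp del: prod_list_replicate simp: prod_list_replicate[symmetric] list_eq_iff_nth_eq)
  have M1: "char_poly ?M1 = char_poly (A * B) * char_poly (0\<^sub>m m m :: complex mat)"
  proof -
    have "char_poly_matrix ?M1 = four_block_mat (char_poly_matrix (A*B)) (0\<^sub>m n m) (map_mat (\<lambda>x. [:-x:]) B) (char_poly_matrix (0\<^sub>m m m))"
      using A B by (intro eq_matI) (auto simp: char_poly_matrix_def)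
    then show ?thesis unfolding char_poly_def using A B
      by (simp add: det_four_block_mat_upper_right_zero[of _ n _ m])
  qed
  have M2: "char_poly ?M2 = char_poly (0\<^sub>m n n :: complex mat) * char_poly (B * A)"
  proof -
    have "char_poly_matrix ?M2 = four_block_mat (char_poly_matrix (0\<^sub>m n n)) (0\<^sub>m n m) (map_mat (\<lambda>x. [:-x:]) B) (char_poly_matrix (B * A))"
      using A B by (intro eq_matI) (auto simp: char_poly_matrix_def)
    then show ?thesis unfolding char_poly_def using A B
      by (simp add: det_four_block_mat_upper_right_zero[of _ n _ m])
  qed
  show ?thesis using e M1 M2 z by (simp add: mult.commute)
qed

text \<open>The two spectra differ only by zeros, which \<open>f 0 = 0\<close> makes invisible.
  Rectangular factors are allowed, and this is how entropies and trace norms are computed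
  below.\<close>

lemma spectral_sum_swap:
  fixes A B :: "complex mat"
  assumes A: "A \<in> carrier_mat n m" and B: "B \<in> carrier_mat m n" and f: "f 0 = 0"
  shows "spectral_sum f (A * B) = spectral_sum f (B * A)"
proof -
  have nz: "char_poly (A * B) \<noteq> 0" "char_poly (B * A) \<noteq> 0"
    using degree_monic_char_poly[of "A*B" n] degree_monic_char_poly[of "B*A" m] A B by auto
  have p: "proots ([:0, 1::complex:] ^ k) = replicate_mset k 0" for k
    using proots_power[of "[:0,1::complex:]" k] proots_linear_factor[of "0::complex"]
    by simp
  have "(\<Sum>x\<in>#proots ([:0, 1:] ^ m * char_poly (A * B)). f (Re x)) = spectral_sum f (A * B)"
    using nz by (subst proots_mult) (auto simp: p f spectral_sum_def)
  moreover have "(\<Sum>x\<in>#proots ([:0, 1:] ^ n * char_poly (B * A)). f (Re x)) = spectral_sum f (B * A)"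
    using nz by (subst proots_mult) (auto simp: p f spectral_sum_def)
  ultimately show ?thesis using char_poly_mult_swap[OF A B] by metis
qed

lemma spectral_sum_diagonal:
  "spectral_sum f (mat n n (\<lambda>(i, j). of_bool (i = j) * of_real (d i))) = (\<Sum>i<n. f (d i))"
proof -
  let ?D = "mat n n (\<lambda>(i, j). of_bool (i = j) * of_real (d i)) :: complex mat"
  have "char_poly ?D = (\<Prod>a\<leftarrow>diag_mat ?D. [:- a, 1:])"
    by (intro char_poly_upper_triangular[where n=n]) auto
  also have "diag_mat ?D = map (\<lambda>i. of_real (d i)) [0..<n]"
    by (auto simp: diag_mat_def)
  also have "(\<Prod>a\<leftarrow>map (\<lambda>i. of_real (d i)) [0..<n]. [:- a, 1:]) = (\<Prod>i<n. [:- complex_of_real (d i), 1:])"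
    by (simp add: o_def prod.list_conv_set_nth atLeast0LessThan)
  finally have "proots (char_poly ?D) = (\<Sum>i<n. {#of_real (d i)#})"
    by (simp add: proots_prod)
  moreover have "(\<Sum>x\<in>#(\<Sum>i<n. {#complex_of_real (d i)#}). f (Re x)) = (\<Sum>i<n. f (d i))" for n
    by (induction n) auto
  ultimately show ?thesis by (simp add: spectral_sum_def)
qed

text \<open>An arbitrary enumeration, used only to form a matrix that has a characteristic
  polynomial; \<open>ent_reindex\<close> shows that the entropy does not depend on it.\<close>

definition kernel_enum :: "'a set \<Rightarrow> nat \<Rightarrow> 'a" where
  "kernel_enum I = (SOME f. bij_betw f {..<card I} I)"

lemma bij_kernel_enum: "finite I \<Longrightarrow> bij_betw (kernel_enum I) {..<card I} I"
  unfolding kernel_enum_def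
  using someI_ex[OF ex_bij_betw_nat_finite[of I]] by (simp add: atLeast0LessThan)

definition kernel_mat :: "'a set \<Rightarrow> 'b set \<Rightarrow> ('a \<Rightarrow> 'b \<Rightarrow> complex) \<Rightarrow> complex mat" where
  "kernel_mat I J \<rho> = mat (card I) (card J) (\<lambda>(i, j). \<rho> (kernel_enum I i) (kernel_enum J j))"

definition entropy_fun :: "real \<Rightarrow> real" where
  "entropy_fun x = - (x * log 2 x)"

definition ent :: "'a set \<Rightarrow> ('a \<Rightarrow> 'a \<Rightarrow> complex) \<Rightarrow> real" where
  "ent I \<rho> = spectral_sum entropy_fun (kernel_mat I I \<rho>)"

lemma entropy_fun_0 [simp]: "entropy_fun 0 = 0"
  by (simp add: entropy_fun_def)

lemma vn_entropy_eq: "vn_entropy \<rho> = spectral_sum entropy_fun \<rho>"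
proof -
  have "- (\<Sum>x\<in>#M. Re x * log 2 (Re x)) = (\<Sum>x\<in>#M. - (Re x * log 2 (Re x)))" for M
    by (induction M) auto
  then show ?thesis by (simp add: vn_entropy_def spectral_sum_def entropy_fun_def)
qed

lemma ent_cong:
  assumes "finite I" "\<And>i j. i \<in> I \<Longrightarrow> j \<in> I \<Longrightarrow> \<rho> i j = \<sigma> i j"
  shows "ent I \<rho> = ent I \<sigma>"
proof -
  have "kernel_mat I I \<rho> = kernel_mat I I \<sigma>"
    using assms(2) bij_betwE[OF bij_kernel_enum[OF assms(1)]]
    by (auto simp: kernel_mat_def intro!: eq_matI)
  then show ?thesis by (simp add: ent_def)
qed

lemma sum_kernel_enum: "finite I \<Longrightarrow> (\<Sum>i<card I. f (kernel_enum I i)) = sum f I"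
  using sum.reindex_bij_betw[OF bij_kernel_enum] .

text \<open>If \<open>B\<close> is the adjoint of \<open>A\<close>, this is the equality of the
  entropies of the two marginals of a pure state.\<close>

lemma ent_swap:
  fixes A :: "'a \<Rightarrow> 'b \<Rightarrow> complex" and B :: "'b \<Rightarrow> 'a \<Rightarrow> complex"
  assumes [simp]: "finite I" "finite J"
  shows "ent I (\<lambda>i i'. \<Sum>j\<in>J. A i j * B j i') = ent J (\<lambda>j j'. \<Sum>i\<in>I. B j i * A i j')"
proof -
  have *: "kernel_mat I I (\<lambda>i i'. \<Sum>j\<in>J. A i j * B j i') = kernel_mat I J A * kernel_mat J I B"
    if "finite I" "finite J" for I :: "'c set" and J :: "'d set" and A B
    using that by (intro eq_matI) (auto simp: kernel_mat_def scalar_prod_def atLeast0LessThan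
        sum_kernel_enum[of _ "\<lambda>j. A _ j * B j _"])
  show ?thesis unfolding ent_def by (subst (1 2) *) (auto intro!: spectral_sum_swap simp: kernel_mat_def)
qed


text \<open>The enumeration behind \<open>ent\<close> need not be the identity on
  \<open>{..<n}\<close>, so the matrix of the kernel is a permuted \<open>M\<close>. It is written
  as a permutation times a rest, and exchanging the two factors undoes the permutation.\<close>

lemma ent_mat:
  assumes "M \<in> carrier_mat n n"
  shows "ent {..<n} (\<lambda>i j. M $$ (i, j)) = vn_entropy M"
proof -
  let ?e = "kernel_enum {..<n}"
  let ?A = "mat n n (\<lambda>(i, j). of_bool (?e i = j)) :: complex mat"
  let ?B = "mat n n (\<lambda>(j, i). M $$ (j, ?e i))"
  have e: "?e i < n" if "i < n" for i
    using bij_betwE[OF bij_kernel_enum[of "{..<n}"]] that by auto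
  have "kernel_mat {..<n} {..<n} (\<lambda>i j. M $$ (i, j)) = ?A * ?B"
    by (intro eq_matI) (auto simp: kernel_mat_def scalar_prod_def e)
  moreover have "?B * ?A = M"
  proof (intro eq_matI)
    fix i j assume "i < dim_row M" "j < dim_col M"
    then have ij: "i < n" "j < n" using assms by auto
    have "(\<Sum>k<n. M $$ (i, ?e k) * of_bool (?e k = j)) = M $$ (i, j)"
      using sum_kernel_enum[of "{..<n}" "\<lambda>k. M $$ (i, k) * of_bool (k = j)"] ij by simp
    then show "(?B * ?A) $$ (i, j) = M $$ (i, j)"
      using ij by (simp add: scalar_prod_def atLeast0LessThan)
  qed (use assms in auto)
  ultimately show ?thesis
    unfolding ent_def vn_entropy_eq using spectral_sum_swap[of ?A n n ?B entropy_fun] by simp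
qed

text \<open>The graph of \<open>f\<close> acts as a permutation kernel, which
  \<open>ent_swap\<close> moves to the other side.\<close>

lemma ent_reindex:
  assumes "bij_betw f J I" "finite I"
  shows "ent J (\<lambda>i j. \<rho> (f i) (f j)) = ent I \<rho>"
proof -
  have J: "finite J" using assms bij_betw_finite by blast
  have fI: "f j \<in> I" if "j \<in> J" for j using assms(1) that by (auto dest: bij_betwE)
  let ?A = "\<lambda>j i. of_bool (f j = i)" and ?B = "\<lambda>i j. \<rho> i (f j)"
  have "ent J (\<lambda>j j'. \<Sum>i\<in>I. ?A j i * ?B i j') = ent I (\<lambda>i i'. \<Sum>j\<in>J. ?B i j * ?A j i')"
    by (rule ent_swap[OF J assms(2)])
  moreover have "ent J (\<lambda>j j'. \<Sum>i\<in>I. ?A j i * ?B i j') = ent J (\<lambda>i j. \<rho> (f i) (f j))"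
    using assms J fI by (intro ent_cong) auto
  moreover have "ent I (\<lambda>i i'. \<Sum>j\<in>J. ?B i j * ?A j i') = ent I \<rho>"
    using assms J sum.reindex_bij_betw[OF assms(1), of "\<lambda>k. \<rho> _ k * of_bool (k = _)"]
    by (intro ent_cong) auto
  ultimately show ?thesis by simp
qed

text \<open>\<open>M\<close> is a product of rectangular factors whose product in the other order is
  diagonal; if \<open>m < n\<close>, the remaining eigenvalues are zeros.\<close>

lemma spectral_sum_isometric:
  fixes n m :: nat
  assumes u: "isometric {..<n} {..<m} u"
    and M: "M = mat n n (\<lambda>(i, j). \<Sum>k<m. of_real (d k) * u i k * cnj (u j k))"
    and f: "f 0 = 0"
  shows "spectral_sum f M = (\<Sum>k<m. f (d k))"
proof -
  let ?A = "mat n m (\<lambda>(i, k). of_real (d k) * u i k)" and ?B = "mat m n (\<lambda>(k, j). cnj (u j k))"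
  have "M = ?A * ?B"
    unfolding M by (intro eq_matI) (auto simp: scalar_prod_def atLeast0LessThan)
  moreover have "?B * ?A = mat m m (\<lambda>(i, j). of_bool (i = j) * of_real (d i))"
  proof (intro eq_matI, goal_cases)
    case (1 k l)
    then have "(\<Sum>i<n. cnj (u i k) * (of_real (d l) * u i l)) = of_real (d l) * of_bool (k = l)"
      using u unfolding isometric_def by (simp add: mult.left_commute flip: sum_distrib_left)
    with 1 show ?case by (simp add: scalar_prod_def atLeast0LessThan)
  qed auto
  ultimately show ?thesis
    using spectral_sum_swap[of ?A n m ?B f] f by (simp add: spectral_sum_diagonal)
qed

lemma isometric_reindex:
  assumes "isometric I K u" "bij_betw f I' I" "bij_betw g K' K"
  shows "isometric I' K' (\<lambda>i k. u (f i) (g k))"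
  unfolding isometric_def
proof (intro ballI)
  fix k l assume kl: "k \<in> K'" "l \<in> K'"
  have "(\<Sum>i\<in>I'. cnj (u (f i) (g k)) * u (f i) (g l)) = (\<Sum>i\<in>I. cnj (u i (g k)) * u i (g l))"
    by (rule sum.reindex_bij_betw[OF assms(2)])
  also have "\<dots> = of_bool (g k = g l)"
    using assms(1,3) kl bij_betwE unfolding isometric_def by blast
  also have "g k = g l \<longleftrightarrow> k = l"
    using assms(3) kl by (auto simp: bij_betw_def inj_on_def)
  finally show "(\<Sum>i\<in>I'. cnj (u (f i) (g k)) * u (f i) (g l)) = of_bool (k = l)" .
qed

lemma ent_spectral:
  assumes [simp]: "finite I" "finite K" and "isometric I K u" "spectral_form I K \<rho> u d"
  shows "ent I \<rho> = (\<Sum>k\<in>K. entropy_fun (d k))"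
proof -
  note b = bij_kernel_enum[OF assms(1)] bij_kernel_enum[OF assms(2)]
  have "kernel_mat I I \<rho> = mat (card I) (card I) (\<lambda>(i, j). \<Sum>k<card K. of_real (d (kernel_enum K k)) *
       u (kernel_enum I i) (kernel_enum K k) * cnj (u (kernel_enum I j) (kernel_enum K k)))"
    using assms(4) bij_betwE[OF b(1)] unfolding kernel_mat_def spectral_form_def
    by (intro eq_matI)
      (auto simp: sum_kernel_enum[of K "\<lambda>k. of_real (d k) * u _ k * cnj (u _ k)"])
  from spectral_sum_isometric[OF isometric_reindex[OF assms(3) b] this, of entropy_fun]
  show ?thesis by (simp add: ent_def sum_kernel_enum[of K "\<lambda>k. entropy_fun (d k)"])
qed

section \<open>Orthonormal families, eigenvectors and the spectral theorem\<close>

lemma sum_product_swap: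
  fixes a :: "'i \<Rightarrow> 'j \<Rightarrow> 'c::comm_semiring_0"
  shows "(\<Sum>i\<in>I. (\<Sum>j\<in>J. a i j * x j) * (\<Sum>k\<in>K. b i k * y k)) =
    (\<Sum>j\<in>J. \<Sum>k\<in>K. (\<Sum>i\<in>I. a i j * b i k) * (x j * y k))"
proof -
  have "(\<Sum>i\<in>I. (\<Sum>j\<in>J. a i j * x j) * (\<Sum>k\<in>K. b i k * y k)) =
     (\<Sum>i\<in>I. \<Sum>j\<in>J. \<Sum>k\<in>K. (a i j * b i k) * (x j * y k))"
    by (simp only: sum_product) (simp add: mult_ac)
  also have "\<dots> = (\<Sum>j\<in>J. \<Sum>i\<in>I. \<Sum>k\<in>K. (a i j * b i k) * (x j * y k))"
    by (rule sum.swap)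
  also have "\<dots> = (\<Sum>j\<in>J. \<Sum>k\<in>K. \<Sum>i\<in>I. (a i j * b i k) * (x j * y k))"
    by (intro sum.cong refl sum.swap)
  finally show ?thesis by (simp add: sum_distrib_right)
qed

lemma sum_swap_pairs:
  "(\<Sum>a\<in>A. \<Sum>b\<in>B. \<Sum>c\<in>C. \<Sum>d\<in>D. f a b c d) = (\<Sum>c\<in>C. \<Sum>d\<in>D. \<Sum>a\<in>A. \<Sum>b\<in>B. f a b c d)"
  using sum.swap[of "\<lambda>x y. f (fst x) (snd x) (fst y) (snd y)" "C \<times> D" "A \<times> B"]
  by (simp add: sum.cartesian_product')

lemma isometric_compose:
  assumes "finite J" "isometric I J g" "isometric J K h"
  shows "isometric I K (\<lambda>i k. \<Sum>j\<in>J. g i j * h j k)"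
  unfolding isometric_def
proof (intro ballI)
  fix k l assume kl: "k \<in> K" "l \<in> K"
  have "(\<Sum>i\<in>I. cnj (\<Sum>j\<in>J. g i j * h j k) * (\<Sum>j\<in>J. g i j * h j l)) =
     (\<Sum>j\<in>J. \<Sum>j'\<in>J. (\<Sum>i\<in>I. cnj (g i j) * g i j') * (cnj (h j k) * h j' l))"
    by (simp add: sum_product_swap)
  also have "\<dots> = (\<Sum>j\<in>J. \<Sum>j'\<in>J. of_bool (j = j') * (cnj (h j k) * h j' l))"
    using assms(2) unfolding isometric_def by (intro sum.cong) auto
  also have "\<dots> = (\<Sum>j\<in>J. cnj (h j k) * h j l)"
    using assms(1) by (simp cong: sum.cong)
  also have "\<dots> = of_bool (k = l)" using assms(3) kl unfolding isometric_def by blast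
  finally show "(\<Sum>i\<in>I. cnj (\<Sum>j\<in>J. g i j * h j k) * (\<Sum>j\<in>J. g i j * h j l)) = of_bool (k = l)" .
qed

lemma unitary_on_iff:
  "unitary_on I K u \<longleftrightarrow> isometric I K u \<and> isometric K I (\<lambda>k i. cnj (u i k))"
  unfolding unitary_on_def isometric_def by auto

lemma unitary_on_compose:
  assumes "finite J" "unitary_on I J g" "unitary_on J K h"
  shows "unitary_on I K (\<lambda>i k. \<Sum>j\<in>J. g i j * h j k)"
  using isometric_compose[OF assms(1), of I g K h]
    isometric_compose[OF assms(1), of K "\<lambda>k j. cnj (h j k)" I "\<lambda>j i. cnj (g i j)"] assms
  by (simp add: unitary_on_iff mult.commute)

lemma kernel_eigenvector:
  fixes \<rho> :: "nat \<Rightarrow> nat \<Rightarrow> complex"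
  assumes "n > 0"
  obtains v e where "(\<Sum>i<n. cnj (v i) * v i) = 1" "\<And>i. i < n \<Longrightarrow> (\<Sum>j<n. \<rho> i j * v j) = e * v i"
proof -
  define A where "A = mat n n (\<lambda>(i, j). \<rho> i j)"
  have A: "A \<in> carrier_mat n n" by (simp add: A_def)
  have "degree (char_poly A) = n" using degree_monic_char_poly[OF A] by simp
  then obtain e where "poly (char_poly A) e = 0"
    using fundamental_theorem_of_algebra[of "char_poly A"] assms by (auto simp: constant_degree)
  then obtain v where v: "v \<in> carrier_vec n" "v \<noteq> 0\<^sub>v n" "A *\<^sub>v v = e \<cdot>\<^sub>v v"
    using eigenvalue_root_char_poly[OF A] A unfolding eigenvalue_def eigenvector_def by auto
  define N where "N = sqrt (\<Sum>i<n. (cmod (v $ i))\<^sup>2)"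
  have "(\<Sum>i<n. (cmod (v $ i))\<^sup>2) \<noteq> 0"
    using v(1,2) by (subst sum_nonneg_eq_0_iff) (auto simp: vec_eq_iff)
  then have N: "N > 0" "N\<^sup>2 = (\<Sum>i<n. (cmod (v $ i))\<^sup>2)"
    unfolding N_def by (auto simp: sum_nonneg less_le)
  show ?thesis
  proof (rule that[of "\<lambda>i. v $ i / of_real N" e])
    have "(\<Sum>i<n. cnj (v $ i / of_real N) * (v $ i / of_real N)) = of_real ((\<Sum>i<n. (cmod (v $ i))\<^sup>2) / N\<^sup>2)"
    proof -
      have "cnj (z / of_real N) * (z / of_real N) = of_real ((cmod z)\<^sup>2 / N\<^sup>2)" for z
        using complex_norm_square[of z] by (simp add: power2_eq_square mult.commute)
      then show ?thesis by (simp add: sum_divide_distrib)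
    qed
    then show "(\<Sum>i<n. cnj (v $ i / of_real N) * (v $ i / of_real N)) = 1"
      unfolding N(2)[symmetric] using N(1) by simp
    fix i assume i: "i < n"
    have "(\<Sum>j<n. \<rho> i j * v $ j) = e * v $ i"
      using arg_cong[OF v(3), of "\<lambda>w. w $ i"] v(1) A i
      by (simp add: scalar_prod_def A_def atLeast0LessThan)
    then show "(\<Sum>j<n. \<rho> i j * (v $ j / of_real N)) = e * (v $ i / of_real N)"
      by (simp flip: sum_divide_distrib)
  qed
qed

(* The Householder reflection exchanging v and a phase multiple of the first basis vector. *)
lemma unit_vector_extends:
  fixes v :: "nat \<Rightarrow> complex"
  assumes v: "(\<Sum>i<n. cnj (v i) * v i) = 1" and n: "0 < n"
  obtains g c where "unitary_on {..<n} {..<n} g" "\<And>i. i < n \<Longrightarrow> g i 0 = c * v i" "cmod c = 1"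
proof -
  \<comment> \<open>The phase is opposite to that of \<open>v 0\<close>, so no cancellation occurs
    in \<open>w\<close>: its squared norm is \<open>2 * s\<close> with \<open>s\<close> at least 1.
    Dividing by \<open>s\<close> in \<open>g\<close> therefore gives the reflection along
    \<open>w\<close>.\<close>
  define a where "a = (if v 0 = 0 then 1 else - sgn (v 0))"
  have a: "cnj a * a = 1" "cnj a * v 0 = - of_real (cmod (v 0))"
    using complex_norm_square[of "v 0"]
    by (auto simp: a_def sgn_div_norm scaleR_conv_of_real power2_eq_square divide_simps mult.commute)
  have a2: "cnj (v 0) * a = - of_real (cmod (v 0))"
    using arg_cong[OF a(2), of cnj] by (simp add: mult.commute)
  define s where "s = 1 + complex_of_real (cmod (v 0))"
  have s0: "s \<noteq> 0" unfolding s_def by (metis add_eq_0_iff norm_ge_zero of_real_1 of_real_add of_real_eq_0_iff add_nonneg_eq_0_iff zero_le_one zero_neq_one)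
  have cs: "cnj s = s" by (simp add: s_def)
  define w where "w = (\<lambda>i. v i - a * of_bool (i = 0))"
  have ww: "(\<Sum>i<n. cnj (w i) * w i) = 2 * s"
  proof -
    have "(\<Sum>i<n. cnj (w i) * w i) = (\<Sum>i<n. cnj (v i) * v i - of_bool (i = 0) * (cnj (v i) * a)
       - of_bool (i = 0) * (cnj a * v i) + of_bool (i = 0) * (cnj a * a))"
      by (intro sum.cong) (auto simp: w_def algebra_simps)
    also have "\<dots> = 1 - cnj (v 0) * a - cnj a * v 0 + cnj a * a"
      using n v by (simp only: sum.distrib sum_subtractf sum_of_bool_mult finite_lessThan lessThan_iff if_True)
    also have "\<dots> = 2 * s" by (simp add: a a2 s_def)
    finally show ?thesis .
  qed
  define g where "g = (\<lambda>i j. of_bool (i = j) - w i * cnj (w j) / s)"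
  have gh: "cnj (g i j) = g j i" for i j by (simp add: g_def cs mult.commute eq_commute)
  have "(\<Sum>i<n. g k i * g i l) = of_bool (k = l)" if kl: "k < n" "l < n" for k l
  proof -
    have "(\<Sum>i<n. g k i * g i l) = (\<Sum>i<n. of_bool (k = i) * of_bool (i = l) - of_bool (k = i) * (w i * cnj (w l) / s)
       - of_bool (i = l) * (w k * cnj (w i) / s) + w k * cnj (w l) / s / s * (cnj (w i) * w i))"
      by (intro sum.cong) (auto simp: g_def algebra_simps)
    also have "\<dots> = of_bool (k = l) - w k * cnj (w l) / s - w k * cnj (w l) / s + w k * cnj (w l) / s / s * (2 * s)"
      using kl ww
      by (simp only: sum.distrib sum_subtractf sum_of_bool_mult finite_lessThan lessThan_iff if_True
          sum_distrib_left[symmetric])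
    also have "\<dots> = of_bool (k = l)" using s0 by simp
    finally show ?thesis .
  qed
  then have u: "unitary_on {..<n} {..<n} g"
    unfolding unitary_on_iff isometric_def gh by auto
  have "g i 0 = cnj a * v i" if "i < n" for i
  proof -
    have "cnj (v 0) = cnj a * (cnj (v 0) * a)" using a(1) by (simp add: mult.left_commute mult.commute)
    then have "cnj (v 0) = - cnj a * of_real (cmod (v 0))" unfolding a2 by simp
    then have "cnj (w 0) = - cnj a * s" by (simp add: w_def s_def algebra_simps)
    then have "g i 0 = of_bool (i = 0) + w i * cnj a" using s0 by (simp add: g_def)
    also have "\<dots> = cnj a * v i" using a(1) by (auto simp: w_def algebra_simps)
    finally show ?thesis .
  qed
  moreover have "cmod (cnj a) = 1" by (simp add: a_def norm_sgn)
  ultimately show ?thesis using that u by blast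
qed


lemma hermitian_onD: "hermitian_on I \<rho> \<Longrightarrow> i \<in> I \<Longrightarrow> j \<in> I \<Longrightarrow> cnj (\<rho> i j) = \<rho> j i"
  by (metis hermitian_on_def)

text \<open>Deflation: in a basis \<open>g\<close> that starts with an eigenvector, the first column
  of the matrix \<open>B\<close> vanishes below its first entry. Hermiticity clears the first row as
  well, and the induction hypothesis diagonalises the remaining block; \<open>h\<close> is the
  direct sum of 1 and that diagonalisation.\<close>

lemma spectral_theorem_nat:
  "hermitian_on {..<n} \<rho> \<Longrightarrow> \<exists>u d. unitary_on {..<n} {..<n::nat} u \<and> spectral_form {..<n} {..<n} \<rho> u d"
proof (induction n arbitrary: \<rho>)
  case 0
  then show ?case by (auto simp: unitary_on_def isometric_def spectral_form_def)
next
  case (Suc n)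
  let ?N = "{..<Suc n}"
  obtain v e where v: "(\<Sum>i<Suc n. cnj (v i) * v i) = 1"
    "\<And>i. i < Suc n \<Longrightarrow> (\<Sum>j<Suc n. \<rho> i j * v j) = e * v i"
    using kernel_eigenvector[of "Suc n" \<rho>] by auto
  obtain g c where g: "unitary_on ?N ?N g" "\<And>i. i < Suc n \<Longrightarrow> g i 0 = c * v i"
    using unit_vector_extends[OF v(1)] by (metis zero_less_Suc)
  have g1: "(\<Sum>i<Suc n. cnj (g i k) * g i l) = of_bool (k = l)" if "k < Suc n" "l < Suc n" for k l
    using g(1) that unfolding unitary_on_def isometric_def by auto
  have g2: "(\<Sum>k<Suc n. g i k * cnj (g j k)) = of_bool (i = j)" if "i < Suc n" "j < Suc n" for i j
    using g(1) that unfolding unitary_on_def by auto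
  have ge: "(\<Sum>j<Suc n. \<rho> i j * g j 0) = e * g i 0" if "i < Suc n" for i
  proof -
    have "(\<Sum>j<Suc n. \<rho> i j * g j 0) = c * (\<Sum>j<Suc n. \<rho> i j * v j)"
      unfolding sum_distrib_left by (intro sum.cong) (auto simp: g(2))
    then show ?thesis using v(2)[OF that] g(2)[OF that] by simp
  qed
  define B where "B = (\<lambda>k l. \<Sum>i<Suc n. \<Sum>j<Suc n. cnj (g i k) * \<rho> i j * g j l)"
  have B0: "B k 0 = e * of_bool (k = 0)" if "k < Suc n" for k
  proof -
    have "B k 0 = (\<Sum>i<Suc n. cnj (g i k) * (\<Sum>j<Suc n. \<rho> i j * g j 0))"
      by (simp only: B_def sum_distrib_left mult.assoc)
    also have "\<dots> = (\<Sum>i<Suc n. cnj (g i k) * (e * g i 0))"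
      by (intro sum.cong) (simp_all only: ge lessThan_iff)
    also have "\<dots> = e * (\<Sum>i<Suc n. cnj (g i k) * g i 0)"
      by (simp only: sum_distrib_left mult.left_commute)
    finally show ?thesis using g1[OF that] by simp
  qed
  have Bh: "cnj (B k l) = B l k" for k l
  proof -
    have "cnj (B k l) = (\<Sum>i<Suc n. \<Sum>j<Suc n. cnj (g j l) * \<rho> j i * g i k)"
      unfolding B_def cnj_sum
      by (intro sum.cong refl) (simp add: hermitian_onD[OF Suc.prems] mult_ac)
    then show ?thesis unfolding B_def by (subst sum.swap)
  qed
  \<comment> \<open>The eigenvalue is a diagonal entry of a hermitian matrix, so taking
    \<open>Re e\<close> in \<open>d'\<close> loses nothing.\<close>
  have e: "cnj e = e" using Bh[of 0 0] B0[of 0] by simp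
  have B0': "B 0 l = e * of_bool (l = 0)" if "l < Suc n" for l
    using Bh[of l 0] B0[OF that] e by auto
  have rho: "\<rho> i j = (\<Sum>k<Suc n. \<Sum>l<Suc n. g i k * B k l * cnj (g j l))"
    if ij: "i < Suc n" "j < Suc n" for i j
  proof -
    have "(\<Sum>k<Suc n. \<Sum>l<Suc n. g i k * B k l * cnj (g j l)) =
      (\<Sum>k<Suc n. \<Sum>l<Suc n. \<Sum>i'<Suc n. \<Sum>j'<Suc n. (g i k * cnj (g i' k)) * ((g j' l * cnj (g j l)) * \<rho> i' j'))"
      by (simp only: B_def sum_distrib_left sum_distrib_right mult_ac)
    also have "\<dots> = (\<Sum>i'<Suc n. \<Sum>j'<Suc n. \<Sum>k<Suc n. \<Sum>l<Suc n. (g i k * cnj (g i' k)) * ((g j' l * cnj (g j l)) * \<rho> i' j'))"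
      by (rule sum_swap_pairs)
    also have "\<dots> = (\<Sum>i'<Suc n. \<Sum>j'<Suc n. (\<Sum>k<Suc n. g i k * cnj (g i' k)) * ((\<Sum>l<Suc n. g j' l * cnj (g j l)) * \<rho> i' j'))"
      by (simp only: sum_product[symmetric] sum_distrib_right[symmetric])
    also have "\<dots> = (\<Sum>i'<Suc n. \<Sum>j'<Suc n. of_bool (i = i') * (of_bool (j' = j) * \<rho> i' j'))"
      using ij by (intro sum.cong refl) (simp only: g2 lessThan_iff)
    also have "\<dots> = \<rho> i j"
      using ij by (simp only: sum_distrib_left[symmetric] sum_of_bool_mult finite_lessThan lessThan_iff if_True)
    finally show ?thesis by simp
  qed
  have "hermitian_on {..<n} (\<lambda>k l. B (Suc k) (Suc l))"
    unfolding hermitian_on_def using Bh by simp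
  from Suc.IH[OF this] obtain u d where u: "unitary_on {..<n} {..<n} u"
    and d: "spectral_form {..<n} {..<n} (\<lambda>k l. B (Suc k) (Suc l)) u d" by blast
  define h where "h = (\<lambda>i j. case i of 0 \<Rightarrow> of_bool (j = 0) | Suc i' \<Rightarrow> (case j of 0 \<Rightarrow> 0 | Suc j' \<Rightarrow> u i' j'))"
  have hs: "h 0 j = of_bool (j = 0)" "h (Suc i) 0 = 0" "h (Suc i) (Suc k) = u i k" for i j k
    by (auto simp: h_def)
  have h: "unitary_on ?N ?N h"
    using u unfolding unitary_on_def isometric_def
    by (auto simp: sum.lessThan_Suc_shift hs less_Suc_eq_0_disj simp del: sum.lessThan_Suc)
  define d' where "d' = (\<lambda>k. case k of 0 \<Rightarrow> Re e | Suc k \<Rightarrow> d k)"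
  have Bd: "B k l = (\<Sum>p<Suc n. of_real (d' p) * h k p * cnj (h l p))" if "k < Suc n" "l < Suc n" for k l
    using that B0[of k] B0'[of l] d e unfolding spectral_form_def
    by (cases k; cases l) (auto simp: sum.lessThan_Suc_shift hs d'_def complex_eq_iff simp del: sum.lessThan_Suc)
  define w where "w = (\<lambda>i p. \<Sum>k<Suc n. g i k * h k p)"
  have "unitary_on ?N ?N w" unfolding w_def by (rule unitary_on_compose[OF _ g(1) h]) simp
  moreover have "spectral_form ?N ?N \<rho> w d'"
    unfolding spectral_form_def
  proof (intro ballI)
    fix i j assume "i \<in> ?N" "j \<in> ?N"
    then have ij: "i < Suc n" "j < Suc n" by auto
    have "(\<Sum>p<Suc n. of_real (d' p) * w i p * cnj (w j p)) =
       (\<Sum>p<Suc n. (\<Sum>k<Suc n. (of_real (d' p) * h k p) * g i k) * (\<Sum>l<Suc n. cnj (h l p) * cnj (g j l)))"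
      by (simp only: w_def cnj_sum complex_cnj_mult sum_distrib_left mult_ac)
    also have "\<dots> = (\<Sum>k<Suc n. \<Sum>l<Suc n. (\<Sum>p<Suc n. of_real (d' p) * h k p * cnj (h l p)) * (g i k * cnj (g j l)))"
      by (rule sum_product_swap)
    also have "\<dots> = (\<Sum>k<Suc n. \<Sum>l<Suc n. g i k * B k l * cnj (g j l))"
      by (intro sum.cong refl) (simp only: Bd lessThan_iff mult_ac)
    finally show "\<rho> i j = (\<Sum>p<Suc n. of_real (d' p) * w i p * cnj (w j p))" using rho[OF ij] by simp
  qed
  ultimately show ?case by blast
qed

theorem spectral_theorem:
  assumes [simp]: "finite I" and "hermitian_on I \<rho>"
  obtains u d where "unitary_on I I u" "spectral_form I I \<rho> u d"
proof -
  define e where "e = kernel_enum I"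
  have e: "bij_betw e {..<card I} I" unfolding e_def by (rule bij_kernel_enum) simp
  have "hermitian_on {..<card I} (\<lambda>i j. \<rho> (e i) (e j))"
    using hermitian_onD[OF assms(2)] bij_betwE[OF e] by (simp add: hermitian_on_def)
  from spectral_theorem_nat[OF this] obtain u d where u: "unitary_on {..<card I} {..<card I} u"
    "spectral_form {..<card I} {..<card I} (\<lambda>i j. \<rho> (e i) (e j)) u d" by blast
  define f where "f = inv_into {..<card I} e"
  have f: "bij_betw f I {..<card I}" unfolding f_def by (rule bij_betw_inv_into[OF e])
  have ef: "e (f i) = i" if "i \<in> I" for i
    using that e unfolding f_def by (meson bij_betw_inv_into_right)
  have "unitary_on I I (\<lambda>i k. u (f i) (f k))"
    using isometric_reindex[of _ _ u, OF _ f f] isometric_reindex[of _ _ "\<lambda>k i. cnj (u i k)", OF _ f f] u(1)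
    unfolding unitary_on_iff by blast
  moreover have "spectral_form I I \<rho> (\<lambda>i k. u (f i) (f k)) (\<lambda>k. d (f k))"
    unfolding spectral_form_def
  proof (intro ballI)
    fix i j assume ij: "i \<in> I" "j \<in> I"
    have "\<rho> i j = \<rho> (e (f i)) (e (f j))" using ij ef by simp
    also have "\<dots> = (\<Sum>k<card I. of_real (d k) * u (f i) k * cnj (u (f j) k))"
      using u(2) ij bij_betwE[OF f] unfolding spectral_form_def by auto
    also have "\<dots> = (\<Sum>k\<in>I. of_real (d (f k)) * u (f i) (f k) * cnj (u (f j) (f k)))"
      by (rule sum.reindex_bij_betw[OF f, symmetric])
    finally show "\<rho> i j = (\<Sum>k\<in>I. of_real (d (f k)) * u (f i) (f k) * cnj (u (f j) (f k)))" .
  qed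
  ultimately show ?thesis using that by blast
qed

section \<open>Monotonicity of the relative entropy and strong subadditivity\<close>

definition psd_on :: "'a set \<Rightarrow> ('a \<Rightarrow> 'a \<Rightarrow> complex) \<Rightarrow> bool" where
  "psd_on I \<rho> \<longleftrightarrow> hermitian_on I \<rho> \<and> (\<forall>v. 0 \<le> Re (\<Sum>i\<in>I. \<Sum>j\<in>I. cnj (v i) * \<rho> i j * v j))"

lemma psd_on_hermitian: "psd_on I \<rho> \<Longrightarrow> hermitian_on I \<rho>"
  by (simp add: psd_on_def)

lemma unitary_onD1:
  "unitary_on I K u \<Longrightarrow> k \<in> K \<Longrightarrow> l \<in> K \<Longrightarrow> (\<Sum>i\<in>I. cnj (u i k) * u i l) = of_bool (k = l)"
  unfolding unitary_on_def isometric_def by blast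

lemma unitary_onD2:
  "unitary_on I K u \<Longrightarrow> i \<in> I \<Longrightarrow> j \<in> I \<Longrightarrow> (\<Sum>k\<in>K. u i k * cnj (u j k)) = of_bool (i = j)"
  unfolding unitary_on_def by blast

lemma spectral_eigenvector:
  assumes "finite K" "isometric I K u" "spectral_form I K \<rho> u d" "i \<in> I" "k \<in> K"
  shows "(\<Sum>j\<in>I. \<rho> i j * u j k) = of_real (d k) * u i k"
proof -
  have "(\<Sum>j\<in>I. \<rho> i j * u j k) = (\<Sum>j\<in>I. (\<Sum>l\<in>K. cnj (u j l) * (of_real (d l) * u i l)) * u j k)"
    using assms(3,4) unfolding spectral_form_def by (intro sum.cong) (auto simp: mult_ac)
  also have "\<dots> = (\<Sum>l\<in>K. (\<Sum>j\<in>I. cnj (u j l) * u j k) * (of_real (d l) * u i l))"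
    unfolding sum_distrib_right by (subst sum.swap) (simp only: mult_ac)
  also have "\<dots> = (\<Sum>l\<in>K. of_bool (l = k) * (of_real (d l) * u i l))"
    using assms(2,5) unfolding isometric_def by (intro sum.cong) auto
  also have "\<dots> = of_real (d k) * u i k"
    using assms(1,5) by (simp only: sum_of_bool_mult if_True)
  finally show ?thesis .
qed

lemma spectral_value:
  assumes "finite K" "isometric I K u" "spectral_form I K \<rho> u d" "k \<in> K"
  shows "(\<Sum>i\<in>I. \<Sum>j\<in>I. cnj (u i k) * \<rho> i j * u j k) = of_real (d k)"
proof -
  have "(\<Sum>i\<in>I. \<Sum>j\<in>I. cnj (u i k) * \<rho> i j * u j k) = (\<Sum>i\<in>I. cnj (u i k) * (\<Sum>j\<in>I. \<rho> i j * u j k))"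
    by (simp only: sum_distrib_left mult.assoc)
  also have "\<dots> = (\<Sum>i\<in>I. cnj (u i k) * (of_real (d k) * u i k))"
    using spectral_eigenvector[OF assms(1-3) _ assms(4)] by (intro sum.cong) auto
  also have "\<dots> = of_real (d k) * (\<Sum>i\<in>I. cnj (u i k) * u i k)"
    by (simp only: sum_distrib_left mult.left_commute)
  also have "\<dots> = of_real (d k)" using assms(2,4) unfolding isometric_def by auto
  finally show ?thesis .
qed

lemma psd_on_spectral_nonneg:
  assumes "finite K" "isometric I K u" "spectral_form I K \<rho> u d" "psd_on I \<rho>" "k \<in> K"
  shows "0 \<le> d k"
proof -
  have "0 \<le> Re (\<Sum>i\<in>I. \<Sum>j\<in>I. cnj (u i k) * \<rho> i j * u j k)"
    using assms(4) unfolding psd_on_def by (elim conjE allE[where x="\<lambda>i. u i k"])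
  then show ?thesis by (simp only: spectral_value[OF assms(1-3,5)] Re_complex_of_real)
qed

lemma spectral_trace:
  assumes "finite K" "isometric I K u" "spectral_form I K \<rho> u d"
  shows "(\<Sum>i\<in>I. \<rho> i i) = of_real (\<Sum>k\<in>K. d k)"
proof -
  have "(\<Sum>i\<in>I. \<rho> i i) = (\<Sum>i\<in>I. \<Sum>k\<in>K. of_real (d k) * (cnj (u i k) * u i k))"
    using assms(3) unfolding spectral_form_def by (intro sum.cong) (auto simp: mult_ac)
  also have "\<dots> = (\<Sum>k\<in>K. of_real (d k) * (\<Sum>i\<in>I. cnj (u i k) * u i k))"
    by (subst sum.swap) (simp only: sum_distrib_left)
  also have "\<dots> = (\<Sum>k\<in>K. of_real (d k))"
    using assms(2) unfolding isometric_def by (intro sum.cong) auto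
  finally show ?thesis by simp
qed

lemma parseval:
  assumes "finite I" "finite K" "unitary_on I K u"
  shows "(\<Sum>i\<in>I. cnj (f i) * g i) = (\<Sum>k\<in>K. cnj (\<Sum>i\<in>I. cnj (u i k) * f i) * (\<Sum>i\<in>I. cnj (u i k) * g i))"
proof -
  have "(\<Sum>k\<in>K. cnj (\<Sum>i\<in>I. cnj (u i k) * f i) * (\<Sum>i\<in>I. cnj (u i k) * g i)) =
    (\<Sum>k\<in>K. (\<Sum>i\<in>I. u i k * cnj (f i)) * (\<Sum>i\<in>I. cnj (u i k) * g i))" by simp
  also have "\<dots> = (\<Sum>i\<in>I. \<Sum>j\<in>I. (\<Sum>k\<in>K. u i k * cnj (u j k)) * (cnj (f i) * g j))"
    by (rule sum_product_swap)
  also have "\<dots> = (\<Sum>i\<in>I. \<Sum>j\<in>I. of_bool (i = j) * (cnj (f i) * g j))"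
    by (intro sum.cong refl) (simp only: unitary_onD2[OF assms(3)])
  also have "\<dots> = (\<Sum>i\<in>I. cnj (f i) * g i)"
    using assms(1) by (intro sum.cong refl) (simp only: sum_of_bool_mult if_True)
  finally show ?thesis by simp
qed

lemma unitary_on_cnj: "unitary_on I K u \<Longrightarrow> unitary_on I K (\<lambda>i k. cnj (u i k))"
  unfolding unitary_on_def isometric_def
proof (elim conjE, intro conjI ballI, goal_cases)
  case (1 k l)
  then have "cnj (\<Sum>i\<in>I. cnj (u i k) * u i l) = of_bool (k = l)" by simp
  then show ?case by simp
next
  case (2 i j)
  then have "cnj (\<Sum>k\<in>K. u i k * cnj (u j k)) = of_bool (i = j)" by simp
  then show ?case by simp
qed

text \<open>Matrix elements <u_k| X |w_l> with different bases on the two sides. With eigenvectors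
  of \<open>P\<close> on the left and of \<open>Q\<close> on the right, left multiplication by
  \<open>P\<close> and right multiplication by \<open>Q\<close> become diagonal simultaneously,
  although \<open>P\<close> and \<open>Q\<close> need not commute.\<close>

definition two_basis_coeff ::
  "'a set \<Rightarrow> ('a \<Rightarrow> 'k \<Rightarrow> complex) \<Rightarrow> ('a \<Rightarrow> 'l \<Rightarrow> complex) \<Rightarrow> ('a \<Rightarrow> 'a \<Rightarrow> complex) \<Rightarrow> 'k \<Rightarrow> 'l \<Rightarrow> complex" where
  "two_basis_coeff I u w X k l = (\<Sum>i\<in>I. cnj (u i k) * (\<Sum>j\<in>I. X i j * w j l))"

lemma parseval_two_basis:
  assumes "finite I" "finite K" "finite L" "unitary_on I K u" "unitary_on I L w"
  shows "(\<Sum>i\<in>I. \<Sum>j\<in>I. cnj (X i j) * Y i j) =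
    (\<Sum>k\<in>K. \<Sum>l\<in>L. cnj (two_basis_coeff I u w X k l) * two_basis_coeff I u w Y k l)"
proof -
  have "(\<Sum>i\<in>I. \<Sum>j\<in>I. cnj (X i j) * Y i j) =
     (\<Sum>i\<in>I. \<Sum>l\<in>L. cnj (\<Sum>j\<in>I. X i j * w j l) * (\<Sum>j\<in>I. Y i j * w j l))"
    by (intro sum.cong refl, subst parseval[OF assms(1,3) unitary_on_cnj[OF assms(5)]])
      (simp add: mult.commute)
  also have "\<dots> = (\<Sum>l\<in>L. \<Sum>i\<in>I. cnj (\<Sum>j\<in>I. X i j * w j l) * (\<Sum>j\<in>I. Y i j * w j l))"
    by (rule sum.swap)
  also have "\<dots> = (\<Sum>l\<in>L. \<Sum>k\<in>K. cnj (two_basis_coeff I u w X k l) * two_basis_coeff I u w Y k l)"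
    unfolding two_basis_coeff_def by (intro sum.cong refl parseval[OF assms(1,2,4)])
  finally show ?thesis by (subst sum.swap)
qed

lemma spectral_left_eigenvector:
  assumes "finite K" "isometric I K u" "spectral_form I K \<rho> u d" "j \<in> I" "k \<in> K"
  shows "(\<Sum>i\<in>I. cnj (u i k) * \<rho> i j) = of_real (d k) * cnj (u j k)"
proof -
  have "spectral_form I K (\<lambda>i j. \<rho> j i) (\<lambda>i k. cnj (u i k)) d"
    using assms(3) unfolding spectral_form_def by (simp add: mult_ac)
  moreover have "isometric I K (\<lambda>i k. cnj (u i k))"
    unfolding isometric_def
  proof (intro ballI)
    fix k l assume "k \<in> K" "l \<in> K"
    then have "cnj (\<Sum>i\<in>I. cnj (u i k) * u i l) = of_bool (k = l)"
      using assms(2) unfolding isometric_def by simp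
    then show "(\<Sum>i\<in>I. cnj (cnj (u i k)) * cnj (u i l)) = of_bool (k = l)" by simp
  qed
  ultimately have "(\<Sum>i\<in>I. \<rho> i j * cnj (u i k)) = of_real (d k) * cnj (u j k)"
    using spectral_eigenvector[OF assms(1) _ _ assms(4,5), of "\<lambda>i k. cnj (u i k)" "\<lambda>i j. \<rho> j i" d] by blast
  then show ?thesis by (simp add: mult.commute)
qed

lemma two_basis_coeff_left:
  assumes "finite K" "isometric I K u" "spectral_form I K P u p" "k \<in> K"
  shows "two_basis_coeff I u w (\<lambda>i j. \<Sum>m\<in>I. P i m * X m j) k l = of_real (p k) * two_basis_coeff I u w X k l"
proof -
  have "two_basis_coeff I u w (\<lambda>i j. \<Sum>m\<in>I. P i m * X m j) k l =
      (\<Sum>i\<in>I. \<Sum>j\<in>I. \<Sum>m\<in>I. cnj (u i k) * P i m * (X m j * w j l))"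
    unfolding two_basis_coeff_def by (simp only: sum_distrib_left sum_distrib_right mult.assoc)
  also have "\<dots> = (\<Sum>i\<in>I. \<Sum>m\<in>I. \<Sum>j\<in>I. cnj (u i k) * P i m * (X m j * w j l))"
    by (intro sum.cong refl sum.swap)
  also have "\<dots> = (\<Sum>m\<in>I. \<Sum>i\<in>I. \<Sum>j\<in>I. cnj (u i k) * P i m * (X m j * w j l))"
    by (rule sum.swap)
  also have "\<dots> = (\<Sum>m\<in>I. (\<Sum>i\<in>I. cnj (u i k) * P i m) * (\<Sum>j\<in>I. X m j * w j l))"
    by (simp only: sum_product)
  also have "\<dots> = (\<Sum>m\<in>I. of_real (p k) * (cnj (u m k) * (\<Sum>j\<in>I. X m j * w j l)))"
    by (intro sum.cong refl) (simp only: spectral_left_eigenvector[OF assms(1-3) _ assms(4)] mult.assoc)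
  finally show ?thesis by (simp only: two_basis_coeff_def sum_distrib_left)
qed

lemma two_basis_coeff_right:
  assumes "finite L" "isometric I L w" "spectral_form I L Q w q" "l \<in> L"
  shows "two_basis_coeff I u w (\<lambda>i j. \<Sum>m\<in>I. X i m * Q m j) k l = of_real (q l) * two_basis_coeff I u w X k l"
proof -
  have "(\<Sum>j\<in>I. (\<Sum>m\<in>I. X i m * Q m j) * w j l) = of_real (q l) * (\<Sum>m\<in>I. X i m * w m l)" for i
  proof -
    have "(\<Sum>j\<in>I. (\<Sum>m\<in>I. X i m * Q m j) * w j l) = (\<Sum>m\<in>I. X i m * (\<Sum>j\<in>I. Q m j * w j l))"
      unfolding sum_distrib_left sum_distrib_right by (subst sum.swap) (simp only: mult.assoc)
    also have "\<dots> = (\<Sum>m\<in>I. X i m * (of_real (q l) * w m l))"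
      by (intro sum.cong refl) (simp only: spectral_eigenvector[OF assms(1-3) _ assms(4)])
    finally show ?thesis by (simp only: sum_distrib_left mult.left_commute)
  qed
  then show ?thesis
    unfolding two_basis_coeff_def by (simp only: sum_distrib_left mult.left_commute)
qed

definition basis_overlap :: "'a set \<Rightarrow> ('a \<Rightarrow> 'k \<Rightarrow> complex) \<Rightarrow> ('a \<Rightarrow> 'l \<Rightarrow> complex) \<Rightarrow> 'k \<Rightarrow> 'l \<Rightarrow> complex" where
  "basis_overlap I u w k l = (\<Sum>i\<in>I. cnj (u i k) * w i l)"

lemma two_basis_coeff_fst:
  assumes "finite K" "isometric I K u" "spectral_form I K P u p" "k \<in> K"
  shows "two_basis_coeff I u w P k l = of_real (p k) * basis_overlap I u w k l"
proof -
  have "two_basis_coeff I u w P k l = (\<Sum>j\<in>I. (\<Sum>i\<in>I. cnj (u i k) * P i j) * w j l)"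
    unfolding two_basis_coeff_def sum_distrib_left sum_distrib_right by (subst sum.swap) (simp only: mult.assoc)
  also have "\<dots> = (\<Sum>j\<in>I. of_real (p k) * cnj (u j k) * w j l)"
    by (intro sum.cong refl) (simp only: spectral_left_eigenvector[OF assms(1-3) _ assms(4)])
  finally show ?thesis by (simp only: basis_overlap_def sum_distrib_left mult.assoc)
qed

lemma two_basis_coeff_snd:
  assumes "finite L" "isometric I L w" "spectral_form I L Q w q" "l \<in> L"
  shows "two_basis_coeff I u w Q k l = of_real (q l) * basis_overlap I u w k l"
proof -
  have "two_basis_coeff I u w Q k l = (\<Sum>i\<in>I. cnj (u i k) * (of_real (q l) * w i l))"
    unfolding two_basis_coeff_def
    by (intro sum.cong refl) (simp only: spectral_eigenvector[OF assms(1-3) _ assms(4)])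
  then show ?thesis by (simp only: basis_overlap_def sum_distrib_left mult.left_commute)
qed

lemma two_basis_coeff_diff:
  "two_basis_coeff I u w (\<lambda>i j. X i j - Y i j) k l = two_basis_coeff I u w X k l - two_basis_coeff I u w Y k l"
  by (simp add: two_basis_coeff_def left_diff_distrib right_diff_distrib sum_subtractf)

lemma two_basis_coeff_expand:
  assumes "finite K" "finite L" "isometric I K u" "isometric I L w" "k \<in> K" "l \<in> L"
  shows "two_basis_coeff I u w (\<lambda>i j. \<Sum>k\<in>K. u i k * (\<Sum>l\<in>L. x k l * cnj (w j l))) k l = x k l"
proof -
  have inner: "(\<Sum>j\<in>I. (\<Sum>m\<in>L. x k m * cnj (w j m)) * w j l) = x k l" for k
  proof -
    have "(\<Sum>j\<in>I. (\<Sum>m\<in>L. x k m * cnj (w j m)) * w j l) = (\<Sum>m\<in>L. x k m * (\<Sum>j\<in>I. cnj (w j m) * w j l))"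
      unfolding sum_distrib_left sum_distrib_right by (subst sum.swap) (simp only: mult.assoc)
    also have "\<dots> = (\<Sum>m\<in>L. x k m * of_bool (m = l))"
      using assms(4,6) unfolding isometric_def by (intro sum.cong refl arg_cong2[of _ _ _ _ "(*)"]) auto
    finally show ?thesis using assms(2,6) by (simp only: sum_of_bool_mult if_True)
  qed
  have "(\<Sum>j\<in>I. (\<Sum>k\<in>K. u i k * (\<Sum>l\<in>L. x k l * cnj (w j l))) * w j l) = (\<Sum>k\<in>K. u i k * x k l)" for i
  proof -
    have "(\<Sum>j\<in>I. (\<Sum>k\<in>K. u i k * (\<Sum>l\<in>L. x k l * cnj (w j l))) * w j l)
      = (\<Sum>k\<in>K. u i k * (\<Sum>j\<in>I. (\<Sum>l\<in>L. x k l * cnj (w j l)) * w j l))"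
      unfolding sum_distrib_right[of _ K] sum_distrib_left[of _ _ I] by (subst sum.swap) (simp only: mult.assoc)
    also have "\<dots> = (\<Sum>k\<in>K. u i k * x k l)" by (simp only: inner)
    finally show ?thesis .
  qed
  then have "two_basis_coeff I u w (\<lambda>i j. \<Sum>k\<in>K. u i k * (\<Sum>l\<in>L. x k l * cnj (w j l))) k l =
     (\<Sum>i\<in>I. cnj (u i k) * (\<Sum>k\<in>K. u i k * x k l))"
    unfolding two_basis_coeff_def by simp
  also have "\<dots> = (\<Sum>m\<in>K. (\<Sum>i\<in>I. cnj (u i k) * u i m) * x m l)"
    unfolding sum_distrib_left sum_distrib_right by (subst sum.swap) (simp only: mult.assoc)
  also have "\<dots> = (\<Sum>m\<in>K. of_bool (k = m) * x m l)"
    using assms(3,5) unfolding isometric_def by (intro sum.cong refl arg_cong2[of _ _ _ _ "(*)"]) auto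
  finally show ?thesis using assms(1,5) by (simp only: sum_of_bool_mult if_True)
qed

(* <X, 2(P-Q)> - <X, ((1-s) L_P + s R_Q) X>; its supremum over X is the quadratic divergence of
   P and Q, and every value at X is linear in (P, Q). *)
definition quad_form :: "'a set \<Rightarrow> ('a \<Rightarrow> 'a \<Rightarrow> complex) \<Rightarrow> ('a \<Rightarrow> 'a \<Rightarrow> complex) \<Rightarrow> real \<Rightarrow> ('a \<Rightarrow> 'a \<Rightarrow> complex) \<Rightarrow> real" where
  "quad_form I P Q s X = 2 * Re (\<Sum>i\<in>I. \<Sum>j\<in>I. cnj (X i j) * (P i j - Q i j))
     - (1 - s) * Re (\<Sum>i\<in>I. \<Sum>j\<in>I. cnj (X i j) * (\<Sum>m\<in>I. P i m * X m j))
     - s * Re (\<Sum>i\<in>I. \<Sum>j\<in>I. cnj (X i j) * (\<Sum>m\<in>I. X i m * Q m j))"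

text \<open>This is <P - Q, Z> for the solution Z of ((1-s) L_P + s R_Q) Z = P - Q, written in
  spectral data. It is a classical chi-square type divergence of the weights |<u_k|w_l>|^2 p_k and
  |<u_k|w_l>|^2 q_l, the Nussbaum-Szkola pair.\<close>

definition quad_divergence :: "'a set \<Rightarrow> 'k set \<Rightarrow> 'l set \<Rightarrow> ('a \<Rightarrow> 'k \<Rightarrow> complex) \<Rightarrow> ('k \<Rightarrow> real) \<Rightarrow> ('a \<Rightarrow> 'l \<Rightarrow> complex) \<Rightarrow> ('l \<Rightarrow> real) \<Rightarrow> real \<Rightarrow> real" where
  "quad_divergence I K L u p w q s =
     (\<Sum>k\<in>K. \<Sum>l\<in>L. (cmod (basis_overlap I u w k l))\<^sup>2 * ((p k - q l)\<^sup>2 / ((1 - s) * p k + s * q l)))"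

text \<open>In the mixed bases the form splits into independent scalar quadratics, one for each pair
  \<open>k\<close>, \<open>l\<close>, so that its upper bound and its maximiser can be found term by
  term.\<close>

lemma quad_form_coeff:
  assumes "finite I" "finite K" "finite L" "unitary_on I K u" "unitary_on I L w"
    "spectral_form I K P u p" "spectral_form I L Q w q"
  defines "x \<equiv> two_basis_coeff I u w"
  shows "quad_form I P Q s X = (\<Sum>k\<in>K. \<Sum>l\<in>L. 2 * (p k - q l) * Re (cnj (x X k l) * basis_overlap I u w k l)
       - ((1 - s) * p k + s * q l) * (cmod (x X k l))\<^sup>2)"
proof -
  have u: "isometric I K u" "isometric I L w" using assms(4,5) unfolding unitary_on_def by auto
  have sq: "cnj z * (of_real r * z) = of_real (r * (cmod z)\<^sup>2)" for z r
    using complex_norm_square[of z] by (simp add: mult_ac)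
  have 1: "(\<Sum>i\<in>I. \<Sum>j\<in>I. cnj (X i j) * (P i j - Q i j)) =
     (\<Sum>k\<in>K. \<Sum>l\<in>L. of_real (p k - q l) * (cnj (x X k l) * basis_overlap I u w k l))"
    unfolding parseval_two_basis[OF assms(1-5), where Y="\<lambda>i j. P i j - Q i j"] two_basis_coeff_diff x_def
    by (intro sum.cong refl)
      (simp add: two_basis_coeff_fst[OF assms(2) u(1) assms(6)] two_basis_coeff_snd[OF assms(3) u(2) assms(7)] algebra_simps)
  have 2: "(\<Sum>i\<in>I. \<Sum>j\<in>I. cnj (X i j) * (\<Sum>m\<in>I. P i m * X m j)) = (\<Sum>k\<in>K. \<Sum>l\<in>L. of_real (p k * (cmod (x X k l))\<^sup>2))"
    unfolding parseval_two_basis[OF assms(1-5), where Y="\<lambda>i j. \<Sum>m\<in>I. P i m * X m j"] x_def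
    by (intro sum.cong refl) (simp only: two_basis_coeff_left[OF assms(2) u(1) assms(6)] sq)
  have 3: "(\<Sum>i\<in>I. \<Sum>j\<in>I. cnj (X i j) * (\<Sum>m\<in>I. X i m * Q m j)) = (\<Sum>k\<in>K. \<Sum>l\<in>L. of_real (q l * (cmod (x X k l))\<^sup>2))"
    unfolding parseval_two_basis[OF assms(1-5), where Y="\<lambda>i j. \<Sum>m\<in>I. X i m * Q m j"] x_def
    by (intro sum.cong refl) (simp only: two_basis_coeff_right[OF assms(3) u(2) assms(7)] sq)
  show ?thesis
    unfolding quad_form_def 1 2 3
    by (simp add: sum_distrib_left sum_subtractf[symmetric] algebra_simps del: sum_subtractf)
qed

lemma quad_form_le:
  assumes "finite I" "finite K" "finite L" "unitary_on I K u" "unitary_on I L w"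
    "spectral_form I K P u p" "spectral_form I L Q w q"
    and "\<And>k. k \<in> K \<Longrightarrow> 0 \<le> p k" "\<And>l. l \<in> L \<Longrightarrow> 0 < q l" "0 < s" "s \<le> 1"
  shows "quad_form I P Q s X \<le> quad_divergence I K L u p w q s"
  unfolding quad_form_coeff[OF assms(1-7)] quad_divergence_def
proof (intro sum_mono)
  fix k l assume kl: "k \<in> K" "l \<in> L"
  define c where "c = basis_overlap I u w k l"
  define x where "x = two_basis_coeff I u w X k l"
  define D where "D = (1 - s) * p k + s * q l"
  \<comment> \<open>Since \<open>p k\<close> may vanish, positivity comes from
    \<open>s * q l\<close>; hence \<open>s = 0\<close> is excluded and \<open>Q\<close> has to be
    invertible.\<close>
  have D: "D > 0" unfolding D_def using assms(8)[OF kl(1)] assms(9)[OF kl(2)] assms(10,11)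
    by (simp add: add_nonneg_pos)
  have r: "Re (cnj x * c) \<le> cmod x * cmod c"
    using complex_Re_le_cmod[of "cnj x * c"] by (simp add: norm_mult)
  have r': "- Re (cnj x * c) \<le> cmod x * cmod c"
    using complex_Re_le_cmod[of "- (cnj x * c)"] by (simp add: norm_mult)
  have "2 * (p k - q l) * Re (cnj x * c) \<le> 2 * \<bar>p k - q l\<bar> * (cmod x * cmod c)"
    using mult_left_mono[OF r, of "2 * \<bar>p k - q l\<bar>"] mult_left_mono[OF r', of "2 * \<bar>p k - q l\<bar>"] by (auto simp: abs_if algebra_simps)
  moreover have "2 * \<bar>p k - q l\<bar> * (cmod x * cmod c) - D * (cmod x)\<^sup>2 \<le> (cmod c)\<^sup>2 * ((p k - q l)\<^sup>2 / D)"
  proof -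
    \<comment> \<open>Completion of the square in \<open>cmod x\<close>.\<close>
    have "0 \<le> (\<bar>p k - q l\<bar> * cmod c - D * cmod x)\<^sup>2 / D" using D by simp
    also have "\<dots> = (cmod c)\<^sup>2 * ((p k - q l)\<^sup>2 / D) - (2 * \<bar>p k - q l\<bar> * (cmod x * cmod c) - D * (cmod x)\<^sup>2)"
      using D by (simp add: power2_eq_square field_simps)
    finally show ?thesis by simp
  qed
  ultimately show "2 * (p k - q l) * Re (cnj x * c) - D * (cmod x)\<^sup>2 \<le> (cmod c)\<^sup>2 * ((p k - q l)\<^sup>2 / D)"
    by linarith
qed

lemma quad_form_attained:
  assumes "finite I" "finite K" "finite L" "unitary_on I K u" "unitary_on I L w"
    "spectral_form I K P u p" "spectral_form I L Q w q"
    and "\<And>k. k \<in> K \<Longrightarrow> 0 \<le> p k" "\<And>l. l \<in> L \<Longrightarrow> 0 < q l" "0 < s" "s \<le> 1"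
  obtains X where "quad_form I P Q s X = quad_divergence I K L u p w q s"
proof
  define c where "c = basis_overlap I u w"
  \<comment> \<open>The stationary point of each scalar quadratic, that is, the solution of ((1-s)
    L_P + s R_Q) X = P - Q in the mixed coordinates.\<close>
  define x where "x = (\<lambda>k l. of_real ((p k - q l) / ((1 - s) * p k + s * q l)) * c k l)"
  let ?X = "\<lambda>i j. \<Sum>k\<in>K. u i k * (\<Sum>l\<in>L. x k l * cnj (w j l))"
  have iso: "isometric I K u" "isometric I L w" using assms(4,5) unfolding unitary_on_def by auto
  show "quad_form I P Q s ?X = quad_divergence I K L u p w q s"
    unfolding quad_form_coeff[OF assms(1-7)] quad_divergence_def
  proof (intro sum.cong refl)
    fix k l assume kl: "k \<in> K" "l \<in> L"
    define D where "D = (1 - s) * p k + s * q l"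
    have D: "D > 0" unfolding D_def using assms(8)[OF kl(1)] assms(9)[OF kl(2)] assms(10,11)
      by (simp add: add_nonneg_pos)
    have e: "two_basis_coeff I u w ?X k l = of_real ((p k - q l) / D) * c k l"
      by (simp only: two_basis_coeff_expand[OF assms(2,3) iso kl]) (simp only: x_def D_def)
    have r: "Re (cnj (of_real ((p k - q l) / D) * c k l) * c k l) = (p k - q l) / D * (cmod (c k l))\<^sup>2"
    proof -
      have "cnj (of_real ((p k - q l) / D) * c k l) * c k l = of_real ((p k - q l) / D * (cmod (c k l))\<^sup>2)"
        using complex_norm_square[of "c k l"] by (simp add: mult_ac)
      then show ?thesis by (metis Re_complex_of_real)
    qed
    have n: "(cmod (of_real ((p k - q l) / D) * c k l))\<^sup>2 = ((p k - q l) / D)\<^sup>2 * (cmod (c k l))\<^sup>2"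
      by (simp only: norm_mult power_mult_distrib norm_of_real power2_abs)
    show "2 * (p k - q l) * Re (cnj (two_basis_coeff I u w ?X k l) * basis_overlap I u w k l) -
          ((1 - s) * p k + s * q l) * (cmod (two_basis_coeff I u w ?X k l))\<^sup>2 =
         (cmod (basis_overlap I u w k l))\<^sup>2 * ((p k - q l)\<^sup>2 / ((1 - s) * p k + s * q l))"
      unfolding e c_def[symmetric] D_def[symmetric] r n using D
      by (simp add: power2_eq_square field_simps)
  qed
qed


lemma cnj_of_bool [simp]: "cnj (of_bool P) = of_bool P"
  by (cases P) auto

definition ptrace :: "'b set \<Rightarrow> ('a \<times> 'b \<Rightarrow> 'a \<times> 'b \<Rightarrow> complex) \<Rightarrow> 'a \<Rightarrow> 'a \<Rightarrow> complex" where
  "ptrace B \<rho> i j = (\<Sum>b\<in>B. \<rho> (i, b) (j, b))"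

text \<open>The adjoint of the partial trace is X -> X tensor 1, a homomorphism. In the quadratic
  terms the two copies of X tensor 1 act trivially on \<open>B\<close>, so tracing out
  \<open>B\<close> reduces \<open>P\<close> and \<open>Q\<close> there as well and the value is
  preserved exactly.\<close>

lemma quad_form_ptrace:
  assumes [simp]: "finite B"
  shows "quad_form I (ptrace B P) (ptrace B Q) s X =
    quad_form (I \<times> B) P Q s (\<lambda>x y. X (fst x) (fst y) * of_bool (snd x = snd y))"
proof -
  let ?X = "\<lambda>x y. X (fst x) (fst y) * of_bool (snd x = snd y)"
  have lin: "(\<Sum>x\<in>I\<times>B. \<Sum>y\<in>I\<times>B. cnj (?X x y) * Y x y) = (\<Sum>i\<in>I. \<Sum>j\<in>I. cnj (X i j) * (\<Sum>b\<in>B. Y (i, b) (j, b)))"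
    for Y
  proof -
    have "(\<Sum>x\<in>I\<times>B. \<Sum>y\<in>I\<times>B. cnj (?X x y) * Y x y) =
       (\<Sum>i\<in>I. \<Sum>b\<in>B. \<Sum>j\<in>I. \<Sum>b'\<in>B. of_bool (b = b') * (cnj (X i j) * Y (i, b) (j, b')))"
      by (simp add: sum.cartesian_product' mult_ac)
    also have "\<dots> = (\<Sum>i\<in>I. \<Sum>b\<in>B. \<Sum>j\<in>I. cnj (X i j) * Y (i, b) (j, b))"
      by (intro sum.cong refl) (simp only: sum_of_bool_mult[OF assms] if_True)
    also have "\<dots> = (\<Sum>i\<in>I. \<Sum>j\<in>I. \<Sum>b\<in>B. cnj (X i j) * Y (i, b) (j, b))"
      by (intro sum.cong refl sum.swap)
    finally show ?thesis by (simp only: sum_distrib_left)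
  qed
  have L: "(\<Sum>m\<in>I\<times>B. P (i, b) m * ?X m (j, b)) = (\<Sum>m\<in>I. P (i, b) (m, b) * X m j)" if "b \<in> B" for i j b
    using that by (simp only: sum.cartesian_product' fst_conv snd_conv mult.assoc[symmetric] sum_of_bool_mult[OF assms] if_True)
  have R: "(\<Sum>m\<in>I\<times>B. ?X (i, b) m * Q m (j, b)) = (\<Sum>m\<in>I. X i m * Q (m, b) (j, b))" if "b \<in> B" for i j b
  proof -
    have "(\<Sum>m\<in>I\<times>B. ?X (i, b) m * Q m (j, b)) = (\<Sum>m\<in>I. \<Sum>b'\<in>B. of_bool (b = b') * (X i m * Q (m, b') (j, b)))"
      by (simp add: sum.cartesian_product' mult_ac)
    then show ?thesis using that by (simp only: sum_of_bool_mult[OF assms] if_True)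
  qed
  have "(\<Sum>b\<in>B. \<Sum>m\<in>I\<times>B. P (i, b) m * ?X m (j, b)) = (\<Sum>m\<in>I. ptrace B P i m * X m j)" for i j
  proof -
    have "(\<Sum>b\<in>B. \<Sum>m\<in>I\<times>B. P (i, b) m * ?X m (j, b)) = (\<Sum>b\<in>B. \<Sum>m\<in>I. P (i, b) (m, b) * X m j)"
      by (intro sum.cong refl L)
    then show ?thesis unfolding ptrace_def sum_distrib_right by (subst sum.swap) simp
  qed
  moreover have "(\<Sum>b\<in>B. \<Sum>m\<in>I\<times>B. ?X (i, b) m * Q m (j, b)) = (\<Sum>m\<in>I. X i m * ptrace B Q m j)" for i j
  proof -
    have "(\<Sum>b\<in>B. \<Sum>m\<in>I\<times>B. ?X (i, b) m * Q m (j, b)) = (\<Sum>b\<in>B. \<Sum>m\<in>I. X i m * Q (m, b) (j, b))"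
      by (intro sum.cong refl R)
    then show ?thesis unfolding ptrace_def sum_distrib_left by (subst sum.swap) simp
  qed
  ultimately show ?thesis
    unfolding quad_form_def lin by (simp only: ptrace_def sum_subtractf)
qed

text \<open>Umegaki's relative entropy in nats, shifted by tr Q - tr P so that it suits unnormalised
  arguments. It equals the classical divergence of the Nussbaum-Szkola weights.\<close>

definition rel_entropy :: "'a set \<Rightarrow> 'k set \<Rightarrow> 'l set \<Rightarrow> ('a \<Rightarrow> 'k \<Rightarrow> complex) \<Rightarrow> ('k \<Rightarrow> real) \<Rightarrow> ('a \<Rightarrow> 'l \<Rightarrow> complex) \<Rightarrow> ('l \<Rightarrow> real) \<Rightarrow> real" where
  "rel_entropy I K L u p w q =
     (\<Sum>k\<in>K. \<Sum>l\<in>L. (cmod (basis_overlap I u w k l))\<^sup>2 * (p k * ln (p k) - p k * ln (q l) + (q l - p k)))"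

text \<open>An antiderivative in \<open>s\<close> of \<open>s\<close> times
  \<open>quad_divergence\<close>. Its increment from 0 to 1 is the relative entropy, which is
  thereby the integral of these weighted divergences.\<close>

definition quad_primitive :: "'a set \<Rightarrow> 'k set \<Rightarrow> 'l set \<Rightarrow> ('a \<Rightarrow> 'k \<Rightarrow> complex) \<Rightarrow> ('k \<Rightarrow> real) \<Rightarrow> ('a \<Rightarrow> 'l \<Rightarrow> complex) \<Rightarrow> ('l \<Rightarrow> real) \<Rightarrow> real \<Rightarrow> real" where
  "quad_primitive I K L u p w q s =
     (\<Sum>k\<in>K. \<Sum>l\<in>L. (cmod (basis_overlap I u w k l))\<^sup>2 * ((q l - p k) * s - p k * ln (p k + s * (q l - p k))))"

lemma quad_primitive_diff:
  "quad_primitive I K L u p w q 1 - quad_primitive I K L u p w q 0 = rel_entropy I K L u p w q"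
  unfolding quad_primitive_def rel_entropy_def by (simp add: sum_subtractf[symmetric] algebra_simps)

lemma quad_primitive_deriv:
  assumes "\<And>k. k \<in> K \<Longrightarrow> 0 \<le> p k" "\<And>l. l \<in> L \<Longrightarrow> 0 < q l" "0 < s" "s \<le> 1"
  shows "(quad_primitive I K L u p w q has_real_derivative s * quad_divergence I K L u p w q s) (at s)"
proof -
  have "((\<lambda>s. (q l - p k) * s - p k * ln (p k + s * (q l - p k))) has_real_derivative
      s * ((p k - q l)\<^sup>2 / ((1 - s) * p k + s * q l))) (at s)" if "k \<in> K" "l \<in> L" for k l
  proof -
    have pos: "0 < p k + s * (q l - p k)"
    proof -
      have "0 < (1 - s) * p k + s * q l" using assms(1)[OF that(1)] assms(2)[OF that(2)] assms(3,4)
        by (simp add: add_nonneg_pos)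
      then show ?thesis by (simp add: algebra_simps)
    qed
    have "((\<lambda>s. (q l - p k) * s - p k * ln (p k + s * (q l - p k))) has_real_derivative
       (q l - p k) - p k * ((q l - p k) / (p k + s * (q l - p k)))) (at s)"
      using pos by (auto intro!: derivative_eq_intros)
    moreover have "(q l - p k) - p k * ((q l - p k) / (p k + s * (q l - p k))) = s * ((p k - q l)\<^sup>2 / ((1 - s) * p k + s * q l))"
    proof -
      have e: "(1 - s) * p k + s * q l = p k + s * (q l - p k)" by (simp add: algebra_simps)
      show ?thesis unfolding e using pos by (simp add: field_simps power2_eq_square)
    qed
    ultimately show ?thesis by simp
  qed
  then have "(quad_primitive I K L u p w q has_real_derivative
     (\<Sum>k\<in>K. \<Sum>l\<in>L. (cmod (basis_overlap I u w k l))\<^sup>2 * (s * ((p k - q l)\<^sup>2 / ((1 - s) * p k + s * q l))))) (at s)"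
    unfolding quad_primitive_def by (intro DERIV_sum DERIV_cmult; blast)
  then show ?thesis by (simp add: quad_divergence_def sum_distrib_left mult.left_commute)
qed

text \<open>The derivative is available only for \<open>s > 0\<close>, because the logarithm at
  \<open>s = 0\<close> has argument \<open>p k\<close>. If \<open>p k = 0\<close>, the whole
  logarithmic term is constantly 0, so continuity survives at the endpoint, and monotonicity on the
  closed interval asks for no more.\<close>

lemma quad_primitive_continuous:
  assumes "\<And>k. k \<in> K \<Longrightarrow> 0 \<le> p k" "\<And>l. l \<in> L \<Longrightarrow> 0 < q l"
  shows "continuous_on {0..1} (quad_primitive I K L u p w q)"
  unfolding quad_primitive_def
proof (intro continuous_on_sum)
  fix k l assume kl: "k \<in> K" "l \<in> L"
  have "continuous_on {0..1} (\<lambda>s. p k * ln (p k + s * (q l - p k)))"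
  proof (cases "p k = 0")
    case False
    then have "p k > 0" using assms(1)[OF kl(1)] by simp
    have "p k + s * (q l - p k) > 0" if "s \<in> {0..1}" for s
    proof (cases "s = 0")
      case False
      have "0 < (1 - s) * p k + s * q l" using that False assms(1)[OF kl(1)] assms(2)[OF kl(2)]
        by (simp add: add_nonneg_pos)
      then show ?thesis by (simp add: algebra_simps)
    qed (use \<open>p k > 0\<close> in simp)
    then show ?thesis by (intro continuous_intros) (auto simp: less_le)
  qed simp
  then show "continuous_on {0..1} (\<lambda>s. (cmod (basis_overlap I u w k l))\<^sup>2 *
      ((q l - p k) * s - p k * ln (p k + s * (q l - p k))))"
    by (rule continuous_on_mult_left[OF continuous_on_diff[OF continuous_on_mult_left[OF continuous_on_id]]])
qed

(* Both sides are primitives of the quadratic divergences, which are monotone because a test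
   kernel X on the reduced system lifts to X tensor 1. *)
theorem rel_entropy_ptrace_le:
  assumes [simp]: "finite I" "finite B" "finite K" "finite L" "finite K1" "finite L1"
    and u: "unitary_on (I \<times> B) K u" "spectral_form (I \<times> B) K P u p"
    and w: "unitary_on (I \<times> B) L w" "spectral_form (I \<times> B) L Q w q"
    and u1: "unitary_on I K1 u1" "spectral_form I K1 (ptrace B P) u1 p1"
    and w1: "unitary_on I L1 w1" "spectral_form I L1 (ptrace B Q) w1 q1"
    and pos: "\<And>k. k \<in> K \<Longrightarrow> 0 \<le> p k" "\<And>l. l \<in> L \<Longrightarrow> 0 < q l"
      "\<And>k. k \<in> K1 \<Longrightarrow> 0 \<le> p1 k" "\<And>l. l \<in> L1 \<Longrightarrow> 0 < q1 l"
  shows "rel_entropy I K1 L1 u1 p1 w1 q1 \<le> rel_entropy (I \<times> B) K L u p w q"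
proof -
  let ?f = "\<lambda>s. quad_primitive (I \<times> B) K L u p w q s - quad_primitive I K1 L1 u1 p1 w1 q1 s"
  have "?f 0 \<le> ?f 1"
  proof (rule DERIV_nonneg_imp_increasing_open[where f="?f"])
    show "continuous_on {0..1} ?f"
      by (intro continuous_on_diff quad_primitive_continuous pos)
    fix s :: real assume s: "0 < s" "s < 1"
    then have s1: "s \<le> 1" by simp
    \<comment> \<open>The optimal test kernel of the reduced pair, once lifted, is merely one
      competitor for the large pair.\<close>
    obtain X where X: "quad_form I (ptrace B P) (ptrace B Q) s X = quad_divergence I K1 L1 u1 p1 w1 q1 s"
      using quad_form_attained[OF _ _ _ u1(1) w1(1) u1(2) w1(2) pos(3,4) s(1) s1] by auto
    have "quad_divergence I K1 L1 u1 p1 w1 q1 s \<le> quad_divergence (I \<times> B) K L u p w q s"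
      unfolding X[symmetric] quad_form_ptrace[OF assms(2)]
      by (rule quad_form_le[OF _ _ _ u(1) w(1) u(2) w(2) pos(1,2) s(1) s1]) auto
    then have "0 \<le> s * quad_divergence (I \<times> B) K L u p w q s - s * quad_divergence I K1 L1 u1 p1 w1 q1 s"
      using s by (simp add: mult_left_mono)
    moreover have "(?f has_real_derivative s * quad_divergence (I \<times> B) K L u p w q s - s * quad_divergence I K1 L1 u1 p1 w1 q1 s) (at s)"
      by (intro DERIV_diff quad_primitive_deriv pos s(1) s1)
    ultimately show "\<exists>y. (?f has_real_derivative y) (at s) \<and> 0 \<le> y" by blast
  qed simp
  then show ?thesis
    using quad_primitive_diff[of "I \<times> B" K L u p w q] quad_primitive_diff[of I K1 L1 u1 p1 w1 q1] by linarith
qed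

text \<open>Together with \<open>basis_overlap_swap\<close>, the squared overlaps of two bases are
  doubly stochastic. This collapses every double sum whose terms involve only one of the two
  eigenvalues.\<close>

lemma basis_overlap_row:
  assumes "finite I" "finite L" "unitary_on I L w" "isometric I K u" "k \<in> K"
  shows "(\<Sum>l\<in>L. (cmod (basis_overlap I u w k l))\<^sup>2) = 1"
proof -
  have "complex_of_real (\<Sum>l\<in>L. (cmod (basis_overlap I u w k l))\<^sup>2) =
    (\<Sum>l\<in>L. cnj (\<Sum>i\<in>I. cnj (w i l) * u i k) * (\<Sum>i\<in>I. cnj (w i l) * u i k))"
    by (simp add: basis_overlap_def complex_norm_square mult.commute del: of_real_power)
  also have "\<dots> = (\<Sum>i\<in>I. cnj (u i k) * u i k)" by (rule parseval[OF assms(1-3), symmetric])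
  also have "\<dots> = 1" using assms(4,5) unfolding isometric_def by simp
  finally show ?thesis by (simp only: of_real_eq_1_iff)
qed

lemma basis_overlap_swap: "cmod (basis_overlap I u w k l) = cmod (basis_overlap I w u l k)"
proof -
  have "basis_overlap I u w k l = cnj (basis_overlap I w u l k)"
    by (simp add: basis_overlap_def mult.commute)
  then show ?thesis by simp
qed

lemma basis_overlap_expectation:
  assumes "finite K" "spectral_form I K P u p"
  shows "(\<Sum>k\<in>K. p k * (cmod (basis_overlap I u w k l))\<^sup>2) = Re (\<Sum>i\<in>I. \<Sum>j\<in>I. cnj (w i l) * P i j * w j l)"
proof -
  have "complex_of_real (\<Sum>k\<in>K. p k * (cmod (basis_overlap I u w k l))\<^sup>2) =
     (\<Sum>k\<in>K. (\<Sum>j\<in>I. of_real (p k) * cnj (u j k) * w j l) * (\<Sum>i\<in>I. u i k * cnj (w i l)))"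
    by (simp add: basis_overlap_def complex_norm_square sum_distrib_left[symmetric] mult.assoc del: of_real_power)
  also have "\<dots> = (\<Sum>j\<in>I. \<Sum>i\<in>I. (\<Sum>k\<in>K. of_real (p k) * cnj (u j k) * u i k) * (w j l * cnj (w i l)))"
    by (rule sum_product_swap)
  also have "\<dots> = (\<Sum>j\<in>I. \<Sum>i\<in>I. cnj (w i l) * P i j * w j l)"
    using assms(2) unfolding spectral_form_def by (intro sum.cong refl) (simp add: mult_ac)
  also have "\<dots> = (\<Sum>i\<in>I. \<Sum>j\<in>I. cnj (w i l) * P i j * w j l)" by (rule sum.swap)
  finally show ?thesis by (metis Re_complex_of_real)
qed

text \<open>The formula tr P ln P - tr P ln Q + tr Q - tr P, with \<open>ln 2\<close> converting
  \<open>ent\<close> from bits to nats and the logarithm of \<open>Q\<close> evaluated in its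
  eigenbasis.\<close>

lemma rel_entropy_eq:
  assumes [simp]: "finite I" "finite K" "finite L"
    and u: "unitary_on I K u" "spectral_form I K P u p"
    and w: "unitary_on I L w" "spectral_form I L Q w q"
  shows "rel_entropy I K L u p w q = - ln 2 * ent I P
     - (\<Sum>l\<in>L. ln (q l) * Re (\<Sum>i\<in>I. \<Sum>j\<in>I. cnj (w i l) * P i j * w j l))
     + Re (\<Sum>i\<in>I. Q i i) - Re (\<Sum>i\<in>I. P i i)"
proof -
  have iu: "isometric I K u" "isometric I L w" using u w unfolding unitary_on_def by auto
  let ?c = "\<lambda>k l. (cmod (basis_overlap I u w k l))\<^sup>2"
  have row: "(\<Sum>l\<in>L. ?c k l) = 1" if "k \<in> K" for k
    by (rule basis_overlap_row[OF _ _ w(1) iu(1) that]) auto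
  have col: "(\<Sum>k\<in>K. ?c k l) = 1" if "l \<in> L" for l
    using basis_overlap_row[OF _ _ u(1) iu(2) that] by (simp add: basis_overlap_swap[of I w u])
  have "rel_entropy I K L u p w q = (\<Sum>k\<in>K. \<Sum>l\<in>L. ?c k l * (p k * ln (p k)))
     - (\<Sum>k\<in>K. \<Sum>l\<in>L. ln (q l) * (p k * ?c k l)) + (\<Sum>k\<in>K. \<Sum>l\<in>L. ?c k l * q l) - (\<Sum>k\<in>K. \<Sum>l\<in>L. ?c k l * p k)"
    unfolding rel_entropy_def by (simp add: sum_subtractf[symmetric] sum.distrib[symmetric] algebra_simps del: sum_subtractf)
  moreover have "(\<Sum>k\<in>K. \<Sum>l\<in>L. ?c k l * (p k * ln (p k))) = - ln 2 * ent I P"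
  proof -
    have "(\<Sum>k\<in>K. \<Sum>l\<in>L. ?c k l * (p k * ln (p k))) = (\<Sum>k\<in>K. p k * ln (p k))"
      by (intro sum.cong refl) (simp add: row flip: sum_distrib_right)
    also have "\<dots> = (\<Sum>k\<in>K. - ln 2 * entropy_fun (p k))"
      by (simp add: entropy_fun_def log_def)
    finally show ?thesis by (simp add: ent_spectral[OF _ _ iu(1) u(2)] sum_distrib_left)
  qed
  moreover have "(\<Sum>k\<in>K. \<Sum>l\<in>L. ln (q l) * (p k * ?c k l)) =
      (\<Sum>l\<in>L. ln (q l) * Re (\<Sum>i\<in>I. \<Sum>j\<in>I. cnj (w i l) * P i j * w j l))"
    by (subst sum.swap) (simp only: sum_distrib_left[symmetric] basis_overlap_expectation[OF assms(2) u(2)])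
  moreover have "(\<Sum>k\<in>K. \<Sum>l\<in>L. ?c k l * q l) = Re (\<Sum>i\<in>I. Q i i)"
    unfolding spectral_trace[OF assms(3) iu(2) w(2)]
    by (subst sum.swap) (simp add: col flip: sum_distrib_right)
  moreover have "(\<Sum>k\<in>K. \<Sum>l\<in>L. ?c k l * p k) = Re (\<Sum>i\<in>I. P i i)"
    unfolding spectral_trace[OF assms(2) iu(1) u(2)]
    by (simp add: row flip: sum_distrib_right)
  ultimately show ?thesis by simp
qed


text \<open>A test vector \<open>v\<close> for the image is pulled back to \<open>V s\<close>, the
  adjoint of \<open>a s\<close> applied to \<open>v\<close>.\<close>

lemma psd_on_kraus:
  assumes "psd_on I \<rho>"
  shows "psd_on J (\<lambda>j j'. \<Sum>s\<in>S. \<Sum>i\<in>I. \<Sum>i'\<in>I. a s j i * \<rho> i i' * cnj (a s j' i'))"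
  unfolding psd_on_def
proof (intro conjI allI)
  note herm = hermitian_onD[OF psd_on_hermitian[OF assms]]
  have "(\<Sum>s\<in>S. \<Sum>i\<in>I. \<Sum>i'\<in>I. a s j' i * \<rho> i i' * cnj (a s j i')) =
      cnj (\<Sum>s\<in>S. \<Sum>i\<in>I. \<Sum>i'\<in>I. a s j i * \<rho> i i' * cnj (a s j' i'))" for j j'
  proof -
    have "cnj (\<Sum>s\<in>S. \<Sum>i\<in>I. \<Sum>i'\<in>I. a s j i * \<rho> i i' * cnj (a s j' i')) =
       (\<Sum>s\<in>S. \<Sum>i\<in>I. \<Sum>i'\<in>I. a s j' i' * \<rho> i' i * cnj (a s j i))"
      unfolding cnj_sum by (intro sum.cong refl) (simp add: herm)
    also have "\<dots> = (\<Sum>s\<in>S. \<Sum>i\<in>I. \<Sum>i'\<in>I. a s j' i * \<rho> i i' * cnj (a s j i'))"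
      by (intro sum.cong refl sum.swap)
    finally show ?thesis by simp
  qed
  then show "hermitian_on J (\<lambda>j j'. \<Sum>s\<in>S. \<Sum>i\<in>I. \<Sum>i'\<in>I. a s j i * \<rho> i i' * cnj (a s j' i'))"
    unfolding hermitian_on_def by blast
  fix v
  define V where "V = (\<lambda>s i. \<Sum>j\<in>J. cnj (a s j i) * v j)"
  have "(\<Sum>j\<in>J. \<Sum>j'\<in>J. cnj (v j) * (\<Sum>s\<in>S. \<Sum>i\<in>I. \<Sum>i'\<in>I. a s j i * \<rho> i i' * cnj (a s j' i')) * v j')
     = (\<Sum>j\<in>J. \<Sum>j'\<in>J. \<Sum>s\<in>S. \<Sum>i\<in>I. \<Sum>i'\<in>I. (a s j i * cnj (v j)) * (\<rho> i i' * (cnj (a s j' i') * v j')))"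
    by (simp only: sum_distrib_left sum_distrib_right mult_ac)
  also have "\<dots> = (\<Sum>s\<in>S. \<Sum>j\<in>J. \<Sum>j'\<in>J. \<Sum>i\<in>I. \<Sum>i'\<in>I. (a s j i * cnj (v j)) * (\<rho> i i' * (cnj (a s j' i') * v j')))"
    by (subst (2) sum.swap, subst sum.swap, rule refl)
  also have "\<dots> = (\<Sum>s\<in>S. \<Sum>i\<in>I. \<Sum>i'\<in>I. \<Sum>j\<in>J. \<Sum>j'\<in>J. (a s j i * cnj (v j)) * (\<rho> i i' * (cnj (a s j' i') * v j')))"
    by (intro sum.cong refl sum_swap_pairs)
  also have "\<dots> = (\<Sum>s\<in>S. \<Sum>i\<in>I. \<Sum>i'\<in>I. cnj (V s i) * \<rho> i i' * V s i')"
    unfolding V_def by (intro sum.cong refl) (simp add: sum_product sum_distrib_left sum_distrib_right mult_ac)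
  finally have e: "(\<Sum>j\<in>J. \<Sum>j'\<in>J. cnj (v j) * (\<Sum>s\<in>S. \<Sum>i\<in>I. \<Sum>i'\<in>I. a s j i * \<rho> i i' * cnj (a s j' i')) * v j')
     = (\<Sum>s\<in>S. \<Sum>i\<in>I. \<Sum>i'\<in>I. cnj (V s i) * \<rho> i i' * V s i')" .
  have "0 \<le> Re (\<Sum>i\<in>I. \<Sum>i'\<in>I. cnj (V s i) * \<rho> i i' * V s i')" for s
    using assms unfolding psd_on_def by (elim conjE allE[where x="V s"])
  then show "0 \<le> Re (\<Sum>j\<in>J. \<Sum>j'\<in>J. cnj (v j) * (\<Sum>s\<in>S. \<Sum>i\<in>I. \<Sum>i'\<in>I. a s j i * \<rho> i i' * cnj (a s j' i')) * v j')"
    unfolding e Re_sum[of _ S] by (intro sum_nonneg) auto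
qed

lemma psd_on_cong:
  assumes "\<And>i j. i \<in> I \<Longrightarrow> j \<in> I \<Longrightarrow> \<rho> i j = \<sigma> i j"
  shows "psd_on I \<rho> \<longleftrightarrow> psd_on I \<sigma>"
  using assms by (simp add: psd_on_def hermitian_on_def cong: sum.cong)

text \<open>The map need not be injective: the new kernel is the conjugation of
  \<open>\<rho>\<close> by the 0-1 kernel of \<open>f\<close>. Relabelling subsystems and fixing the
  value of a subsystem are both instances.\<close>

lemma psd_on_map:
  assumes "finite I" "psd_on I \<rho>" "f ` J \<subseteq> I"
  shows "psd_on J (\<lambda>i j. \<rho> (f i) (f j))"
proof -
  have "psd_on J (\<lambda>j j'. \<Sum>s\<in>{()}. \<Sum>i\<in>I. \<Sum>i'\<in>I. of_bool (f j = i) * \<rho> i i' * cnj (of_bool (f j' = i')))"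
    by (rule psd_on_kraus[OF assms(2)])
  also have "?this \<longleftrightarrow> ?thesis"
    using assms(1,3) by (intro psd_on_cong)
      (auto simp: mult.assoc Int_insert_right image_subset_iff simp flip: sum_distrib_left)
  finally show ?thesis .
qed

lemma psd_on_sum:
  assumes "\<And>s. s \<in> S \<Longrightarrow> psd_on I (\<rho> s)"
  shows "psd_on I (\<lambda>i j. \<Sum>s\<in>S. \<rho> s i j)"
  unfolding psd_on_def
proof (intro conjI allI)
  show "hermitian_on I (\<lambda>i j. \<Sum>s\<in>S. \<rho> s i j)"
    using hermitian_onD[OF psd_on_hermitian[OF assms]] unfolding hermitian_on_def by simp
  fix v
  have "(\<Sum>i\<in>I. \<Sum>j\<in>I. cnj (v i) * (\<Sum>s\<in>S. \<rho> s i j) * v j) = (\<Sum>i\<in>I. \<Sum>j\<in>I. \<Sum>s\<in>S. cnj (v i) * \<rho> s i j * v j)"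
    by (simp only: sum_distrib_left sum_distrib_right)
  also have "\<dots> = (\<Sum>s\<in>S. \<Sum>i\<in>I. \<Sum>j\<in>I. cnj (v i) * \<rho> s i j * v j)"
    by (subst (2) sum.swap, subst sum.swap, rule refl)
  finally show "0 \<le> Re (\<Sum>i\<in>I. \<Sum>j\<in>I. cnj (v i) * (\<Sum>s\<in>S. \<rho> s i j) * v j)"
    using assms unfolding psd_on_def by (auto intro: sum_nonneg)
qed

lemma psd_on_ptrace:
  assumes "finite I" "finite B" "psd_on (I \<times> B) \<rho>"
  shows "psd_on I (ptrace B \<rho>)"
  unfolding ptrace_def
  by (intro psd_on_sum psd_on_map[OF _ assms(3)]) (use assms in auto)

section \<open>Spectral data of a shift by the identity and of a tensor product with the
  identity\<close>

lemma spectral_form_const_add: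
  assumes "unitary_on I K u" "spectral_form I K \<rho> u d"
  shows "spectral_form I K (\<lambda>i j. \<rho> i j + of_real c * of_bool (i = j)) u (\<lambda>k. d k + c)"
  unfolding spectral_form_def
proof (intro ballI)
  fix i j assume ij: "i \<in> I" "j \<in> I"
  have "(\<Sum>k\<in>K. of_real (d k + c) * u i k * cnj (u j k)) =
    (\<Sum>k\<in>K. of_real (d k) * u i k * cnj (u j k)) + of_real c * (\<Sum>k\<in>K. u i k * cnj (u j k))"
    by (simp add: sum.distrib sum_distrib_left algebra_simps)
  then show "\<rho> i j + of_real c * of_bool (i = j) = (\<Sum>k\<in>K. of_real (d k + c) * u i k * cnj (u j k))"
    using unitary_onD2[OF assms(1) ij] assms(2) ij unfolding spectral_form_def by simp
qed

lemma unitary_on_ampliate: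
  assumes "finite A" "unitary_on I K u"
  shows "unitary_on (A \<times> I) (A \<times> K) (\<lambda>x k. of_bool (fst x = fst k) * u (snd x) (snd k))"
proof -
  have iso: "isometric (A \<times> I) (A \<times> K) (\<lambda>x k. of_bool (fst x = fst k) * u (snd x) (snd k))"
    if "isometric I K u" for I :: "'x set" and K :: "'y set" and u
    unfolding isometric_def
  proof (intro ballI)
    fix k l assume kl: "k \<in> A \<times> K" "l \<in> A \<times> K"
    have "(\<Sum>x\<in>A\<times>I. cnj (of_bool (fst x = fst k) * u (snd x) (snd k)) * (of_bool (fst x = fst l) * u (snd x) (snd l)))
       = (\<Sum>a\<in>A. of_bool (a = fst k) * (of_bool (a = fst l) * (\<Sum>i\<in>I. cnj (u i (snd k)) * u i (snd l))))"
      by (simp add: sum.cartesian_product' sum_distrib_left mult_ac)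
    also have "\<dots> = of_bool (fst k = fst l) * (\<Sum>i\<in>I. cnj (u i (snd k)) * u i (snd l))"
      using kl assms(1) by (simp only: sum_of_bool_mult) auto
    also have "\<dots> = of_bool (k = l)"
      using that kl unfolding isometric_def by (auto simp: prod_eq_iff)
    finally show "(\<Sum>x\<in>A\<times>I. cnj (of_bool (fst x = fst k) * u (snd x) (snd k)) * (of_bool (fst x = fst l) * u (snd x) (snd l)))
       = of_bool (k = l)" .
  qed
  show ?thesis
    using iso[of I K u] iso[of K I "\<lambda>k i. cnj (u i k)"] assms(2)
    unfolding unitary_on_iff by (simp add: eq_commute)
qed

lemma spectral_form_ampliate:
  assumes "finite A" "spectral_form I K \<rho> u d"
  shows "spectral_form (A \<times> I) (A \<times> K) (\<lambda>x y. of_bool (fst x = fst y) * \<rho> (snd x) (snd y))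
     (\<lambda>x k. of_bool (fst x = fst k) * u (snd x) (snd k)) (\<lambda>k. d (snd k))"
  unfolding spectral_form_def
proof (intro ballI)
  fix x y assume xy: "x \<in> A \<times> I" "y \<in> A \<times> I"
  have "(\<Sum>k\<in>A\<times>K. of_real (d (snd k)) * (of_bool (fst x = fst k) * u (snd x) (snd k)) *
         cnj (of_bool (fst y = fst k) * u (snd y) (snd k))) =
     (\<Sum>a\<in>A. of_bool (fst x = a) * (of_bool (fst y = a) * (\<Sum>k\<in>K. of_real (d k) * u (snd x) k * cnj (u (snd y) k))))"
    by (simp add: sum.cartesian_product' sum_distrib_left mult_ac)
  also have "\<dots> = of_bool (fst y = fst x) * (\<Sum>k\<in>K. of_real (d k) * u (snd x) k * cnj (u (snd y) k))"
    using xy assms(1) by (simp only: sum_of_bool_mult) auto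
  also have "\<dots> = of_bool (fst x = fst y) * \<rho> (snd x) (snd y)"
    using xy assms(2) unfolding spectral_form_def by (cases "fst x = fst y") (simp_all add: mem_Times_iff)
  finally show "of_bool (fst x = fst y) * \<rho> (snd x) (snd y) =
     (\<Sum>k\<in>A\<times>K. of_real (d (snd k)) * (of_bool (fst x = fst k) * u (snd x) (snd k)) *
         cnj (of_bool (fst y = fst k) * u (snd y) (snd k)))" by simp
qed

lemma unitary_on_reindex:
  assumes "unitary_on I K u" "bij_betw f I' I"
  shows "unitary_on I' K (\<lambda>i k. u (f i) k)"
proof -
  have "isometric I K u" "isometric K I (\<lambda>k i. cnj (u i k))"
    using assms(1) unfolding unitary_on_iff by auto
  from isometric_reindex[OF this(1) assms(2) bij_betw_id] isometric_reindex[OF this(2) bij_betw_id assms(2)]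
  show ?thesis unfolding unitary_on_iff by simp
qed

lemma spectral_form_reindex:
  assumes "spectral_form I K \<rho> u d" "f ` I' \<subseteq> I"
  shows "spectral_form I' K (\<lambda>i j. \<rho> (f i) (f j)) (\<lambda>i k. u (f i) k) d"
  using assms unfolding spectral_form_def by (auto simp: image_subset_iff)


(* Monotonicity of the relative entropy of \<rho> with respect to \<open>1 \<otimes> (\<rho>_EB + \<delta>)\<close> under tracing
   out B; the shift by \<delta> makes the second argument invertible and disappears in the limit. *)
theorem strong_subadditivity:
  fixes A :: "'a set" and E :: "'e set" and B :: "'b set"
  assumes [simp]: "finite A" "finite E" "finite B" and B: "B \<noteq> {}"
    and \<rho>: "psd_on ((A \<times> E) \<times> B) \<rho>"
  defines "\<rho>EB \<equiv> \<lambda>x y. \<Sum>a\<in>A. \<rho> ((a, fst x), snd x) ((a, fst y), snd y)"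
  shows "ent ((A \<times> E) \<times> B) \<rho> + ent E (ptrace B \<rho>EB) \<le> ent (A \<times> E) (ptrace B \<rho>) + ent (E \<times> B) \<rho>EB"
proof -
  let ?I = "(A \<times> E) \<times> B"
  define \<rho>AE where "\<rho>AE = ptrace B \<rho>"
  define \<rho>E where "\<rho>E = ptrace B \<rho>EB"
  have psdEB: "psd_on (E \<times> B) \<rho>EB"
    unfolding \<rho>EB_def by (intro psd_on_sum psd_on_map[OF _ \<rho>]) auto
  have psdAE: "psd_on (A \<times> E) \<rho>AE" unfolding \<rho>AE_def by (intro psd_on_ptrace[OF _ _ \<rho>]) auto
  have psdE: "psd_on E \<rho>E" unfolding \<rho>E_def by (intro psd_on_ptrace[OF _ _ psdEB]) auto
  obtain u p where u: "unitary_on ?I ?I u" "spectral_form ?I ?I \<rho> u p"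
    using spectral_theorem[OF _ psd_on_hermitian[OF \<rho>]] by auto
  obtain u1 p1 where u1: "unitary_on (A \<times> E) (A \<times> E) u1" "spectral_form (A \<times> E) (A \<times> E) \<rho>AE u1 p1"
    using spectral_theorem[OF _ psd_on_hermitian[OF psdAE]] by auto
  obtain w r where w: "unitary_on (E \<times> B) (E \<times> B) w" "spectral_form (E \<times> B) (E \<times> B) \<rho>EB w r"
    using spectral_theorem[OF _ psd_on_hermitian[OF psdEB]] by auto
  obtain w1 r1 where w1: "unitary_on E E w1" "spectral_form E E \<rho>E w1 r1"
    using spectral_theorem[OF _ psd_on_hermitian[OF psdE]] by auto
  have p: "0 \<le> p k" if "k \<in> ?I" for k
    using psd_on_spectral_nonneg[OF _ _ u(2) \<rho> that] u(1) by (auto simp: unitary_on_def)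
  have p1: "0 \<le> p1 k" if "k \<in> A \<times> E" for k
    using psd_on_spectral_nonneg[OF _ _ u1(2) psdAE that] u1(1) by (auto simp: unitary_on_def)
  have r: "0 \<le> r k" if "k \<in> E \<times> B" for k
    using psd_on_spectral_nonneg[OF _ _ w(2) psdEB that] w(1) by (auto simp: unitary_on_def)
  have r1: "0 \<le> r1 k" if "k \<in> E" for k
    using psd_on_spectral_nonneg[OF _ _ w1(2) psdE that] w1(1) by (auto simp: unitary_on_def)
  define g where "g = (\<lambda>x::('a \<times> 'e) \<times> 'b. (fst (fst x), (snd (fst x), snd x)))"
  have g: "bij_betw g ?I (A \<times> (E \<times> B))"
    by (rule bij_betw_byWitness[where f'="\<lambda>y. ((fst y, fst (snd y)), snd (snd y))"]) (auto simp: g_def)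
  define W :: "('a \<times> 'e) \<times> 'b \<Rightarrow> 'a \<times> 'e \<times> 'b \<Rightarrow> complex"
    where "W = (\<lambda>x k. of_bool (fst (g x) = fst k) * w (snd (g x)) (snd k))"
  have W: "unitary_on ?I (A \<times> (E \<times> B)) W"
    unfolding W_def using unitary_on_reindex[OF unitary_on_ampliate[OF _ w(1)] g] by simp
  define W1 :: "'a \<times> 'e \<Rightarrow> 'a \<times> 'e \<Rightarrow> complex"
    where "W1 = (\<lambda>x k. of_bool (fst x = fst k) * w1 (snd x) (snd k))"
  have W1: "unitary_on (A \<times> E) (A \<times> E) W1"
    unfolding W1_def by (rule unitary_on_ampliate[OF _ w1(1)]) simp
  let ?b = "real (card B)"
  have b: "?b > 0" using B by (simp add: card_gt_0_iff)
  have ineq: "- ln 2 * ent (A \<times> E) \<rho>AE - (\<Sum>k\<in>E. r1 k * ln (r1 k + \<delta> * ?b))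
      \<le> - ln 2 * ent ?I \<rho> - (\<Sum>k\<in>E \<times> B. r k * ln (r k + \<delta>))" if \<delta>: "\<delta> > 0" for \<delta>
  proof -
    \<comment> \<open>\<open>Q\<close> is 1 tensor (\<open>\<rho>EB\<close> +
      \<open>\<delta>\<close>). Its partial trace over \<open>B\<close> has the same shape, with
      \<open>\<rho>E\<close> and a shift multiplied by \<open>card B\<close>, so both second
      arguments have explicit spectra.\<close>
    define Q where "Q = (\<lambda>x y. of_bool (fst (g x) = fst (g y)) *
       (\<rho>EB (snd (g x)) (snd (g y)) + of_real \<delta> * of_bool (snd (g x) = snd (g y))))"
    have Q: "spectral_form ?I (A \<times> (E \<times> B)) Q W (\<lambda>k. r (snd k) + \<delta>)"
      unfolding Q_def W_def
      using spectral_form_reindex[OF spectral_form_ampliate[OF _ spectral_form_const_add[OF w, of \<delta>]], of A g ?I]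
        bij_betw_imp_surj_on[OF g] by simp
    have Q1: "spectral_form (A \<times> E) (A \<times> E) (ptrace B Q) W1 (\<lambda>k. r1 (snd k) + \<delta> * ?b)"
    proof -
      have "ptrace B Q x y = of_bool (fst x = fst y) * (\<rho>E (snd x) (snd y) + of_real (\<delta> * ?b) * of_bool (snd x = snd y))" for x y
        unfolding ptrace_def Q_def \<rho>E_def
        by (simp add: g_def sum.distrib algebra_simps flip: sum_distrib_left)
      moreover have "spectral_form (A \<times> E) (A \<times> E)
         (\<lambda>x y. of_bool (fst x = fst y) * (\<rho>E (snd x) (snd y) + of_real (\<delta> * ?b) * of_bool (snd x = snd y))) W1 (\<lambda>k. r1 (snd k) + \<delta> * ?b)"
        unfolding W1_def by (rule spectral_form_ampliate[OF _ spectral_form_const_add[OF w1]]) simp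
      ultimately show ?thesis unfolding spectral_form_def by simp
    qed
    have "rel_entropy (A \<times> E) (A \<times> E) (A \<times> E) u1 p1 W1 (\<lambda>k. r1 (snd k) + \<delta> * ?b)
      \<le> rel_entropy ?I ?I (A \<times> (E \<times> B)) u p W (\<lambda>k. r (snd k) + \<delta>)"
    proof (rule rel_entropy_ptrace_le[OF _ _ _ _ _ _ u W Q u1(1) u1(2)[unfolded \<rho>AE_def] W1 Q1])
      show "0 < r (snd k) + \<delta>" if "k \<in> A \<times> E \<times> B" for k using r[of "snd k"] that \<delta> by auto
      show "0 < r1 (snd k) + \<delta> * ?b" if "k \<in> A \<times> E" for k
        using r1[of "snd k"] that \<delta> b by (auto intro!: add_nonneg_pos)
    qed (use p p1 in auto)
    moreover have "rel_entropy (A \<times> E) (A \<times> E) (A \<times> E) u1 p1 W1 (\<lambda>k. r1 (snd k) + \<delta> * ?b) =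
      - ln 2 * ent (A \<times> E) \<rho>AE - (\<Sum>k\<in>E. r1 k * ln (r1 k + \<delta> * ?b))
       + Re (\<Sum>i\<in>A \<times> E. ptrace B Q i i) - Re (\<Sum>i\<in>A \<times> E. \<rho>AE i i)"
    proof -
      \<comment> \<open>The logarithm of the reduced \<open>Q\<close> acts trivially on
        \<open>A\<close>, so its expectation in \<open>\<rho>AE\<close> is an expectation in
        \<open>\<rho>E\<close>, where it is diagonal. The same argument is used for
        \<open>\<rho>\<close> and \<open>\<rho>EB\<close> below.\<close>
      have "(\<Sum>l\<in>A \<times> E. ln (r1 (snd l) + \<delta> * ?b) * Re (\<Sum>i\<in>A \<times> E. \<Sum>j\<in>A \<times> E. cnj (W1 i l) * \<rho>AE i j * W1 j l))
         = (\<Sum>k\<in>E. r1 k * ln (r1 k + \<delta> * ?b))"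
      proof -
        have "(\<Sum>i\<in>A \<times> E. \<Sum>j\<in>A \<times> E. cnj (W1 i (a, k)) * \<rho>AE i j * W1 j (a, k)) =
           (\<Sum>i\<in>E. \<Sum>j\<in>E. cnj (w1 i k) * \<rho>AE (a, i) (a, j) * w1 j k)" if "a \<in> A" for a k
        proof -
          have "(\<Sum>i\<in>A \<times> E. \<Sum>j\<in>A \<times> E. cnj (W1 i (a, k)) * \<rho>AE i j * W1 j (a, k)) =
            (\<Sum>a'\<in>A. of_bool (a' = a) * (\<Sum>i\<in>E. \<Sum>a''\<in>A. of_bool (a'' = a) * (\<Sum>j\<in>E. cnj (w1 i k) * \<rho>AE (a', i) (a'', j) * w1 j k)))"
            by (simp add: sum.cartesian_product' W1_def sum_distrib_left mult_ac)
          then show ?thesis using that by (simp only: sum_of_bool_mult assms(1) if_True)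
        qed
        note 1 = this
        have "(\<Sum>a\<in>A. Re (\<Sum>i\<in>A \<times> E. \<Sum>j\<in>A \<times> E. cnj (W1 i (a, k)) * \<rho>AE i j * W1 j (a, k))) = r1 k" if "k \<in> E" for k
        proof -
          have "(\<Sum>a\<in>A. \<Sum>i\<in>A \<times> E. \<Sum>j\<in>A \<times> E. cnj (W1 i (a, k)) * \<rho>AE i j * W1 j (a, k)) =
             (\<Sum>a\<in>A. \<Sum>i\<in>E. \<Sum>j\<in>E. cnj (w1 i k) * \<rho>AE (a, i) (a, j) * w1 j k)"
            by (intro sum.cong refl 1)
          also have "\<dots> = (\<Sum>i\<in>E. \<Sum>j\<in>E. \<Sum>a\<in>A. cnj (w1 i k) * \<rho>AE (a, i) (a, j) * w1 j k)"
            by (subst sum.swap, intro sum.cong refl, rule sum.swap)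
          also have "\<dots> = (\<Sum>i\<in>E. \<Sum>j\<in>E. cnj (w1 i k) * \<rho>E i j * w1 j k)"
          proof -
            have "(\<Sum>a\<in>A. \<rho>AE (a, i) (a, j)) = \<rho>E i j" for i j
              unfolding \<rho>E_def \<rho>AE_def ptrace_def \<rho>EB_def fst_conv snd_conv by (rule sum.swap)
            then show ?thesis by (simp only: sum_distrib_left[symmetric] sum_distrib_right[symmetric])
          qed
          also have "\<dots> = of_real (r1 k)"
            by (rule spectral_value[OF _ _ w1(2) that]) (use w1(1) in \<open>auto simp: unitary_on_def\<close>)
          finally show ?thesis by (metis Re_complex_of_real Re_sum)
        qed
        then show ?thesis
          by (simp add: sum.cartesian_product' sum.swap[of _ E A] mult.commute flip: sum_distrib_left)
      qed
      then show ?thesis using rel_entropy_eq[OF _ _ _ u1 W1 Q1] by simp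
    qed
    moreover have "rel_entropy ?I ?I (A \<times> (E \<times> B)) u p W (\<lambda>k. r (snd k) + \<delta>) =
      - ln 2 * ent ?I \<rho> - (\<Sum>k\<in>E \<times> B. r k * ln (r k + \<delta>))
       + Re (\<Sum>i\<in>?I. Q i i) - Re (\<Sum>i\<in>?I. \<rho> i i)"
    proof -
      have "(\<Sum>l\<in>A \<times> (E \<times> B). ln (r (snd l) + \<delta>) * Re (\<Sum>i\<in>?I. \<Sum>j\<in>?I. cnj (W i l) * \<rho> i j * W j l))
         = (\<Sum>k\<in>E \<times> B. r k * ln (r k + \<delta>))"
      proof -
        have "(\<Sum>i\<in>?I. \<Sum>j\<in>?I. cnj (W i (a, k)) * \<rho> i j * W j (a, k)) =
           (\<Sum>i\<in>E \<times> B. \<Sum>j\<in>E \<times> B. cnj (w i k) * \<rho> ((a, fst i), snd i) ((a, fst j), snd j) * w j k)" if "a \<in> A" for a k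
        proof -
          have "(\<Sum>i\<in>?I. \<Sum>j\<in>?I. cnj (W i (a, k)) * \<rho> i j * W j (a, k)) =
            (\<Sum>a'\<in>A. of_bool (a' = a) * (\<Sum>i\<in>E \<times> B. \<Sum>a''\<in>A. of_bool (a'' = a) *
               (\<Sum>j\<in>E \<times> B. cnj (w i k) * \<rho> ((a', fst i), snd i) ((a'', fst j), snd j) * w j k)))"
            by (simp add: sum.cartesian_product' W_def g_def sum_distrib_left mult_ac)
          then show ?thesis using that by (simp only: sum_of_bool_mult assms(1) if_True)
        qed
        note 1 = this
        have "(\<Sum>a\<in>A. Re (\<Sum>i\<in>?I. \<Sum>j\<in>?I. cnj (W i (a, k)) * \<rho> i j * W j (a, k))) = r k" if "k \<in> E \<times> B" for k
        proof -
          have "(\<Sum>a\<in>A. \<Sum>i\<in>?I. \<Sum>j\<in>?I. cnj (W i (a, k)) * \<rho> i j * W j (a, k)) =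
             (\<Sum>a\<in>A. \<Sum>i\<in>E \<times> B. \<Sum>j\<in>E \<times> B. cnj (w i k) * \<rho> ((a, fst i), snd i) ((a, fst j), snd j) * w j k)"
            by (intro sum.cong refl 1)
          also have "\<dots> = (\<Sum>i\<in>E \<times> B. \<Sum>j\<in>E \<times> B. \<Sum>a\<in>A. cnj (w i k) * \<rho> ((a, fst i), snd i) ((a, fst j), snd j) * w j k)"
            by (subst sum.swap, intro sum.cong refl, rule sum.swap)
          also have "\<dots> = (\<Sum>i\<in>E \<times> B. \<Sum>j\<in>E \<times> B. cnj (w i k) * \<rho>EB i j * w j k)"
            unfolding \<rho>EB_def by (simp only: sum_distrib_left sum_distrib_right)
          also have "\<dots> = of_real (r k)"
            by (rule spectral_value[OF _ _ w(2) that]) (use w(1) in \<open>auto simp: unitary_on_def\<close>)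
          finally show ?thesis by (metis Re_complex_of_real Re_sum)
        qed
        note 2 = this
        have "(\<Sum>l\<in>A \<times> (E \<times> B). ln (r (snd l) + \<delta>) * Re (\<Sum>i\<in>?I. \<Sum>j\<in>?I. cnj (W i l) * \<rho> i j * W j l))
          = (\<Sum>k\<in>E \<times> B. \<Sum>a\<in>A. ln (r k + \<delta>) * Re (\<Sum>i\<in>?I. \<Sum>j\<in>?I. cnj (W i (a, k)) * \<rho> i j * W j (a, k)))"
          by (subst sum.swap) (simp only: sum.cartesian_product'[of _ A "E \<times> B"] snd_conv)
        also have "\<dots> = (\<Sum>k\<in>E \<times> B. ln (r k + \<delta>) * r k)"
          by (intro sum.cong refl) (simp only: sum_distrib_left[symmetric] 2)
        finally show ?thesis by (simp only: mult.commute)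
      qed
      then show ?thesis using rel_entropy_eq[OF _ _ _ u W Q] by simp
    qed
    \<comment> \<open>The partial trace preserves traces, so the trace terms of the two relative
      entropies cancel.\<close>
    moreover have "(\<Sum>i\<in>A \<times> E. ptrace B Q i i) = (\<Sum>i\<in>?I. Q i i)" "(\<Sum>i\<in>A \<times> E. \<rho>AE i i) = (\<Sum>i\<in>?I. \<rho> i i)"
      unfolding \<rho>AE_def ptrace_def by (simp_all only: sum.cartesian_product'[of _ "A \<times> E" B])
    ultimately show ?thesis by simp
  qed
  \<comment> \<open>A zero eigenvalue multiplies its logarithm by 0 for every
    \<open>\<delta>\<close>, so the singularity of the logarithm never matters.\<close>
  have lim: "((\<lambda>\<delta>. \<Sum>k\<in>K. f k * ln (f k + \<delta> * c)) \<longlongrightarrow> (\<Sum>k\<in>K. f k * ln (f k))) (at_right 0)"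
    if "\<And>k. k \<in> K \<Longrightarrow> 0 \<le> f k" for f :: "'x \<Rightarrow> real" and K c
  proof (intro tendsto_sum)
    fix k assume k: "k \<in> K"
    show "((\<lambda>\<delta>. f k * ln (f k + \<delta> * c)) \<longlongrightarrow> f k * ln (f k)) (at_right 0)"
    proof (cases "f k = 0")
      case False
      have "((\<lambda>\<delta>. f k * ln (f k + \<delta> * c)) \<longlongrightarrow> f k * ln (f k + 0 * c)) (at_right 0)"
        using False that[OF k] by (intro tendsto_intros) auto
      then show ?thesis by simp
    qed simp
  qed
  have "- ln 2 * ent (A \<times> E) \<rho>AE - (\<Sum>k\<in>E. r1 k * ln (r1 k)) \<le> - ln 2 * ent ?I \<rho> - (\<Sum>k\<in>E \<times> B. r k * ln (r k))"
  proof (rule tendsto_le)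
    show "((\<lambda>\<delta>. - ln 2 * ent (A \<times> E) \<rho>AE - (\<Sum>k\<in>E. r1 k * ln (r1 k + \<delta> * ?b))) \<longlongrightarrow>
       - ln 2 * ent (A \<times> E) \<rho>AE - (\<Sum>k\<in>E. r1 k * ln (r1 k))) (at_right 0)"
      by (intro tendsto_diff tendsto_const lim r1)
    show "((\<lambda>\<delta>. - ln 2 * ent ?I \<rho> - (\<Sum>k\<in>E \<times> B. r k * ln (r k + \<delta>))) \<longlongrightarrow>
       - ln 2 * ent ?I \<rho> - (\<Sum>k\<in>E \<times> B. r k * ln (r k))) (at_right 0)"
      using lim[of "E \<times> B" r 1] r by (intro tendsto_diff tendsto_const) auto
    show "\<forall>\<^sub>F \<delta> in at_right 0. - ln 2 * ent (A \<times> E) \<rho>AE - (\<Sum>k\<in>E. r1 k * ln (r1 k + \<delta> * ?b))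
       \<le> - ln 2 * ent ?I \<rho> - (\<Sum>k\<in>E \<times> B. r k * ln (r k + \<delta>))"
      using ineq by (auto intro: eventually_at_right_less[THEN eventually_mono])
  qed simp
  moreover have "(\<Sum>k\<in>E. r1 k * ln (r1 k)) = - ln 2 * ent E \<rho>E"
    using w1 ent_spectral[of E E w1 \<rho>E r1]
    by (simp add: unitary_on_def entropy_fun_def log_def sum_negf flip: sum_divide_distrib)
  moreover have "(\<Sum>k\<in>E \<times> B. r k * ln (r k)) = - ln 2 * ent (E \<times> B) \<rho>EB"
    using w ent_spectral[of "E \<times> B" "E \<times> B" w \<rho>EB r]
    by (simp add: unitary_on_def entropy_fun_def log_def sum_negf flip: sum_divide_distrib)
  ultimately have "ln 2 * (ent ?I \<rho> + ent E \<rho>E) \<le> ln 2 * (ent (A \<times> E) \<rho>AE + ent (E \<times> B) \<rho>EB)"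
    by (simp add: algebra_simps)
  then show ?thesis unfolding \<rho>AE_def \<rho>E_def by (subst (asm) mult_le_cancel_left_pos) auto
qed

section \<open>Tensor products, purification and measurements\<close>

text \<open>\<open>ent_swap\<close> moves the left factor \<open>V\<close> to the far right, where
  it meets its adjoint and cancels.\<close>

lemma ent_isometry:
  assumes "finite I" "finite J" "isometric J I V"
  shows "ent J (\<lambda>j j'. \<Sum>i\<in>I. \<Sum>i'\<in>I. V j i * \<rho> i i' * cnj (V j' i')) = ent I \<rho>"
proof -
  let ?B = "\<lambda>i j'. \<Sum>i'\<in>I. \<rho> i i' * cnj (V j' i')"
  have "ent J (\<lambda>j j'. \<Sum>i\<in>I. \<Sum>i'\<in>I. V j i * \<rho> i i' * cnj (V j' i')) = ent J (\<lambda>j j'. \<Sum>i\<in>I. V j i * ?B i j')"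
    by (simp only: sum_distrib_left mult.assoc)
  also have "\<dots> = ent I (\<lambda>i i'. \<Sum>j\<in>J. ?B i j * V j i')"
    by (rule ent_swap[OF assms(2,1)])
  also have "\<dots> = ent I \<rho>"
  proof (rule ent_cong[OF assms(1)])
    fix i i' assume i: "i \<in> I" "i' \<in> I"
    have "(\<Sum>j\<in>J. ?B i j * V j i') = (\<Sum>i''\<in>I. \<rho> i i'' * (\<Sum>j\<in>J. cnj (V j i'') * V j i'))"
      unfolding sum_distrib_left sum_distrib_right by (subst sum.swap) (simp only: mult.assoc)
    also have "\<dots> = (\<Sum>i''\<in>I. \<rho> i i'' * of_bool (i'' = i'))"
      using assms(3) i unfolding isometric_def by (intro sum.cong refl arg_cong2[of _ _ _ _ "(*)"]) auto
    finally show "(\<Sum>j\<in>J. ?B i j * V j i') = \<rho> i i'" using assms(1) i by (simp only: sum_of_bool_mult if_True)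
  qed
  finally show ?thesis .
qed

text \<open>Conjugation by 1 tensor \<open>W\<close>, where \<open>W\<close> acts on the second
  subsystem and may be rectangular.\<close>

definition conj_snd :: "'y set \<Rightarrow> ('j \<Rightarrow> 'y \<Rightarrow> complex) \<Rightarrow> ('x \<times> 'y \<Rightarrow> 'x \<times> 'y \<Rightarrow> complex) \<Rightarrow> 'x \<times> 'j \<Rightarrow> 'x \<times> 'j \<Rightarrow> complex" where
  "conj_snd Y W \<rho> z z' = (\<Sum>y\<in>Y. \<Sum>y'\<in>Y. W (snd z) y * \<rho> (fst z, y) (fst z', y') * cnj (W (snd z') y'))"

lemma conj_snd_eq:
  assumes "finite X" "fst z \<in> X" "fst z' \<in> X"
  shows "conj_snd Y W \<rho> z z' = (\<Sum>i\<in>X\<times>Y. \<Sum>i'\<in>X\<times>Y.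
     (of_bool (fst z = fst i) * W (snd z) (snd i)) * \<rho> i i' * cnj (of_bool (fst z' = fst i') * W (snd z') (snd i')))"
proof -
  have "(\<Sum>i\<in>X\<times>Y. \<Sum>i'\<in>X\<times>Y.
     (of_bool (fst z = fst i) * W (snd z) (snd i)) * \<rho> i i' * cnj (of_bool (fst z' = fst i') * W (snd z') (snd i'))) =
    (\<Sum>x\<in>X. of_bool (fst z = x) * (\<Sum>y\<in>Y. \<Sum>x'\<in>X. of_bool (fst z' = x') * (\<Sum>y'\<in>Y. W (snd z) y * \<rho> (x, y) (x', y') * cnj (W (snd z') y'))))"
    by (simp add: sum.cartesian_product' sum_distrib_left mult_ac)
  also have "\<dots> = conj_snd Y W \<rho> z z'"
    using assms by (simp only: sum_of_bool_mult if_True conj_snd_def)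
  finally show ?thesis by simp
qed

lemma isometric_ampliate:
  assumes "finite X" "isometric J Y W"
  shows "isometric (X \<times> J) (X \<times> Y) (\<lambda>z i. of_bool (fst z = fst i) * W (snd z) (snd i))"
  unfolding isometric_def
proof (intro ballI)
  fix k l assume kl: "k \<in> X \<times> Y" "l \<in> X \<times> Y"
  have "(\<Sum>z\<in>X\<times>J. cnj (of_bool (fst z = fst k) * W (snd z) (snd k)) * (of_bool (fst z = fst l) * W (snd z) (snd l)))
     = (\<Sum>x\<in>X. of_bool (x = fst k) * (of_bool (x = fst l) * (\<Sum>j\<in>J. cnj (W j (snd k)) * W j (snd l))))"
    by (simp add: sum.cartesian_product' sum_distrib_left mult_ac)
  also have "\<dots> = of_bool (fst k = fst l) * (\<Sum>j\<in>J. cnj (W j (snd k)) * W j (snd l))"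
    using kl assms(1) by (simp only: sum_of_bool_mult) auto
  also have "\<dots> = of_bool (k = l)"
    using assms(2) kl unfolding isometric_def by (auto simp: prod_eq_iff)
  finally show "(\<Sum>z\<in>X\<times>J. cnj (of_bool (fst z = fst k) * W (snd z) (snd k)) * (of_bool (fst z = fst l) * W (snd z) (snd l)))
     = of_bool (k = l)" .
qed

lemma ent_conj_snd:
  assumes "finite X" "finite Y" "finite J" "isometric J Y W"
  shows "ent (X \<times> J) (conj_snd Y W \<rho>) = ent (X \<times> Y) \<rho>"
proof -
  have "ent (X \<times> J) (conj_snd Y W \<rho>) = ent (X \<times> J) (\<lambda>z z'. \<Sum>i\<in>X\<times>Y. \<Sum>i'\<in>X\<times>Y.
     (of_bool (fst z = fst i) * W (snd z) (snd i)) * \<rho> i i' * cnj (of_bool (fst z' = fst i') * W (snd z') (snd i')))"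
    using assms(1,3) by (intro ent_cong conj_snd_eq) auto
  also have "\<dots> = ent (X \<times> Y) \<rho>"
    by (rule ent_isometry[OF _ _ isometric_ampliate[OF assms(1,4)]]) (use assms in auto)
  finally show ?thesis .
qed

lemma psd_on_conj_snd:
  assumes "finite X" "psd_on (X \<times> Y) \<rho>"
  shows "psd_on (X \<times> J) (conj_snd Y W \<rho>)"
proof -
  have "psd_on (X \<times> J) (\<lambda>z z'. \<Sum>s\<in>{()}. \<Sum>i\<in>X\<times>Y. \<Sum>i'\<in>X\<times>Y.
     (of_bool (fst z = fst i) * W (snd z) (snd i)) * \<rho> i i' * cnj (of_bool (fst z' = fst i') * W (snd z') (snd i')))"
    by (rule psd_on_kraus[OF assms(2)])
  also have "?this \<longleftrightarrow> ?thesis"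
    by (intro psd_on_cong) (simp add: conj_snd_eq[OF assms(1)] mem_Times_iff)
  finally show ?thesis .
qed

text \<open>The blocks are unnormalised and carry their probabilities as traces, so entropies simply
  add and no separate Shannon term appears. Classical registers are handled in this form
  throughout.\<close>

lemma ent_block_diagonal:
  assumes [simp]: "finite O'" "finite I" and "\<And>x. x \<in> O' \<Longrightarrow> hermitian_on I (\<rho> x)"
  shows "ent (O' \<times> I) (\<lambda>x y. of_bool (fst x = fst y) * \<rho> (fst x) (snd x) (snd y)) = (\<Sum>x\<in>O'. ent I (\<rho> x))"
proof -
  have "\<exists>u d. unitary_on I I u \<and> spectral_form I I (\<rho> x) u d" if "x \<in> O'" for x
    using spectral_theorem[OF _ assms(3)[OF that]] by (metis assms(2))
  then obtain u d where u: "\<And>x. x \<in> O' \<Longrightarrow> unitary_on I I (u x)" "\<And>x. x \<in> O' \<Longrightarrow> spectral_form I I (\<rho> x) (u x) (d x)"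
    by metis
  let ?U = "\<lambda>z k. of_bool (fst z = fst k) * u (fst k) (snd z) (snd k)"
  have iso: "isometric (O' \<times> I) (O' \<times> I) ?U"
    unfolding isometric_def
  proof (intro ballI)
    fix k l assume kl: "k \<in> O' \<times> I" "l \<in> O' \<times> I"
    have "(\<Sum>z\<in>O'\<times>I. cnj (?U z k) * ?U z l)
       = (\<Sum>x\<in>O'. of_bool (x = fst k) * (of_bool (x = fst l) * (\<Sum>j\<in>I. cnj (u (fst k) j (snd k)) * u (fst l) j (snd l))))"
      by (simp only: sum.cartesian_product' sum_distrib_left mult_ac fst_conv snd_conv complex_cnj_mult cnj_of_bool)
    also have "\<dots> = of_bool (fst k = fst l) * (\<Sum>j\<in>I. cnj (u (fst k) j (snd k)) * u (fst l) j (snd l))"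
      using kl by (simp only: sum_of_bool_mult assms) auto
    also have "\<dots> = of_bool (k = l)"
      using unitary_onD1[OF u(1), of "fst l" "snd k" "snd l"] kl
      by (cases "fst k = fst l") (auto simp: prod_eq_iff)
    finally show "(\<Sum>z\<in>O'\<times>I. cnj (?U z k) * ?U z l) = of_bool (k = l)" .
  qed
  have "spectral_form (O' \<times> I) (O' \<times> I) (\<lambda>x y. of_bool (fst x = fst y) * \<rho> (fst x) (snd x) (snd y)) ?U (\<lambda>k. d (fst k) (snd k))"
    unfolding spectral_form_def
  proof (intro ballI)
    fix x y assume xy: "x \<in> O' \<times> I" "y \<in> O' \<times> I"
    have "(\<Sum>k\<in>O'\<times>I. of_real (d (fst k) (snd k)) * ?U x k * cnj (?U y k)) =
       (\<Sum>z\<in>O'. of_bool (fst x = z) * (of_bool (fst y = z) * (\<Sum>k\<in>I. of_real (d z k) * u z (snd x) k * cnj (u z (snd y) k))))"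
      by (simp add: sum.cartesian_product' sum_distrib_left mult_ac)
    also have "\<dots> = of_bool (fst y = fst x) * (\<Sum>k\<in>I. of_real (d (fst x) k) * u (fst x) (snd x) k * cnj (u (fst x) (snd y) k))"
      using xy by (simp only: sum_of_bool_mult assms) auto
    also have "\<dots> = of_bool (fst x = fst y) * \<rho> (fst x) (snd x) (snd y)"
      using xy u(2)[of "fst x"] unfolding spectral_form_def by (cases "fst x = fst y") (simp_all add: mem_Times_iff)
    finally show "of_bool (fst x = fst y) * \<rho> (fst x) (snd x) (snd y) =
       (\<Sum>k\<in>O'\<times>I. of_real (d (fst k) (snd k)) * ?U x k * cnj (?U y k))" by simp
  qed
  from ent_spectral[OF _ _ iso this] have "ent (O' \<times> I) (\<lambda>x y. of_bool (fst x = fst y) * \<rho> (fst x) (snd x) (snd y)) =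
     (\<Sum>x\<in>O'. \<Sum>k\<in>I. entropy_fun (d x k))" by (simp add: sum.cartesian_product')
  also have "\<dots> = (\<Sum>x\<in>O'. ent I (\<rho> x))"
  proof (intro sum.cong refl)
    fix x assume x: "x \<in> O'"
    show "(\<Sum>k\<in>I. entropy_fun (d x k)) = ent I (\<rho> x)"
      by (rule ent_spectral[OF _ _ _ u(2)[OF x], symmetric]) (use u(1)[OF x] in \<open>auto simp: unitary_on_def\<close>)
  qed
  finally show ?thesis .
qed

lemma ent_diagonal:
  assumes "finite I"
  shows "ent I (\<lambda>i j. of_bool (i = j) * of_real (p i)) = (\<Sum>i\<in>I. entropy_fun (p i))"
proof (rule ent_spectral[OF assms assms])
  show "isometric I I (\<lambda>i k. of_bool (i = k))"
    unfolding isometric_def using assms by (simp only: cnj_of_bool sum_of_bool_mult) auto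
  show "spectral_form I I (\<lambda>i j. of_bool (i = j) * of_real (p i)) (\<lambda>i k. of_bool (i = k)) p"
    unfolding spectral_form_def
  proof (intro ballI)
    fix i j assume ij: "i \<in> I" "j \<in> I"
    have "(\<Sum>k\<in>I. of_real (p k) * of_bool (i = k) * cnj (of_bool (j = k))) =
        (\<Sum>k\<in>I. of_bool (i = k) * (of_bool (j = k) * of_real (p k)))" by (simp add: mult_ac)
    then show "of_bool (i = j) * of_real (p i) = (\<Sum>k\<in>I. of_real (p k) * of_bool (i = k) * cnj (of_bool (j = k)))"
      using assms ij by (simp only: sum_of_bool_mult if_True) (cases "i = j", auto)
  qed
qed

lemma entropy_fun_mult:
  assumes "0 \<le> a" "0 \<le> b"
  shows "entropy_fun (a * b) = a * entropy_fun b + b * entropy_fun a"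
  using assms by (cases "a = 0"; cases "b = 0") (auto simp: entropy_fun_def log_mult algebra_simps)

lemma ent_tensor:
  assumes [simp]: "finite I" "finite J" and \<rho>: "psd_on I \<rho>" and \<sigma>: "psd_on J \<sigma>"
  shows "ent (I \<times> J) (\<lambda>x y. \<rho> (fst x) (fst y) * \<sigma> (snd x) (snd y)) =
     Re (\<Sum>i\<in>I. \<rho> i i) * ent J \<sigma> + Re (\<Sum>j\<in>J. \<sigma> j j) * ent I \<rho>"
proof -
  obtain u p where u: "unitary_on I I u" "spectral_form I I \<rho> u p"
    using spectral_theorem[OF _ psd_on_hermitian[OF \<rho>]] by auto
  obtain w q where w: "unitary_on J J w" "spectral_form J J \<sigma> w q"
    using spectral_theorem[OF _ psd_on_hermitian[OF \<sigma>]] by auto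
  have iu: "isometric I I u" "isometric J J w" using u w by (auto simp: unitary_on_def)
  have p: "0 \<le> p k" if "k \<in> I" for k using psd_on_spectral_nonneg[OF _ iu(1) u(2) \<rho> that] by simp
  have q: "0 \<le> q k" if "k \<in> J" for k using psd_on_spectral_nonneg[OF _ iu(2) w(2) \<sigma> that] by simp
  let ?U = "\<lambda>z k. u (fst z) (fst k) * w (snd z) (snd k)"
  have iso: "isometric (I \<times> J) (I \<times> J) ?U"
    unfolding isometric_def
  proof (intro ballI)
    fix k l assume kl: "k \<in> I \<times> J" "l \<in> I \<times> J"
    have "(\<Sum>z\<in>I\<times>J. cnj (?U z k) * ?U z l) =
      (\<Sum>i\<in>I. cnj (u i (fst k)) * u i (fst l)) * (\<Sum>j\<in>J. cnj (w j (snd k)) * w j (snd l))"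
      by (simp add: sum.cartesian_product' sum_product mult_ac)
    then show "(\<Sum>z\<in>I\<times>J. cnj (?U z k) * ?U z l) = of_bool (k = l)"
      using kl iu unfolding isometric_def by (auto simp: prod_eq_iff)
  qed
  have sp: "spectral_form (I \<times> J) (I \<times> J) (\<lambda>x y. \<rho> (fst x) (fst y) * \<sigma> (snd x) (snd y)) ?U (\<lambda>k. p (fst k) * q (snd k))"
    unfolding spectral_form_def
  proof (intro ballI)
    fix x y assume xy: "x \<in> I \<times> J" "y \<in> I \<times> J"
    have "(\<Sum>k\<in>I\<times>J. of_real (p (fst k) * q (snd k)) * ?U x k * cnj (?U y k)) =
      (\<Sum>k\<in>I. of_real (p k) * u (fst x) k * cnj (u (fst y) k)) * (\<Sum>k\<in>J. of_real (q k) * w (snd x) k * cnj (w (snd y) k))"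
      by (simp add: sum.cartesian_product' sum_product mult_ac)
    then show "\<rho> (fst x) (fst y) * \<sigma> (snd x) (snd y) = (\<Sum>k\<in>I\<times>J. of_real (p (fst k) * q (snd k)) * ?U x k * cnj (?U y k))"
      using xy u(2) w(2) unfolding spectral_form_def by (auto simp: mem_Times_iff)
  qed
  have "ent (I \<times> J) (\<lambda>x y. \<rho> (fst x) (fst y) * \<sigma> (snd x) (snd y)) = (\<Sum>i\<in>I. \<Sum>j\<in>J. entropy_fun (p i * q j))"
    using ent_spectral[OF _ _ iso sp] by (simp add: sum.cartesian_product')
  also have "\<dots> = (\<Sum>i\<in>I. \<Sum>j\<in>J. p i * entropy_fun (q j) + q j * entropy_fun (p i))"
    by (intro sum.cong refl entropy_fun_mult p q)
  also have "\<dots> = (\<Sum>i\<in>I. p i) * (\<Sum>j\<in>J. entropy_fun (q j)) + (\<Sum>j\<in>J. q j) * (\<Sum>i\<in>I. entropy_fun (p i))"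
    by (simp add: sum.distrib sum_product sum.swap[of _ J I])
  finally show ?thesis
    by (simp add: ent_spectral[OF _ _ iu(1) u(2)] ent_spectral[OF _ _ iu(2) w(2)]
        spectral_trace[OF _ iu(1) u(2)] spectral_trace[OF _ iu(2) w(2)])
qed

lemma ent_transpose:
  assumes "finite I" "hermitian_on I \<rho>"
  shows "ent I (\<lambda>i j. \<rho> j i) = ent I \<rho>"
proof -
  obtain u d where u: "unitary_on I I u" "spectral_form I I \<rho> u d"
    using spectral_theorem[OF assms] by auto
  have "spectral_form I I (\<lambda>i j. \<rho> j i) (\<lambda>i k. cnj (u i k)) d"
    using u(2) unfolding spectral_form_def by (simp add: mult_ac)
  then have "ent I (\<lambda>i j. \<rho> j i) = (\<Sum>k\<in>I. entropy_fun (d k))"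
    using unitary_on_cnj[OF u(1)] by (intro ent_spectral assms) (auto simp: unitary_on_def)
  also have "\<dots> = ent I \<rho>"
    using u by (intro ent_spectral[symmetric] assms) (auto simp: unitary_on_def)
  finally show ?thesis .
qed

text \<open>Strong subadditivity with a one-point conditioning system, whose entropy is 0 because
  the trace is 1.\<close>

lemma subadditivity:
  assumes [simp]: "finite A" "finite B" and \<rho>: "psd_on (A \<times> B) \<rho>" and tr: "(\<Sum>x\<in>A \<times> B. \<rho> x x) = 1"
  shows "ent (A \<times> B) \<rho> \<le> ent A (ptrace B \<rho>) + ent B (\<lambda>b b'. \<Sum>a\<in>A. \<rho> (a, b) (a, b'))"
proof -
  have B: "B \<noteq> {}" using tr by auto
  let ?f = "\<lambda>x :: ('a \<times> unit) \<times> 'b. (fst (fst x), snd x)"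
  have f: "bij_betw ?f ((A \<times> {()}) \<times> B) (A \<times> B)"
    by (rule bij_betw_byWitness[where f'="\<lambda>x. ((fst x, ()), snd x)"]) auto
  have psd: "psd_on ((A \<times> {()}) \<times> B) (\<lambda>x y. \<rho> (?f x) (?f y))"
    by (rule psd_on_map[OF _ \<rho>]) auto
  have b: "bij_betw fst (A \<times> {()}) A" "bij_betw snd ({()} \<times> B) B"
    by (auto simp: bij_betw_def inj_on_def image_def)
  have e1: "ent ((A \<times> {()}) \<times> B) (\<lambda>x y. \<rho> (?f x) (?f y)) = ent (A \<times> B) \<rho>"
    by (rule ent_reindex[OF f]) simp
  have e2: "ent (A \<times> {()}) (ptrace B (\<lambda>x y. \<rho> (?f x) (?f y))) = ent A (ptrace B \<rho>)"
    using ent_reindex[OF b(1), of "ptrace B \<rho>"] by (simp add: ptrace_def[abs_def])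
  have e3: "ent ({()} \<times> B) (\<lambda>x y. \<Sum>a\<in>A. \<rho> (a, snd x) (a, snd y)) = ent B (\<lambda>b b'. \<Sum>a\<in>A. \<rho> (a, b) (a, b'))"
    using ent_reindex[OF b(2), of "\<lambda>b b'. \<Sum>a\<in>A. \<rho> (a, b) (a, b')"] by simp
  have e4: "ent {()} (ptrace B (\<lambda>x y. \<Sum>a\<in>A. \<rho> (a, snd x) (a, snd y))) = 0"
  proof -
    have "(\<Sum>b\<in>B. \<Sum>a\<in>A. \<rho> (a, b) (a, b)) = 1"
      using tr by (subst sum.swap) (simp add: sum.cartesian_product')
    then have "ent {()} (ptrace B (\<lambda>x y. \<Sum>a\<in>A. \<rho> (a, snd x) (a, snd y))) = ent {()} (\<lambda>i j. of_bool (i = j) * of_real 1)"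
      by (intro ent_cong) (auto simp: ptrace_def)
    also have "\<dots> = 0" by (subst ent_diagonal) (auto simp: entropy_fun_def)
    finally show ?thesis .
  qed
  show ?thesis
    using strong_subadditivity[OF _ _ _ B psd] e1 e2 e3 e4 by simp
qed

text \<open>The columns are eigenvectors scaled by square roots of the eigenvalues. Read as a vector
  with two indices, \<open>M\<close> is a purification of \<open>\<rho>\<close>.\<close>

lemma gram_decomposition:
  assumes "finite I" "psd_on I \<rho>"
  obtains M where "\<And>i j. i \<in> I \<Longrightarrow> j \<in> I \<Longrightarrow> \<rho> i j = (\<Sum>k\<in>I. M i k * cnj (M j k))"
proof -
  obtain u d where u: "unitary_on I I u" "spectral_form I I \<rho> u d"
    using spectral_theorem[OF assms(1) psd_on_hermitian[OF assms(2)]] by auto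
  have d: "0 \<le> d k" if "k \<in> I" for k
    using psd_on_spectral_nonneg[OF assms(1) _ u(2) assms(2) that] u(1) by (simp add: unitary_on_def)
  show ?thesis
  proof (rule that[of "\<lambda>i k. of_real (sqrt (d k)) * u i k"])
    fix i j assume ij: "i \<in> I" "j \<in> I"
    have sq: "of_real (sqrt (d k)) * u i k * cnj (of_real (sqrt (d k)) * u j k) = of_real (d k) * u i k * cnj (u j k)"
      if "k \<in> I" for k
    proof -
      have "of_real (sqrt (d k)) * u i k * cnj (of_real (sqrt (d k)) * u j k) =
        of_real (sqrt (d k) * sqrt (d k)) * (u i k * cnj (u j k))"
        unfolding of_real_mult by (simp add: mult_ac)
      also have "sqrt (d k) * sqrt (d k) = d k" using d[OF that] by simp
      finally show ?thesis by (simp only: mult.assoc)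
    qed
    have "\<rho> i j = (\<Sum>k\<in>I. of_real (d k) * u i k * cnj (u j k))"
      using u(2) ij unfolding spectral_form_def by blast
    also have "\<dots> = (\<Sum>k\<in>I. of_real (sqrt (d k)) * u i k * cnj (of_real (sqrt (d k)) * u j k))"
      by (intro sum.cong refl sq[symmetric])
    finally show "\<rho> i j = (\<Sum>k\<in>I. of_real (sqrt (d k)) * u i k * cnj (of_real (sqrt (d k)) * u j k))" .
  qed
qed

lemma psd_on_gram:
  "psd_on I (\<lambda>i j. \<Sum>k\<in>K. M i k * cnj (M j k))"
  unfolding psd_on_def
proof (intro conjI allI)
  show "hermitian_on I (\<lambda>i j. \<Sum>k\<in>K. M i k * cnj (M j k))"
    unfolding hermitian_on_def by (simp add: mult.commute)
  fix v
  have "(\<Sum>i\<in>I. \<Sum>j\<in>I. cnj (v i) * (\<Sum>k\<in>K. M i k * cnj (M j k)) * v j) =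
     (\<Sum>i\<in>I. \<Sum>j\<in>I. (\<Sum>k\<in>K. M i k * cnj (M j k)) * (cnj (v i) * v j))"
    by (simp only: mult_ac)
  also have "\<dots> = (\<Sum>k\<in>K. (\<Sum>i\<in>I. M i k * cnj (v i)) * (\<Sum>j\<in>I. cnj (M j k) * v j))"
    by (rule sum_product_swap[symmetric])
  also have "\<dots> = (\<Sum>k\<in>K. of_real ((cmod (\<Sum>i\<in>I. M i k * cnj (v i)))\<^sup>2))"
    by (intro sum.cong refl) (simp add: complex_norm_square mult.commute del: of_real_power)
  finally show "0 \<le> Re (\<Sum>i\<in>I. \<Sum>j\<in>I. cnj (v i) * (\<Sum>k\<in>K. M i k * cnj (M j k)) * v j)"
    by (simp add: sum_nonneg)
qed

lemma psd_on_tensor: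
  assumes "finite I" "finite J" "psd_on I \<rho>" "psd_on J \<sigma>"
  shows "psd_on (I \<times> J) (\<lambda>x y. \<rho> (fst x) (fst y) * \<sigma> (snd x) (snd y))"
proof -
  obtain M where M: "\<And>i j. i \<in> I \<Longrightarrow> j \<in> I \<Longrightarrow> \<rho> i j = (\<Sum>k\<in>I. M i k * cnj (M j k))"
    using gram_decomposition[OF assms(1,3)] by blast
  obtain N where N: "\<And>i j. i \<in> J \<Longrightarrow> j \<in> J \<Longrightarrow> \<sigma> i j = (\<Sum>k\<in>J. N i k * cnj (N j k))"
    using gram_decomposition[OF assms(2,4)] by blast
  have "psd_on (I \<times> J) (\<lambda>x y. \<Sum>k\<in>I\<times>J. (M (fst x) (fst k) * N (snd x) (snd k)) * cnj (M (fst y) (fst k) * N (snd y) (snd k)))"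
    by (rule psd_on_gram)
  also have "?this \<longleftrightarrow> ?thesis"
    by (intro psd_on_cong) (auto simp: M N sum.cartesian_product' sum_product mult_ac)
  finally show ?thesis .
qed

(* Subadditivity for the complementary marginal of a purification. *)
lemma araki_lieb:
  assumes [simp]: "finite X" "finite E" and \<rho>: "psd_on (X \<times> E) \<rho>" and tr: "(\<Sum>z\<in>X \<times> E. \<rho> z z) = 1"
  shows "ent E (\<lambda>e e'. \<Sum>x\<in>X. \<rho> (x, e) (x, e')) \<le> ent (X \<times> E) \<rho> + ent X (ptrace E \<rho>)"
proof -
  let ?R = "X \<times> E"
  obtain M where M: "\<And>i j. i \<in> ?R \<Longrightarrow> j \<in> ?R \<Longrightarrow> \<rho> i j = (\<Sum>k\<in>?R. M i k * cnj (M j k))"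
    using gram_decomposition[OF _ \<rho>] by auto
  \<comment> \<open>\<open>M\<close> is read as a vector on X, E and a purifying copy of
    \<open>?R\<close>. This is the transpose of its marginal on X and \<open>?R\<close>; the
    transposed form is the one that \<open>ent_swap\<close> produces from the marginal on E.\<close>
  define \<pi> where "\<pi> = (\<lambda>x y. \<Sum>e\<in>E. cnj (M (fst x, e) (snd x)) * M (fst y, e) (snd y))"
  have psd: "psd_on (X \<times> ?R) \<pi>"
    using psd_on_gram[of "X \<times> ?R" "\<lambda>x e. cnj (M (fst x, e) (snd x))" E] by (simp add: \<pi>_def)
  have "ent E (\<lambda>e e'. \<Sum>x\<in>X. \<rho> (x, e) (x, e')) = ent E (\<lambda>e e'. \<Sum>j\<in>X \<times> ?R. M (fst j, e) (snd j) * cnj (M (fst j, e') (snd j)))"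
    by (intro ent_cong) (auto simp: M sum.cartesian_product'[of _ X ?R])
  also have "\<dots> = ent (X \<times> ?R) \<pi>"
    unfolding \<pi>_def by (rule ent_swap) auto
  also have "\<dots> \<le> ent X (ptrace ?R \<pi>) + ent ?R (\<lambda>r r'. \<Sum>x\<in>X. \<pi> (x, r) (x, r'))"
  proof (rule subadditivity[OF _ _ psd])
    have "(\<Sum>x\<in>X \<times> ?R. \<pi> x x) = (\<Sum>x\<in>X. \<Sum>r\<in>?R. \<Sum>e\<in>E. M (x, e) r * cnj (M (x, e) r))"
      by (simp only: sum.cartesian_product'[of _ X ?R] \<pi>_def fst_conv snd_conv mult.commute)
    also have "\<dots> = (\<Sum>x\<in>X. \<Sum>e\<in>E. \<Sum>r\<in>?R. M (x, e) r * cnj (M (x, e) r))"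
      by (intro sum.cong refl sum.swap)
    also have "\<dots> = (\<Sum>x\<in>X. \<Sum>e\<in>E. \<rho> (x, e) (x, e))"
      by (intro sum.cong refl M[symmetric]) auto
    also have "\<dots> = 1" using tr by (simp only: sum.cartesian_product')
    finally show "(\<Sum>x\<in>X \<times> ?R. \<pi> x x) = 1" .
  qed auto
  also have "ent X (ptrace ?R \<pi>) = ent X (ptrace E \<rho>)"
  proof -
    have "ent X (ptrace ?R \<pi>) = ent X (\<lambda>x x'. ptrace E \<rho> x' x)"
    proof (intro ent_cong)
      fix x x' assume x: "x \<in> X" "x' \<in> X"
      have "ptrace ?R \<pi> x x' = (\<Sum>e\<in>E. \<Sum>r\<in>?R. M (x', e) r * cnj (M (x, e) r))"
        unfolding ptrace_def \<pi>_def fst_conv snd_conv by (subst sum.swap) (simp only: mult.commute)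
      also have "\<dots> = ptrace E \<rho> x' x"
        unfolding ptrace_def using x by (intro sum.cong refl M[symmetric]) auto
      finally show "ptrace ?R \<pi> x x' = ptrace E \<rho> x' x" .
    qed simp
    then show ?thesis
      using ent_transpose[OF _ psd_on_hermitian[OF psd_on_ptrace[OF _ _ \<rho>]]] by simp
  qed
  also have "ent ?R (\<lambda>r r'. \<Sum>x\<in>X. \<pi> (x, r) (x, r')) = ent ?R \<rho>"
  proof -
    have "ent ?R (\<lambda>r r'. \<Sum>x\<in>X. \<pi> (x, r) (x, r')) = ent ?R (\<lambda>r r'. \<Sum>z\<in>?R. cnj (M z r) * M z r')"
      by (simp only: \<pi>_def fst_conv snd_conv sum.cartesian_product'[of "\<lambda>z. cnj (M z _) * M z _" X E])
    also have "\<dots> = ent ?R (\<lambda>z z'. \<Sum>r\<in>?R. M z r * cnj (M z' r))"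
      by (rule ent_swap[symmetric]) auto
    also have "\<dots> = ent ?R \<rho>" by (intro ent_cong) (auto simp only: M finite_cartesian_product assms)
    finally show ?thesis .
  qed
  finally show ?thesis by simp
qed

(* Data processing of the conditional entropy under measuring Y with rank-one effects and keeping
   only the label of the outcome: dilate by |y> -> sum_l r(l,y) |lab l> |l>, then trace out l. *)
lemma ent_measure_le:
  assumes [simp]: "finite A" "finite E" "finite Y" "finite L" "finite O'" and "Y \<noteq> {}"
    and \<rho>: "psd_on ((A \<times> E) \<times> Y) \<rho>" and r: "isometric L Y r" and lab: "lab ` L \<subseteq> O'"
  defines "\<tau> \<equiv> \<lambda>x z z'. \<Sum>l | l \<in> L \<and> lab l = x. \<Sum>y\<in>Y. \<Sum>y'\<in>Y. r l y * \<rho> (z, y) (z', y') * cnj (r l y')"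
  shows "ent ((A \<times> E) \<times> Y) \<rho> - ent (E \<times> Y) (\<lambda>x y. \<Sum>a\<in>A. \<rho> ((a, fst x), snd x) ((a, fst y), snd y)) \<le>
    (\<Sum>x\<in>O'. ent (A \<times> E) (\<tau> x) - ent E (\<lambda>e e'. \<Sum>a\<in>A. \<tau> x (a, e) (a, e')))"
proof -
  have L: "L \<noteq> {}"
  proof
    assume "L = {}"
    obtain y where "y \<in> Y" using \<open>Y \<noteq> {}\<close> by blast
    then have "(\<Sum>l\<in>L. cnj (r l y) * r l y) = 1" using r unfolding isometric_def by simp
    with \<open>L = {}\<close> show False by simp
  qed
  define W where "W = (\<lambda>j y. of_bool (fst j = lab (snd j)) * r (snd j) y)"
  have W: "isometric (O' \<times> L) Y W"
    unfolding isometric_def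
  proof (intro ballI)
    fix k l assume kl: "k \<in> Y" "l \<in> Y"
    have "(\<Sum>i\<in>O' \<times> L. cnj (W i k) * W i l) = (\<Sum>i\<in>L. \<Sum>x\<in>O'. of_bool (x = lab i) * (cnj (r i k) * r i l))"
      unfolding sum.cartesian_product' by (subst sum.swap, intro sum.cong refl) (auto simp: W_def)
    also have "\<dots> = (\<Sum>i\<in>L. cnj (r i k) * r i l)"
      using lab by (intro sum.cong refl) (simp only: sum_of_bool_mult assms(5), auto)
    also have "\<dots> = of_bool (k = l)" using r kl unfolding isometric_def by blast
    finally show "(\<Sum>i\<in>O' \<times> L. cnj (W i k) * W i l) = of_bool (k = l)" .
  qed
  define R where "R = conj_snd Y W \<rho>"
  define \<rho>EY where "\<rho>EY = (\<lambda>x y. \<Sum>a\<in>A. \<rho> ((a, fst x), snd x) ((a, fst y), snd y))"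
  define f where "f = (\<lambda>x :: ('a \<times> ('b \<times> 'e)) \<times> 'd. ((fst (fst x), fst (snd (fst x))), (snd (snd (fst x)), snd x)))"
  have f: "bij_betw f ((A \<times> (E \<times> O')) \<times> L) ((A \<times> E) \<times> (O' \<times> L))"
    by (rule bij_betw_byWitness[where f'="\<lambda>x. ((fst (fst x), (snd (fst x), fst (snd x))), snd (snd x))"]) (auto simp: f_def)
  have psdR: "psd_on ((A \<times> E) \<times> (O' \<times> L)) R"
    unfolding R_def by (rule psd_on_conj_snd[OF _ \<rho>]) simp
  have psdR': "psd_on ((A \<times> (E \<times> O')) \<times> L) (\<lambda>x y. R (f x) (f y))"
    by (rule psd_on_map[OF _ psdR]) (auto simp: f_def)
  have 1: "ent ((A \<times> (E \<times> O')) \<times> L) (\<lambda>x y. R (f x) (f y)) = ent ((A \<times> E) \<times> Y) \<rho>"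
    unfolding ent_reindex[OF f, simplified] R_def by (rule ent_conj_snd[OF _ _ _ W]) auto
  define g where "g = (\<lambda>x :: ('b \<times> 'e) \<times> 'd. (fst (fst x), (snd (fst x), snd x)))"
  have g: "bij_betw g ((E \<times> O') \<times> L) (E \<times> (O' \<times> L))"
    by (rule bij_betw_byWitness[where f'="\<lambda>x. ((fst x, fst (snd x)), snd (snd x))"]) (auto simp: g_def)
  have REB: "(\<Sum>a\<in>A. R (f ((a, fst x), snd x)) (f ((a, fst y), snd y))) = conj_snd Y W \<rho>EY (g x) (g y)" for x y
  proof -
    have "(\<Sum>a\<in>A. R (f ((a, fst x), snd x)) (f ((a, fst y), snd y))) =
      (\<Sum>a\<in>A. \<Sum>k\<in>Y. \<Sum>l\<in>Y. W (snd (g x)) k * \<rho> ((a, fst (g x)), k) ((a, fst (g y)), l) * cnj (W (snd (g y)) l))"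
      by (simp add: R_def conj_snd_def f_def g_def)
    also have "\<dots> = (\<Sum>k\<in>Y. \<Sum>l\<in>Y. \<Sum>a\<in>A. W (snd (g x)) k * \<rho> ((a, fst (g x)), k) ((a, fst (g y)), l) * cnj (W (snd (g y)) l))"
      by (subst sum.swap, intro sum.cong refl, rule sum.swap)
    finally show ?thesis
      by (simp add: conj_snd_def \<rho>EY_def sum_distrib_left sum_distrib_right)
  qed
  have 2: "ent ((E \<times> O') \<times> L) (\<lambda>x y. \<Sum>a\<in>A. R (f ((a, fst x), snd x)) (f ((a, fst y), snd y))) = ent (E \<times> Y) \<rho>EY"
    unfolding REB ent_reindex[OF g, simplified] by (rule ent_conj_snd[OF _ _ _ W]) auto
  have \<tau>: "psd_on (A \<times> E) (\<tau> x)" for x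
  proof -
    have "psd_on (A \<times> E) (\<lambda>z z'. \<Sum>l | l \<in> L \<and> lab l = x. conj_snd Y r \<rho> (z, l) (z', l))"
    proof (rule psd_on_sum)
      fix l assume "l \<in> {l. l \<in> L \<and> lab l = x}"
      then show "psd_on (A \<times> E) (\<lambda>z z'. conj_snd Y r \<rho> (z, l) (z', l))"
        by (intro psd_on_map[OF _ psd_on_conj_snd[OF _ \<rho>, of L r], of "\<lambda>z. (z, l)"]) auto
    qed
    then show ?thesis by (simp add: \<tau>_def conj_snd_def)
  qed
  \<comment> \<open>The outcome \<open>l\<close> determines its label, so tracing out
    \<open>l\<close> removes all coherence between different labels.\<close>
  have tr: "ptrace L (\<lambda>x y. R (f x) (f y)) x y = of_bool (snd (snd x) = snd (snd y)) * \<tau> (snd (snd x)) (fst x, fst (snd x)) (fst y, fst (snd y))" for x y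
  proof -
    have "ptrace L (\<lambda>x y. R (f x) (f y)) x y = (\<Sum>l\<in>L. of_bool (snd (snd x) = lab l \<and> snd (snd y) = lab l) *
       (\<Sum>k\<in>Y. \<Sum>k'\<in>Y. r l k * \<rho> ((fst x, fst (snd x)), k) ((fst y, fst (snd y)), k') * cnj (r l k')))"
      by (simp add: ptrace_def R_def conj_snd_def f_def W_def of_bool_conj sum_distrib_left mult_ac)
    also have "\<dots> = of_bool (snd (snd x) = snd (snd y)) * (\<Sum>l\<in>L. of_bool (lab l = snd (snd x)) *
       (\<Sum>k\<in>Y. \<Sum>k'\<in>Y. r l k * \<rho> ((fst x, fst (snd x)), k) ((fst y, fst (snd y)), k') * cnj (r l k')))"
      unfolding sum_distrib_left[of "of_bool (snd (snd x) = snd (snd y))"] by (intro sum.cong refl) auto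
    also have "\<dots> = of_bool (snd (snd x) = snd (snd y)) * \<tau> (snd (snd x)) (fst x, fst (snd x)) (fst y, fst (snd y))"
      unfolding \<tau>_def by (subst sum.inter_filter, simp, intro arg_cong2[of _ _ _ _ "(*)"] sum.cong refl) auto
    finally show ?thesis .
  qed
  have h: "bij_betw (\<lambda>x :: 'a \<times> 'b \<times> 'e. (snd (snd x), (fst x, fst (snd x)))) (A \<times> (E \<times> O')) (O' \<times> (A \<times> E))"
    by (rule bij_betw_byWitness[where f'="\<lambda>x. (fst (snd x), (snd (snd x), fst x))"]) auto
  have 3: "ent (A \<times> (E \<times> O')) (ptrace L (\<lambda>x y. R (f x) (f y))) = (\<Sum>x\<in>O'. ent (A \<times> E) (\<tau> x))"
    unfolding ent_block_diagonal[OF _ _ psd_on_hermitian[OF \<tau>], of O', simplified, symmetric]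
    by (subst ent_reindex[OF h, symmetric]) (auto intro!: ent_cong simp: tr)
  have h': "bij_betw (\<lambda>x :: 'b \<times> 'e. (snd x, fst x)) (E \<times> O') (O' \<times> E)"
    by (rule bij_betw_byWitness[where f'="\<lambda>x. (snd x, fst x)"]) auto
  have \<tau>E: "psd_on E (\<lambda>e e'. \<Sum>a\<in>A. \<tau> x (a, e) (a, e'))" for x
    by (intro psd_on_sum psd_on_map[OF _ \<tau>]) auto
  have 4: "ent (E \<times> O') (ptrace L (\<lambda>x y. \<Sum>a\<in>A. R (f ((a, fst x), snd x)) (f ((a, fst y), snd y)))) =
     (\<Sum>x\<in>O'. ent E (\<lambda>e e'. \<Sum>a\<in>A. \<tau> x (a, e) (a, e')))"
  proof -
    have "ptrace L (\<lambda>x y. \<Sum>a\<in>A. R (f ((a, fst x), snd x)) (f ((a, fst y), snd y))) x y =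
       of_bool (snd x = snd y) * (\<Sum>a\<in>A. \<tau> (snd x) (a, fst x) (a, fst y))" for x y
    proof -
      have "ptrace L (\<lambda>x y. \<Sum>a\<in>A. R (f ((a, fst x), snd x)) (f ((a, fst y), snd y))) x y =
         (\<Sum>a\<in>A. ptrace L (\<lambda>x y. R (f x) (f y)) (a, x) (a, y))"
        unfolding ptrace_def fst_conv snd_conv by (rule sum.swap)
      then show ?thesis by (simp add: tr sum_distrib_left)
    qed
    then show ?thesis
      unfolding ent_block_diagonal[OF _ _ psd_on_hermitian[OF \<tau>E], of O', simplified, symmetric]
      by (subst ent_reindex[OF h', symmetric]) (auto intro!: ent_cong)
  qed
  \<comment> \<open>Strong subadditivity with the label added to the conditioning system and the
    outcome \<open>l\<close> as the system that is traced out.\<close>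
  have "ent ((A \<times> E) \<times> Y) \<rho> + (\<Sum>x\<in>O'. ent E (\<lambda>e e'. \<Sum>a\<in>A. \<tau> x (a, e) (a, e'))) \<le>
    (\<Sum>x\<in>O'. ent (A \<times> E) (\<tau> x)) + ent (E \<times> Y) \<rho>EY"
    using strong_subadditivity[OF _ _ _ L psdR'] unfolding 1 2 3 4 by simp
  then show ?thesis unfolding \<rho>EY_def sum_subtractf by linarith
qed

lemma psd_on_block_diagonal:
  assumes [simp]: "finite I" "finite K" and \<tau>: "\<And>k. k \<in> K \<Longrightarrow> psd_on I (\<tau> k)"
  shows "psd_on (K \<times> I) (\<lambda>x y. of_bool (fst x = fst y) * \<tau> (fst x) (snd x) (snd y))"
proof -
  have "psd_on (K \<times> I) (\<lambda>x y. \<Sum>k\<in>K. of_bool (fst x = k) * of_bool (fst y = k) * \<tau> k (snd x) (snd y))"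
  proof (rule psd_on_sum)
    fix k assume k: "k \<in> K"
    have "psd_on (K \<times> I) (\<lambda>x y. \<Sum>s\<in>{()}. \<Sum>i\<in>I. \<Sum>i'\<in>I.
       (of_bool (snd x = i) * of_bool (fst x = k)) * \<tau> k i i' * cnj (of_bool (snd y = i') * of_bool (fst y = k)))"
      by (rule psd_on_kraus[OF \<tau>[OF k]])
    also have "?this \<longleftrightarrow> psd_on (K \<times> I) (\<lambda>x y. of_bool (fst x = k) * of_bool (fst y = k) * \<tau> k (snd x) (snd y))"
    proof (intro psd_on_cong)
      fix x y assume xy: "x \<in> K \<times> I" "y \<in> K \<times> I"
      have "(\<Sum>s\<in>{()}. \<Sum>i\<in>I. \<Sum>i'\<in>I.
       (of_bool (snd x = i) * of_bool (fst x = k)) * \<tau> k i i' * cnj (of_bool (snd y = i') * of_bool (fst y = k))) =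
        (\<Sum>i\<in>I. of_bool (snd x = i) * (\<Sum>i'\<in>I. of_bool (snd y = i') * (of_bool (fst x = k) * of_bool (fst y = k) * \<tau> k i i')))"
        unfolding sum_distrib_left by (simp add: mult_ac)
      then show "(\<Sum>s\<in>{()}. \<Sum>i\<in>I. \<Sum>i'\<in>I.
       (of_bool (snd x = i) * of_bool (fst x = k)) * \<tau> k i i' * cnj (of_bool (snd y = i') * of_bool (fst y = k))) =
       of_bool (fst x = k) * of_bool (fst y = k) * \<tau> k (snd x) (snd y)"
        using xy by (simp only: sum_of_bool_mult assms(1,2) mem_Times_iff simp_thms if_True)
    qed
    finally show "psd_on (K \<times> I) (\<lambda>x y. of_bool (fst x = k) * of_bool (fst y = k) * \<tau> k (snd x) (snd y))" .
  qed
  also have "?this \<longleftrightarrow> ?thesis"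
  proof (intro psd_on_cong)
    fix x y assume xy: "x \<in> K \<times> I" "y \<in> K \<times> I"
    then show "(\<Sum>k\<in>K. of_bool (fst x = k) * of_bool (fst y = k) * \<tau> k (snd x) (snd y)) =
       of_bool (fst x = fst y) * \<tau> (fst x) (snd x) (snd y)"
      unfolding mult.assoc by (simp only: sum_of_bool_mult assms mem_Times_iff if_True) (simp add: eq_commute)
  qed
  finally show ?thesis .
qed

text \<open>Discarding a classical register K from the condition: H(A|EK) \<le> H(A|E), with K as
  the system that strong subadditivity traces out.\<close>

lemma conditional_entropy_concave:
  assumes [simp]: "finite A" "finite E" "finite K" and K: "K \<noteq> {}"
    and \<tau>: "\<And>k. k \<in> K \<Longrightarrow> psd_on (A \<times> E) (\<tau> k)"
  shows "(\<Sum>k\<in>K. ent (A \<times> E) (\<tau> k) - ent E (\<lambda>e e'. \<Sum>a\<in>A. \<tau> k (a, e) (a, e'))) \<le>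
    ent (A \<times> E) (\<lambda>x y. \<Sum>k\<in>K. \<tau> k x y) - ent E (\<lambda>e e'. \<Sum>k\<in>K. \<Sum>a\<in>A. \<tau> k (a, e) (a, e'))"
proof -
  define R where "R = (\<lambda>x y. of_bool (snd x = snd y) * \<tau> (snd x) (fst x) (fst y))"
  have swap: "bij_betw (\<lambda>x. (snd x, fst x)) (X \<times> K) (K \<times> X)" for X :: "'x set"
    by (rule bij_betw_byWitness[where f'="\<lambda>x. (snd x, fst x)"]) auto
  have psd: "psd_on ((A \<times> E) \<times> K) R"
  proof -
    have "psd_on (K \<times> (A \<times> E)) (\<lambda>x y. of_bool (fst x = fst y) * \<tau> (fst x) (snd x) (snd y))"
      by (rule psd_on_block_diagonal[OF _ _ \<tau>]) auto
    from psd_on_map[OF _ this, of "\<lambda>x. (snd x, fst x)" "(A \<times> E) \<times> K"] show ?thesis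
      unfolding R_def by (simp add: image_subset_iff mem_Times_iff)
  qed
  have 1: "ent ((A \<times> E) \<times> K) R = (\<Sum>k\<in>K. ent (A \<times> E) (\<tau> k))"
  proof -
    have "ent ((A \<times> E) \<times> K) R = ent (K \<times> (A \<times> E)) (\<lambda>x y. of_bool (fst x = fst y) * \<tau> (fst x) (snd x) (snd y))"
      unfolding R_def by (subst ent_reindex[OF swap, symmetric]) auto
    also have "\<dots> = (\<Sum>k\<in>K. ent (A \<times> E) (\<tau> k))"
      by (rule ent_block_diagonal) (auto intro: psd_on_hermitian \<tau>)
    finally show ?thesis .
  qed
  have \<tau>E: "psd_on E (\<lambda>e e'. \<Sum>a\<in>A. \<tau> k (a, e) (a, e'))" if "k \<in> K" for k
    by (intro psd_on_sum psd_on_map[OF _ \<tau>[OF that]]) auto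
  have 2: "ent (E \<times> K) (\<lambda>x y. \<Sum>a\<in>A. R ((a, fst x), snd x) ((a, fst y), snd y)) = (\<Sum>k\<in>K. ent E (\<lambda>e e'. \<Sum>a\<in>A. \<tau> k (a, e) (a, e')))"
  proof -
    have "ent (E \<times> K) (\<lambda>x y. \<Sum>a\<in>A. R ((a, fst x), snd x) ((a, fst y), snd y)) =
       ent (K \<times> E) (\<lambda>x y. of_bool (fst x = fst y) * (\<Sum>a\<in>A. \<tau> (fst x) (a, snd x) (a, snd y)))"
      unfolding R_def by (subst ent_reindex[OF swap, symmetric]) (auto simp only: fst_conv snd_conv sum_distrib_left assms)
    also have "\<dots> = (\<Sum>k\<in>K. ent E (\<lambda>e e'. \<Sum>a\<in>A. \<tau> k (a, e) (a, e')))"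
      by (rule ent_block_diagonal) (auto intro: psd_on_hermitian \<tau>E)
    finally show ?thesis .
  qed
  have 3: "ptrace K R = (\<lambda>x y. \<Sum>k\<in>K. \<tau> k x y)"
    by (simp add: ptrace_def R_def fun_eq_iff)
  have 4: "ptrace K (\<lambda>x y. \<Sum>a\<in>A. R ((a, fst x), snd x) ((a, fst y), snd y)) = (\<lambda>e e'. \<Sum>k\<in>K. \<Sum>a\<in>A. \<tau> k (a, e) (a, e'))"
    by (simp add: ptrace_def R_def fun_eq_iff)
  show ?thesis
    using strong_subadditivity[OF _ _ _ K psd] unfolding 1 2 3 4 sum_subtractf by simp
qed

lemma isometric_complete:
  assumes [simp]: "finite Y" "finite L" and r: "isometric L Y r"
  shows "(\<Sum>l\<in>L. \<Sum>y\<in>Y. \<Sum>y'\<in>Y. r l y * f y y' * cnj (r l y')) = (\<Sum>y\<in>Y. f y y)"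
proof -
  have "(\<Sum>l\<in>L. \<Sum>y\<in>Y. \<Sum>y'\<in>Y. r l y * f y y' * cnj (r l y')) = (\<Sum>y\<in>Y. \<Sum>y'\<in>Y. \<Sum>l\<in>L. r l y * f y y' * cnj (r l y'))"
    by (subst sum.swap, intro sum.cong refl, rule sum.swap)
  also have "\<dots> = (\<Sum>y\<in>Y. \<Sum>y'\<in>Y. (\<Sum>l\<in>L. cnj (r l y') * r l y) * f y y')"
    by (simp only: sum_distrib_left sum_distrib_right mult_ac)
  also have "\<dots> = (\<Sum>y\<in>Y. \<Sum>y'\<in>Y. of_bool (y' = y) * f y y')"
    using r unfolding isometric_def by (intro sum.cong refl arg_cong2[of _ _ _ _ "(*)"]) auto
  also have "\<dots> = (\<Sum>y\<in>Y. f y y)"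
    by (intro sum.cong refl) (simp only: sum_of_bool_mult assms if_True)
  finally show ?thesis .
qed

lemma sum_labelled:
  assumes "finite L" "finite O'" "lab ` L \<subseteq> O'"
  shows "(\<Sum>x\<in>O'. \<Sum>l | l \<in> L \<and> lab l = x. f l) = sum f L"
  using sum.group[OF assms(1,2,3), of f] .

text \<open>With the index \<open>i\<close> as a classical register this reads H(I|BE) \<le>
  H(I|JE), data processing under the measurement of \<open>B\<close>. It is
  \<open>ent_measure_le\<close> with the register in the role of the unmeasured system.\<close>

lemma ent_measure_ensemble:
  assumes [simp]: "finite I" "finite E" "finite B" "finite M" "finite J" and "B \<noteq> {}"
    and \<tau>: "\<And>i. i \<in> I \<Longrightarrow> psd_on (B \<times> E) (\<tau> i)"
    and s: "isometric M B s" and lab: "lab ` M \<subseteq> J"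
  defines "\<theta> \<equiv> \<lambda>i j e e'. \<Sum>l | l \<in> M \<and> lab l = j. \<Sum>b\<in>B. \<Sum>b'\<in>B. s l b * \<tau> i (b, e) (b', e') * cnj (s l b')"
  shows "(\<Sum>i\<in>I. ent (B \<times> E) (\<tau> i)) - ent (B \<times> E) (\<lambda>x y. \<Sum>i\<in>I. \<tau> i x y) \<le>
    (\<Sum>j\<in>J. (\<Sum>i\<in>I. ent E (\<theta> i j)) - ent E (\<lambda>e e'. \<Sum>i\<in>I. \<theta> i j e e'))"
proof -
  let ?f = "\<lambda>x. (fst (fst x), (snd x, snd (fst x)))"
  have f: "bij_betw ?f ((I \<times> E) \<times> B) (I \<times> (B \<times> E))"
    by (rule bij_betw_byWitness[where f'="\<lambda>x. ((fst x, snd (snd x)), fst (snd x))"]) auto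
  define D where "D = (\<lambda>x y. of_bool (fst x = fst y) * \<tau> (fst x) (snd x) (snd y))"
  have D: "psd_on (I \<times> (B \<times> E)) D"
    unfolding D_def by (rule psd_on_block_diagonal[OF _ _ \<tau>]) auto
  have psd: "psd_on ((I \<times> E) \<times> B) (\<lambda>x y. D (?f x) (?f y))"
    by (rule psd_on_map[OF _ D]) auto
  have 1: "ent ((I \<times> E) \<times> B) (\<lambda>x y. D (?f x) (?f y)) = (\<Sum>i\<in>I. ent (B \<times> E) (\<tau> i))"
  proof -
    have "ent ((I \<times> E) \<times> B) (\<lambda>x y. D (?f x) (?f y)) = ent (I \<times> (B \<times> E)) D"
      by (rule ent_reindex[OF f]) simp
    also have "\<dots> = (\<Sum>i\<in>I. ent (B \<times> E) (\<tau> i))"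
      unfolding D_def by (rule ent_block_diagonal) (auto intro: psd_on_hermitian \<tau>)
    finally show ?thesis .
  qed
  have sw: "bij_betw (\<lambda>x. (snd x, fst x)) (E \<times> B) (B \<times> E)"
    by (rule bij_betw_byWitness[where f'="\<lambda>x. (snd x, fst x)"]) auto
  have 2: "ent (E \<times> B) (\<lambda>x y. \<Sum>i\<in>I. D (?f ((i, fst x), snd x)) (?f ((i, fst y), snd y))) = ent (B \<times> E) (\<lambda>x y. \<Sum>i\<in>I. \<tau> i x y)"
    using ent_reindex[OF sw, of "\<lambda>x y. \<Sum>i\<in>I. \<tau> i x y"] by (simp add: D_def)
  have \<theta>: "(\<Sum>l | l \<in> M \<and> lab l = j. \<Sum>b\<in>B. \<Sum>b'\<in>B. s l b * D (?f (z, b)) (?f (z', b')) * cnj (s l b')) =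
      of_bool (fst z = fst z') * \<theta> (fst z) j (snd z) (snd z')" for j z z'
    unfolding \<theta>_def D_def by (simp add: sum_distrib_left mult_ac)
  have \<theta>_psd: "psd_on E (\<theta> i j)" if "i \<in> I" for i j
  proof -
    have "psd_on E (\<lambda>e e'. \<Sum>l | l \<in> M \<and> lab l = j. conj_snd B s (\<lambda>x y. \<tau> i (snd x, fst x) (snd y, fst y)) (e, l) (e', l))"
    proof (rule psd_on_sum)
      fix l assume "l \<in> {l. l \<in> M \<and> lab l = j}"
      moreover have "psd_on (E \<times> B) (\<lambda>x y. \<tau> i (snd x, fst x) (snd y, fst y))"
        by (rule psd_on_map[OF _ \<tau>[OF that]]) auto
      ultimately show "psd_on E (\<lambda>e e'. conj_snd B s (\<lambda>x y. \<tau> i (snd x, fst x) (snd y, fst y)) (e, l) (e', l))"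
        by (intro psd_on_map[OF _ psd_on_conj_snd[of E B _ M s], of _ "\<lambda>z. (z, l)"]) auto
    qed
    then show ?thesis by (simp add: \<theta>_def conj_snd_def)
  qed
  have 3: "ent (I \<times> E) (\<lambda>z z'. \<Sum>l | l \<in> M \<and> lab l = j. \<Sum>b\<in>B. \<Sum>b'\<in>B. s l b * D (?f (z, b)) (?f (z', b')) * cnj (s l b')) =
     (\<Sum>i\<in>I. ent E (\<theta> i j))" for j
    unfolding \<theta> by (rule ent_block_diagonal[OF _ _ psd_on_hermitian[OF \<theta>_psd]]) auto
  have 4: "(\<Sum>i\<in>I. \<Sum>l | l \<in> M \<and> lab l = j. \<Sum>b\<in>B. \<Sum>b'\<in>B. s l b * D (?f ((i, e), b)) (?f ((i, e'), b')) * cnj (s l b')) =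
     (\<Sum>i\<in>I. \<theta> i j e e')" for j e e'
    unfolding \<theta> by simp
  show ?thesis
    using ent_measure_le[OF assms(1,2,3,4,5,6) psd s lab] unfolding 1 2 3 4 .
qed

(* The conditional mutual information I(Y:B|E), with Y the joint system of Alice and Charlie, does
   not increase when Charlie announces k, Alice learns i and Bob learns j; the message k is handed
   to E. *)
theorem measured_cond_mutual_info_le:
  assumes [simp]: "finite B" "finite E" "finite Y" "finite L" "finite K" "finite I" "finite J"
    and ne: "B \<noteq> {}" "Y \<noteq> {}" "K \<noteq> {}"
    and \<Omega>: "psd_on ((B \<times> E) \<times> Y) \<Omega>"
    and r: "isometric L Y r" and lab: "lab ` L \<subseteq> K \<times> I"
    and M: "\<And>k. k \<in> K \<Longrightarrow> finite (M k)" and s: "\<And>k. k \<in> K \<Longrightarrow> isometric (M k) B (s k)"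
    and labB: "\<And>k. k \<in> K \<Longrightarrow> labB k ` M k \<subseteq> J"
  defines "\<tau> \<equiv> \<lambda>k i z z'. \<Sum>l | l \<in> L \<and> lab l = (k, i). \<Sum>y\<in>Y. \<Sum>y'\<in>Y. r l y * \<Omega> (z, y) (z', y') * cnj (r l y')"
  defines "\<theta> \<equiv> \<lambda>k i j e e'. \<Sum>l | l \<in> M k \<and> labB k l = j. \<Sum>b\<in>B. \<Sum>b'\<in>B. s k l b * \<tau> k i (b, e) (b', e') * cnj (s k l b')"
  defines "\<Theta> \<equiv> \<lambda>i j x y. of_bool (fst x = fst y) * \<theta> (fst x) i j (snd x) (snd y)"
  shows "(\<Sum>i\<in>I. ent (K \<times> E) (\<lambda>x y. \<Sum>j\<in>J. \<Theta> i j x y)) + (\<Sum>j\<in>J. ent (K \<times> E) (\<lambda>x y. \<Sum>i\<in>I. \<Theta> i j x y))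
      - (\<Sum>i\<in>I. \<Sum>j\<in>J. ent (K \<times> E) (\<Theta> i j)) - ent (K \<times> E) (\<lambda>x y. \<Sum>i\<in>I. \<Sum>j\<in>J. \<Theta> i j x y)
    \<le> ent (E \<times> Y) (\<lambda>x y. \<Sum>b\<in>B. \<Omega> ((b, fst x), snd x) ((b, fst y), snd y)) - ent ((B \<times> E) \<times> Y) \<Omega>
      + ent (B \<times> E) (ptrace Y \<Omega>) - ent E (\<lambda>e e'. \<Sum>b\<in>B. ptrace Y \<Omega> (b, e) (b, e'))"
proof -
  have \<tau>: "psd_on (B \<times> E) (\<tau> k i)" for k i
  proof -
    have "psd_on (B \<times> E) (\<lambda>z z'. \<Sum>l | l \<in> L \<and> lab l = (k, i). conj_snd Y r \<Omega> (z, l) (z', l))"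
    proof (rule psd_on_sum)
      fix l assume "l \<in> {l. l \<in> L \<and> lab l = (k, i)}"
      then show "psd_on (B \<times> E) (\<lambda>z z'. conj_snd Y r \<Omega> (z, l) (z', l))"
        by (intro psd_on_map[OF _ psd_on_conj_snd[OF _ \<Omega>, of L r], of "\<lambda>z. (z, l)"]) auto
    qed
    then show ?thesis by (simp add: \<tau>_def conj_snd_def)
  qed
  have \<theta>_psd: "psd_on E (\<theta> k i j)" if "k \<in> K" for k i j
  proof -
    have "psd_on E (\<lambda>e e'. \<Sum>l | l \<in> M k \<and> labB k l = j. conj_snd B (s k) (\<lambda>x y. \<tau> k i (snd x, fst x) (snd y, fst y)) (e, l) (e', l))"
    proof (rule psd_on_sum)
      fix l assume "l \<in> {l. l \<in> M k \<and> labB k l = j}"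
      moreover have "psd_on (E \<times> B) (\<lambda>x y. \<tau> k i (snd x, fst x) (snd y, fst y))"
        by (rule psd_on_map[OF _ \<tau>]) auto
      ultimately show "psd_on E (\<lambda>e e'. conj_snd B (s k) (\<lambda>x y. \<tau> k i (snd x, fst x) (snd y, fst y)) (e, l) (e', l))"
        using M[OF that]
        by (intro psd_on_map[OF _ psd_on_conj_snd[of E B _ "M k" "s k"], of _ "\<lambda>z. (z, l)"]) auto
    qed
    then show ?thesis by (simp add: \<theta>_def conj_snd_def)
  qed
  have sum\<theta>: "(\<Sum>j\<in>J. \<theta> k i j e e') = (\<Sum>b\<in>B. \<tau> k i (b, e) (b, e'))" if "k \<in> K" for k i e e'
    unfolding \<theta>_def sum_labelled[OF M[OF that] assms(7) labB[OF that]]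
    by (rule isometric_complete[OF _ M[OF that] s[OF that]]) simp
  have sum\<tau>: "(\<Sum>k\<in>K. \<Sum>i\<in>I. \<tau> k i x y) = ptrace Y \<Omega> x y" for x y
  proof -
    have "(\<Sum>k\<in>K. \<Sum>i\<in>I. \<tau> k i x y) = (\<Sum>z\<in>K\<times>I. \<Sum>l | l \<in> L \<and> lab l = z. \<Sum>w\<in>Y. \<Sum>w'\<in>Y. r l w * \<Omega> (x, w) (y, w') * cnj (r l w'))"
      by (simp add: sum.cartesian_product' \<tau>_def)
    also have "\<dots> = ptrace Y \<Omega> x y"
      unfolding ptrace_def
      by (subst sum_labelled[OF _ _ lab]) (auto intro: isometric_complete[OF _ _ r])
    finally show ?thesis .
  qed
  \<comment> \<open>Measuring Y lowers what is known about B: H(B|EY) \<le> H(B|EKI).\<close>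
  have step1: "ent ((B \<times> E) \<times> Y) \<Omega> - ent (E \<times> Y) (\<lambda>x y. \<Sum>b\<in>B. \<Omega> ((b, fst x), snd x) ((b, fst y), snd y)) \<le>
     (\<Sum>k\<in>K. \<Sum>i\<in>I. ent (B \<times> E) (\<tau> k i) - ent E (\<lambda>e e'. \<Sum>j\<in>J. \<theta> k i j e e'))"
  proof -
    have "(\<Sum>z\<in>K\<times>I. ent (B \<times> E) (\<tau> (fst z) (snd z)) - ent E (\<lambda>e e'. \<Sum>b\<in>B. \<tau> (fst z) (snd z) (b, e) (b, e'))) =
       (\<Sum>k\<in>K. \<Sum>i\<in>I. ent (B \<times> E) (\<tau> k i) - ent E (\<lambda>e e'. \<Sum>j\<in>J. \<theta> k i j e e'))"
      by (simp add: sum.cartesian_product' sum\<theta>)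
    then show ?thesis
      using ent_measure_le[OF assms(1,2,3,4) _ ne(2) \<Omega> r lab] unfolding \<tau>_def by simp
  qed
  \<comment> \<open>Forgetting the message: H(B|EK) \<le> H(B|E).\<close>
  have step2: "(\<Sum>k\<in>K. ent (B \<times> E) (\<lambda>x y. \<Sum>i\<in>I. \<tau> k i x y) - ent E (\<lambda>e e'. \<Sum>i\<in>I. \<Sum>j\<in>J. \<theta> k i j e e'))
     \<le> ent (B \<times> E) (ptrace Y \<Omega>) - ent E (\<lambda>e e'. \<Sum>b\<in>B. ptrace Y \<Omega> (b, e) (b, e'))"
  proof -
    have psd: "psd_on (B \<times> E) (\<lambda>x y. \<Sum>i\<in>I. \<tau> k i x y)" for k
      by (intro psd_on_sum \<tau>)
    have "(\<Sum>k\<in>K. ent (B \<times> E) (\<lambda>x y. \<Sum>i\<in>I. \<tau> k i x y) - ent E (\<lambda>e e'. \<Sum>b\<in>B. \<Sum>i\<in>I. \<tau> k i (b, e) (b, e')))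
     \<le> ent (B \<times> E) (\<lambda>x y. \<Sum>k\<in>K. \<Sum>i\<in>I. \<tau> k i x y) - ent E (\<lambda>e e'. \<Sum>k\<in>K. \<Sum>b\<in>B. \<Sum>i\<in>I. \<tau> k i (b, e) (b, e'))"
      by (rule conditional_entropy_concave[OF _ _ _ ne(3) psd]) auto
    moreover have "(\<Sum>k\<in>K. \<Sum>b\<in>B. \<Sum>i\<in>I. \<tau> k i (b, e) (b, e')) = (\<Sum>b\<in>B. ptrace Y \<Omega> (b, e) (b, e'))" for e e'
      by (subst sum.swap) (simp add: sum\<tau>)
    moreover have "(\<Sum>b\<in>B. \<Sum>i\<in>I. \<tau> k i (b, e) (b, e')) = (\<Sum>i\<in>I. \<Sum>j\<in>J. \<theta> k i j e e')" if "k \<in> K" for k e e'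
      by (subst sum.swap) (simp add: sum\<theta>[OF that])
    ultimately show ?thesis by (simp add: sum\<tau> cong: sum.cong)
  qed
  \<comment> \<open>Bob's measurement: H(I|BEK) \<le> H(I|JEK), proved for each \<open>k\<close>
    separately because his measurement depends on the message.\<close>
  have step3: "(\<Sum>i\<in>I. ent (B \<times> E) (\<tau> k i)) - ent (B \<times> E) (\<lambda>x y. \<Sum>i\<in>I. \<tau> k i x y) \<le>
    (\<Sum>j\<in>J. (\<Sum>i\<in>I. ent E (\<theta> k i j)) - ent E (\<lambda>e e'. \<Sum>i\<in>I. \<theta> k i j e e'))" if "k \<in> K" for k
    unfolding \<theta>_def
    by (rule ent_measure_ensemble[OF _ _ _ M[OF that] _ ne(1) \<tau> s[OF that] labB[OF that]]) auto
  have block: "ent (K \<times> E) (\<lambda>x y. of_bool (fst x = fst y) * f (fst x) (snd x) (snd y)) = (\<Sum>k\<in>K. ent E (f k))"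
    if "\<And>k. k \<in> K \<Longrightarrow> psd_on E (f k)" for f
    by (rule ent_block_diagonal[OF _ _ psd_on_hermitian[OF that]]) auto
  have e1: "ent (K \<times> E) (\<lambda>x y. \<Sum>j\<in>J. \<Theta> i j x y) = (\<Sum>k\<in>K. ent E (\<lambda>e e'. \<Sum>j\<in>J. \<theta> k i j e e'))" for i
    unfolding \<Theta>_def sum_distrib_left[symmetric] by (rule block) (intro psd_on_sum \<theta>_psd)
  have e2: "ent (K \<times> E) (\<lambda>x y. \<Sum>i\<in>I. \<Theta> i j x y) = (\<Sum>k\<in>K. ent E (\<lambda>e e'. \<Sum>i\<in>I. \<theta> k i j e e'))" for j
    unfolding \<Theta>_def sum_distrib_left[symmetric] by (rule block) (intro psd_on_sum \<theta>_psd)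
  have e3: "ent (K \<times> E) (\<Theta> i j) = (\<Sum>k\<in>K. ent E (\<theta> k i j))" for i j
    unfolding \<Theta>_def by (rule block[OF \<theta>_psd])
  have e4: "ent (K \<times> E) (\<lambda>x y. \<Sum>i\<in>I. \<Sum>j\<in>J. \<Theta> i j x y) = (\<Sum>k\<in>K. ent E (\<lambda>e e'. \<Sum>i\<in>I. \<Sum>j\<in>J. \<theta> k i j e e'))"
    unfolding \<Theta>_def sum_distrib_left[symmetric] by (rule block) (intro psd_on_sum \<theta>_psd)
  \<comment> \<open>The chain is I(I:J|EK) \<le> I(I:B|EK) = H(B|EK) - H(B|EKI) \<le> H(B|E) -
    H(B|EY), and the last difference is I(Y:B|E).\<close>
  have "(\<Sum>k\<in>K. (\<Sum>i\<in>I. ent (B \<times> E) (\<tau> k i)) - ent (B \<times> E) (\<lambda>x y. \<Sum>i\<in>I. \<tau> k i x y)) \<le>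
    (\<Sum>k\<in>K. \<Sum>j\<in>J. (\<Sum>i\<in>I. ent E (\<theta> k i j)) - ent E (\<lambda>e e'. \<Sum>i\<in>I. \<theta> k i j e e'))"
    by (rule sum_mono[OF step3])
  then have "(\<Sum>i\<in>I. \<Sum>k\<in>K. ent E (\<lambda>e e'. \<Sum>j\<in>J. \<theta> k i j e e')) + (\<Sum>j\<in>J. \<Sum>k\<in>K. ent E (\<lambda>e e'. \<Sum>i\<in>I. \<theta> k i j e e'))
     - (\<Sum>k\<in>K. \<Sum>j\<in>J. \<Sum>i\<in>I. ent E (\<theta> k i j)) - (\<Sum>k\<in>K. ent E (\<lambda>e e'. \<Sum>i\<in>I. \<Sum>j\<in>J. \<theta> k i j e e'))
     \<le> (\<Sum>k\<in>K. ent (B \<times> E) (\<lambda>x y. \<Sum>i\<in>I. \<tau> k i x y) - ent E (\<lambda>e e'. \<Sum>i\<in>I. \<Sum>j\<in>J. \<theta> k i j e e'))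
       - (\<Sum>k\<in>K. \<Sum>i\<in>I. ent (B \<times> E) (\<tau> k i) - ent E (\<lambda>e e'. \<Sum>j\<in>J. \<theta> k i j e e'))"
    unfolding sum.swap[of _ K I] sum.swap[of _ K J] sum_subtractf by simp
  also have "\<dots> \<le> (ent (B \<times> E) (ptrace Y \<Omega>) - ent E (\<lambda>e e'. \<Sum>b\<in>B. ptrace Y \<Omega> (b, e) (b, e')))
      - (ent ((B \<times> E) \<times> Y) \<Omega> - ent (E \<times> Y) (\<lambda>x y. \<Sum>b\<in>B. \<Omega> ((b, fst x), snd x) ((b, fst y), snd y)))"
    using step1 step2 by linarith
  finally have main: "(\<Sum>i\<in>I. \<Sum>k\<in>K. ent E (\<lambda>e e'. \<Sum>j\<in>J. \<theta> k i j e e')) + (\<Sum>j\<in>J. \<Sum>k\<in>K. ent E (\<lambda>e e'. \<Sum>i\<in>I. \<theta> k i j e e'))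
     - (\<Sum>k\<in>K. \<Sum>j\<in>J. \<Sum>i\<in>I. ent E (\<theta> k i j)) - (\<Sum>k\<in>K. ent E (\<lambda>e e'. \<Sum>i\<in>I. \<Sum>j\<in>J. \<theta> k i j e e')) \<le>
     (ent (B \<times> E) (ptrace Y \<Omega>) - ent E (\<lambda>e e'. \<Sum>b\<in>B. ptrace Y \<Omega> (b, e) (b, e')))
      - (ent ((B \<times> E) \<times> Y) \<Omega> - ent (E \<times> Y) (\<lambda>x y. \<Sum>b\<in>B. \<Omega> ((b, fst x), snd x) ((b, fst y), snd y)))" .
  have sw: "(\<Sum>i\<in>I. \<Sum>j\<in>J. \<Sum>k\<in>K. ent E (\<theta> k i j)) = (\<Sum>k\<in>K. \<Sum>j\<in>J. \<Sum>i\<in>I. ent E (\<theta> k i j))"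
    by (subst sum.swap[of _ K], subst sum.swap[of _ K], subst sum.swap[of _ I J], rule refl)
  show ?thesis unfolding e1 e2 e3 e4 sw using main by linarith
qed

section \<open>Conditional mutual information of a key\<close>

text \<open>Gibbs' inequality for a single term. The linear correction allows any positive weight
  \<open>q\<close>; after summation it is at most 0 as soon as the weights \<open>q\<close> sum to
  no more than the \<open>p\<close>.\<close>

lemma entropy_fun_le_cross:
  assumes "0 \<le> p" "0 < q"
  shows "entropy_fun p \<le> - p * log 2 q + (q - p) / ln 2"
proof (cases "p = 0")
  case False
  then have p: "p > 0" using assms by simp
  have "ln (q / p) \<le> q / p - 1" using p assms by (intro ln_le_minus_one) auto
  then have "p * ln (q / p) \<le> q - p" using p by (simp add: field_simps)
  then have "- (p * ln p) \<le> - p * ln q + (q - p)" using p assms by (simp add: ln_div algebra_simps)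
  then have "- (p * ln p) / ln 2 \<le> (- p * ln q + (q - p)) / ln 2" by (intro divide_right_mono) auto
  then show ?thesis by (simp add: entropy_fun_def log_def add_divide_distrib diff_divide_distrib)
qed (use assms in simp)

lemma entropy_sum_le_peaked:
  assumes fin: "finite K" and k0: "k0 \<in> K" and p: "\<And>k. k \<in> K \<Longrightarrow> 0 \<le> p k" "(\<Sum>k\<in>K. p k) = 1"
    and N: "real (card K) \<le> N\<^sup>2" "1 \<le> N"
  shows "(\<Sum>k\<in>K. entropy_fun (p k)) \<le> 1 + 2 * (1 - p k0) * log 2 N"
proof -
  \<comment> \<open>Half of the reference weight sits on the peak and costs one bit; the other half
    is spread so thinly that \<open>N\<^sup>2\<close> points can share it, at a cost of
    \<open>1 + 2 * log 2 N\<close> bits each.\<close>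
  define q where "q = (\<lambda>k. if k = k0 then 1/2 else 1 / (2 * N\<^sup>2))"
  have q: "0 < q k" for k using N by (simp add: q_def)
  have lq: "- log 2 (q k) = 1 + (if k = k0 then 0 else 2 * log 2 N)" for k
    using N by (simp add: q_def log_divide log_mult log_nat_power)
  have sq: "(\<Sum>k\<in>K. q k) \<le> 1"
  proof -
    have "(\<Sum>k\<in>K. q k) = 1/2 + (\<Sum>k\<in>K-{k0}. 1 / (2 * N\<^sup>2))"
      unfolding sum.remove[OF fin k0] by (simp add: q_def)
    also have "\<dots> \<le> 1/2 + real (card K) * (1 / (2 * N\<^sup>2))"
      using fin N by (auto intro!: divide_right_mono simp: card_Diff_singleton_if)
    also have "\<dots> \<le> 1" using N by (simp add: field_simps)
    finally show ?thesis .
  qed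
  have "(\<Sum>k\<in>K. entropy_fun (p k)) \<le> (\<Sum>k\<in>K. - p k * log 2 (q k) + (q k - p k) / ln 2)"
    by (intro sum_mono entropy_fun_le_cross p q)
  also have "\<dots> = (\<Sum>k\<in>K. p k * (1 + (if k = k0 then 0 else 2 * log 2 N))) + ((\<Sum>k\<in>K. q k) - (\<Sum>k\<in>K. p k)) / ln 2"
  proof -
    have "(\<Sum>k\<in>K. (q k - p k) / ln 2) = ((\<Sum>k\<in>K. q k) - (\<Sum>k\<in>K. p k)) / ln 2"
      by (simp only: sum_divide_distrib[symmetric] sum_subtractf)
    then show ?thesis unfolding lq[symmetric] by (simp only: sum.distrib) simp
  qed
  also have "\<dots> \<le> (\<Sum>k\<in>K. p k * (1 + (if k = k0 then 0 else 2 * log 2 N)))"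
    using sq p(2) by (simp add: divide_le_0_iff)
  also have "\<dots> = (\<Sum>k\<in>K. p k) + (\<Sum>k\<in>K - {k0}. p k) * (2 * log 2 N)"
  proof -
    have "(\<Sum>k\<in>K - {k0}. p k * (if k = k0 then 0 else 2 * log 2 N)) = (\<Sum>k\<in>K - {k0}. p k * (2 * log 2 N))"
      by (intro sum.cong) auto
    then show ?thesis
      unfolding distrib_left sum.distrib sum_distrib_right sum.remove[OF fin k0, of "\<lambda>k. p k * (if k = k0 then 0 else 2 * log 2 N)"]
      by simp
  qed
  also have "(\<Sum>k\<in>K - {k0}. p k) = 1 - p k0"
    using p(2) sum.remove[OF fin k0, of p] by simp
  finally show ?thesis using p(2) by (simp add: algebra_simps)
qed

text \<open>The largest eigenvalue is at least the overlap with any unit vector, hence at least 1 -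
  \<epsilon>, and a peaked spectrum has small entropy. \<open>N\<close> stands for the dimension of
  one key, so that \<open>N\<^sup>2\<close> suits the pair of keys.\<close>

lemma ent_le_fidelity:
  assumes fin: "finite I" and \<rho>: "psd_on I \<rho>" "(\<Sum>i\<in>I. \<rho> i i) = 1"
    and \<phi>: "(\<Sum>i\<in>I. (cmod (\<phi> i))\<^sup>2) = 1"
    and F: "1 - \<epsilon> \<le> Re (\<Sum>i\<in>I. \<Sum>j\<in>I. cnj (\<phi> i) * \<rho> i j * \<phi> j)"
    and N: "real (card I) \<le> N\<^sup>2" "1 \<le> N"
  shows "ent I \<rho> \<le> 1 + 2 * \<epsilon> * log 2 N"
proof -
  obtain u d where u: "unitary_on I I u" "spectral_form I I \<rho> u d"
    using spectral_theorem[OF fin psd_on_hermitian[OF \<rho>(1)]] by auto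
  have iso: "isometric I I u" using u(1) by (simp add: unitary_on_def)
  have d: "0 \<le> d k" if "k \<in> I" for k using psd_on_spectral_nonneg[OF fin iso u(2) \<rho>(1) that] .
  have sd: "(\<Sum>k\<in>I. d k) = 1"
    using spectral_trace[OF fin iso u(2)] \<rho>(2) by (metis of_real_eq_1_iff)
  define c where "c = (\<lambda>k. (cmod (basis_overlap I u (\<lambda>i _. \<phi> i) k ()))\<^sup>2)"
  have cs: "(\<Sum>k\<in>I. c k) = 1"
  proof -
    have "complex_of_real (\<Sum>k\<in>I. c k) = (\<Sum>k\<in>I. cnj (\<Sum>i\<in>I. cnj (u i k) * \<phi> i) * (\<Sum>i\<in>I. cnj (u i k) * \<phi> i))"
      unfolding c_def basis_overlap_def of_real_sum complex_norm_square by (simp only: mult.commute)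
    also have "\<dots> = (\<Sum>i\<in>I. cnj (\<phi> i) * \<phi> i)" by (rule parseval[OF fin fin u(1), symmetric])
    also have "\<dots> = of_real (\<Sum>i\<in>I. (cmod (\<phi> i))\<^sup>2)"
      unfolding of_real_sum complex_norm_square by (simp only: mult.commute)
    finally show ?thesis unfolding \<phi> by (metis of_real_eq_1_iff of_real_1)
  qed
  have ne: "I \<noteq> {}" using \<rho>(2) by auto
  obtain k0 where k0: "k0 \<in> I" "d k0 = Max (d ` I)"
  proof -
    have "Max (d ` I) \<in> d ` I" using fin ne by (intro Max_in) auto
    then show ?thesis using that by auto
  qed
  have k0_max: "d k \<le> d k0" if "k \<in> I" for k
    unfolding k0(2) using fin that by (intro Max_ge) auto
  have "1 - \<epsilon> \<le> (\<Sum>k\<in>I. d k * c k)"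
    using F basis_overlap_expectation[OF fin u(2), of "\<lambda>i _. \<phi> i" "()"] by (simp add: c_def)
  also have "\<dots> \<le> (\<Sum>k\<in>I. d k0 * c k)"
    by (intro sum_mono mult_right_mono k0_max) (auto simp: c_def)
  also have "\<dots> = d k0" by (simp add: cs flip: sum_distrib_left)
  finally have dk: "1 - d k0 \<le> \<epsilon>" by simp
  have "ent I \<rho> = (\<Sum>k\<in>I. entropy_fun (d k))" by (rule ent_spectral[OF fin fin iso u(2)])
  also have "\<dots> \<le> 1 + 2 * (1 - d k0) * log 2 N"
    by (rule entropy_sum_le_peaked[OF fin k0(1) d sd N])
  also have "\<dots> \<le> 1 + 2 * \<epsilon> * log 2 N"
    using dk N by (auto intro!: mult_right_mono)
  finally show ?thesis .
qed

lemma entropy_sum_ge_flat: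
  assumes fin: "finite J" and q: "\<And>j. j \<in> J \<Longrightarrow> 0 \<le> q j" "(\<Sum>j\<in>J. q j) = 1" and N: "1 \<le> N"
    and T: "\<And>T. T \<subseteq> J \<Longrightarrow> (\<Sum>j\<in>T. q j) \<le> real (card T) / N + \<epsilon>"
  shows "(1 - 2 * \<epsilon>) * log 2 N - 1 \<le> (\<Sum>j\<in>J. entropy_fun (q j))"
proof -
  \<comment> \<open>The points that exceed twice the uniform weight. Their total weight is at least
    2 card T / N, but by hypothesis at most card T / N + \<epsilon>, so it is at most 2 \<epsilon>.
    Each other point of weight \<open>q\<close> contributes at least \<open>q\<close> times (log N -
    1).\<close>
  define T where "T = {j\<in>J. 2 / N < q j}"
  have TJ: "T \<subseteq> J" "finite T" using fin by (auto simp: T_def)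
  have "real (card T) * (2 / N) \<le> (\<Sum>j\<in>T. q j)"
    using sum_bounded_below[of T "2 / N" q] by (auto simp: T_def less_imp_le)
  moreover have "real (card T) * (2 / N) = 2 * (real (card T) / N)" by simp
  ultimately have qT: "(\<Sum>j\<in>T. q j) \<le> 2 * \<epsilon>" using T[OF TJ(1)] by linarith
  have le1: "q j \<le> 1" if "j \<in> J" for j
    using member_le_sum[of j J q] that q fin by auto
  have "(\<Sum>j\<in>J. entropy_fun (q j)) = (\<Sum>j\<in>J - T. entropy_fun (q j)) + (\<Sum>j\<in>T. entropy_fun (q j))"
    by (rule sum.subset_diff[OF TJ(1) fin])
  moreover have "0 \<le> (\<Sum>j\<in>T. entropy_fun (q j))"
  proof (intro sum_nonneg)
    fix j assume "j \<in> T"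
    then have "j \<in> J" "0 < q j" using N by (auto simp: T_def intro: less_trans[of 0 "2/N"])
    then show "0 \<le> entropy_fun (q j)"
      using le1[of j] by (simp add: entropy_fun_def mult_nonneg_nonpos)
  qed
  moreover have "(\<Sum>j\<in>J - T. q j * (log 2 N - 1)) \<le> (\<Sum>j\<in>J - T. entropy_fun (q j))"
  proof (intro sum_mono)
    fix j assume j: "j \<in> J - T"
    show "q j * (log 2 N - 1) \<le> entropy_fun (q j)"
    proof (cases "q j = 0")
      case False
      then have "0 < q j" "q j \<le> 2 / N" using j q(1)[of j] by (auto simp: T_def)
      then have "log 2 (q j) \<le> log 2 (2 / N)" using N by (subst log_le_cancel_iff) auto
      also have "\<dots> = 1 - log 2 N" using N by (simp add: log_divide)
      finally have "q j * log 2 (q j) \<le> q j * (1 - log 2 N)" using \<open>0 < q j\<close> by simp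
      then show ?thesis by (simp add: entropy_fun_def algebra_simps)
    qed simp
  qed
  moreover have "(\<Sum>j\<in>J - T. q j * (log 2 N - 1)) = (1 - (\<Sum>j\<in>T. q j)) * (log 2 N - 1)"
    using q(2) sum.subset_diff[OF TJ(1) fin, of q] by (simp flip: sum_distrib_right)
  moreover have "(1 - 2 * \<epsilon>) * log 2 N - 1 \<le> (1 - (\<Sum>j\<in>T. q j)) * (log 2 N - 1)"
  proof -
    have "0 \<le> (\<Sum>j\<in>T. q j)" using q TJ by (auto intro!: sum_nonneg)
    moreover have "(\<Sum>j\<in>T. q j) * log 2 N \<le> 2 * \<epsilon> * log 2 N" using qT N by (intro mult_right_mono) auto
    ultimately show ?thesis by (simp add: algebra_simps)
  qed
  ultimately show ?thesis by linarith
qed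

text \<open>A Fano-type bound. Gibbs' inequality is applied with the conditional distribution that
  puts 1/2 on \<open>j = i\<close> and spreads 1/2 uniformly: agreeing pairs then cost at most one
  bit and the others \<open>1 + log 2 N\<close>.\<close>

lemma conditional_entropy_correlated:
  fixes I :: "'i set" and p :: "'i \<Rightarrow> 'i \<Rightarrow> real"
  assumes fin: "finite I" and N: "real (card I) = N" "1 \<le> N"
    and p: "\<And>i j. 0 \<le> p i j" "(\<Sum>i\<in>I. \<Sum>j\<in>I. p i j) = 1"
    and off: "(\<Sum>i\<in>I. \<Sum>j\<in>I - {i}. p i j) \<le> \<epsilon>"
  shows "(\<Sum>i\<in>I. (\<Sum>j\<in>I. entropy_fun (p i j)) - entropy_fun (\<Sum>j\<in>I. p i j)) \<le> 1 + \<epsilon> * log 2 N"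
proof -
  define P where "P = (\<lambda>i. \<Sum>j\<in>I. p i j)"
  define q :: "'i \<Rightarrow> 'i \<Rightarrow> real" where "q = (\<lambda>i j. (if i = j then 1/2 else 0) + 1 / (2 * N))"
  have q: "0 < q i j" for i j using N by (simp add: q_def add_nonneg_pos)
  have sq: "(\<Sum>j\<in>I. q i j) = 1" if "i \<in> I" for i
    using fin that N unfolding q_def sum.distrib by auto
  have lq: "- log 2 (q i j) \<le> 1 + (if i = j then 0 else log 2 N)" for i j
  proof (cases "i = j")
    case True
    have "log 2 (1/2) \<le> log 2 (q i j)" using True N by (subst log_le_cancel_iff) (auto simp: q_def add_pos_nonneg)
    then show ?thesis using True by (simp add: log_divide)
  next
    case False
    then show ?thesis using N by (simp add: q_def log_divide log_mult)
  qed
  have "(\<Sum>j\<in>I. entropy_fun (p i j)) - entropy_fun (P i) \<le> (\<Sum>j\<in>I. p i j * (1 + (if i = j then 0 else log 2 N)))"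
    if i: "i \<in> I" for i
  proof (cases "P i = 0")
    case True
    then have "p i j = 0" if "j \<in> I" for j
      using that fin p(1) sum_nonneg_eq_0_iff[of I "p i"] unfolding P_def by auto
    then show ?thesis using True by simp
  next
    case False
    then have P: "0 < P i" using p(1) sum_nonneg[of I "p i"] unfolding P_def by (simp add: less_le)
    have "(\<Sum>j\<in>I. entropy_fun (p i j)) \<le> (\<Sum>j\<in>I. - p i j * log 2 (P i * q i j) + (P i * q i j - p i j) / ln 2)"
      by (intro sum_mono entropy_fun_le_cross p mult_pos_pos P q)
    also have "\<dots> = (\<Sum>j\<in>I. - p i j * log 2 (P i) + - p i j * log 2 (q i j)) + (P i * (\<Sum>j\<in>I. q i j) - P i) / ln 2"
    proof -
      have "- p i j * log 2 (P i * q i j) = - p i j * log 2 (P i) + - p i j * log 2 (q i j)" for j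
        using P q[of i j] by (simp add: log_mult algebra_simps)
      moreover have "(\<Sum>j\<in>I. (P i * q i j - p i j) / ln 2) = (P i * (\<Sum>j\<in>I. q i j) - P i) / ln 2"
        by (simp only: sum_divide_distrib[symmetric] sum_subtractf sum_distrib_left[symmetric] P_def)
      ultimately show ?thesis by (simp only: sum.distrib)
    qed
    also have "\<dots> = entropy_fun (P i) + (\<Sum>j\<in>I. p i j * - log 2 (q i j))"
    proof -
      have "(\<Sum>j\<in>I. - p i j * log 2 (P i)) = entropy_fun (P i)"
        by (simp add: entropy_fun_def P_def sum_negf flip: sum_distrib_right)
      then show ?thesis unfolding sum.distrib sq[OF i] by simp
    qed
    also have "\<dots> \<le> entropy_fun (P i) + (\<Sum>j\<in>I. p i j * (1 + (if i = j then 0 else log 2 N)))"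
      by (intro add_left_mono sum_mono mult_left_mono lq p)
    finally show ?thesis by simp
  qed
  then have "(\<Sum>i\<in>I. (\<Sum>j\<in>I. entropy_fun (p i j)) - entropy_fun (P i)) \<le> (\<Sum>i\<in>I. \<Sum>j\<in>I. p i j * (1 + (if i = j then 0 else log 2 N)))"
    by (rule sum_mono)
  also have "\<dots> = 1 + (\<Sum>i\<in>I. \<Sum>j\<in>I - {i}. p i j) * log 2 N"
  proof -
    have "(\<Sum>j\<in>I. p i j * (if i = j then 0 else log 2 N)) = (\<Sum>j\<in>I - {i}. p i j) * log 2 N" if "i \<in> I" for i
      unfolding sum.remove[OF fin that] sum_distrib_right by (simp, intro sum.cong refl, auto)
    then show ?thesis by (simp add: distrib_left sum.distrib p(2) sum_distrib_right cong: sum.cong)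
  qed
  also have "\<dots> \<le> 1 + \<epsilon> * log 2 N" using off N by (auto intro: mult_right_mono)
  finally show ?thesis unfolding P_def .
qed

lemma ent_unit:
  assumes "finite X" "x0 \<in> X" "X \<subseteq> {x0}"
  shows "ent X (\<lambda>x y. of_real c) = entropy_fun c"
proof -
  have X: "X = {x0}" using assms by auto
  have "ent X (\<lambda>x y. of_real c) = ent X (\<lambda>i j. of_bool (i = j) * of_real c)"
    using assms X by (intro ent_cong) auto
  also have "\<dots> = (\<Sum>x\<in>X. entropy_fun c)" by (rule ent_diagonal[OF assms(1)])
  finally show ?thesis by (simp add: X)
qed

lemma psd_on_diag_nonneg:
  assumes "finite I" "psd_on I \<rho>" "i \<in> I"
  shows "0 \<le> Re (\<rho> i i)" "\<rho> i i = of_real (Re (\<rho> i i))"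
proof -
  have "0 \<le> Re (\<Sum>k\<in>I. \<Sum>j\<in>I. cnj (of_bool (k = i)) * \<rho> k j * of_bool (j = i))"
    using assms(2) unfolding psd_on_def by (elim conjE allE[where x="\<lambda>j. of_bool (j = i)"])
  also have "(\<Sum>k\<in>I. \<Sum>j\<in>I. cnj (of_bool (k = i)) * \<rho> k j * of_bool (j = i)) = \<rho> i i"
    using assms(1,3) by (simp only: sum_of_bool_mult cnj_of_bool if_True)
  finally show "0 \<le> Re (\<rho> i i)" .
  show "\<rho> i i = of_real (Re (\<rho> i i))"
    using hermitian_onD[OF psd_on_hermitian[OF assms(2)] assms(3,3)] by (simp add: complex_eq_iff)
qed

text \<open>The quantity is H(J|E) - H(J|IE) for the measured keys. The second term is small by
  correlation. For the first, the coherent state \<open>R\<close> gives H(JE) \<ge> H(J) + H(IJE) -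
  H(IJ) and H(E) \<le> H(IJE) + H(IJ); the large entropy H(IJE) cancels, and H(IJ) is small because
  the key is almost pure.\<close>

theorem key_cond_mutual_info_ge:
  fixes R :: "('i \<times> 'i) \<times> 'e \<Rightarrow> ('i \<times> 'i) \<times> 'e \<Rightarrow> complex"
  assumes fin[simp]: "finite I" "finite E" and N: "real (card I) = N" "1 \<le> N"
    and R: "psd_on ((I \<times> I) \<times> E) R" "(\<Sum>x\<in>(I \<times> I) \<times> E. R x x) = 1"
    and \<epsilon>: "0 \<le> \<epsilon>"
  defines "p \<equiv> \<lambda>i j. \<Sum>e\<in>E. R ((i, j), e) ((i, j), e)"
  assumes off: "Re (\<Sum>i\<in>I. \<Sum>j\<in>I - {i}. p i j) \<le> \<epsilon>"
    and flat: "\<And>T. T \<subseteq> I \<Longrightarrow> Re (\<Sum>j\<in>T. \<Sum>i\<in>I. p i j) \<le> real (card T) / N + \<epsilon>"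
    and fid: "1 - \<epsilon> \<le> Re (\<Sum>i\<in>I. \<Sum>j\<in>I. \<Sum>e\<in>E. R ((i, i), e) ((j, j), e)) / N"
  defines "\<Theta> \<equiv> \<lambda>i j e e'. R ((i, j), e) ((i, j), e')"
  shows "(1 - 7 * \<epsilon>) * log 2 N - 4 \<le>
    (\<Sum>i\<in>I. ent E (\<lambda>x y. \<Sum>j\<in>I. \<Theta> i j x y)) + (\<Sum>j\<in>I. ent E (\<lambda>x y. \<Sum>i\<in>I. \<Theta> i j x y))
      - (\<Sum>i\<in>I. \<Sum>j\<in>I. ent E (\<Theta> i j)) - ent E (\<lambda>x y. \<Sum>i\<in>I. \<Sum>j\<in>I. \<Theta> i j x y)"
proof -
  have ne: "I \<noteq> {}" "E \<noteq> {}" using R(2) by auto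
  define P where "P = (\<lambda>i j. if i \<in> I \<and> j \<in> I then Re (p i j) else 0)"
  have pP: "p i j = of_real (P i j)" "0 \<le> P i j" if "i \<in> I" "j \<in> I" for i j
  proof -
    have "R ((i, j), e) ((i, j), e) = of_real (Re (R ((i, j), e) ((i, j), e)))" "0 \<le> Re (R ((i, j), e) ((i, j), e))" if "e \<in> E" for e
      using psd_on_diag_nonneg[OF _ R(1)] \<open>i \<in> I\<close> \<open>j \<in> I\<close> that by auto
    then have "p i j = of_real (\<Sum>e\<in>E. Re (R ((i, j), e) ((i, j), e)))" "0 \<le> (\<Sum>e\<in>E. Re (R ((i, j), e) ((i, j), e)))"
      unfolding p_def by (simp_all add: sum_nonneg)
    then show "p i j = of_real (P i j)" "0 \<le> P i j" using that by (simp_all add: P_def)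
  qed
  have P0: "0 \<le> P i j" for i j using pP(2)[of i j] by (cases "i \<in> I \<and> j \<in> I") (auto simp: P_def)
  have sp: "(\<Sum>i\<in>I. \<Sum>j\<in>I. p i j) = 1"
    using R(2) unfolding p_def by (simp only: sum.cartesian_product')
  then have "complex_of_real (\<Sum>i\<in>I. \<Sum>j\<in>I. P i j) = 1" by (simp add: pP(1) cong: sum.cong)
  then have sP: "(\<Sum>i\<in>I. \<Sum>j\<in>I. P i j) = 1" by (metis of_real_eq_1_iff)
  have \<Theta>: "psd_on E (\<Theta> i j)" if "i \<in> I" "j \<in> I" for i j
    unfolding \<Theta>_def by (rule psd_on_map[OF _ R(1), of "\<lambda>e. ((i, j), e)"]) (use that in auto)
  have tr\<Theta>: "(\<Sum>e\<in>E. \<Theta> i j e e) = p i j" for i j by (simp add: \<Theta>_def p_def)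
  \<comment> \<open>conditioning on the key of Alice alone instead of on it and E\<close>
  have a: "(\<Sum>i\<in>I. (\<Sum>j\<in>I. ent E (\<Theta> i j)) - ent E (\<lambda>x y. \<Sum>j\<in>I. \<Theta> i j x y)) \<le> 1 + \<epsilon> * log 2 N"
  proof -
    have "(\<Sum>j\<in>I. ent E (\<Theta> i j)) - ent E (\<lambda>x y. \<Sum>j\<in>I. \<Theta> i j x y) \<le>
       (\<Sum>j\<in>I. entropy_fun (P i j)) - entropy_fun (\<Sum>j\<in>I. P i j)" if i: "i \<in> I" for i
    proof -
      \<comment> \<open>The one-point system is what is left of \<open>E\<close> after it is
        measured and the outcome forgotten; this turns \<open>ent_measure_ensemble\<close> into
        H(J|IE) \<le> H(J|I), here for a fixed \<open>i\<close>.\<close>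
      have b: "bij_betw fst (E \<times> {()}) E" by (auto simp: bij_betw_def inj_on_def image_def)
      have psd: "psd_on (E \<times> {()}) (\<lambda>x y. \<Theta> i j (fst x) (fst y))" if "j \<in> I" for j
        by (rule psd_on_map[OF _ \<Theta>[OF i that]]) auto
      have iso: "isometric E E (\<lambda>l b. of_bool (l = b))"
        unfolding isometric_def by (simp only: cnj_of_bool sum_of_bool_mult fin if_True) auto
      have meas: "(\<Sum>l | l \<in> E \<and> () = u. \<Sum>b\<in>E. \<Sum>b'\<in>E. of_bool (l = b) * \<Theta> i j (fst (b, e)) (fst (b', e')) * cnj (of_bool (l = b')))
         = of_real (P i j)" if "j \<in> I" for j and e e' u :: unit
      proof -
        have "{l. l \<in> E \<and> () = u} = E" by auto
        then have "(\<Sum>l | l \<in> E \<and> () = u. \<Sum>b\<in>E. \<Sum>b'\<in>E. of_bool (l = b) * \<Theta> i j (fst (b, e)) (fst (b', e')) * cnj (of_bool (l = b')))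
          = (\<Sum>l\<in>E. \<Theta> i j l l)"
          by (simp only: cnj_of_bool fst_conv mult.assoc sum_distrib_left[symmetric] sum_of_bool_mult fin if_True cong: sum.cong)
        then show ?thesis using tr\<Theta> pP(1)[OF i that] by simp
      qed
      have flat1: "ent (E \<times> {()}) (\<lambda>x y. f (fst x) (fst y)) = ent E f" for f
        using ent_reindex[OF b, of f] by simp
      have unit1: "ent {()} (\<lambda>e e'. of_real c) = entropy_fun c" for c
        by (rule ent_unit[of _ "()"]) auto
      have "(\<Sum>j\<in>I. ent (E \<times> {()}) (\<lambda>x y. \<Theta> i j (fst x) (fst y))) - ent (E \<times> {()}) (\<lambda>x y. \<Sum>j\<in>I. \<Theta> i j (fst x) (fst y)) \<le>
         (\<Sum>u\<in>{()}. (\<Sum>j\<in>I. ent {()} (\<lambda>e e'. \<Sum>l | l \<in> E \<and> () = u. \<Sum>b\<in>E. \<Sum>b'\<in>E. of_bool (l = b) * \<Theta> i j (fst (b, e)) (fst (b', e')) * cnj (of_bool (l = b'))))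
           - ent {()} (\<lambda>e e'. \<Sum>j\<in>I. \<Sum>l | l \<in> E \<and> () = u. \<Sum>b\<in>E. \<Sum>b'\<in>E. of_bool (l = b) * \<Theta> i j (fst (b, e)) (fst (b', e')) * cnj (of_bool (l = b'))))"
        by (rule ent_measure_ensemble[OF _ _ _ _ _ ne(2) psd iso]) auto
      also have "\<dots> = (\<Sum>u\<in>{()}. (\<Sum>j\<in>I. entropy_fun (P i j)) - entropy_fun (\<Sum>j\<in>I. P i j))"
        by (simp only: meas of_real_sum[symmetric] unit1 cong: sum.cong)
      finally show ?thesis
        unfolding flat1 flat1[of "\<lambda>x y. \<Sum>j\<in>I. \<Theta> i j x y"] by simp
    qed
    then have "(\<Sum>i\<in>I. (\<Sum>j\<in>I. ent E (\<Theta> i j)) - ent E (\<lambda>x y. \<Sum>j\<in>I. \<Theta> i j x y)) \<le>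
       (\<Sum>i\<in>I. (\<Sum>j\<in>I. entropy_fun (P i j)) - entropy_fun (\<Sum>j\<in>I. P i j))"
      by (rule sum_mono)
    also have "\<dots> \<le> 1 + \<epsilon> * log 2 N"
    proof (rule conditional_entropy_correlated[OF fin(1) N P0 sP])
      have "complex_of_real (\<Sum>i\<in>I. \<Sum>j\<in>I - {i}. P i j) = (\<Sum>i\<in>I. \<Sum>j\<in>I - {i}. p i j)"
        unfolding of_real_sum by (intro sum.cong refl) (simp add: pP)
      then show "(\<Sum>i\<in>I. \<Sum>j\<in>I - {i}. P i j) \<le> \<epsilon>" using off by (metis Re_complex_of_real)
    qed
    finally show ?thesis .
  qed
  define RI where "RI = ptrace E R"
  define RE where "RE = (\<lambda>e e'. \<Sum>x\<in>I\<times>I. R (x, e) (x, e'))"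
  have RE: "RE = (\<lambda>x y. \<Sum>i\<in>I. \<Sum>j\<in>I. \<Theta> i j x y)"
    by (simp add: RE_def \<Theta>_def sum.cartesian_product' fun_eq_iff)
  have AL: "ent E RE \<le> ent ((I \<times> I) \<times> E) R + ent (I \<times> I) RI"
    unfolding RE_def RI_def by (rule araki_lieb[OF _ _ R]) auto
  \<comment> \<open>measuring the key of Bob on both key systems\<close>
  define Q where "Q = (\<lambda>j. \<Sum>i\<in>I. P i j)"
  have b: "ent ((I \<times> I) \<times> E) R - ent (I \<times> I) RI \<le> (\<Sum>j\<in>I. ent E (\<lambda>x y. \<Sum>i\<in>I. \<Theta> i j x y) - entropy_fun (Q j))"
  proof -
    let ?f = "\<lambda>x :: ('e \<times> unit) \<times> ('i \<times> 'i). (snd x, fst (fst x))"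
    have f: "bij_betw ?f ((E \<times> {()}) \<times> (I \<times> I)) ((I \<times> I) \<times> E)"
      by (rule bij_betw_byWitness[where f'="\<lambda>x. ((snd x, ()), fst x)"]) auto
    have g: "bij_betw fst (E \<times> {()}) E" by (auto simp: bij_betw_def inj_on_def image_def)
    have h: "bij_betw snd ({()} \<times> (I \<times> I)) (I \<times> I)" by (auto simp: bij_betw_def inj_on_def image_def)
    have psd: "psd_on ((E \<times> {()}) \<times> (I \<times> I)) (\<lambda>x y. R (?f x) (?f y))"
      by (rule psd_on_map[OF _ R(1)]) auto
    have iso: "isometric (I \<times> I) (I \<times> I) (\<lambda>l y. of_bool (l = y))"
      unfolding isometric_def by (simp only: cnj_of_bool sum_of_bool_mult fin finite_cartesian_product if_True) auto
    have meas: "(\<Sum>l | l \<in> I \<times> I \<and> snd l = j. \<Sum>y\<in>I\<times>I. \<Sum>y'\<in>I\<times>I. of_bool (l = y) * R (?f (z, y)) (?f (z', y')) * cnj (of_bool (l = y')))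
      = (\<Sum>i\<in>I. \<Theta> i j (fst z) (fst z'))" if "j \<in> I" for j z z'
    proof -
      have "(\<Sum>l | l \<in> I \<times> I \<and> snd l = j. \<Sum>y\<in>I\<times>I. \<Sum>y'\<in>I\<times>I. of_bool (l = y) * R (?f (z, y)) (?f (z', y')) * cnj (of_bool (l = y')))
        = (\<Sum>l | l \<in> I \<times> I \<and> snd l = j. R (l, fst z) (l, fst z'))"
        by (intro sum.cong refl)
          (simp only: mem_Collect_eq cnj_of_bool fst_conv snd_conv mult.assoc sum_distrib_left[symmetric]
            sum_of_bool_mult fin finite_cartesian_product if_True)
      also have "\<dots> = (\<Sum>i\<in>I. R ((i, j), fst z) ((i, j), fst z'))"
        by (rule sum.reindex_bij_witness[where i="\<lambda>i. (i, j)" and j=fst]) (use that in auto)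
      finally show ?thesis by (simp add: \<Theta>_def)
    qed
    have e1: "ent ((E \<times> {()}) \<times> (I \<times> I)) (\<lambda>x y. R (?f x) (?f y)) = ent ((I \<times> I) \<times> E) R"
      by (rule ent_reindex[OF f]) simp
    have e2: "ent ({()} \<times> (I \<times> I)) (\<lambda>x y. \<Sum>a\<in>E. R (?f ((a, fst x), snd x)) (?f ((a, fst y), snd y))) = ent (I \<times> I) RI"
      using ent_reindex[OF h, of RI] by (simp add: RI_def ptrace_def)
    have e3: "ent (E \<times> {()}) (\<lambda>z z'. \<Sum>i\<in>I. \<Theta> i j (fst z) (fst z')) = ent E (\<lambda>x y. \<Sum>i\<in>I. \<Theta> i j x y)" for j
      using ent_reindex[OF g, of "\<lambda>x y. \<Sum>i\<in>I. \<Theta> i j x y"] by simp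
    have e4: "ent {()} (\<lambda>e e'. \<Sum>a\<in>E. \<Sum>i\<in>I. \<Theta> i j (fst (a, e)) (fst (a, e'))) = entropy_fun (Q j)" if "j \<in> I" for j
    proof -
      have "(\<Sum>a\<in>E. \<Sum>i\<in>I. \<Theta> i j a a) = of_real (Q j)"
        by (subst sum.swap) (simp add: tr\<Theta> Q_def pP that cong: sum.cong)
      then show ?thesis using ent_unit[of "{()}" "()" "Q j"] by simp
    qed
    \<comment> \<open>H(E|IJ) \<le> H(E|J): the environment is the unmeasured system, the condition
      is trivial, and of the measured pair only the second key is kept.\<close>
    have "ent ((I \<times> I) \<times> E) R - ent (I \<times> I) RI \<le>
      (\<Sum>j\<in>I. ent (E \<times> {()}) (\<lambda>z z'. \<Sum>l | l \<in> I \<times> I \<and> snd l = j. \<Sum>y\<in>I\<times>I. \<Sum>y'\<in>I\<times>I. of_bool (l = y) * R (?f (z, y)) (?f (z', y')) * cnj (of_bool (l = y')))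
        - ent {()} (\<lambda>e e'. \<Sum>a\<in>E. \<Sum>l | l \<in> I \<times> I \<and> snd l = j. \<Sum>y\<in>I\<times>I. \<Sum>y'\<in>I\<times>I. of_bool (l = y) * R (?f ((a, e), y)) (?f ((a, e'), y')) * cnj (of_bool (l = y'))))"
      using ent_measure_le[where lab=snd and O'=I, OF _ _ _ _ _ _ psd iso] ne unfolding e1 e2 by auto
    also have "\<dots> = (\<Sum>j\<in>I. ent E (\<lambda>x y. \<Sum>i\<in>I. \<Theta> i j x y) - entropy_fun (Q j))"
      by (intro sum.cong refl) (simp only: meas e3 e4)
    finally show ?thesis .
  qed
  have c: "ent (I \<times> I) RI \<le> 1 + 2 * \<epsilon> * log 2 N"
  proof (rule ent_le_fidelity)
    show "psd_on (I \<times> I) RI" unfolding RI_def by (rule psd_on_ptrace[OF _ _ R(1)]) auto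
    show "(\<Sum>x\<in>I \<times> I. RI x x) = 1" using R(2) by (simp add: RI_def ptrace_def sum.cartesian_product'[of _ "I \<times> I" E])
    \<comment> \<open>The maximally entangled vector of the two keys, whose expectation in
      \<open>RI\<close> is what \<open>fid\<close> bounds.\<close>
    let ?\<phi> = "\<lambda>x :: 'i \<times> 'i. complex_of_real (of_bool (fst x = snd x) / sqrt N)"
    show "(\<Sum>x\<in>I \<times> I. (cmod (?\<phi> x))\<^sup>2) = 1"
    proof -
      have "(\<Sum>x\<in>I \<times> I. (cmod (?\<phi> x))\<^sup>2) = (\<Sum>i\<in>I. \<Sum>j\<in>I. of_bool (i = j) * (1 / N))"
        using N by (auto simp: sum.cartesian_product' norm_divide power_divide intro!: sum.cong)
      also have "\<dots> = 1" using N by (simp only: sum_of_bool_mult fin if_True) simp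
      finally show ?thesis .
    qed
    have "(\<Sum>x\<in>I \<times> I. \<Sum>y\<in>I \<times> I. cnj (?\<phi> x) * RI x y * ?\<phi> y) =
       (\<Sum>i\<in>I. \<Sum>i'\<in>I. of_bool (i = i') * (\<Sum>j\<in>I. \<Sum>j'\<in>I. of_bool (j = j') * (RI (i, i') (j, j') / N)))"
    proof -
      have "complex_of_real (sqrt N) * complex_of_real (sqrt N) = of_real N"
        using N by (metis of_real_mult real_sqrt_mult_self abs_of_nonneg order_trans zero_le_one)
      then have "cnj (?\<phi> x) * z * ?\<phi> y = of_bool (fst x = snd x) * (of_bool (fst y = snd y) * (z / N))" for x y z
        by (auto simp: of_bool_def)
      then show ?thesis by (simp only: sum.cartesian_product' sum_distrib_left fst_conv snd_conv)
    qed
    also have "\<dots> = (\<Sum>i\<in>I. \<Sum>j\<in>I. RI (i, i) (j, j)) / N"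
      by (simp only: sum_of_bool_mult fin if_True sum_divide_distrib cong: sum.cong)
    finally have "Re (\<Sum>x\<in>I \<times> I. \<Sum>y\<in>I \<times> I. cnj (?\<phi> x) * RI x y * ?\<phi> y) =
      Re (\<Sum>i\<in>I. \<Sum>j\<in>I. \<Sum>e\<in>E. R ((i, i), e) ((j, j), e)) / N"
      by (simp add: RI_def ptrace_def)
    then show "1 - \<epsilon> \<le> Re (\<Sum>x\<in>I \<times> I. \<Sum>y\<in>I \<times> I. cnj (?\<phi> x) * RI x y * ?\<phi> y)" using fid by simp
    show "real (card (I \<times> I)) \<le> N\<^sup>2" using N by (simp add: card_cartesian_product power2_eq_square)
  qed (use N in auto)
  have d: "(1 - 2 * \<epsilon>) * log 2 N - 1 \<le> (\<Sum>j\<in>I. entropy_fun (Q j))"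
  proof (rule entropy_sum_ge_flat)
    show "0 \<le> Q j" for j unfolding Q_def by (simp add: sum_nonneg P0)
    show "(\<Sum>j\<in>I. Q j) = 1" unfolding Q_def using sP by (subst sum.swap) simp
    fix T assume T: "T \<subseteq> I"
    have "complex_of_real (\<Sum>j\<in>T. Q j) = (\<Sum>j\<in>T. \<Sum>i\<in>I. p i j)"
      unfolding Q_def of_real_sum using T by (intro sum.cong refl) (auto simp: pP)
    then show "(\<Sum>j\<in>T. Q j) \<le> real (card T) / N + \<epsilon>" using flat[OF T] by (metis Re_complex_of_real)
  qed (use N in auto)
  \<comment> \<open>The entropy of \<open>RI\<close> is lost twice, through \<open>b\<close> and
    through \<open>AL\<close>. Adding \<open>a\<close>, twice \<open>c\<close>, and \<open>d\<close>
    gives 7 = 1 + 4 + 2 and 4 = 1 + 2 + 1.\<close>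
  have "0 \<le> log 2 N" using N by simp
  then show ?thesis
    using a b c d AL unfolding RE sum_subtractf by (simp add: algebra_simps)
qed

section \<open>Matrices on composite systems\<close>

lemma bij_betw_mixed_radix:
  "bij_betw (\<lambda>x. fst x * d + snd x) ({..<n} \<times> {..<d}) {..<n * d :: nat}"
proof (rule bij_betw_byWitness[where f'="\<lambda>i. (i div d, i mod d)"])
  show "(\<lambda>x. fst x * d + snd x) ` ({..<n} \<times> {..<d}) \<subseteq> {..<n * d}"
  proof
    fix y assume "y \<in> (\<lambda>x. fst x * d + snd x) ` ({..<n} \<times> {..<d})"
    then obtain a b where "a < n" "b < d" "y = a * d + b" by auto
    moreover from this have "a * d + b < Suc a * d" by simp
    moreover have "Suc a * d \<le> n * d" using \<open>a < n\<close> by (intro mult_le_mono1) simp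
    ultimately show "y \<in> {..<n * d}" by simp
  qed
  show "(\<lambda>i. (i div d, i mod d)) ` {..<n * d} \<subseteq> {..<n} \<times> {..<d}"
    by (auto simp: less_mult_imp_div_less intro!: mod_less_divisor) (metis gr0I less_nat_zero_code mult_0_right)
qed auto

lemma mixed_radix_less: "a < n \<Longrightarrow> b < d \<Longrightarrow> a * d + b < n * (d :: nat)"
  using bij_betwE[OF bij_betw_mixed_radix[of d n]] by force

lemma sum_mixed_radix:
  "(\<Sum>i<n * d. f i) = (\<Sum>a<n. \<Sum>b<d :: nat. f (a * d + b))"
  using sum.reindex_bij_betw[OF bij_betw_mixed_radix[of d n], of f] by (simp add: sum.cartesian_product')

definition valid_index :: "nat list \<Rightarrow> nat list \<Rightarrow> bool" where
  "valid_index ds xs \<longleftrightarrow> list_all2 (<) xs ds"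

lemma valid_index_Nil [simp]: "valid_index [] xs \<longleftrightarrow> xs = []"
  by (simp add: valid_index_def)

lemma valid_index_Cons [simp]: "valid_index (d # ds) (x # xs) \<longleftrightarrow> x < d \<and> valid_index ds xs"
  by (simp add: valid_index_def)

lemma valid_index_append:
  "length xs = length ds \<Longrightarrow> valid_index (ds @ es) (xs @ ys) \<longleftrightarrow> valid_index ds xs \<and> valid_index es ys"
  by (simp add: valid_index_def list_all2_append)

lemma index_enc_less: "valid_index ds xs \<Longrightarrow> index_enc ds xs < prod_list ds"
proof (induction ds xs rule: index_enc.induct)
  case (1 d ds x xs)
  then show ?case by (simp add: mixed_radix_less)
qed (auto simp: valid_index_def)

lemma index_dec_enc [simp]: "valid_index ds xs \<Longrightarrow> index_dec ds (index_enc ds xs) = xs"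
proof (induction ds xs rule: index_enc.induct)
  case (1 d ds x xs)
  then have "index_enc ds xs < prod_list ds" using index_enc_less[of ds xs] by simp
  moreover from this have "prod_list ds \<noteq> 0" by linarith
  ultimately show ?case using 1 by simp
qed (auto simp: valid_index_def)

lemma index_enc_append:
  "length xs = length ds \<Longrightarrow> index_enc (ds @ es) (xs @ ys) = index_enc ds xs * prod_list es + index_enc es ys"
proof (induction ds arbitrary: xs)
  case (Cons d ds)
  then obtain x xs' where "xs = x # xs'" by (cases xs) auto
  with Cons show ?case by (simp add: algebra_simps)
qed simp

lemma valid_index_dec: "i < prod_list ds \<Longrightarrow> valid_index ds (index_dec ds i) \<and> index_enc ds (index_dec ds i) = i"
proof (induction ds arbitrary: i)
  case (Cons d ds)
  then have "prod_list ds \<noteq> 0" by (metis mult_0_right not_less0 prod_list.Cons)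
  then have "prod_list ds > 0" by linarith
  with Cons show ?case by (auto simp: less_mult_imp_div_less)
qed simp

lemma permute_systems_index:
  assumes "valid_index (map ((!) ds) p) ys" "valid_index (map ((!) ds) p) ys'"
    and "prod_list (map ((!) ds) p) = prod_list ds"
  shows "permute_systems ds p M $$ (index_enc (map ((!) ds) p) ys, index_enc (map ((!) ds) p) ys') =
    M $$ (index_enc ds (map (\<lambda>l. the (map_of (zip p ys) l)) [0..<length ds]),
          index_enc ds (map (\<lambda>l. the (map_of (zip p ys') l)) [0..<length ds]))"
  using index_enc_less[OF assms(1)] index_enc_less[OF assms(2)] assms
  by (simp add: permute_systems_def Let_def)

lemma permute_systems_carrier [simp]: "permute_systems ds p M \<in> carrier_mat (prod_list ds) (prod_list ds)"
  by (simp add: permute_systems_def Let_def)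

lemma upt_3: "[0..<3] = [0, 1, 2 :: nat]" and upt_4: "[0..<4] = [0, 1, 2, 3 :: nat]"
  by (auto simp: upt_rec)

lemma marginal_02:
  assumes "a < dA" "e < dE" "a' < dA" "e' < dE"
  shows "marginal [dA, dB, dE] [0, 2] M $$ (a * dE + e, a' * dE + e') =
    (\<Sum>b<dB. M $$ (a * (dB * dE) + (b * dE + e), a' * (dB * dE) + (b * dE + e')))"
proof -
  have "permute_systems [dA, dB, dE] [0, 2, 1] M $$ ((a * dE + e) * dB + b, (a' * dE + e') * dB + b) =
     M $$ (a * (dB * dE) + (b * dE + e), a' * (dB * dE) + (b * dE + e'))" if "b < dB" for b
    using permute_systems_index[of "[dA, dB, dE]" "[0, 2, 1]" "[a, e, b]" "[a', e', b]" M] assms that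
    by (simp add: numeral_2_eq_2 algebra_simps)
  then show ?thesis
    using assms mixed_radix_less[of a dA e dE] mixed_radix_less[of a' dA e' dE]
    by (simp add: marginal_def trace_snd_def upt_3 Let_def numeral_3_eq_3 numeral_2_eq_2)
qed

lemma marginal_12:
  assumes "b < dB" "e < dE" "b' < dB" "e' < dE"
  shows "marginal [dA, dB, dE] [1, 2] M $$ (b * dE + e, b' * dE + e') =
    (\<Sum>a<dA. M $$ (a * (dB * dE) + (b * dE + e), a * (dB * dE) + (b' * dE + e')))"
proof -
  have "permute_systems [dA, dB, dE] [1, 2, 0] M $$ ((b * dE + e) * dA + a, (b' * dE + e') * dA + a) =
     M $$ (a * (dB * dE) + (b * dE + e), a * (dB * dE) + (b' * dE + e'))" if "a < dA" for a
    using permute_systems_index[of "[dA, dB, dE]" "[1, 2, 0]" "[b, e, a]" "[b', e', a]" M] assms that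
    by (simp add: numeral_2_eq_2 algebra_simps)
  then show ?thesis
    using assms mixed_radix_less[of b dB e dE] mixed_radix_less[of b' dB e' dE]
    by (simp add: marginal_def trace_snd_def upt_3 Let_def numeral_3_eq_3 numeral_2_eq_2)
qed

lemma marginal_01:
  assumes "a < dA" "b < dB" "a' < dA" "b' < dB"
  shows "marginal [dA, dB, dE] [0, 1] M $$ (a * dB + b, a' * dB + b') =
    (\<Sum>e<dE. M $$ (a * (dB * dE) + (b * dE + e), a' * (dB * dE) + (b' * dE + e)))"
proof -
  have "permute_systems [dA, dB, dE] [0, 1, 2] M $$ ((a * dB + b) * dE + e, (a' * dB + b') * dE + e) =
     M $$ (a * (dB * dE) + (b * dE + e), a' * (dB * dE) + (b' * dE + e))" if "e < dE" for e
    using permute_systems_index[of "[dA, dB, dE]" "[0, 1, 2]" "[a, b, e]" "[a', b', e]" M] assms that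
    by (simp add: numeral_2_eq_2 algebra_simps)
  then show ?thesis
    using assms mixed_radix_less[of a dA b dB] mixed_radix_less[of a' dA b' dB]
    by (simp add: marginal_def trace_snd_def upt_3 Let_def numeral_3_eq_3 numeral_2_eq_2)
qed

lemma marginal_2:
  assumes "e < dE" "e' < dE"
  shows "marginal [dA, dB, dE] [2] M $$ (e, e') =
    (\<Sum>a<dA. \<Sum>b<dB. M $$ (a * (dB * dE) + (b * dE + e), a * (dB * dE) + (b * dE + e')))"
proof -
  have "permute_systems [dA, dB, dE] [2, 0, 1] M $$ (e * (dA * dB) + (a * dB + b), e' * (dA * dB) + (a * dB + b)) =
     M $$ (a * (dB * dE) + (b * dE + e), a * (dB * dE) + (b * dE + e'))" if "a < dA" "b < dB" for a b
    using permute_systems_index[of "[dA, dB, dE]" "[2, 0, 1]" "[e, a, b]" "[e', a, b]" M] assms that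
    by (simp add: numeral_2_eq_2 algebra_simps)
  then show ?thesis
    using assms
    by (simp add: marginal_def trace_snd_def upt_3 Let_def numeral_3_eq_3 numeral_2_eq_2 sum_mixed_radix)
qed

lemma marginal_carrier:
  "marginal [dA, dB, dE] [0, 2] M \<in> carrier_mat (dA * dE) (dA * dE)"
  "marginal [dA, dB, dE] [1, 2] M \<in> carrier_mat (dB * dE) (dB * dE)"
  "marginal [dA, dB, dE] [0, 1] M \<in> carrier_mat (dA * dB) (dA * dB)"
  "marginal [dA, dB, dE] [2] M \<in> carrier_mat dE dE"
  by (auto simp: marginal_def trace_snd_def Let_def numeral_2_eq_2)

lemma ent_mat_pair:
  assumes "M \<in> carrier_mat (n * d) (n * d)"
  shows "ent ({..<n} \<times> {..<d}) (\<lambda>x y. M $$ (fst x * d + snd x, fst y * d + snd y)) = vn_entropy M"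
  using ent_reindex[OF bij_betw_mixed_radix[of d n], of "\<lambda>i j. M $$ (i, j)"] ent_mat[OF assms] by simp

section \<open>From matrices to kernels: positivity, Kraus sums and Kronecker products\<close>

lemma psd_imp_psd_on:
  assumes "psd n M"
  shows "psd_on {..<n} (\<lambda>i j. M $$ (i, j))"
  unfolding psd_on_def
proof (intro conjI allI)
  have M: "M \<in> carrier_mat n n" "mat_adjoint M = M" using assms by (auto simp: psd_def)
  show "hermitian_on {..<n} (\<lambda>i j. M $$ (i, j))"
    unfolding hermitian_on_def
  proof (intro ballI)
    fix i j assume "i \<in> {..<n}" "j \<in> {..<n}"
    then have "mat_adjoint M $$ (j, i) = conjugate (M $$ (i, j))" using M(1) by simp
    then show "M $$ (j, i) = cnj (M $$ (i, j))" by (simp add: M(2))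
  qed
  fix v :: "nat \<Rightarrow> complex"
  have "(\<Sum>i<n. \<Sum>j<n. cnj (v i) * M $$ (i, j) * v j) = (M *\<^sub>v vec n v) \<bullet>c vec n v"
    using M(1) by (simp add: scalar_prod_def atLeast0LessThan sum_distrib_left sum_distrib_right mult_ac)
  moreover have "0 \<le> Re ((M *\<^sub>v vec n v) \<bullet>c vec n v)" using assms by (auto simp: psd_def)
  ultimately show "0 \<le> Re (\<Sum>i<n. \<Sum>j<n. cnj (v i) * M $$ (i, j) * v j)" by simp
qed

lemma mat_sum_carrier: "(\<And>M. M \<in> set Ms \<Longrightarrow> M \<in> carrier_mat n n) \<Longrightarrow> mat_sum n Ms \<in> carrier_mat n n"
  by (induction Ms) (auto simp: mat_sum_def)

lemma mat_sum_index:
  "(\<And>M. M \<in> set Ms \<Longrightarrow> M \<in> carrier_mat n n) \<Longrightarrow> i < n \<Longrightarrow> j < n \<Longrightarrow>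
    mat_sum n Ms $$ (i, j) = (\<Sum>M\<leftarrow>Ms. M $$ (i, j))"
proof (induction Ms)
  case (Cons M Ms)
  then have "mat_sum n Ms \<in> carrier_mat n n" by (intro mat_sum_carrier) auto
  moreover have "mat_sum n (M # Ms) = M + mat_sum n Ms" by (simp add: mat_sum_def)
  ultimately show ?case using Cons by simp
qed (simp add: mat_sum_def)

lemma mult_adjoint_index:
  assumes "K \<in> carrier_mat e d" "X \<in> carrier_mat d d" "i < e" "j < e"
  shows "(K * X * mat_adjoint K) $$ (i, j) = (\<Sum>p<d. \<Sum>q<d. K $$ (i, p) * X $$ (p, q) * cnj (K $$ (j, q)))"
proof -
  have "(K * X * mat_adjoint K) $$ (i, j) = (\<Sum>q<d. (\<Sum>p<d. K $$ (i, p) * X $$ (p, q)) * cnj (K $$ (j, q)))"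
    using assms by (simp add: scalar_prod_def atLeast0LessThan)
  then show ?thesis unfolding sum_distrib_right by (subst sum.swap)
qed

lemma kron_index:
  assumes "i < dim_row A" "j < dim_col A" "k < dim_row B" "l < dim_col B"
  shows "(A \<otimes>\<^sub>m B) $$ (i * dim_row B + k, j * dim_col B + l) = A $$ (i, j) * B $$ (k, l)"
  using assms by (simp add: kron_def mixed_radix_less)

lemma kron_dim [simp]: "dim_row (A \<otimes>\<^sub>m B) = dim_row A * dim_row B" "dim_col (A \<otimes>\<^sub>m B) = dim_col A * dim_col B"
  by (simp_all add: kron_def)

text \<open>The stacked Kraus operators form an isometry. Its rows, labelled by Kraus index and
  output basis state, are thus the effects of a rank-one measurement on the input.\<close>

lemma channel_complete:
  assumes "is_channel d e Ks" "a < d" "a' < d"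
  shows "(\<Sum>x<length Ks. \<Sum>\<alpha><e. cnj (Ks ! x $$ (\<alpha>, a)) * Ks ! x $$ (\<alpha>, a')) = of_bool (a = a')"
proof -
  have Ks: "K \<in> carrier_mat e d" if "K \<in> set Ks" for K using assms(1) that by (simp add: is_channel_def)
  have "of_bool (a = a') = mat_sum d (map (\<lambda>K. mat_adjoint K * K) Ks) $$ (a, a')"
    using assms by (simp add: is_channel_def)
  also have "\<dots> = (\<Sum>K\<leftarrow>Ks. (mat_adjoint K * K) $$ (a, a'))"
    using Ks assms by (subst mat_sum_index) (auto simp: o_def carrier_matD(2)[OF Ks] intro!: carrier_matI)
  also have "\<dots> = (\<Sum>K\<leftarrow>Ks. \<Sum>\<alpha><e. cnj (K $$ (\<alpha>, a)) * K $$ (\<alpha>, a'))"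
  proof (intro arg_cong[of _ _ sum_list] map_cong refl)
    fix K assume "K \<in> set Ks"
    from Ks[OF this] show "(mat_adjoint K * K) $$ (a, a') = (\<Sum>\<alpha><e. cnj (K $$ (\<alpha>, a)) * K $$ (\<alpha>, a'))"
      using assms by (simp add: scalar_prod_def atLeast0LessThan)
  qed
  also have "\<dots> = (\<Sum>x<length Ks. \<Sum>\<alpha><e. cnj (Ks ! x $$ (\<alpha>, a)) * Ks ! x $$ (\<alpha>, a'))"
    by (simp add: sum_list_sum_nth atLeast0LessThan)
  finally show ?thesis by simp
qed

lemma bessel:
  assumes "finite I" "finite U" "isometric I U w"
  shows "(\<Sum>u\<in>U. (cmod (\<Sum>i\<in>I. cnj (w i u) * v i))\<^sup>2) \<le> (\<Sum>i\<in>I. (cmod (v i))\<^sup>2)"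
proof -
  define c where "c = (\<lambda>u. \<Sum>i\<in>I. cnj (w i u) * v i)"
  \<comment> \<open>The orthogonal projection of \<open>v\<close> onto the span of the columns; the
    claim is the nonnegativity of the squared distance.\<close>
  define y where "y = (\<lambda>i. \<Sum>u\<in>U. w i u * c u)"
  have sq: "complex_of_real (\<Sum>i\<in>J. (cmod (f i))\<^sup>2) = (\<Sum>i\<in>J. cnj (f i) * f i)" for J :: "'x set" and f
    unfolding of_real_sum complex_norm_square by (simp only: mult.commute)
  have yy: "(\<Sum>i\<in>I. cnj (y i) * y i) = (\<Sum>u\<in>U. cnj (c u) * c u)"
  proof -
    have "(\<Sum>i\<in>I. cnj (y i) * y i) = (\<Sum>i\<in>I. (\<Sum>u\<in>U. cnj (w i u) * cnj (c u)) * (\<Sum>u\<in>U. w i u * c u))"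
      by (simp add: y_def)
    also have "\<dots> = (\<Sum>u\<in>U. \<Sum>u'\<in>U. (\<Sum>i\<in>I. cnj (w i u) * w i u') * (cnj (c u) * c u'))"
      by (rule sum_product_swap)
    also have "\<dots> = (\<Sum>u\<in>U. \<Sum>u'\<in>U. of_bool (u = u') * (cnj (c u) * c u'))"
      using assms(3) unfolding isometric_def by (intro sum.cong refl arg_cong2[of _ _ _ _ "(*)"]) auto
    finally show ?thesis using assms(2) by (simp only: sum_of_bool_mult if_True cong: sum.cong)
  qed
  have yv: "(\<Sum>i\<in>I. cnj (y i) * v i) = (\<Sum>u\<in>U. cnj (c u) * c u)"
  proof -
    have "(\<Sum>i\<in>I. cnj (y i) * v i) = (\<Sum>i\<in>I. \<Sum>u\<in>U. cnj (c u) * (cnj (w i u) * v i))"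
      by (simp add: y_def sum_distrib_right sum_distrib_left mult_ac)
    also have "\<dots> = (\<Sum>u\<in>U. cnj (c u) * (\<Sum>i\<in>I. cnj (w i u) * v i))"
      by (subst sum.swap) (simp only: sum_distrib_left)
    finally show ?thesis by (simp only: c_def)
  qed
  have vy: "(\<Sum>i\<in>I. cnj (v i) * y i) = (\<Sum>u\<in>U. cnj (c u) * c u)"
    using arg_cong[OF yv, of cnj] by (simp add: mult.commute)
  have "0 \<le> (\<Sum>i\<in>I. (cmod (v i - y i))\<^sup>2)" by (simp add: sum_nonneg)
  also have "(\<Sum>i\<in>I. (cmod (v i - y i))\<^sup>2) = (\<Sum>i\<in>I. (cmod (v i))\<^sup>2) - (\<Sum>u\<in>U. (cmod (c u))\<^sup>2)"
  proof -
    have "complex_of_real (\<Sum>i\<in>I. (cmod (v i - y i))\<^sup>2) =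
      (\<Sum>i\<in>I. cnj (v i) * v i) - (\<Sum>i\<in>I. cnj (v i) * y i) - (\<Sum>i\<in>I. cnj (y i) * v i) + (\<Sum>i\<in>I. cnj (y i) * y i)"
      unfolding sq by (simp add: sum_subtractf[symmetric] sum.distrib[symmetric] algebra_simps del: sum_subtractf)
    also have "\<dots> = of_real ((\<Sum>i\<in>I. (cmod (v i))\<^sup>2) - (\<Sum>u\<in>U. (cmod (c u))\<^sup>2))"
      unfolding yy yv vy of_real_diff sq by simp
    finally show ?thesis by (simp only: of_real_eq_iff)
  qed
  finally show ?thesis by (simp add: c_def)
qed

text \<open>The columns of \<open>w\<close> span the range of a projection, whose expectation in
  \<open>D\<close> is bounded by the trace norm: in an eigenbasis of \<open>D\<close> the projection
  has diagonal entries between 0 and 1, by Bessel's inequality.\<close>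

lemma trace_norm_ge:
  assumes D: "D \<in> carrier_mat n n" "hermitian_on {..<n} (\<lambda>i j. D $$ (i, j))"
    and U: "finite U" and w: "isometric {..<n} U w"
  shows "\<bar>Re (\<Sum>u\<in>U. \<Sum>i<n. \<Sum>j<n. cnj (w i u) * D $$ (i, j) * w j u)\<bar> \<le> trace_norm D"
proof -
  obtain v d where v: "unitary_on {..<n} {..<n} v" "spectral_form {..<n} {..<n} (\<lambda>i j. D $$ (i, j)) v d"
    using spectral_theorem[OF _ D(2)] by auto
  have iso: "isometric {..<n} {..<n} v" using v(1) by (simp add: unitary_on_def)
  have "trace_norm D = (\<Sum>k<n. sqrt ((d k)\<^sup>2))"
  proof -
    have "mat_adjoint D * D = mat n n (\<lambda>(i, j). \<Sum>k<n. of_real ((d k)\<^sup>2) * v i k * cnj (v j k))"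
    proof (intro eq_matI, goal_cases)
      case (1 i j)
      then have ij: "i < n" "j < n" by auto
      have "(mat_adjoint D * D) $$ (i, j) = (\<Sum>k<n. D $$ (i, k) * D $$ (k, j))"
        using D(1) ij hermitian_onD[OF D(2)] by (simp add: scalar_prod_def atLeast0LessThan)
      also have "\<dots> = (\<Sum>k<n. (\<Sum>l<n. cnj (v k l) * (of_real (d l) * v i l)) * D $$ (k, j))"
        using v(2) ij unfolding spectral_form_def by (intro sum.cong refl) (auto simp: mult_ac)
      also have "\<dots> = (\<Sum>l<n. (of_real (d l) * v i l) * (\<Sum>k<n. cnj (v k l) * D $$ (k, j)))"
        unfolding sum_distrib_left sum_distrib_right by (subst sum.swap) (simp only: mult_ac)
      also have "\<dots> = (\<Sum>l<n. (of_real (d l) * v i l) * (of_real (d l) * cnj (v j l)))"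
        using ij by (intro sum.cong refl) (simp add: spectral_left_eigenvector[OF _ iso v(2)])
      finally show ?case using ij by (simp add: power2_eq_square mult_ac)
    qed (use D in auto)
    from spectral_sum_isometric[OF iso this, of sqrt] show ?thesis
      by (simp add: trace_norm_def spectral_sum_def)
  qed
  then have tn: "trace_norm D = (\<Sum>k<n. \<bar>d k\<bar>)" by simp
  define c where "c = (\<lambda>k. \<Sum>u\<in>U. (cmod (basis_overlap {..<n} v w k u))\<^sup>2)"
  have c1: "c k \<le> 1" if "k < n" for k
  proof -
    have "c k = (\<Sum>u\<in>U. (cmod (\<Sum>i<n. cnj (w i u) * v i k))\<^sup>2)"
      unfolding c_def basis_overlap_swap[of _ v w] by (simp add: basis_overlap_def)
    also have "\<dots> \<le> (\<Sum>i<n. (cmod (v i k))\<^sup>2)" by (rule bessel[OF _ U w]) simp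
    also have "\<dots> = 1"
    proof -
      have "complex_of_real (\<Sum>i<n. (cmod (v i k))\<^sup>2) = (\<Sum>i<n. cnj (v i k) * v i k)"
        unfolding of_real_sum complex_norm_square by (simp only: mult.commute)
      also have "\<dots> = 1" using iso that unfolding isometric_def by simp
      finally show ?thesis by (simp only: of_real_eq_1_iff)
    qed
    finally show ?thesis .
  qed
  have "Re (\<Sum>u\<in>U. \<Sum>i<n. \<Sum>j<n. cnj (w i u) * D $$ (i, j) * w j u) = (\<Sum>u\<in>U. \<Sum>k<n. d k * (cmod (basis_overlap {..<n} v w k u))\<^sup>2)"
    by (simp only: Re_sum[of _ U] basis_overlap_expectation[OF finite_lessThan v(2)])
  also have "\<dots> = (\<Sum>k<n. d k * c k)"
    unfolding c_def sum_distrib_left by (rule sum.swap)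
  finally have "\<bar>Re (\<Sum>u\<in>U. \<Sum>i<n. \<Sum>j<n. cnj (w i u) * D $$ (i, j) * w j u)\<bar> \<le> (\<Sum>k<n. \<bar>d k * c k\<bar>)"
    by simp
  also have "\<dots> \<le> (\<Sum>k<n. \<bar>d k\<bar>)"
  proof (intro sum_mono)
    fix k assume "k \<in> {..<n}"
    moreover have "0 \<le> c k" by (simp add: c_def sum_nonneg)
    ultimately show "\<bar>d k * c k\<bar> \<le> \<bar>d k\<bar>" using c1[of k] by (simp add: abs_mult mult_left_le)
  qed
  finally show ?thesis unfolding tn .
qed

lemma trace_norm_ge_reindex:
  assumes g: "bij_betw g J {..<n}" and D: "D \<in> carrier_mat n n" "hermitian_on J (\<lambda>x y. D $$ (g x, g y))"
    and U: "finite U" and w: "isometric J U w"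
  shows "\<bar>Re (\<Sum>u\<in>U. \<Sum>x\<in>J. \<Sum>y\<in>J. cnj (w x u) * D $$ (g x, g y) * w y u)\<bar> \<le> trace_norm D"
proof -
  define h where "h = inv_into J g"
  have h: "bij_betw h {..<n} J" unfolding h_def by (rule bij_betw_inv_into[OF g])
  have gh: "g (h i) = i" if "i < n" for i
    using that g unfolding h_def by (meson bij_betw_inv_into_right lessThan_iff)
  have hg: "h (g x) = x" if "x \<in> J" for x
    using that g unfolding h_def by (meson bij_betw_inv_into_left)
  have herm: "hermitian_on {..<n} (\<lambda>i j. D $$ (i, j))"
    unfolding hermitian_on_def
  proof (intro ballI)
    fix i j assume "i \<in> {..<n}" "j \<in> {..<n}"
    then show "D $$ (j, i) = cnj (D $$ (i, j))"
      using hermitian_onD[OF D(2), of "h i" "h j"] bij_betwE[OF h] by (simp add: gh)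
  qed
  have "isometric {..<n} U (\<lambda>i u. w (h i) u)"
    using isometric_reindex[OF w h bij_betw_id] by simp
  from trace_norm_ge[OF D(1) herm U this]
  have "\<bar>Re (\<Sum>u\<in>U. \<Sum>i<n. \<Sum>j<n. cnj (w (h i) u) * D $$ (i, j) * w (h j) u)\<bar> \<le> trace_norm D" .
  also have "(\<Sum>u\<in>U. \<Sum>i<n. \<Sum>j<n. cnj (w (h i) u) * D $$ (i, j) * w (h j) u) =
    (\<Sum>u\<in>U. \<Sum>x\<in>J. \<Sum>y\<in>J. cnj (w x u) * D $$ (g x, g y) * w y u)"
    unfolding sum.reindex_bij_betw[OF g, symmetric] by (intro sum.cong refl) (simp add: hg)
  finally show ?thesis .
qed

lemma unitary_mat_columns:
  assumes "is_unitary n U" "t < n" "t' < n"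
  shows "(\<Sum>u<n. cnj (U $$ (u, t)) * U $$ (u, t')) = of_bool (t = t')"
    "(\<Sum>u<n. U $$ (t, u) * cnj (U $$ (t', u))) = of_bool (t = t')"
proof -
  have U: "U \<in> carrier_mat n n" "mat_adjoint U * U = 1\<^sub>m n" "U * mat_adjoint U = 1\<^sub>m n"
    using assms(1) by (auto simp: is_unitary_def)
  have "of_bool (t = t') = (mat_adjoint U * U) $$ (t, t')"
    unfolding U(2) using assms(2,3) by simp
  also have "\<dots> = (\<Sum>u<n. cnj (U $$ (u, t)) * U $$ (u, t'))"
    using U(1) assms(2,3) by (simp add: scalar_prod_def atLeast0LessThan)
  finally show "(\<Sum>u<n. cnj (U $$ (u, t)) * U $$ (u, t')) = of_bool (t = t')" by (rule sym)
  have "of_bool (t = t') = (U * mat_adjoint U) $$ (t, t')"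
    unfolding U(3) using assms(2,3) by simp
  also have "\<dots> = (\<Sum>u<n. U $$ (t, u) * cnj (U $$ (t', u)))"
    using U(1) assms(2,3) by (simp add: scalar_prod_def atLeast0LessThan)
  finally show "(\<Sum>u<n. U $$ (t, u) * cnj (U $$ (t', u))) = of_bool (t = t')" by (rule sym)
qed

(* Position of |i>_A |t div sB>_A' |j>_B |t mod sB>_B' on a system with cut AA':BB'. *)
definition key_shield_index :: "nat \<Rightarrow> nat \<Rightarrow> nat \<Rightarrow> (nat \<times> nat) \<times> nat \<Rightarrow> nat" where
  "key_shield_index K sA sB x =
     (fst (fst x) * sA + snd x div sB) * (K * sB) + (snd (fst x) * sB + snd x mod sB)"

lemma bij_key_shield_index:
  "bij_betw (key_shield_index K sA sB) (({..<K} \<times> {..<K}) \<times> {..<sA * sB}) {..<(K * sA) * (K * sB)}"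
proof -
  let ?e = "\<lambda>d x. fst x * d + snd x :: nat"
  let ?s = "\<lambda>x :: (nat \<times> nat) \<times> nat. ((fst (fst x), snd x div sB), (snd (fst x), snd x mod sB))"
  have 1: "bij_betw ?s (({..<K} \<times> {..<K}) \<times> {..<sA * sB}) (({..<K} \<times> {..<sA}) \<times> ({..<K} \<times> {..<sB}))"
  proof (rule bij_betw_byWitness[where f'="\<lambda>y. ((fst (fst y), fst (snd y)), snd (fst y) * sB + snd (snd y))"])
    show "?s ` (({..<K} \<times> {..<K}) \<times> {..<sA * sB}) \<subseteq> ({..<K} \<times> {..<sA}) \<times> {..<K} \<times> {..<sB}"
      using bij_betw_mixed_radix[of sB sA]
      by (auto simp: less_mult_imp_div_less intro!: mod_less_divisor) (metis gr0I less_nat_zero_code mult_0_right)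
  qed (auto simp: mixed_radix_less)
  have 2: "bij_betw (map_prod (?e sA) (?e sB)) (({..<K} \<times> {..<sA}) \<times> ({..<K} \<times> {..<sB})) ({..<K * sA} \<times> {..<K * sB})"
    by (intro bij_betw_map_prod bij_betw_mixed_radix)
  have "key_shield_index K sA sB = ?e (K * sB) \<circ> map_prod (?e sA) (?e sB) \<circ> ?s"
    by (simp add: fun_eq_iff key_shield_index_def)
  then show ?thesis
    using bij_betw_trans[OF 1 bij_betw_trans[OF 2 bij_betw_mixed_radix]] by (simp add: comp_assoc)
qed

lemma sum_list_concat_map: "(\<Sum>y\<leftarrow>concat (map f xs). g y) = (\<Sum>x\<leftarrow>xs. \<Sum>y\<leftarrow>f x. g y)"
  by (induction xs) auto

text \<open>In these coordinates both keys come first and the two shields share one index. The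
  regrouping along the cut disappears, and the twist shows as one unitary on the row side and one on
  the column side, each chosen by the key on that side.\<close>

lemma private_state_index:
  assumes "is_private_state m sA sB \<gamma>"
  defines "K \<equiv> 2 ^ m" and "S \<equiv> sA * sB"
  obtains \<sigma> U where "is_state S \<sigma>" "\<And>i. i < K \<Longrightarrow> is_unitary S (U i)"
    "\<gamma> \<in> carrier_mat ((K * sA) * (K * sB)) ((K * sA) * (K * sB))"
    "\<And>x y. x \<in> ({..<K} \<times> {..<K}) \<times> {..<S} \<Longrightarrow> y \<in> ({..<K} \<times> {..<K}) \<times> {..<S} \<Longrightarrow>
      \<gamma> $$ (key_shield_index K sA sB x, key_shield_index K sA sB y) =
      of_bool (fst (fst x) = snd (fst x)) * of_bool (fst (fst y) = snd (fst y)) *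
       (\<Sum>a<S. \<Sum>b<S. U (fst (fst x)) $$ (snd x, a) * \<sigma> $$ (a, b) * cnj (U (fst (fst y)) $$ (snd y, b))) / of_nat K"
proof -
  define V where "V = (\<lambda>(U :: nat \<Rightarrow> complex mat) \<sigma> i j. U i * \<sigma> * mat_adjoint (U j))"
  define Ms where "Ms = (\<lambda>U \<sigma>. [(ketbra K i j \<otimes>\<^sub>m ketbra K i j) \<otimes>\<^sub>m (U i * \<sigma> * mat_adjoint (U j)).
                    i \<leftarrow> [0..<K], j \<leftarrow> [0..<K]])"
  obtain \<sigma> U where \<sigma>: "is_state S \<sigma>" and U: "\<And>i. i < K \<Longrightarrow> is_unitary S (U i)"
    and \<gamma>: "\<gamma> = permute_systems [K, K, sA, sB] [0, 2, 1, 3] (1 / of_nat K \<cdot>\<^sub>m mat_sum (K * K * S) (Ms U \<sigma>))"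
    using assms(1) unfolding is_private_state_def K_def S_def Ms_def by auto
  have \<sigma>c: "\<sigma> \<in> carrier_mat S S" using \<sigma> by (simp add: is_state_def psd_def)
  have Uc: "U i \<in> carrier_mat S S" if "i < K" for i using U[OF that] by (simp add: is_unitary_def)
  have V: "U i * \<sigma> * mat_adjoint (U j) \<in> carrier_mat S S" if "i < K" "j < K" for i j
    using Uc[OF that(1)] Uc[OF that(2)] by (intro carrier_matI) auto
  have kb: "ketbra K i j \<in> carrier_mat K K" for i j by (simp add: ketbra_def)
  have kc: "M \<in> carrier_mat (K * K * S) (K * K * S)" if "M \<in> set (Ms U \<sigma>)" for M
    using that V kb unfolding Ms_def by (auto intro!: carrier_matI simp: carrier_matD[OF kb] carrier_matD[OF V] carrier_matD[OF Uc])
  have Vi: "(U i * \<sigma> * mat_adjoint (U j)) $$ (t, t') = (\<Sum>a<S. \<Sum>b<S. U i $$ (t, a) * \<sigma> $$ (a, b) * cnj (U j $$ (t', b)))"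
    if "i < K" "j < K" "t < S" "t' < S" for i j t t'
  proof -
    have "(U i * \<sigma> * mat_adjoint (U j)) $$ (t, t') = (\<Sum>b<S. (\<Sum>a<S. U i $$ (t, a) * \<sigma> $$ (a, b)) * cnj (U j $$ (t', b)))"
      using that Uc[OF that(1)] Uc[OF that(2)] \<sigma>c by (simp add: scalar_prod_def atLeast0LessThan)
    then show ?thesis unfolding sum_distrib_right by (subst sum.swap)
  qed
  have ent: "mat_sum (K * K * S) (Ms U \<sigma>) $$ ((i * K + j) * S + t, (i' * K + j') * S + t') =
     of_bool (i = j) * of_bool (i' = j') * (U i * \<sigma> * mat_adjoint (U i')) $$ (t, t')"
    if "i < K" "j < K" "t < S" "i' < K" "j' < K" "t' < S" for i j t i' j' t'
  proof -
    have "mat_sum (K * K * S) (Ms U \<sigma>) $$ ((i * K + j) * S + t, (i' * K + j') * S + t') =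
       (\<Sum>M\<leftarrow>Ms U \<sigma>. M $$ ((i * K + j) * S + t, (i' * K + j') * S + t'))"
      using that by (intro mat_sum_index kc) (auto simp: mixed_radix_less)
    also have "\<dots> = (\<Sum>p\<leftarrow>[0..<K]. \<Sum>q\<leftarrow>[0..<K]. ((ketbra K p q \<otimes>\<^sub>m ketbra K p q) \<otimes>\<^sub>m (U p * \<sigma> * mat_adjoint (U q))) $$ ((i * K + j) * S + t, (i' * K + j') * S + t'))"
      by (simp add: Ms_def sum_list_concat_map o_def)
    also have "\<dots> = (\<Sum>p<K. \<Sum>q<K. ((ketbra K p q \<otimes>\<^sub>m ketbra K p q) \<otimes>\<^sub>m (U p * \<sigma> * mat_adjoint (U q))) $$ ((i * K + j) * S + t, (i' * K + j') * S + t'))"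
      by (simp add: interv_sum_list_conv_sum_set_nat atLeast0LessThan)
    also have "\<dots> = (\<Sum>p<K. \<Sum>q<K. of_bool (i = p) * (of_bool (i' = q) * (of_bool (j = p) * of_bool (j' = q) * (U p * \<sigma> * mat_adjoint (U q)) $$ (t, t'))))"
    proof (intro sum.cong refl)
      fix p q assume "p \<in> {..<K}" "q \<in> {..<K}"
      then have pq: "p < K" "q < K" by auto
      have "((ketbra K p q \<otimes>\<^sub>m ketbra K p q) \<otimes>\<^sub>m (U p * \<sigma> * mat_adjoint (U q))) $$ ((i * K + j) * S + t, (i' * K + j') * S + t') =
        (ketbra K p q \<otimes>\<^sub>m ketbra K p q) $$ (i * K + j, i' * K + j') * (U p * \<sigma> * mat_adjoint (U q)) $$ (t, t')"
        using kron_index[of "i * K + j" "ketbra K p q \<otimes>\<^sub>m ketbra K p q" "i' * K + j'" t "U p * \<sigma> * mat_adjoint (U q)" t'] that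
          carrier_matD[OF kb[of p q]] carrier_matD[OF V[OF pq]] by (simp add: mixed_radix_less)
      also have "(ketbra K p q \<otimes>\<^sub>m ketbra K p q) $$ (i * K + j, i' * K + j') = ketbra K p q $$ (i, i') * ketbra K p q $$ (j, j')"
        using kron_index[of i "ketbra K p q" i' j "ketbra K p q" j'] that carrier_matD[OF kb[of p q]] by simp
      also have "\<dots> = of_bool (i = p) * (of_bool (i' = q) * (of_bool (j = p) * of_bool (j' = q)))"
        using that by (simp add: ketbra_def)
      finally show "((ketbra K p q \<otimes>\<^sub>m ketbra K p q) \<otimes>\<^sub>m (U p * \<sigma> * mat_adjoint (U q))) $$ ((i * K + j) * S + t, (i' * K + j') * S + t') =
        of_bool (i = p) * (of_bool (i' = q) * (of_bool (j = p) * of_bool (j' = q) * (U p * \<sigma> * mat_adjoint (U q)) $$ (t, t')))"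
        by (simp only: mult.assoc)
    qed
    also have "\<dots> = of_bool (j = i) * of_bool (j' = i') * (U i * \<sigma> * mat_adjoint (U i')) $$ (t, t')"
      using that by (simp only: sum_distrib_left[symmetric] sum_of_bool_mult finite_lessThan lessThan_iff if_True)
    finally show ?thesis by (cases "i = j"; cases "i' = j'") auto
  qed
  show ?thesis
  proof (rule that[OF \<sigma> U])
    have pl: "prod_list [K, K, sA, sB] = (K * sA) * (K * sB)" by (simp add: mult_ac)
    show "\<gamma> \<in> carrier_mat ((K * sA) * (K * sB)) ((K * sA) * (K * sB))"
      unfolding \<gamma> pl[symmetric] by (rule permute_systems_carrier)
    fix x y assume "x \<in> ({..<K} \<times> {..<K}) \<times> {..<S}" "y \<in> ({..<K} \<times> {..<K}) \<times> {..<S}"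
    then obtain i j t i' j' t' where x: "x = ((i, j), t)" "i < K" "j < K" "t < S" and y: "y = ((i', j'), t')" "i' < K" "j' < K" "t' < S"
      by auto
    have t: "t div sB < sA" "t mod sB < sB" "t' div sB < sA" "t' mod sB < sB"
      using x(4) y(4) unfolding S_def by (auto simp: less_mult_imp_div_less intro!: mod_less_divisor) (metis gr0I less_nat_zero_code mult_0_right)+
    have e: "index_enc (map ((!) [K, K, sA, sB]) [0, 2, 1, 3]) [i, t div sB, j, t mod sB] = key_shield_index K sA sB ((i, j), t)" for i j t
      by (simp add: key_shield_index_def numeral_2_eq_2 numeral_3_eq_3 algebra_simps)
    have e2: "index_enc [K, K, sA, sB] (map (\<lambda>l. the (map_of (zip [0, 2, 1, 3] [i, t div sB, j, t mod sB]) l)) [0..<length [K, K, sA, sB]]) = (i * K + j) * S + t" for i j t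
    proof -
      have "index_enc [K, K, sA, sB] (map (\<lambda>l. the (map_of (zip [0, 2, 1, 3] [i, t div sB, j, t mod sB]) l)) [0..<length [K, K, sA, sB]])
        = i * (K * (sA * sB)) + (j * (sA * sB) + (t div sB * sB + t mod sB))"
        by (simp add: numeral_2_eq_2 numeral_3_eq_3)
      then show ?thesis by (simp add: S_def algebra_simps)
    qed
    have "permute_systems [K, K, sA, sB] [0, 2, 1, 3] M $$
       (index_enc (map ((!) [K, K, sA, sB]) [0, 2, 1, 3]) [i, t div sB, j, t mod sB],
        index_enc (map ((!) [K, K, sA, sB]) [0, 2, 1, 3]) [i', t' div sB, j', t' mod sB]) =
       M $$ ((i * K + j) * S + t, (i' * K + j') * S + t')" for M
      unfolding e2[symmetric]
      by (rule permute_systems_index) (use x y t in \<open>auto simp: numeral_2_eq_2 numeral_3_eq_3 mult_ac\<close>)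
    then have "\<gamma> $$ (key_shield_index K sA sB x, key_shield_index K sA sB y) =
       (1 / of_nat K \<cdot>\<^sub>m mat_sum (K * K * S) (Ms U \<sigma>)) $$ ((i * K + j) * S + t, (i' * K + j') * S + t')"
      unfolding \<gamma> x(1) y(1) e by blast
    also have "\<dots> = 1 / of_nat K * mat_sum (K * K * S) (Ms U \<sigma>) $$ ((i * K + j) * S + t, (i' * K + j') * S + t')"
    proof -
      have "mat_sum (K * K * S) (Ms U \<sigma>) \<in> carrier_mat (K * K * S) (K * K * S)"
        by (rule mat_sum_carrier) (rule kc)
      then show ?thesis using x y by (simp add: mixed_radix_less)
    qed
    finally show "\<gamma> $$ (key_shield_index K sA sB x, key_shield_index K sA sB y) =
      of_bool (fst (fst x) = snd (fst x)) * of_bool (fst (fst y) = snd (fst y)) *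
       (\<Sum>a<S. \<Sum>b<S. U (fst (fst x)) $$ (snd x, a) * \<sigma> $$ (a, b) * cnj (U (fst (fst y)) $$ (snd y, b))) / of_nat K"
      using x y by (simp add: ent Vi)
  qed auto
qed

lemma sum_list_index: "(\<Sum>x\<leftarrow>xs. f x) = (\<Sum>i<length xs. f (xs ! i))"
  by (simp add: sum_list_sum_nth atLeast0LessThan)

lemma sum_swap_inner:
  "(\<Sum>g\<in>G. \<Sum>k\<in>K. \<Sum>x\<in>X k. \<Sum>y\<in>Y k. f g k x y) = (\<Sum>k\<in>K. \<Sum>x\<in>X k. \<Sum>y\<in>Y k. \<Sum>g\<in>G. f g k x y)"
proof -
  have "(\<Sum>g\<in>G. \<Sum>k\<in>K. \<Sum>x\<in>X k. \<Sum>y\<in>Y k. f g k x y) = (\<Sum>k\<in>K. \<Sum>g\<in>G. \<Sum>x\<in>X k. \<Sum>y\<in>Y k. f g k x y)"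
    by (rule sum.swap)
  also have "\<dots> = (\<Sum>k\<in>K. \<Sum>x\<in>X k. \<Sum>g\<in>G. \<Sum>y\<in>Y k. f g k x y)"
    by (rule sum.cong[OF refl]) (rule sum.swap)
  also have "\<dots> = (\<Sum>k\<in>K. \<Sum>x\<in>X k. \<Sum>y\<in>Y k. \<Sum>g\<in>G. f g k x y)"
    by (rule sum.cong[OF refl], rule sum.cong[OF refl]) (rule sum.swap)
  finally show ?thesis .
qed

text \<open>Charlie's output is traced out, so \<open>\<gamma>\<close> has the same value on both
  sides and acts as one more Kraus label. His input then enters only through the pair
  \<open>c\<close>, \<open>c'\<close>, which is why a transposition of his system can be absorbed
  later.\<close>

lemma apply_protocol_index:
  fixes P :: protocol
  defines "PA \<equiv> \<lambda>k. fst (P ! k)" and "PC \<equiv> \<lambda>k. fst (snd (P ! k))" and "PB \<equiv> \<lambda>k. snd (snd (P ! k))"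
  assumes P: "is_oneway_LOCC NA NC NB eA eC eB P" and X: "X \<in> carrier_mat (NA * (NC * NB)) (NA * (NC * NB))"
    and i: "\<alpha> < eA" "\<beta> < eB" "\<alpha>' < eA" "\<beta>' < eB"
  shows "marginal [eA, eC, eB] [0, 2] (apply_protocol eA eC eB P X) $$ (\<alpha> * eB + \<beta>, \<alpha>' * eB + \<beta>') =
    (\<Sum>k<length P. \<Sum>x<length (PA k). \<Sum>y<length (PC k). \<Sum>\<gamma><eC. \<Sum>z<length (PB k).
      \<Sum>b<NB. \<Sum>b'<NB. \<Sum>a<NA. \<Sum>a'<NA. \<Sum>c<NC. \<Sum>c'<NC.
        PA k ! x $$ (\<alpha>, a) * (PC k ! y $$ (\<gamma>, c) * PB k ! z $$ (\<beta>, b)) *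
        X $$ (a * (NC * NB) + (c * NB + b), a' * (NC * NB) + (c' * NB + b')) *
        cnj (PA k ! x $$ (\<alpha>', a') * (PC k ! y $$ (\<gamma>, c') * PB k ! z $$ (\<beta>', b'))))"
proof -
  have carr: "A \<in> carrier_mat eA NA" "B \<in> carrier_mat eB NB" "C \<in> carrier_mat eC NC"
    if "(As, Cs, Bs) \<in> set P" "A \<in> set As" "C \<in> set Cs" "B \<in> set Bs" for As Cs Bs A B C
    using P that unfolding is_oneway_LOCC_def is_channel_def by fastforce+
  define Ks where "Ks = [A \<otimes>\<^sub>m C \<otimes>\<^sub>m B. (As, Cs, Bs) \<leftarrow> P, A \<leftarrow> As, C \<leftarrow> Cs, B \<leftarrow> Bs]"
  have Ks: "M \<in> carrier_mat (eA * (eC * eB)) (NA * (NC * NB))" if "M \<in> set Ks" for M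
  proof -
    from that obtain As Cs Bs A C B where *: "(As, Cs, Bs) \<in> set P" "A \<in> set As" "C \<in> set Cs" "B \<in> set Bs"
      and M: "M = A \<otimes>\<^sub>m C \<otimes>\<^sub>m B" unfolding Ks_def by auto
    show ?thesis unfolding M using carr[OF *] by (intro carrier_matI) auto
  qed
  have M: "M * X * mat_adjoint M \<in> carrier_mat (eA * eC * eB) (eA * eC * eB)" if "M \<in> set Ks" for M
    using Ks[OF that] by (intro carrier_matI) (auto simp: mult.assoc)
  let ?E = "\<lambda>\<alpha> \<gamma> \<beta>. \<alpha> * (eC * eB) + (\<gamma> * eB + \<beta>)"
  let ?D = "\<lambda>a c b. a * (NC * NB) + (c * NB + b)"
  have E: "?E \<alpha> \<gamma> \<beta> < eA * (eC * eB)" if "\<alpha> < eA" "\<gamma> < eC" "\<beta> < eB" for \<alpha> \<gamma> \<beta>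
    using that by (simp add: mixed_radix_less)
  have kr: "((A \<otimes>\<^sub>m C \<otimes>\<^sub>m B) * X * mat_adjoint (A \<otimes>\<^sub>m C \<otimes>\<^sub>m B)) $$ (?E \<alpha> \<gamma> \<beta>, ?E \<alpha>' \<gamma> \<beta>') =
     (\<Sum>b<NB. \<Sum>b'<NB. \<Sum>a<NA. \<Sum>a'<NA. \<Sum>c<NC. \<Sum>c'<NC.
        A $$ (\<alpha>, a) * (C $$ (\<gamma>, c) * B $$ (\<beta>, b)) * X $$ (?D a c b, ?D a' c' b') *
        cnj (A $$ (\<alpha>', a') * (C $$ (\<gamma>, c') * B $$ (\<beta>', b'))))"
    if A: "A \<in> carrier_mat eA NA" and B: "B \<in> carrier_mat eB NB" and C: "C \<in> carrier_mat eC NC" and \<gamma>: "\<gamma> < eC" for A B C \<gamma>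
  proof -
    have k: "(A \<otimes>\<^sub>m C \<otimes>\<^sub>m B) $$ (?E \<alpha> \<gamma> \<beta>, ?D a c b) = A $$ (\<alpha>, a) * (C $$ (\<gamma>, c) * B $$ (\<beta>, b))"
      if "\<alpha> < eA" "\<beta> < eB" "a < NA" "c < NC" "b < NB" for \<alpha> \<beta> a b c
      using kron_index[of \<alpha> A a "\<gamma> * eB + \<beta>" "C \<otimes>\<^sub>m B" "c * NB + b"] kron_index[of \<gamma> C c \<beta> B b] that \<gamma>
        carrier_matD[OF A] carrier_matD[OF B] carrier_matD[OF C] by (simp add: mixed_radix_less)
    have "((A \<otimes>\<^sub>m C \<otimes>\<^sub>m B) * X * mat_adjoint (A \<otimes>\<^sub>m C \<otimes>\<^sub>m B)) $$ (?E \<alpha> \<gamma> \<beta>, ?E \<alpha>' \<gamma> \<beta>') =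
      (\<Sum>p<NA * (NC * NB). \<Sum>q<NA * (NC * NB). (A \<otimes>\<^sub>m C \<otimes>\<^sub>m B) $$ (?E \<alpha> \<gamma> \<beta>, p) * X $$ (p, q) * cnj ((A \<otimes>\<^sub>m C \<otimes>\<^sub>m B) $$ (?E \<alpha>' \<gamma> \<beta>', q)))"
      using E i \<gamma> carrier_matD[OF A] carrier_matD[OF B] carrier_matD[OF C]
      by (intro mult_adjoint_index[OF _ X, of _ "eA * (eC * eB)"] carrier_matI) auto
    also have "\<dots> = (\<Sum>a<NA. \<Sum>c<NC. \<Sum>b<NB. \<Sum>a'<NA. \<Sum>c'<NC. \<Sum>b'<NB.
        A $$ (\<alpha>, a) * (C $$ (\<gamma>, c) * B $$ (\<beta>, b)) * X $$ (?D a c b, ?D a' c' b') *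
        cnj (A $$ (\<alpha>', a') * (C $$ (\<gamma>, c') * B $$ (\<beta>', b'))))"
      unfolding sum_mixed_radix by (intro sum.cong refl) (simp add: k i)
    also have "\<dots> = (\<Sum>(a, c, b, a', c', b')\<in>{..<NA} \<times> {..<NC} \<times> {..<NB} \<times> {..<NA} \<times> {..<NC} \<times> {..<NB}.
        A $$ (\<alpha>, a) * (C $$ (\<gamma>, c) * B $$ (\<beta>, b)) * X $$ (?D a c b, ?D a' c' b') *
        cnj (A $$ (\<alpha>', a') * (C $$ (\<gamma>, c') * B $$ (\<beta>', b'))))"
      by (simp add: sum.cartesian_product' split_beta)
    also have "\<dots> = (\<Sum>(b, b', a, a', c, c')\<in>{..<NB} \<times> {..<NB} \<times> {..<NA} \<times> {..<NA} \<times> {..<NC} \<times> {..<NC}.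
        A $$ (\<alpha>, a) * (C $$ (\<gamma>, c) * B $$ (\<beta>, b)) * X $$ (?D a c b, ?D a' c' b') *
        cnj (A $$ (\<alpha>', a') * (C $$ (\<gamma>, c') * B $$ (\<beta>', b'))))"
      by (rule sum.reindex_bij_witness[where i="\<lambda>(b, b', a, a', c, c'). (a, c, b, a', c', b')"
          and j="\<lambda>(a, c, b, a', c', b'). (b, b', a, a', c, c')"]) auto
    finally show ?thesis by (simp add: sum.cartesian_product' split_beta)
  qed
  have ent: "apply_protocol eA eC eB P X $$ (?E \<alpha> \<gamma> \<beta>, ?E \<alpha>' \<gamma> \<beta>') =
     (\<Sum>k<length P. \<Sum>x<length (PA k). \<Sum>y<length (PC k). \<Sum>z<length (PB k).
      \<Sum>b<NB. \<Sum>b'<NB. \<Sum>a<NA. \<Sum>a'<NA. \<Sum>c<NC. \<Sum>c'<NC.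
        PA k ! x $$ (\<alpha>, a) * (PC k ! y $$ (\<gamma>, c) * PB k ! z $$ (\<beta>, b)) * X $$ (?D a c b, ?D a' c' b') *
        cnj (PA k ! x $$ (\<alpha>', a') * (PC k ! y $$ (\<gamma>, c') * PB k ! z $$ (\<beta>', b'))))" if \<gamma>: "\<gamma> < eC" for \<gamma>
  proof -
    let ?G = "\<lambda>M. (M * X * mat_adjoint M) $$ (?E \<alpha> \<gamma> \<beta>, ?E \<alpha>' \<gamma> \<beta>')"
    have "apply_protocol eA eC eB P X $$ (?E \<alpha> \<gamma> \<beta>, ?E \<alpha>' \<gamma> \<beta>') = (\<Sum>M\<leftarrow>Ks. ?G M)"
      unfolding apply_protocol_def kraus_map_def Ks_def[symmetric]
      using M E[OF i(1) \<gamma> i(2)] E[OF i(3) \<gamma> i(4)] by (subst mat_sum_index) (auto simp: o_def mult.assoc)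
    also have "\<dots> = (\<Sum>(As, Cs, Bs)\<leftarrow>P. \<Sum>A\<leftarrow>As. \<Sum>C\<leftarrow>Cs. \<Sum>B\<leftarrow>Bs. ?G (A \<otimes>\<^sub>m C \<otimes>\<^sub>m B))"
      unfolding Ks_def by (simp add: sum_list_concat_map case_prod_unfold o_def)
    also have "\<dots> = (\<Sum>k<length P. \<Sum>x<length (PA k). \<Sum>y<length (PC k). \<Sum>z<length (PB k).
        ?G ((PA k ! x) \<otimes>\<^sub>m (PC k ! y) \<otimes>\<^sub>m (PB k ! z)))"
      by (simp add: sum_list_index case_prod_unfold PA_def PB_def PC_def)
    also have "\<dots> = (\<Sum>k<length P. \<Sum>x<length (PA k). \<Sum>y<length (PC k). \<Sum>z<length (PB k).
      \<Sum>b<NB. \<Sum>b'<NB. \<Sum>a<NA. \<Sum>a'<NA. \<Sum>c<NC. \<Sum>c'<NC.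
        PA k ! x $$ (\<alpha>, a) * (PC k ! y $$ (\<gamma>, c) * PB k ! z $$ (\<beta>, b)) * X $$ (?D a c b, ?D a' c' b') *
        cnj (PA k ! x $$ (\<alpha>', a') * (PC k ! y $$ (\<gamma>, c') * PB k ! z $$ (\<beta>', b'))))"
    proof (intro sum.cong refl kr)
      fix k x y z assume "k \<in> {..<length P}" "x \<in> {..<length (PA k)}" "y \<in> {..<length (PC k)}" "z \<in> {..<length (PB k)}"
      then have "(PA k, PC k, PB k) \<in> set P" "PA k ! x \<in> set (PA k)" "PC k ! y \<in> set (PC k)" "PB k ! z \<in> set (PB k)"
        by (auto simp: PA_def PB_def PC_def)
      from carr[OF this] show "PA k ! x \<in> carrier_mat eA NA" "PB k ! z \<in> carrier_mat eB NB" "PC k ! y \<in> carrier_mat eC NC"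
        by auto
    qed (use \<gamma> in auto)
    finally show ?thesis .
  qed
  have "marginal [eA, eC, eB] [0, 2] (apply_protocol eA eC eB P X) $$ (\<alpha> * eB + \<beta>, \<alpha>' * eB + \<beta>') =
    (\<Sum>\<gamma><eC. apply_protocol eA eC eB P X $$ (?E \<alpha> \<gamma> \<beta>, ?E \<alpha>' \<gamma> \<beta>'))"
    by (rule marginal_02[OF i])
  also have "\<dots> = (\<Sum>\<gamma><eC. \<Sum>k<length P. \<Sum>x<length (PA k). \<Sum>y<length (PC k). \<Sum>z<length (PB k).
      \<Sum>b<NB. \<Sum>b'<NB. \<Sum>a<NA. \<Sum>a'<NA. \<Sum>c<NC. \<Sum>c'<NC.
        PA k ! x $$ (\<alpha>, a) * (PC k ! y $$ (\<gamma>, c) * PB k ! z $$ (\<beta>, b)) * X $$ (?D a c b, ?D a' c' b') *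
        cnj (PA k ! x $$ (\<alpha>', a') * (PC k ! y $$ (\<gamma>, c') * PB k ! z $$ (\<beta>', b'))))"
    by (intro sum.cong refl ent) simp
  also have "\<dots> = (\<Sum>k<length P. \<Sum>x<length (PA k). \<Sum>y<length (PC k). \<Sum>\<gamma><eC. \<Sum>z<length (PB k).
      \<Sum>b<NB. \<Sum>b'<NB. \<Sum>a<NA. \<Sum>a'<NA. \<Sum>c<NC. \<Sum>c'<NC.
        PA k ! x $$ (\<alpha>, a) * (PC k ! y $$ (\<gamma>, c) * PB k ! z $$ (\<beta>, b)) * X $$ (?D a c b, ?D a' c' b') *
        cnj (PA k ! x $$ (\<alpha>', a') * (PC k ! y $$ (\<gamma>, c') * PB k ! z $$ (\<beta>', b'))))"
    by (rule sum_swap_inner)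
  finally show ?thesis .
qed

section \<open>One-way protocols on partially transposed states\<close>

text \<open>An output number consists of a key digit \<open>l div d\<close> and a shield digit
  \<open>l mod d\<close>. Fixing the key leaves a free sum over the shield.\<close>

lemma sum_label_div:
  assumes "j < K"
  shows "(\<Sum>l | l \<in> W \<times> {..<K * d} \<and> snd l div d = j. f l) = (\<Sum>z\<in>W. \<Sum>s<d. f (z, j * d + s :: nat))"
proof -
  have "(\<Sum>l | l \<in> W \<times> {..<K * d} \<and> snd l div d = j. f l) = (\<Sum>l\<in>W \<times> {..<d}. f (fst l, j * d + snd l))"
  proof (rule sum.reindex_bij_witness[where i="\<lambda>l. (fst l, j * d + snd l)" and j="\<lambda>l. (fst l, snd l mod d)"])
    fix l assume "l \<in> {l. l \<in> W \<times> {..<K * d} \<and> snd l div d = j}"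
    then have l: "fst l \<in> W" "snd l < K * d" "snd l div d = j" by auto
    then have "0 < d" by (cases "d = 0") auto
    then show "(fst l, snd l mod d) \<in> W \<times> {..<d}" using l by simp
    have e: "j * d + snd l mod d = snd l" using l(3) by (metis div_mult_mod_eq)
    then show "(fst (fst l, snd l mod d), j * d + snd (fst l, snd l mod d)) = l" by simp
    show "f (fst (fst l, snd l mod d), j * d + snd (fst l, snd l mod d)) = f l" using e by simp
  next
    fix l assume "l \<in> W \<times> {..<d}"
    then show "(fst (fst l, j * d + snd l), snd (fst l, j * d + snd l) mod d) = l"
      "(fst l, j * d + snd l) \<in> {l. l \<in> W \<times> {..<K * d} \<and> snd l div d = j}"
      using assms by (auto simp: mixed_radix_less)
  qed
  then show ?thesis by (simp add: sum.cartesian_product')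
qed

lemma sum_diagonal:
  fixes f :: "'i \<Rightarrow> 'i \<Rightarrow> complex"
  assumes "finite I"
  shows "(\<Sum>i\<in>I. \<Sum>j\<in>I. of_bool (i = j) * f i j) = (\<Sum>i\<in>I. f i i)"
  by (rule sum.cong[OF refl]) (simp only: sum_of_bool_mult assms if_True)

locale oneway_protocol =
  fixes NA NC NB eA eC eB :: nat and P :: protocol
  assumes P: "is_oneway_LOCC NA NC NB eA eC eB P"
begin

definition "PA k = fst (P ! k)"
definition "PC k = fst (snd (P ! k))"
definition "PB k = snd (snd (P ! k))"

text \<open>All that is discarded on the side of Alice and Charlie for message \<open>k\<close>: her
  Kraus label, his Kraus label, and the basis state of his output.\<close>

definition "WA k = {..<length (PA k)} \<times> {..<length (PC k)} \<times> {..<eC}"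

abbreviation "AC \<equiv> {..<NA} \<times> {..<NC}"

(* The complex conjugate on Charlie's Kraus operators compensates the partial transpose of C. *)
definition "rowAC k w \<alpha> y = PA k ! fst w $$ (\<alpha>, fst y) * cnj (PC k ! fst (snd w) $$ (snd (snd w), snd y))"

definition "rowB k z \<beta> b = PB k ! z $$ (\<beta>, b)"

text \<open>The outcomes of one rank-one measurement on the joint system of Alice and Charlie:
  message, discarded labels, and Alice's output.\<close>

definition "messagesAC = (SIGMA k:{..<length P}. WA k \<times> {..<eA})"

text \<open>For message \<open>k\<close>, the block of the joint output of Alice, Bob and E between
  the outputs \<open>x\<close> and \<open>x'\<close>. Only the discarded labels are summed;
  coherences of key and shield are still present.\<close>

definition output_block :: "((nat \<times> 'e) \<times> (nat \<times> nat) \<Rightarrow> (nat \<times> 'e) \<times> (nat \<times> nat) \<Rightarrow> complex) \<Rightarrow> nat \<Rightarrow> nat \<times> nat \<Rightarrow> nat \<times> nat \<Rightarrow> 'e \<Rightarrow> 'e \<Rightarrow> complex" where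
  "output_block \<Omega> k x x' e e' = (\<Sum>q\<in>WA k \<times> {..<length (PB k)}. \<Sum>h\<in>{..<NB} \<times> AC. \<Sum>h'\<in>{..<NB} \<times> AC.
     (rowAC k (fst q) (fst x) (snd h) * rowB k (snd q) (snd x) (fst h)) * \<Omega> ((fst h, e), snd h) ((fst h', e'), snd h') *
     cnj (rowAC k (fst q) (fst x') (snd h') * rowB k (snd q) (snd x') (fst h')))"

lemma finite_WA [simp]: "finite (WA k)"
  by (simp add: WA_def)

lemma channelA: "k < length P \<Longrightarrow> is_channel NA eA (PA k)"
  and channelB: "k < length P \<Longrightarrow> is_channel NB eB (PB k)"
  using P nth_mem[of k P] unfolding is_oneway_LOCC_def PA_def PB_def by (fastforce simp: case_prod_unfold)+

lemma isometric_rowB: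
  assumes "k < length P"
  shows "isometric ({..<length (PB k)} \<times> {..<eB}) {..<NB} (\<lambda>l. rowB k (fst l) (snd l))"
  using channel_complete[OF channelB[OF assms]]
  by (simp add: isometric_def rowB_def sum.cartesian_product')

text \<open>A single branch of Charlie's instrument is in general not complete, only all branches
  together are; hence the sum over all messages.\<close>

lemma charlie_complete:
  assumes "c < NC" "c' < NC"
  shows "(\<Sum>k<length P. \<Sum>y<length (PC k). \<Sum>\<gamma><eC. cnj (PC k ! y $$ (\<gamma>, c)) * PC k ! y $$ (\<gamma>, c')) = of_bool (c = c')"
proof -
  let ?Cs = "concat (map (\<lambda>(As, Cs, Bs). Cs) P)"
  have "of_bool (c = c') = (\<Sum>x<length ?Cs. \<Sum>\<gamma><eC. cnj (?Cs ! x $$ (\<gamma>, c)) * ?Cs ! x $$ (\<gamma>, c'))"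
    using P assms unfolding is_oneway_LOCC_def by (intro channel_complete[symmetric]) auto
  also have "\<dots> = (\<Sum>C\<leftarrow>?Cs. \<Sum>\<gamma><eC. cnj (C $$ (\<gamma>, c)) * C $$ (\<gamma>, c'))"
    by (rule sum_list_index[symmetric])
  also have "\<dots> = (\<Sum>k<length P. \<Sum>y<length (PC k). \<Sum>\<gamma><eC. cnj (PC k ! y $$ (\<gamma>, c)) * PC k ! y $$ (\<gamma>, c'))"
    by (subst sum_list_concat_map) (simp only: sum_list_index case_prod_unfold PC_def)
  finally show ?thesis by simp
qed

text \<open>Alice's channel is complete for every message, so her labels are summed first and leave
  Charlie's completeness relation. The conjugation only exchanges the two arguments in it, which a
  symmetric delta does not notice.\<close>

lemma isometric_rowAC: "isometric messagesAC AC (\<lambda>l. rowAC (fst l) (fst (snd l)) (snd (snd l)))"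
  unfolding isometric_def
proof (intro ballI)
  fix y y' assume y: "y \<in> AC" "y' \<in> AC"
  have "(\<Sum>l\<in>messagesAC. cnj (rowAC (fst l) (fst (snd l)) (snd (snd l)) y) * rowAC (fst l) (fst (snd l)) (snd (snd l)) y') =
    (\<Sum>k<length P. \<Sum>l\<in>WA k \<times> {..<eA}. cnj (rowAC k (fst l) (snd l) y) * rowAC k (fst l) (snd l) y')"
    using sum.Sigma[of "{..<length P}" "\<lambda>k. WA k \<times> {..<eA}" "\<lambda>k l. cnj (rowAC k (fst l) (snd l) y) * rowAC k (fst l) (snd l) y'"]
    by (simp add: messagesAC_def case_prod_unfold)
  also have "\<dots> = (\<Sum>k<length P. \<Sum>x<length (PA k). \<Sum>w<length (PC k). \<Sum>\<gamma><eC. \<Sum>\<alpha><eA.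
      (cnj (PC k ! w $$ (\<gamma>, snd y')) * PC k ! w $$ (\<gamma>, snd y)) * (cnj (PA k ! x $$ (\<alpha>, fst y)) * PA k ! x $$ (\<alpha>, fst y')))"
    by (simp add: WA_def sum.cartesian_product' rowAC_def mult_ac)
  also have "\<dots> = (\<Sum>k<length P. \<Sum>w<length (PC k). \<Sum>\<gamma><eC. cnj (PC k ! w $$ (\<gamma>, snd y')) * PC k ! w $$ (\<gamma>, snd y) *
      (\<Sum>x<length (PA k). \<Sum>\<alpha><eA. cnj (PA k ! x $$ (\<alpha>, fst y)) * PA k ! x $$ (\<alpha>, fst y')))"
  proof (rule sum.cong[OF refl])
    fix k
    have "(\<Sum>x<length (PA k). \<Sum>w<length (PC k). \<Sum>\<gamma><eC. \<Sum>\<alpha><eA. f w \<gamma> * g x \<alpha>) =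
       (\<Sum>w<length (PC k). \<Sum>\<gamma><eC. f w \<gamma> * (\<Sum>x<length (PA k). \<Sum>\<alpha><eA. g x \<alpha>))" for f g :: "nat \<Rightarrow> nat \<Rightarrow> complex"
    proof -
      have "(\<Sum>x<length (PA k). \<Sum>w<length (PC k). \<Sum>\<gamma><eC. \<Sum>\<alpha><eA. f w \<gamma> * g x \<alpha>) =
        (\<Sum>w<length (PC k). \<Sum>x<length (PA k). \<Sum>\<gamma><eC. \<Sum>\<alpha><eA. f w \<gamma> * g x \<alpha>)" by (rule sum.swap)
      also have "\<dots> = (\<Sum>w<length (PC k). \<Sum>\<gamma><eC. \<Sum>x<length (PA k). \<Sum>\<alpha><eA. f w \<gamma> * g x \<alpha>)"
        by (rule sum.cong[OF refl]) (rule sum.swap)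
      finally show ?thesis by (simp only: sum_distrib_left)
    qed
    then show "(\<Sum>x<length (PA k). \<Sum>w<length (PC k). \<Sum>\<gamma><eC. \<Sum>\<alpha><eA.
      (cnj (PC k ! w $$ (\<gamma>, snd y')) * PC k ! w $$ (\<gamma>, snd y)) * (cnj (PA k ! x $$ (\<alpha>, fst y)) * PA k ! x $$ (\<alpha>, fst y'))) =
     (\<Sum>w<length (PC k). \<Sum>\<gamma><eC. cnj (PC k ! w $$ (\<gamma>, snd y')) * PC k ! w $$ (\<gamma>, snd y) *
      (\<Sum>x<length (PA k). \<Sum>\<alpha><eA. cnj (PA k ! x $$ (\<alpha>, fst y)) * PA k ! x $$ (\<alpha>, fst y')))" .
  qed
  also have "\<dots> = (\<Sum>k<length P. \<Sum>w<length (PC k). \<Sum>\<gamma><eC. cnj (PC k ! w $$ (\<gamma>, snd y')) * PC k ! w $$ (\<gamma>, snd y) * of_bool (fst y = fst y'))"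
    using y by (intro sum.cong refl) (simp only: channel_complete[OF channelA] lessThan_iff mem_Times_iff)
  also have "\<dots> = of_bool (snd y' = snd y) * of_bool (fst y = fst y')"
    using charlie_complete[of "snd y'" "snd y"] y by (simp only: sum_distrib_right[symmetric] mem_Times_iff lessThan_iff)
  also have "\<dots> = of_bool (y = y')" by (auto simp: prod_eq_iff)
  finally show "(\<Sum>l\<in>messagesAC. cnj (rowAC (fst l) (fst (snd l)) (snd (snd l)) y) * rowAC (fst l) (fst (snd l)) (snd (snd l)) y') = of_bool (y = y')" .
qed

text \<open>By \<open>ext\<close>, tracing out E leaves \<open>X\<close> with Charlie's row and
  column indices exchanged. Conjugated Kraus operators exchange them once more, so the output is
  that of the original protocol on \<open>X\<close>.\<close>

lemma sum_output_block:
  assumes X: "X \<in> carrier_mat (NA * (NC * NB)) (NA * (NC * NB))"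
    and ext: "\<And>a c b a' c' b'. a < NA \<Longrightarrow> c < NC \<Longrightarrow> b < NB \<Longrightarrow> a' < NA \<Longrightarrow> c' < NC \<Longrightarrow> b' < NB \<Longrightarrow>
      (\<Sum>e\<in>E. \<Omega> ((b, e), (a, c)) ((b', e), (a', c'))) = X $$ (a * (NC * NB) + (c' * NB + b), a' * (NC * NB) + (c * NB + b'))"
    and i: "\<alpha> < eA" "\<beta> < eB" "\<alpha>' < eA" "\<beta>' < eB"
  shows "(\<Sum>k<length P. \<Sum>e\<in>E. output_block \<Omega> k (\<alpha>, \<beta>) (\<alpha>', \<beta>') e e) =
    marginal [eA, eC, eB] [0, 2] (apply_protocol eA eC eB P X) $$ (\<alpha> * eB + \<beta>, \<alpha>' * eB + \<beta>')"
proof -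
  let ?F = "\<lambda>k x y \<gamma> z b b' a a' c c'. PA k ! x $$ (\<alpha>, a) * (PC k ! y $$ (\<gamma>, c) * PB k ! z $$ (\<beta>, b)) *
        X $$ (a * (NC * NB) + (c * NB + b), a' * (NC * NB) + (c' * NB + b')) *
        cnj (PA k ! x $$ (\<alpha>', a') * (PC k ! y $$ (\<gamma>, c') * PB k ! z $$ (\<beta>', b')))"
  have block: "(\<Sum>e\<in>E. output_block \<Omega> k (\<alpha>, \<beta>) (\<alpha>', \<beta>') e e) =
    (\<Sum>x<length (PA k). \<Sum>y<length (PC k). \<Sum>\<gamma><eC. \<Sum>z<length (PB k).
      \<Sum>b<NB. \<Sum>b'<NB. \<Sum>a<NA. \<Sum>a'<NA. \<Sum>c<NC. \<Sum>c'<NC. ?F k x y \<gamma> z b b' a a' c c')" for k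
  proof -
    let ?H = "{..<NB} \<times> AC"
    let ?L = "\<lambda>q h h'. rowAC k (fst q) \<alpha> (snd h) * rowB k (snd q) \<beta> (fst h) *
       X $$ (fst (snd h) * (NC * NB) + (snd (snd h') * NB + fst h), fst (snd h') * (NC * NB) + (snd (snd h) * NB + fst h')) *
       cnj (rowAC k (fst q) \<alpha>' (snd h') * rowB k (snd q) \<beta>' (fst h'))"
    have "(\<Sum>e\<in>E. output_block \<Omega> k (\<alpha>, \<beta>) (\<alpha>', \<beta>') e e) =
      (\<Sum>q\<in>WA k \<times> {..<length (PB k)}. \<Sum>e\<in>E. \<Sum>h\<in>?H. \<Sum>h'\<in>?H.
       (rowAC k (fst q) \<alpha> (snd h) * rowB k (snd q) \<beta> (fst h)) * \<Omega> ((fst h, e), snd h) ((fst h', e), snd h') *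
       cnj (rowAC k (fst q) \<alpha>' (snd h') * rowB k (snd q) \<beta>' (fst h')))"
      unfolding output_block_def fst_conv snd_conv by (rule sum.swap)
    also have "\<dots> = (\<Sum>q\<in>WA k \<times> {..<length (PB k)}. \<Sum>h\<in>?H. \<Sum>e\<in>E. \<Sum>h'\<in>?H.
       (rowAC k (fst q) \<alpha> (snd h) * rowB k (snd q) \<beta> (fst h)) * \<Omega> ((fst h, e), snd h) ((fst h', e), snd h') *
       cnj (rowAC k (fst q) \<alpha>' (snd h') * rowB k (snd q) \<beta>' (fst h')))"
      by (rule sum.cong[OF refl]) (rule sum.swap)
    also have "\<dots> = (\<Sum>q\<in>WA k \<times> {..<length (PB k)}. \<Sum>h\<in>?H. \<Sum>h'\<in>?H. \<Sum>e\<in>E.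
       (rowAC k (fst q) \<alpha> (snd h) * rowB k (snd q) \<beta> (fst h)) * \<Omega> ((fst h, e), snd h) ((fst h', e), snd h') *
       cnj (rowAC k (fst q) \<alpha>' (snd h') * rowB k (snd q) \<beta>' (fst h')))"
      by (rule sum.cong[OF refl], rule sum.cong[OF refl]) (rule sum.swap)
    also have "\<dots> = (\<Sum>q\<in>WA k \<times> {..<length (PB k)}. \<Sum>h\<in>?H. \<Sum>h'\<in>?H. ?L q h h')"
    proof (intro sum.cong refl)
      fix q h h' assume "h \<in> ?H" "h' \<in> ?H"
      then have "(\<Sum>e\<in>E. \<Omega> ((fst h, e), snd h) ((fst h', e), snd h')) =
        X $$ (fst (snd h) * (NC * NB) + (snd (snd h') * NB + fst h), fst (snd h') * (NC * NB) + (snd (snd h) * NB + fst h'))"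
        using ext[of "fst (snd h)" "snd (snd h)" "fst h" "fst (snd h')" "snd (snd h')" "fst h'"] by auto
      then show "(\<Sum>e\<in>E. (rowAC k (fst q) \<alpha> (snd h) * rowB k (snd q) \<beta> (fst h)) * \<Omega> ((fst h, e), snd h) ((fst h', e), snd h') *
       cnj (rowAC k (fst q) \<alpha>' (snd h') * rowB k (snd q) \<beta>' (fst h'))) = ?L q h h'"
        by (simp only: sum_distrib_left[symmetric] sum_distrib_right[symmetric])
    qed
    also have "\<dots> = (\<Sum>(q, h, h')\<in>(WA k \<times> {..<length (PB k)}) \<times> ?H \<times> ?H. ?L q h h')"
      by (simp only: sum.cartesian_product' case_prod_unfold fst_conv snd_conv)
    also have "\<dots> = (\<Sum>(x, y, \<gamma>, z, b, b', a, a', c, c')\<in>{..<length (PA k)} \<times> {..<length (PC k)} \<times> {..<eC} \<times> {..<length (PB k)} \<times>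
       {..<NB} \<times> {..<NB} \<times> {..<NA} \<times> {..<NA} \<times> {..<NC} \<times> {..<NC}. ?F k x y \<gamma> z b b' a a' c c')"
      \<comment> \<open>Here the transposition is undone: the left index \<open>h\<close> receives
        \<open>c'\<close> and the right index \<open>h'\<close> receives \<open>c\<close>.\<close>
      by (rule sum.reindex_bij_witness[where i="\<lambda>(x, y, \<gamma>, z, b, b', a, a', c, c'). (((x, y, \<gamma>), z), (b, a, c'), (b', a', c))"
          and j="\<lambda>(((x, y, \<gamma>), z), (b, a, c'), (b', a', c)). (x, y, \<gamma>, z, b, b', a, a', c, c')"])
        (auto simp: WA_def rowAC_def rowB_def mult_ac)
    finally show ?thesis by (simp only: sum.cartesian_product' case_prod_unfold fst_conv snd_conv)
  qed
  show ?thesis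
    unfolding apply_protocol_index[OF P X i, folded PA_def PB_def PC_def] by (rule sum.cong[OF refl], rule block)
qed

lemma psd_on_output_block:
  assumes "finite E" "psd_on (({..<NB} \<times> E) \<times> AC) \<Omega>"
  shows "psd_on (E \<times> ({..<eA} \<times> {..<eB})) (\<lambda>x y. output_block \<Omega> k (snd x) (snd y) (fst x) (fst y))"
proof -
  define \<Omega>' where "\<Omega>' = (\<lambda>x y. \<Omega> ((fst (snd x), fst x), snd (snd x)) ((fst (snd y), fst y), snd (snd y)))"
  have "psd_on (E \<times> ({..<NB} \<times> AC)) \<Omega>'"
    unfolding \<Omega>'_def by (rule psd_on_map[OF _ assms(2), of "\<lambda>x. ((fst (snd x), fst x), snd (snd x))"]) (use assms in auto)
  then have "psd_on (E \<times> ({..<eA} \<times> {..<eB})) (\<lambda>x y. \<Sum>q\<in>WA k \<times> {..<length (PB k)}.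
     conj_snd ({..<NB} \<times> AC) (\<lambda>x h. rowAC k (fst q) (fst x) (snd h) * rowB k (snd q) (snd x) (fst h)) \<Omega>' x y)"
    by (intro psd_on_sum psd_on_conj_snd assms)
  then show ?thesis by (simp only: output_block_def conj_snd_def \<Omega>'_def fst_conv snd_conv)
qed

text \<open>Relates two descriptions of the same operator on E: the rank-one measurements of all
  parties, keeping only the message and the two keys, and the diagonal block of the coherent output
  with the shield traced out.\<close>

lemma measured_output_block:
  fixes \<Omega> :: "(nat \<times> 'e) \<times> (nat \<times> nat) \<Rightarrow> (nat \<times> 'e) \<times> (nat \<times> nat) \<Rightarrow> complex"
  assumes eA: "eA = K * sA" and eB: "eB = K * sB" and k: "k < length P" and i: "i < K" "j < K"
  defines "\<tau> \<equiv> \<lambda>k i z z'. \<Sum>l | l \<in> messagesAC \<and> (fst l, snd (snd l) div sA) = (k, i). \<Sum>y\<in>AC. \<Sum>y'\<in>AC.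
     rowAC (fst l) (fst (snd l)) (snd (snd l)) y * \<Omega> (z, y) (z', y') * cnj (rowAC (fst l) (fst (snd l)) (snd (snd l)) y')"
  shows "(\<Sum>l | l \<in> {..<length (PB k)} \<times> {..<eB} \<and> snd l div sB = j. \<Sum>b<NB. \<Sum>b'<NB.
      rowB k (fst l) (snd l) b * \<tau> k i (b, e) (b', e') * cnj (rowB k (fst l) (snd l) b')) =
    (\<Sum>t<sA * sB. output_block \<Omega> k (i * sA + t div sB, j * sB + t mod sB) (i * sA + t div sB, j * sB + t mod sB) e e')"
proof -
  let ?G = "\<lambda>w s b y b' y'. rowAC k w (i * sA + s) y * \<Omega> ((b, e), y) ((b', e'), y') * cnj (rowAC k w (i * sA + s) y')"
  have \<tau>: "\<tau> k i (b, e) (b', e') = (\<Sum>w\<in>WA k. \<Sum>s<sA. \<Sum>y\<in>AC. \<Sum>y'\<in>AC. ?G w s b y b' y')" for b b'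
  proof -
    have "\<tau> k i (b, e) (b', e') = (\<Sum>l | l \<in> WA k \<times> {..<eA} \<and> snd l div sA = i. \<Sum>y\<in>AC. \<Sum>y'\<in>AC.
        rowAC k (fst l) (snd l) y * \<Omega> ((b, e), y) ((b', e'), y') * cnj (rowAC k (fst l) (snd l) y'))"
      unfolding \<tau>_def
      by (rule sum.reindex_bij_witness[where i="\<lambda>l. (k, l)" and j=snd]) (use k in \<open>auto simp: messagesAC_def\<close>)
    then show ?thesis unfolding sum_label_div[OF i(1), where d=sA, folded eA] fst_conv snd_conv .
  qed
  let ?F = "\<lambda>z w s1 s2 b y b' y'. (rowAC k w (i * sA + s1) y * rowB k z (j * sB + s2) b) * \<Omega> ((b, e), y) ((b', e'), y') *
     cnj (rowAC k w (i * sA + s1) y' * rowB k z (j * sB + s2) b')"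
  have "(\<Sum>l | l \<in> {..<length (PB k)} \<times> {..<eB} \<and> snd l div sB = j. \<Sum>b<NB. \<Sum>b'<NB.
      rowB k (fst l) (snd l) b * \<tau> k i (b, e) (b', e') * cnj (rowB k (fst l) (snd l) b')) =
    (\<Sum>z<length (PB k). \<Sum>s2<sB. \<Sum>b<NB. \<Sum>b'<NB. \<Sum>w\<in>WA k. \<Sum>s1<sA. \<Sum>y\<in>AC. \<Sum>y'\<in>AC. ?F z w s1 s2 b y b' y')"
    unfolding eB sum_label_div[OF i(2)] \<tau> by (simp add: sum_distrib_left sum_distrib_right mult_ac)
  also have "\<dots> = (\<Sum>(z, s2, b, b', w, s1, y, y')\<in>{..<length (PB k)} \<times> {..<sB} \<times> {..<NB} \<times> {..<NB} \<times> WA k \<times> {..<sA} \<times> AC \<times> AC.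
     ?F z w s1 s2 b y b' y')"
    by (simp only: sum.cartesian_product'[of _ _ "_ \<times> _"] sum.cartesian_product'[of _ AC AC] case_prod_unfold fst_conv snd_conv)
  also have "\<dots> = (\<Sum>(s1, s2, q, h, h')\<in>{..<sA} \<times> {..<sB} \<times> (WA k \<times> {..<length (PB k)}) \<times> ({..<NB} \<times> AC) \<times> ({..<NB} \<times> AC).
     ?F (snd q) (fst q) s1 s2 (fst h) (snd h) (fst h') (snd h'))"
    by (rule sum.reindex_bij_witness[where i="\<lambda>(s1, s2, q, h, h'). (snd q, s2, fst h, fst h', fst q, s1, snd h, snd h')"
        and j="\<lambda>(z, s2, b, b', w, s1, y, y'). (s1, s2, (w, z), (b, y), (b', y'))"]) auto
  also have "\<dots> = (\<Sum>s1<sA. \<Sum>s2<sB. \<Sum>q\<in>WA k \<times> {..<length (PB k)}. \<Sum>h\<in>{..<NB} \<times> AC. \<Sum>h'\<in>{..<NB} \<times> AC.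
     ?F (snd q) (fst q) s1 s2 (fst h) (snd h) (fst h') (snd h'))"
    by (simp only: sum.cartesian_product'[of _ "{..<sA}"] sum.cartesian_product'[of _ "{..<sB}"]
        sum.cartesian_product'[of _ "WA k \<times> {..<length (PB k)}"] sum.cartesian_product'[of _ "{..<NB} \<times> AC" "{..<NB} \<times> AC"]
        case_prod_unfold fst_conv snd_conv)
  also have "\<dots> = (\<Sum>t<sA * sB. output_block \<Omega> k (i * sA + t div sB, j * sB + t mod sB) (i * sA + t div sB, j * sB + t mod sB) e e')"
    unfolding sum_mixed_radix by (intro sum.cong refl) (simp add: output_block_def)
  finally show ?thesis .
qed

text \<open>Bob's channel is complete for each message and is summed first; what remains is the
  completeness of the joint measurement of Alice and Charlie.\<close>

lemma trace_output_block:
  fixes \<Omega> :: "(nat \<times> 'e) \<times> (nat \<times> nat) \<Rightarrow> (nat \<times> 'e) \<times> (nat \<times> nat) \<Rightarrow> complex"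
  shows "(\<Sum>\<alpha><eA. \<Sum>\<beta><eB. \<Sum>k<length P. output_block \<Omega> k (\<alpha>, \<beta>) (\<alpha>, \<beta>) e e) = (\<Sum>b<NB. \<Sum>y\<in>AC. \<Omega> ((b, e), y) ((b, e), y))"
proof -
  let ?f = "\<lambda>k w \<alpha> b b'. \<Sum>y\<in>AC. \<Sum>y'\<in>AC. rowAC k w \<alpha> y * \<Omega> ((b, e), y) ((b', e), y') * cnj (rowAC k w \<alpha> y')"
  have "(\<Sum>\<beta><eB. output_block \<Omega> k (\<alpha>, \<beta>) (\<alpha>, \<beta>) e e) = (\<Sum>w\<in>WA k. \<Sum>b<NB. ?f k w \<alpha> b b)"
    if "k < length P" for k \<alpha>
  proof -
    let ?g = "\<lambda>w z \<beta> b y b' y'. (rowAC k w \<alpha> y * rowB k z \<beta> b) * \<Omega> ((b, e), y) ((b', e), y') * cnj (rowAC k w \<alpha> y' * rowB k z \<beta> b')"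
    have "(\<Sum>\<beta><eB. output_block \<Omega> k (\<alpha>, \<beta>) (\<alpha>, \<beta>) e e) =
      (\<Sum>(\<beta>, q, h, h')\<in>{..<eB} \<times> (WA k \<times> {..<length (PB k)}) \<times> ({..<NB} \<times> AC) \<times> ({..<NB} \<times> AC).
        ?g (fst q) (snd q) \<beta> (fst h) (snd h) (fst h') (snd h'))"
      by (simp only: output_block_def sum.cartesian_product'[of _ "{..<eB}"]
        sum.cartesian_product'[of _ "WA k \<times> {..<length (PB k)}"] sum.cartesian_product'[of _ "{..<NB} \<times> AC" "{..<NB} \<times> AC"]
        case_prod_unfold fst_conv snd_conv)
    also have "\<dots> = (\<Sum>(w, l, b, b', y, y')\<in>WA k \<times> ({..<length (PB k)} \<times> {..<eB}) \<times> {..<NB} \<times> {..<NB} \<times> AC \<times> AC.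
        ?g w (fst l) (snd l) b y b' y')"
      by (rule sum.reindex_bij_witness[where i="\<lambda>(w, l, b, b', y, y'). (snd l, (w, fst l), (b, y), (b', y'))"
        and j="\<lambda>(\<beta>, q, h, h'). (fst q, (snd q, \<beta>), fst h, fst h', snd h, snd h')"]) auto
    also have "\<dots> = (\<Sum>w\<in>WA k. \<Sum>l\<in>{..<length (PB k)} \<times> {..<eB}. \<Sum>b<NB. \<Sum>b'<NB. \<Sum>y\<in>AC. \<Sum>y'\<in>AC. ?g w (fst l) (snd l) b y b' y')"
      by (simp only: sum.cartesian_product'[of _ "WA k"] sum.cartesian_product'[of _ "{..<length (PB k)} \<times> {..<eB}"]
         sum.cartesian_product'[of _ "{..<NB}"] sum.cartesian_product'[of _ AC AC] case_prod_unfold fst_conv snd_conv)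
    also have "\<dots> = (\<Sum>w\<in>WA k. \<Sum>l\<in>{..<length (PB k)} \<times> {..<eB}. \<Sum>b<NB. \<Sum>b'<NB.
        rowB k (fst l) (snd l) b * ?f k w \<alpha> b b' * cnj (rowB k (fst l) (snd l) b'))"
      by (simp only: sum_distrib_left sum_distrib_right complex_cnj_mult mult_ac)
    also have "\<dots> = (\<Sum>w\<in>WA k. \<Sum>b<NB. ?f k w \<alpha> b b)"
      by (intro sum.cong refl isometric_complete[OF _ _ isometric_rowB[OF that]]) auto
    finally show ?thesis .
  qed
  note bob = this
  have "(\<Sum>\<alpha><eA. \<Sum>\<beta><eB. \<Sum>k<length P. output_block \<Omega> k (\<alpha>, \<beta>) (\<alpha>, \<beta>) e e) =
    (\<Sum>\<alpha><eA. \<Sum>k<length P. \<Sum>\<beta><eB. output_block \<Omega> k (\<alpha>, \<beta>) (\<alpha>, \<beta>) e e)"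
    by (intro sum.cong refl sum.swap)
  also have "\<dots> = (\<Sum>\<alpha><eA. \<Sum>k<length P. \<Sum>w\<in>WA k. \<Sum>b<NB. ?f k w \<alpha> b b)"
    by (intro sum.cong refl bob) simp
  also have "\<dots> = (\<Sum>k<length P. \<Sum>\<alpha><eA. \<Sum>w\<in>WA k. \<Sum>b<NB. ?f k w \<alpha> b b)"
    by (rule sum.swap)
  also have "\<dots> = (\<Sum>k<length P. \<Sum>l\<in>WA k \<times> {..<eA}. \<Sum>b<NB. ?f k (fst l) (snd l) b b)"
    by (intro sum.cong refl) (simp only: sum.cartesian_product'[of _ "WA _"] fst_conv snd_conv, rule sum.swap)
  also have "\<dots> = (\<Sum>l\<in>messagesAC. \<Sum>b<NB. ?f (fst l) (fst (snd l)) (snd (snd l)) b b)"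
    using sum.Sigma[of "{..<length P}" "\<lambda>k. WA k \<times> {..<eA}" "\<lambda>k l. \<Sum>b<NB. ?f k (fst l) (snd l) b b"]
    by (simp add: messagesAC_def case_prod_unfold)
  also have "\<dots> = (\<Sum>b<NB. \<Sum>l\<in>messagesAC. ?f (fst l) (fst (snd l)) (snd (snd l)) b b)"
    by (rule sum.swap)
  also have "\<dots> = (\<Sum>b<NB. \<Sum>y\<in>AC. \<Omega> ((b, e), y) ((b, e), y))"
    by (intro sum.cong refl isometric_complete[OF _ _ isometric_rowAC]) (auto simp: messagesAC_def)
  finally show ?thesis .
qed

end

(* By ext, \<Omega> extends the partial transpose of X on C: the positions of c and c' are exchanged. *)
theorem one_shot_key_bound:
  fixes \<Omega> :: "(nat \<times> 'e) \<times> (nat \<times> nat) \<Rightarrow> (nat \<times> 'e) \<times> (nat \<times> nat) \<Rightarrow> complex"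
  assumes P: "is_oneway_LOCC NA NC NB (2 ^ m * sA) eC (2 ^ m * sB) P"
    and \<gamma>: "is_private_state m sA sB \<gamma>"
    and X: "X \<in> carrier_mat (NA * (NC * NB)) (NA * (NC * NB))"
    and close: "trace_norm (marginal [2 ^ m * sA, eC, 2 ^ m * sB] [0, 2] (apply_protocol (2 ^ m * sA) eC (2 ^ m * sB) P X) - \<gamma>) \<le> \<epsilon>"
    and E[simp]: "finite E" and \<Omega>: "psd_on (({..<NB} \<times> E) \<times> ({..<NA} \<times> {..<NC})) \<Omega>"
    and tr: "(\<Sum>x\<in>({..<NB} \<times> E) \<times> ({..<NA} \<times> {..<NC}). \<Omega> x x) = 1"
    and ext: "\<And>a c b a' c' b'. a < NA \<Longrightarrow> c < NC \<Longrightarrow> b < NB \<Longrightarrow> a' < NA \<Longrightarrow> c' < NC \<Longrightarrow> b' < NB \<Longrightarrow>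
      (\<Sum>e\<in>E. \<Omega> ((b, e), (a, c)) ((b', e), (a', c'))) = X $$ (a * (NC * NB) + (c' * NB + b), a' * (NC * NB) + (c * NB + b'))"
  defines "Y \<equiv> {..<NA} \<times> {..<NC}"
  shows "(1 - 7 * \<epsilon>) * real m - 4 \<le>
    ent (E \<times> Y) (\<lambda>x y. \<Sum>b<NB. \<Omega> ((b, fst x), snd x) ((b, fst y), snd y)) - ent (({..<NB} \<times> E) \<times> Y) \<Omega>
      + ent ({..<NB} \<times> E) (ptrace Y \<Omega>) - ent E (\<lambda>e e'. \<Sum>b<NB. ptrace Y \<Omega> (b, e) (b, e'))"
proof -
  define K where "K = (2 ^ m :: nat)"
  define S where "S = sA * sB"
  define eA where "eA = K * sA"
  define eB where "eB = K * sB"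
  have K: "0 < K" "real K = 2 ^ m" by (auto simp: K_def)
  interpret oneway_protocol NA NC NB eA eC eB P
    using P by unfold_locales (simp add: eA_def eB_def K_def)
  define out where "out = marginal [eA, eC, eB] [0, 2] (apply_protocol eA eC eB P X)"
  obtain \<sigma> U where \<sigma>: "is_state S \<sigma>" and U: "\<And>i. i < K \<Longrightarrow> is_unitary S (U i)"
    and \<gamma>c: "\<gamma> \<in> carrier_mat (eA * eB) (eA * eB)"
    and \<gamma>e: "\<And>x y. x \<in> ({..<K} \<times> {..<K}) \<times> {..<S} \<Longrightarrow> y \<in> ({..<K} \<times> {..<K}) \<times> {..<S} \<Longrightarrow>
      \<gamma> $$ (key_shield_index K sA sB x, key_shield_index K sA sB y) =
      of_bool (fst (fst x) = snd (fst x)) * of_bool (fst (fst y) = snd (fst y)) *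
       (\<Sum>a<S. \<Sum>b<S. U (fst (fst x)) $$ (snd x, a) * \<sigma> $$ (a, b) * cnj (U (fst (fst y)) $$ (snd y, b))) / of_nat K"
    by (rule private_state_index[OF \<gamma>, folded K_def, folded eA_def eB_def S_def]) (rule that; assumption)
  define I where "I = {..<K}"
  define J where "J = (I \<times> I) \<times> {..<S}"
  define g where "g = key_shield_index K sA sB"
  define pos where "pos = (\<lambda>x :: (nat \<times> nat) \<times> nat. (fst (fst x) * sA + snd x div sB, snd (fst x) * sB + snd x mod sB))"
  have finIJ[simp]: "finite I" "finite J" by (auto simp: I_def J_def)
  have gpos: "g x = fst (pos x) * eB + snd (pos x)" for x
    by (simp add: g_def pos_def key_shield_index_def eB_def)
  have g: "bij_betw g J {..<eA * eB}"
    unfolding g_def J_def I_def S_def eA_def eB_def by (rule bij_key_shield_index)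
  have pos: "fst (pos x) < eA" "snd (pos x) < eB" if "x \<in> J" for x
  proof -
    have t: "snd x < sA * sB" "fst (fst x) < K" "snd (fst x) < K" using that by (auto simp: J_def I_def S_def)
    then have "0 < sB" by (cases "sB = 0") auto
    then show "fst (pos x) < eA" "snd (pos x) < eB"
      using t by (auto simp: pos_def eA_def eB_def mixed_radix_less less_mult_imp_div_less)
  qed
  define kk where "kk = {..<length P}"
  define Om where "Om = (\<lambda>x y. \<Sum>k\<in>kk. \<Sum>e\<in>E. output_block \<Omega> k (pos x) (pos y) e e)"
  have out_Om: "out $$ (g x, g y) = Om x y" if "x \<in> J" "y \<in> J" for x y
    using sum_output_block[OF X ext pos[OF that(1)] pos[OF that(2)]] unfolding gpos out_def Om_def kk_def by simp
  have outc: "out \<in> carrier_mat (eA * eB) (eA * eB)" unfolding out_def by (rule marginal_carrier)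
  define V where "V = (\<lambda>i t u. U i $$ (t, u))"
  have V1: "(\<Sum>u<S. cnj (V i t u) * V i t' u) = of_bool (t = t')" if "i \<in> I" "t < S" "t' < S" for i t t'
    using unitary_mat_columns(2)[OF U, of i t' t] that by (auto simp: V_def I_def mult.commute)
  have V2: "isometric {..<S} {..<S} (V i)" if "i \<in> I" for i
    using unitary_mat_columns(1)[OF U, of i] that by (auto simp: V_def I_def isometric_def)
  have \<sigma>tr: "(\<Sum>t<S. \<sigma> $$ (t, t)) = 1" and \<sigma>h: "hermitian_on {..<S} (\<lambda>i j. \<sigma> $$ (i, j))"
    using \<sigma> psd_on_hermitian[OF psd_imp_psd_on] by (auto simp: is_state_def mat_trace_def psd_def)
  define \<Gamma> where "\<Gamma> = (\<lambda>x y :: (nat \<times> nat) \<times> nat. of_bool (fst (fst x) = snd (fst x)) * of_bool (fst (fst y) = snd (fst y)) *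
       (\<Sum>a<S. \<Sum>b<S. V (fst (fst x)) (snd x) a * \<sigma> $$ (a, b) * cnj (V (fst (fst y)) (snd y) b)) / of_nat K)"
  have D: "(out - \<gamma>) $$ (g x, g y) = Om x y - \<Gamma> x y" if "x \<in> J" "y \<in> J" for x y
  proof -
    have "g x < eA * eB" "g y < eA * eB" using that bij_betwE[OF g] by auto
    then have "(out - \<gamma>) $$ (g x, g y) = out $$ (g x, g y) - \<gamma> $$ (g x, g y)" using \<gamma>c outc by simp
    also have "\<gamma> $$ (g x, g y) = \<Gamma> x y"
      using \<gamma>e[of x y] that by (simp add: g_def \<Gamma>_def V_def J_def I_def)
    finally show ?thesis using out_Om[OF that] by simp
  qed
  have Om_psd: "psd_on J Om"
  proof -
    have blk: "psd_on J (\<lambda>x y. output_block \<Omega> k (pos x) (pos y) e e)" if "e \<in> E" for k e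
      using psd_on_map[OF _ psd_on_output_block[OF E \<Omega>], of "\<lambda>x. (e, pos x)" J k] that pos
      by (auto simp: image_subset_iff mem_Times_iff)
    show ?thesis unfolding Om_def by (intro psd_on_sum blk)
  qed
  have \<Gamma>h: "cnj (\<Gamma> x y) = \<Gamma> y x" for x y
  proof -
    have sw: "cnj (\<Sum>a<S. \<Sum>b<S. V i t a * \<sigma> $$ (a, b) * cnj (V j s b)) = (\<Sum>a<S. \<Sum>b<S. V j s a * \<sigma> $$ (a, b) * cnj (V i t b))" for i j t s
    proof -
      have "cnj (\<Sum>a<S. \<Sum>b<S. V i t a * \<sigma> $$ (a, b) * cnj (V j s b)) = (\<Sum>a<S. \<Sum>b<S. V j s b * \<sigma> $$ (b, a) * cnj (V i t a))"
        unfolding cnj_sum by (intro sum.cong refl) (simp add: hermitian_onD[OF \<sigma>h] mult_ac)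
      then show ?thesis by (subst sum.swap)
    qed
    show ?thesis
      unfolding \<Gamma>_def complex_cnj_divide complex_cnj_mult cnj_of_bool sw complex_cnj_of_nat
      by (simp only: mult_ac)
  qed
  have Dh: "hermitian_on J (\<lambda>x y. (out - \<gamma>) $$ (g x, g y))"
    unfolding hermitian_on_def
  proof (intro ballI)
    fix x y assume "x \<in> J" "y \<in> J"
    then show "(out - \<gamma>) $$ (g y, g x) = cnj ((out - \<gamma>) $$ (g x, g y))"
      by (simp add: D \<Gamma>h hermitian_onD[OF psd_on_hermitian[OF Om_psd]])
  qed
  have Dc: "out - \<gamma> \<in> carrier_mat (eA * eB) (eA * eB)" using \<gamma>c by (rule minus_carrier_mat)
  have tn: "trace_norm (out - \<gamma>) \<le> \<epsilon>" using close by (simp add: out_def eA_def eB_def K_def)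
  \<comment> \<open>The closeness of the output to the private state is used only in this form: no
    projection distinguishes them by more than \<epsilon>, whatever the shield dimension.\<close>
  have test: "\<bar>Re (\<Sum>u\<in>W. \<Sum>x\<in>J. \<Sum>y\<in>J. cnj (w x u) * Om x y * w y u) - Re (\<Sum>u\<in>W. \<Sum>x\<in>J. \<Sum>y\<in>J. cnj (w x u) * \<Gamma> x y * w y u)\<bar> \<le> \<epsilon>"
    if "finite W" "isometric J W w" for W :: "'w set" and w
  proof -
    have "(\<Sum>u\<in>W. \<Sum>x\<in>J. \<Sum>y\<in>J. cnj (w x u) * (out - \<gamma>) $$ (g x, g y) * w y u) =
      (\<Sum>u\<in>W. \<Sum>x\<in>J. \<Sum>y\<in>J. cnj (w x u) * Om x y * w y u) - (\<Sum>u\<in>W. \<Sum>x\<in>J. \<Sum>y\<in>J. cnj (w x u) * \<Gamma> x y * w y u)"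
      by (simp add: D right_diff_distrib left_diff_distrib sum_subtractf cong: sum.cong)
    then show ?thesis
      using trace_norm_ge_reindex[OF g Dc Dh that] tn by simp
  qed
  \<comment> \<open>The empty family of test vectors already forces this.\<close>
  have \<epsilon>: "0 \<le> \<epsilon>" using test[of "{} :: nat set" "\<lambda>_ _. 0"] by (simp add: isometric_def)
  \<comment> \<open>undoing the twisting and tracing out the shield\<close>
  define R where "R = (\<lambda>x x' :: (nat \<times> nat) \<times> (nat \<times> 'e). of_bool (fst (snd x) = fst (snd x')) *
    (\<Sum>u<S. \<Sum>t<S. \<Sum>t'<S. cnj (V (fst (fst x)) t u) *
       output_block \<Omega> (fst (snd x)) (pos (fst x, t)) (pos (fst x', t')) (snd (snd x)) (snd (snd x')) * V (fst (fst x')) t' u))"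
  have R_psd: "psd_on ((I \<times> I) \<times> (kk \<times> E)) R"
  proof -
    define Q where "Q = (\<lambda>k z z' :: 'e \<times> (nat \<times> nat). \<Sum>u<S. \<Sum>t<S. \<Sum>t'<S. cnj (V (fst (snd z)) t u) *
       output_block \<Omega> k (pos (snd z, t)) (pos (snd z', t')) (fst z) (fst z') * V (fst (snd z')) t' u)"
    have "psd_on (E \<times> (I \<times> I)) (Q k)" for k
    proof -
      let ?B = "(E \<times> (I \<times> I)) \<times> {..<S}"
      let ?T = "\<lambda>x y. output_block \<Omega> k (pos (snd (fst x), snd x)) (pos (snd (fst y), snd y)) (fst (fst x)) (fst (fst y))"
      have "psd_on ?B ?T"
        using psd_on_map[OF _ psd_on_output_block[OF E \<Omega>], of "\<lambda>x. (fst (fst x), pos (snd (fst x), snd x))" ?B k] pos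
        by (auto simp: image_subset_iff mem_Times_iff J_def)
      from psd_on_kraus[OF this, where J="E \<times> (I \<times> I)" and S="{..<S}" and a="\<lambda>u z x. of_bool (z = fst x) * cnj (V (fst (snd z)) (snd x) u)"]
      have "psd_on (E \<times> (I \<times> I)) (\<lambda>z z'. \<Sum>u<S. \<Sum>x\<in>?B. \<Sum>y\<in>?B. of_bool (z = fst x) * cnj (V (fst (snd z)) (snd x) u) * ?T x y *
         cnj (of_bool (z' = fst y) * cnj (V (fst (snd z')) (snd y) u)))" .
      also have "?this \<longleftrightarrow> ?thesis"
      proof (intro psd_on_cong)
        fix z z' assume z: "z \<in> E \<times> (I \<times> I)" "z' \<in> E \<times> (I \<times> I)"
        have "(\<Sum>x\<in>?B. \<Sum>y\<in>?B. of_bool (z = fst x) * cnj (V (fst (snd z)) (snd x) u) * ?T x y *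
         cnj (of_bool (z' = fst y) * cnj (V (fst (snd z')) (snd y) u))) =
          (\<Sum>x\<in>E \<times> (I \<times> I). of_bool (z = x) * (\<Sum>t<S. \<Sum>y\<in>E \<times> (I \<times> I). of_bool (z' = y) * (\<Sum>t'<S. cnj (V (fst (snd z)) t u) *
             ?T (x, t) (y, t') * V (fst (snd z')) t' u)))" for u
          by (simp only: sum.cartesian_product'[of _ "E \<times> (I \<times> I)" "{..<S}"] fst_conv snd_conv sum_distrib_left complex_cnj_mult
             cnj_of_bool complex_cnj_cnj mult_ac)
        then show "(\<Sum>u<S. \<Sum>x\<in>?B. \<Sum>y\<in>?B. of_bool (z = fst x) * cnj (V (fst (snd z)) (snd x) u) * ?T x y *
         cnj (of_bool (z' = fst y) * cnj (V (fst (snd z')) (snd y) u))) = Q k z z'"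
          using z by (simp only: sum_of_bool_mult finite_cartesian_product E finIJ if_True Q_def fst_conv snd_conv)
      qed
      finally show ?thesis .
    qed
    then have "psd_on (kk \<times> (E \<times> (I \<times> I))) (\<lambda>x y. of_bool (fst x = fst y) * Q (fst x) (snd x) (snd y))"
      by (intro psd_on_block_diagonal) (auto simp: kk_def)
    from psd_on_map[OF _ this, of "\<lambda>x. (fst (snd x), (snd (snd x), fst x))" "(I \<times> I) \<times> (kk \<times> E)"]
    show ?thesis unfolding R_def Q_def fst_conv snd_conv by (auto simp: kk_def image_subset_iff)
  qed
  \<comment> \<open>On a diagonal block both sides carry the same unitary, selected by Alice's key
    \<open>i\<close>, and the sum over the shield removes it. Measured keys therefore do not see the
    untwisting.\<close>
  have R_diag: "R ((i, j), x) ((i, j), y) = of_bool (fst x = fst y) *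
      (\<Sum>t<S. output_block \<Omega> (fst x) (pos ((i, j), t)) (pos ((i, j), t)) (snd x) (snd y))" if "i \<in> I" for i j x y
  proof -
    let ?T = "\<lambda>t t'. output_block \<Omega> (fst x) (pos ((i, j), t)) (pos ((i, j), t')) (snd x) (snd y)"
    have "(\<Sum>u<S. \<Sum>t<S. \<Sum>t'<S. cnj (V i t u) * ?T t t' * V i t' u) = (\<Sum>t<S. \<Sum>t'<S. \<Sum>u<S. cnj (V i t u) * ?T t t' * V i t' u)"
      by (subst sum.swap, rule sum.cong[OF refl], rule sum.swap)
    also have "\<dots> = (\<Sum>t<S. \<Sum>t'<S. (\<Sum>u<S. cnj (V i t u) * V i t' u) * ?T t t')"
      by (simp only: sum_distrib_left sum_distrib_right mult_ac)
    also have "\<dots> = (\<Sum>t<S. \<Sum>t'<S. of_bool (t = t') * ?T t t')"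
      by (intro sum.cong refl) (simp only: V1[OF that] lessThan_iff)
    also have "\<dots> = (\<Sum>t<S. ?T t t)"
      by (intro sum.cong refl) (simp only: sum_of_bool_mult finite_lessThan if_True)
    finally show ?thesis by (simp add: R_def)
  qed
  define pp where "pp = (\<lambda>i j. \<Sum>x\<in>kk \<times> E. R ((i, j), x) ((i, j), x))"
  have pp: "pp i j = (\<Sum>t<S. Om ((i, j), t) ((i, j), t))" if "i \<in> I" for i j
  proof -
    have "pp i j = (\<Sum>k\<in>kk. \<Sum>e\<in>E. \<Sum>t<S. output_block \<Omega> k (pos ((i, j), t)) (pos ((i, j), t)) e e)"
      unfolding pp_def R_diag[OF that] by (simp add: sum.cartesian_product')
    also have "\<dots> = (\<Sum>t<S. \<Sum>k\<in>kk. \<Sum>e\<in>E. output_block \<Omega> k (pos ((i, j), t)) (pos ((i, j), t)) e e)"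
      by (subst (2) sum.swap, subst sum.swap, rule refl)
    finally show ?thesis by (simp add: Om_def)
  qed
  have ppQ: "(\<Sum>x\<in>Q. pp (fst x) (snd x)) = (\<Sum>u\<in>Q \<times> {..<S}. Om u u)" if "Q \<subseteq> I \<times> I" for Q
    using that by (auto simp: sum.cartesian_product' pp subset_iff intro!: sum.cong)
  have \<Gamma>diag: "(\<Sum>t<S. \<Gamma> ((i, j), t) ((i, j), t)) = of_bool (i = j) / of_nat K" if "i \<in> I" for i j
  proof -
    have "(\<Sum>t<S. \<Sum>a<S. \<Sum>b<S. V i t a * \<sigma> $$ (a, b) * cnj (V i t b)) = 1"
      using isometric_complete[OF _ _ V2[OF that], of "\<lambda>a b. \<sigma> $$ (a, b)"] \<sigma>tr by simp
    then show ?thesis by (simp add: \<Gamma>_def flip: sum_divide_distrib sum_distrib_left)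
  qed
  \<comment> \<open>The projection onto all basis vectors whose key pair lies in \<open>Q\<close>.
    Off-diagonal pairs give the error of correlation, and the pairs in \<open>I \<times> T\<close>
    give the uniformity of Bob's key.\<close>
  have diag_test: "\<bar>Re (\<Sum>x\<in>Q. pp (fst x) (snd x)) - Re (\<Sum>x\<in>Q. of_bool (fst x = snd x) / of_nat K)\<bar> \<le> \<epsilon>" if Q: "Q \<subseteq> I \<times> I" for Q
  proof -
    let ?W = "Q \<times> {..<S}" and ?w = "\<lambda>x u. of_bool (x = u)"
    have WJ: "?W \<subseteq> J" using Q by (auto simp: J_def)
    have fW: "finite ?W" using finite_subset[OF WJ] by simp
    have iso: "isometric J ?W ?w"
      unfolding isometric_def using WJ by (auto simp only: cnj_of_bool sum_of_bool_mult finIJ subset_iff if_True)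
    have pick: "(\<Sum>u\<in>?W. \<Sum>x\<in>J. \<Sum>y\<in>J. cnj (?w x u) * M x y * ?w y u) = (\<Sum>u\<in>?W. M u u)" for M :: "_ \<Rightarrow> _ \<Rightarrow> complex"
    proof (rule sum.cong[OF refl])
      fix u assume "u \<in> ?W"
      then have "u \<in> J" using WJ by blast
      then show "(\<Sum>x\<in>J. \<Sum>y\<in>J. cnj (?w x u) * M x y * ?w y u) = M u u"
        by (simp only: cnj_of_bool sum_of_bool_mult finIJ if_True)
    qed
    have "(\<Sum>u\<in>?W. \<Gamma> u u) = (\<Sum>x\<in>Q. of_bool (fst x = snd x) / of_nat K)"
      using Q by (auto simp: sum.cartesian_product'[of _ Q] \<Gamma>diag subset_iff intro!: sum.cong)
    then show ?thesis using test[OF fW iso] unfolding pick ppQ[OF Q] by simp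
  qed
  have trR: "(\<Sum>x\<in>(I \<times> I) \<times> (kk \<times> E). R x x) = 1"
  proof -
    have "(\<Sum>x\<in>(I \<times> I) \<times> (kk \<times> E). R x x) = (\<Sum>x\<in>I \<times> I. pp (fst x) (snd x))"
      by (simp only: sum.cartesian_product'[of _ "I \<times> I" "kk \<times> E"] pp_def prod.collapse)
    also have "\<dots> = (\<Sum>u\<in>J. Om u u)" using ppQ[of "I \<times> I"] by (simp add: J_def)
    also have "\<dots> = (\<Sum>u\<in>J. out $$ (g u, g u))" by (simp add: out_Om cong: sum.cong)
    also have "\<dots> = (\<Sum>n<eA * eB. out $$ (n, n))" by (rule sum.reindex_bij_betw[OF g])
    also have "\<dots> = (\<Sum>\<alpha><eA. \<Sum>\<beta><eB. \<Sum>k<length P. \<Sum>e\<in>E. output_block \<Omega> k (\<alpha>, \<beta>) (\<alpha>, \<beta>) e e)"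
      unfolding sum_mixed_radix out_def by (intro sum.cong refl sum_output_block[OF X ext, symmetric]) auto
    also have "\<dots> = (\<Sum>\<alpha><eA. \<Sum>\<beta><eB. \<Sum>e\<in>E. \<Sum>k<length P. output_block \<Omega> k (\<alpha>, \<beta>) (\<alpha>, \<beta>) e e)"
      by (intro sum.cong refl sum.swap)
    also have "\<dots> = (\<Sum>e\<in>E. \<Sum>\<alpha><eA. \<Sum>\<beta><eB. \<Sum>k<length P. output_block \<Omega> k (\<alpha>, \<beta>) (\<alpha>, \<beta>) e e)"
      by (subst (2) sum.swap, subst sum.swap, rule refl)
    also have "\<dots> = (\<Sum>e\<in>E. \<Sum>b<NB. \<Sum>y\<in>{..<NA} \<times> {..<NC}. \<Omega> ((b, e), y) ((b, e), y))"
      by (simp only: trace_output_block)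
    also have "\<dots> = (\<Sum>x\<in>({..<NB} \<times> E) \<times> ({..<NA} \<times> {..<NC}). \<Omega> x x)"
      unfolding sum.cartesian_product'[of _ "{..<NB} \<times> E"] sum.cartesian_product'[of _ "{..<NB}" E] by (rule sum.swap)
    finally show ?thesis using tr by simp
  qed
  define \<Theta> where "\<Theta> = (\<lambda>i j x y. R ((i, j), x) ((i, j), y))"
  have key: "(1 - 7 * \<epsilon>) * log 2 (real K) - 4 \<le>
    (\<Sum>i\<in>I. ent (kk \<times> E) (\<lambda>x y. \<Sum>j\<in>I. \<Theta> i j x y)) + (\<Sum>j\<in>I. ent (kk \<times> E) (\<lambda>x y. \<Sum>i\<in>I. \<Theta> i j x y))
      - (\<Sum>i\<in>I. \<Sum>j\<in>I. ent (kk \<times> E) (\<Theta> i j)) - ent (kk \<times> E) (\<lambda>x y. \<Sum>i\<in>I. \<Sum>j\<in>I. \<Theta> i j x y)"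
    unfolding \<Theta>_def
  proof (rule key_cond_mutual_info_ge[OF _ _ _ _ R_psd trR \<epsilon>])
    show "Re (\<Sum>i\<in>I. \<Sum>j\<in>I - {i}. \<Sum>x\<in>kk \<times> E. R ((i, j), x) ((i, j), x)) \<le> \<epsilon>"
    proof -
      have e: "(\<Sum>i\<in>I. \<Sum>j\<in>I - {i}. pp i j) = (\<Sum>x\<in>(SIGMA i:I. I - {i}). pp (fst x) (snd x))"
        by (subst sum.Sigma) (auto simp: case_prod_unfold)
      have z: "(\<Sum>x\<in>(SIGMA i:I. I - {i}). of_bool (fst x = snd x) / complex_of_nat K) = 0"
        by (intro sum.neutral) auto
      have "(SIGMA i:I. I - {i}) \<subseteq> I \<times> I" by auto
      from diag_test[OF this] have "Re (\<Sum>i\<in>I. \<Sum>j\<in>I - {i}. pp i j) \<le> \<epsilon>" unfolding z e[symmetric] by simp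
      then show ?thesis unfolding pp_def .
    qed
    show "Re (\<Sum>j\<in>T. \<Sum>i\<in>I. \<Sum>x\<in>kk \<times> E. R ((i, j), x) ((i, j), x)) \<le> real (card T) / real K + \<epsilon>" if T: "T \<subseteq> I" for T
    proof -
      have fT: "finite T" using T finite_subset finIJ by blast
      have e: "(\<Sum>j\<in>T. \<Sum>i\<in>I. pp i j) = (\<Sum>x\<in>I \<times> T. pp (fst x) (snd x))"
        by (subst sum.swap) (simp add: sum.cartesian_product')
      have "(\<Sum>x\<in>I \<times> T. of_bool (fst x = snd x) / complex_of_nat K) = (\<Sum>j\<in>T. \<Sum>i\<in>I. of_bool (i = j) * (1 / complex_of_nat K))"
        by (subst sum.swap) (simp add: sum.cartesian_product')
      also have "\<dots> = (\<Sum>j\<in>T. 1 / complex_of_nat K)"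
        using T by (intro sum.cong refl) (simp only: sum_of_bool_mult finIJ subset_iff if_True)
      finally have z: "(\<Sum>x\<in>I \<times> T. of_bool (fst x = snd x) / complex_of_nat K) = of_real (real (card T) / real K)"
        by simp
      have "I \<times> T \<subseteq> I \<times> I" using T by auto
      from diag_test[OF this] have "Re (\<Sum>j\<in>T. \<Sum>i\<in>I. pp i j) \<le> real (card T) / real K + \<epsilon>"
        unfolding z e[symmetric] Re_complex_of_real by linarith
      then show ?thesis unfolding pp_def .
    qed
    show "1 - \<epsilon> \<le> Re (\<Sum>i\<in>I. \<Sum>j\<in>I. \<Sum>x\<in>kk \<times> E. R ((i, i), x) ((j, j), x)) / real K"
    proof -
      \<comment> \<open>Column \<open>u\<close> is the twisted maximally entangled state: the
        normalised sum over \<open>i\<close> of |ii> tensor U_i |u>. The projection onto these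
        columns has expectation 1 in the private state, hence at least 1 - \<epsilon> in the output,
        where it measures the overlap of the untwisted key with a maximally entangled state.\<close>
      define w where "w = (\<lambda>(x :: (nat \<times> nat) \<times> nat) u. of_bool (fst (fst x) = snd (fst x)) * (V (fst (fst x)) (snd x) u / complex_of_real (sqrt (real K))))"
      have sK: "complex_of_real (sqrt (real K)) * complex_of_real (sqrt (real K)) = of_nat K"
        by (metis of_real_mult of_real_of_nat_eq real_sqrt_mult_self abs_of_nat)
      have iso: "isometric J {..<S} w"
        unfolding isometric_def
      proof (intro ballI)
        fix u u' assume u: "u \<in> {..<S}" "u' \<in> {..<S}"
        have "(\<Sum>x\<in>J. cnj (w x u) * w x u') = (\<Sum>i\<in>I. \<Sum>j\<in>I. of_bool (i = j) * (\<Sum>t<S. cnj (V i t u) * V i t u') / of_nat K)"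
          unfolding J_def sum.cartesian_product' sum_distrib_left sum_divide_distrib
          by (intro sum.cong refl) (simp add: w_def flip: sK)
        also have "\<dots> = (\<Sum>i\<in>I. \<Sum>j\<in>I. of_bool (i = j) * (of_bool (u = u') / of_nat K))"
          using V2 u unfolding isometric_def by (intro sum.cong refl) simp
        also have "\<dots> = (\<Sum>i\<in>I. of_bool (u = u') / of_nat K)"
          by (intro sum.cong refl) (simp only: sum_of_bool_mult finIJ if_True)
        also have "\<dots> = of_bool (u = u')" using K(1) by (simp add: I_def)
        finally show "(\<Sum>x\<in>J. cnj (w x u) * w x u') = of_bool (u = u')" .
      qed
      have W: "(\<Sum>u<S. \<Sum>x\<in>J. \<Sum>y\<in>J. cnj (w x u) * M x y * w y u) =
        (\<Sum>i\<in>I. \<Sum>j\<in>I. \<Sum>u<S. \<Sum>t<S. \<Sum>t'<S. cnj (V i t u) * M ((i, i), t) ((j, j), t') * V j t' u) / of_nat K" for M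
      proof -
        have "(\<Sum>x\<in>J. \<Sum>y\<in>J. cnj (w x u) * M x y * w y u) =
          (\<Sum>i\<in>I. \<Sum>j\<in>I. \<Sum>t<S. \<Sum>t'<S. cnj (V i t u) * M ((i, i), t) ((j, j), t') * V j t' u) / of_nat K" for u
        proof -
          have "(\<Sum>x\<in>J. \<Sum>y\<in>J. cnj (w x u) * M x y * w y u) =
            (\<Sum>i\<in>I. \<Sum>i'\<in>I. of_bool (i = i') * (\<Sum>t<S. \<Sum>j\<in>I. \<Sum>j'\<in>I. of_bool (j = j') *
               (\<Sum>t'<S. cnj (V i t u) * M ((i, i'), t) ((j, j'), t') * V j t' u / of_nat K)))"
            unfolding J_def sum.cartesian_product' sum_distrib_left
            by (intro sum.cong refl) (simp add: w_def flip: sK)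
          also have "\<dots> = (\<Sum>i\<in>I. \<Sum>t<S. \<Sum>j\<in>I. \<Sum>t'<S. cnj (V i t u) * M ((i, i), t) ((j, j), t') * V j t' u / of_nat K)"
            by (simp only: sum_diagonal[OF finIJ(1)])
          also have "\<dots> = (\<Sum>i\<in>I. \<Sum>j\<in>I. \<Sum>t<S. \<Sum>t'<S. cnj (V i t u) * M ((i, i), t) ((j, j), t') * V j t' u / of_nat K)"
            by (intro sum.cong refl sum.swap)
          finally show ?thesis by (simp only: sum_divide_distrib)
        qed
        then have "(\<Sum>u<S. \<Sum>x\<in>J. \<Sum>y\<in>J. cnj (w x u) * M x y * w y u) =
          (\<Sum>u<S. \<Sum>i\<in>I. \<Sum>j\<in>I. \<Sum>t<S. \<Sum>t'<S. cnj (V i t u) * M ((i, i), t) ((j, j), t') * V j t' u) / of_nat K"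
          by (simp only: sum_divide_distrib[symmetric])
        also have "(\<Sum>u<S. \<Sum>i\<in>I. \<Sum>j\<in>I. \<Sum>t<S. \<Sum>t'<S. cnj (V i t u) * M ((i, i), t) ((j, j), t') * V j t' u) =
          (\<Sum>i\<in>I. \<Sum>j\<in>I. \<Sum>u<S. \<Sum>t<S. \<Sum>t'<S. cnj (V i t u) * M ((i, i), t) ((j, j), t') * V j t' u)"
          by (subst sum.swap, rule sum.cong[OF refl], rule sum.swap)
        finally show ?thesis .
      qed
      have "(\<Sum>u<S. \<Sum>x\<in>J. \<Sum>y\<in>J. cnj (w x u) * \<Gamma> x y * w y u) = 1"
      proof -
        have one: "(\<Sum>u<S. \<Sum>t<S. \<Sum>t'<S. cnj (V i t u) * \<Gamma> ((i, i), t) ((j, j), t') * V j t' u) = 1 / of_nat K" if ij: "i \<in> I" "j \<in> I" for i j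
        proof -
          have "(\<Sum>t<S. \<Sum>t'<S. cnj (V i t u) * \<Gamma> ((i, i), t) ((j, j), t') * V j t' u) = \<sigma> $$ (u, u) / of_nat K" if u: "u < S" for u
          proof -
            have "(\<Sum>t<S. \<Sum>t'<S. cnj (V i t u) * \<Gamma> ((i, i), t) ((j, j), t') * V j t' u) =
              (\<Sum>t<S. \<Sum>t'<S. \<Sum>a<S. \<Sum>b<S. (cnj (V i t u) * V i t a) * ((cnj (V j t' b) * V j t' u) * (\<sigma> $$ (a, b) / of_nat K)))"
              by (simp add: \<Gamma>_def sum_distrib_left sum_distrib_right sum_divide_distrib mult_ac)
            also have "\<dots> = (\<Sum>a<S. \<Sum>b<S. \<Sum>t<S. \<Sum>t'<S. (cnj (V i t u) * V i t a) * ((cnj (V j t' b) * V j t' u) * (\<sigma> $$ (a, b) / of_nat K)))"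
              by (rule sum_swap_pairs)
            also have "\<dots> = (\<Sum>a<S. \<Sum>b<S. (\<Sum>t<S. cnj (V i t u) * V i t a) * ((\<Sum>t'<S. cnj (V j t' b) * V j t' u) * (\<sigma> $$ (a, b) / of_nat K)))"
              by (simp only: sum_product[symmetric] sum_distrib_right[symmetric])
            also have "\<dots> = (\<Sum>a<S. \<Sum>b<S. of_bool (u = a) * (of_bool (b = u) * (\<sigma> $$ (a, b) / of_nat K)))"
              using V2[OF ij(1)] V2[OF ij(2)] u unfolding isometric_def by (intro sum.cong refl) auto
            also have "\<dots> = \<sigma> $$ (u, u) / of_nat K"
              using u by (simp only: sum_distrib_left[symmetric] sum_of_bool_mult finite_lessThan lessThan_iff if_True)
            finally show ?thesis .
          qed
          then show ?thesis using \<sigma>tr by (simp flip: sum_divide_distrib)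
        qed
        have "(\<Sum>i\<in>I. \<Sum>j\<in>I. \<Sum>u<S. \<Sum>t<S. \<Sum>t'<S. cnj (V i t u) * \<Gamma> ((i, i), t) ((j, j), t') * V j t' u) =
          (\<Sum>i\<in>I. \<Sum>j\<in>I. 1 / of_nat K)"
          by (rule sum.cong[OF refl], rule sum.cong[OF refl], rule one)
        also have "\<dots> / of_nat K = 1" using K(1) by (simp add: I_def)
        finally show ?thesis unfolding W .
      qed
      with test[OF _ iso] have "1 - \<epsilon> \<le> Re (\<Sum>u<S. \<Sum>x\<in>J. \<Sum>y\<in>J. cnj (w x u) * Om x y * w y u)"
        by (simp add: abs_le_iff)
      also have "(\<Sum>u<S. \<Sum>x\<in>J. \<Sum>y\<in>J. cnj (w x u) * Om x y * w y u) =
        (\<Sum>i\<in>I. \<Sum>j\<in>I. \<Sum>x\<in>kk \<times> E. R ((i, i), x) ((j, j), x)) / of_nat K"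
      proof -
        have "(\<Sum>x\<in>kk \<times> E. R ((i, i), x) ((j, j), x)) = (\<Sum>u<S. \<Sum>t<S. \<Sum>t'<S. cnj (V i t u) * Om ((i, i), t) ((j, j), t') * V j t' u)" for i j
        proof -
          let ?T = "\<lambda>x t t'. output_block \<Omega> (fst x) (pos ((i, i), t)) (pos ((j, j), t')) (snd x) (snd x)"
          have "(\<Sum>x\<in>kk \<times> E. R ((i, i), x) ((j, j), x)) = (\<Sum>x\<in>kk \<times> E. \<Sum>u<S. \<Sum>t<S. \<Sum>t'<S. cnj (V i t u) * ?T x t t' * V j t' u)"
            by (simp add: R_def)
          also have "\<dots> = (\<Sum>u<S. \<Sum>t<S. \<Sum>t'<S. \<Sum>x\<in>kk \<times> E. cnj (V i t u) * ?T x t t' * V j t' u)"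
            by (rule sum_swap_inner)
          also have "\<dots> = (\<Sum>u<S. \<Sum>t<S. \<Sum>t'<S. cnj (V i t u) * Om ((i, i), t) ((j, j), t') * V j t' u)"
            by (simp only: sum_distrib_left[symmetric] sum_distrib_right[symmetric] Om_def sum.cartesian_product' fst_conv snd_conv)
          finally show ?thesis .
        qed
        then show ?thesis unfolding W by simp
      qed
      finally show ?thesis by (simp add: Re_divide_of_nat)
    qed
  qed (use K in \<open>auto simp: kk_def I_def\<close>)
  define \<tau> where "\<tau> = (\<lambda>k i z z'. \<Sum>l | l \<in> messagesAC \<and> (fst l, snd (snd l) div sA) = (k, i). \<Sum>y\<in>Y. \<Sum>y'\<in>Y.
     rowAC (fst l) (fst (snd l)) (snd (snd l)) y * \<Omega> (z, y) (z', y') * cnj (rowAC (fst l) (fst (snd l)) (snd (snd l)) y'))"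
  define \<theta> where "\<theta> = (\<lambda>k i j e e'. \<Sum>l | l \<in> {..<length (PB k)} \<times> {..<eB} \<and> snd l div sB = j. \<Sum>b<NB. \<Sum>b'<NB.
      rowB k (fst l) (snd l) b * \<tau> k i (b, e) (b', e') * cnj (rowB k (fst l) (snd l) b'))"
  define \<Theta>' where "\<Theta>' = (\<lambda>i j x y. of_bool (fst x = fst y) * \<theta> (fst x) i j (snd x) (snd y))"
  \<comment> \<open>The measured blocks coincide with the diagonal blocks of the untwisted coherent
    state. So the upper bound from data processing and the lower bound \<open>key\<close> speak of
    the same quantity.\<close>
  have \<Theta>: "\<Theta>' i j x y = \<Theta> i j x y" if "i \<in> I" "j \<in> I" "x \<in> kk \<times> E" for i j x y
  proof -
    have "fst x < length P" "i < K" "j < K" using that by (auto simp: kk_def I_def)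
    from measured_output_block[OF eA_def eB_def this, of \<Omega> "snd x" "snd y"] show ?thesis
      unfolding \<Theta>'_def \<theta>_def \<tau>_def \<Theta>_def R_diag[OF that(1)] Y_def pos_def S_def fst_conv snd_conv by simp
  qed
  have ne: "{..<NB} \<noteq> {}" "Y \<noteq> {}" using tr unfolding Y_def by (auto simp del: lessThan_iff)
  have lab: "(\<lambda>l. (fst l, snd (snd l) div sA)) ` messagesAC \<subseteq> kk \<times> I"
    using less_mult_imp_div_less[of _ K sA, folded eA_def]
    by (auto simp: messagesAC_def kk_def I_def)
  have labB: "(\<lambda>l. snd l div sB) ` ({..<length (PB k)} \<times> {..<eB}) \<subseteq> I" for k
    using less_mult_imp_div_less[of _ K sB, folded eB_def] by (auto simp: I_def)
  have neK: "kk \<noteq> {}"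
  proof
    assume kk0: "kk = {}"
    obtain c where "c < NC" using ne(2) by (auto simp: Y_def)
    from charlie_complete[OF this this] kk0 show False by (simp add: kk_def)
  qed
  have "(\<Sum>i\<in>I. ent (kk \<times> E) (\<lambda>x y. \<Sum>j\<in>I. \<Theta>' i j x y)) + (\<Sum>j\<in>I. ent (kk \<times> E) (\<lambda>x y. \<Sum>i\<in>I. \<Theta>' i j x y))
      - (\<Sum>i\<in>I. \<Sum>j\<in>I. ent (kk \<times> E) (\<Theta>' i j)) - ent (kk \<times> E) (\<lambda>x y. \<Sum>i\<in>I. \<Sum>j\<in>I. \<Theta>' i j x y)
    \<le> ent (E \<times> Y) (\<lambda>x y. \<Sum>b<NB. \<Omega> ((b, fst x), snd x) ((b, fst y), snd y)) - ent (({..<NB} \<times> E) \<times> Y) \<Omega>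
      + ent ({..<NB} \<times> E) (ptrace Y \<Omega>) - ent E (\<lambda>e e'. \<Sum>b<NB. ptrace Y \<Omega> (b, e) (b, e'))"
    unfolding \<Theta>'_def \<theta>_def \<tau>_def
    using lab labB
    by (intro measured_cond_mutual_info_le[where L=messagesAC and lab="\<lambda>l. (fst l, snd (snd l) div sA)"
        and M="\<lambda>k. {..<length (PB k)} \<times> {..<eB}" and s="\<lambda>k l. rowB k (fst l) (snd l)" and labB="\<lambda>k l. snd l div sB"
        and r="\<lambda>l. rowAC (fst l) (fst (snd l)) (snd (snd l))"])
      (use ne neK \<Omega> isometric_rowAC isometric_rowB in
        \<open>simp_all add: Y_def messagesAC_def kk_def I_def\<close>)
  moreover have "ent (kk \<times> E) (\<lambda>x y. \<Sum>j\<in>I. \<Theta>' i j x y) = ent (kk \<times> E) (\<lambda>x y. \<Sum>j\<in>I. \<Theta> i j x y)" if "i \<in> I" for i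
    using that by (intro ent_cong sum.cong refl \<Theta>) (auto simp: kk_def)
  moreover have "ent (kk \<times> E) (\<lambda>x y. \<Sum>i\<in>I. \<Theta>' i j x y) = ent (kk \<times> E) (\<lambda>x y. \<Sum>i\<in>I. \<Theta> i j x y)" if "j \<in> I" for j
    using that by (intro ent_cong sum.cong refl \<Theta>) (auto simp: kk_def)
  moreover have "ent (kk \<times> E) (\<Theta>' i j) = ent (kk \<times> E) (\<Theta> i j)" if "i \<in> I" "j \<in> I" for i j
    using that by (intro ent_cong \<Theta>) (auto simp: kk_def)
  moreover have "ent (kk \<times> E) (\<lambda>x y. \<Sum>i\<in>I. \<Sum>j\<in>I. \<Theta>' i j x y) = ent (kk \<times> E) (\<lambda>x y. \<Sum>i\<in>I. \<Sum>j\<in>I. \<Theta> i j x y)"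
    by (intro ent_cong sum.cong refl \<Theta>) (auto simp: kk_def)
  moreover have "log 2 (real K) = real m" using K(2) by (simp add: log_nat_power)
  ultimately show ?thesis using key by (simp cong: sum.cong)
qed

section \<open>Tensor powers\<close>

definition words :: "nat \<Rightarrow> 'a set \<Rightarrow> 'a list set" where
  "words n I = {xs. length xs = n \<and> set xs \<subseteq> I}"

lemma words_0 [simp]: "words 0 I = {[]}"
  by (auto simp: words_def)

lemma finite_words [simp]: "finite I \<Longrightarrow> finite (words n I)"
  using finite_lists_length_eq[of I n] by (simp add: words_def conj_commute)

lemma words_nth: "xs \<in> words n I \<Longrightarrow> t < n \<Longrightarrow> xs ! t \<in> I"
  by (auto simp: words_def)

lemma bij_words_Cons: "bij_betw (\<lambda>x. fst x # snd x) (I \<times> words n I) (words (Suc n) I)"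
  by (rule bij_betw_byWitness[where f'="\<lambda>xs. (hd xs, tl xs)"])
    (auto simp: words_def length_Suc_conv)

text \<open>Distributivity over positions. Traces and partial traces of tensor powers factorise
  through this law and its variants for digits.\<close>

lemma sum_words_prod:
  fixes f :: "nat \<Rightarrow> 'a \<Rightarrow> complex"
  shows "(\<Sum>xs\<in>words n I. \<Prod>t<n. f t (xs ! t)) = (\<Prod>t<n. \<Sum>x\<in>I. f t x)"
proof (induction n arbitrary: f)
  case (Suc n)
  have "(\<Sum>xs\<in>words (Suc n) I. \<Prod>t<Suc n. f t (xs ! t)) =
    (\<Sum>x\<in>I \<times> words n I. \<Prod>t<Suc n. f t ((fst x # snd x) ! t))"
    by (rule sum.reindex_bij_betw[OF bij_words_Cons, symmetric])
  also have "\<dots> = (\<Sum>x\<in>I. f 0 x) * (\<Sum>xs\<in>words n I. \<Prod>t<n. f (Suc t) (xs ! t))"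
    by (simp add: sum.cartesian_product' prod.lessThan_Suc_shift sum_product del: prod.lessThan_Suc)
  also have "\<dots> = (\<Prod>t<Suc n. \<Sum>x\<in>I. f t x)"
    by (simp only: Suc.IH[of "\<lambda>t. f (Suc t)"] prod.lessThan_Suc_shift)
  finally show ?case .
qed simp

definition tensor_power :: "nat \<Rightarrow> ('a \<Rightarrow> 'a \<Rightarrow> complex) \<Rightarrow> 'a list \<Rightarrow> 'a list \<Rightarrow> complex" where
  "tensor_power n \<rho> xs ys = (\<Prod>t<n. \<rho> (xs ! t) (ys ! t))"

lemma tensor_power_Suc:
  "tensor_power (Suc n) \<rho> (x # xs) (y # ys) = \<rho> x y * tensor_power n \<rho> xs ys"
  by (simp add: tensor_power_def prod.lessThan_Suc_shift del: prod.lessThan_Suc)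

lemma trace_tensor_power: "(\<Sum>xs\<in>words n I. tensor_power n \<rho> xs xs) = (\<Sum>x\<in>I. \<rho> x x) ^ n"
  unfolding tensor_power_def using sum_words_prod[of "\<lambda>_ x. \<rho> x x" n I] by simp

lemma psd_on_tensor_power:
  assumes [simp]: "finite I" and \<rho>: "psd_on I \<rho>"
  shows "psd_on (words n I) (tensor_power n \<rho>)"
proof (induction n)
  case 0
  have "psd_on {[] :: 'a list} (\<lambda>i j. \<Sum>k\<in>{()}. (\<lambda>_ _. 1) i k * cnj ((\<lambda>_ _. 1) j k))"
    by (rule psd_on_gram)
  then show ?case by (simp add: tensor_power_def[abs_def])
next
  case (Suc n)
  have "psd_on (words (Suc n) I) (\<lambda>xs ys. \<rho> (hd xs) (hd ys) * tensor_power n \<rho> (tl xs) (tl ys))"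
  proof -
    have "(\<lambda>xs. (hd xs, tl xs)) ` words (Suc n) I \<subseteq> I \<times> words n I"
      by (auto simp: words_def length_Suc_conv)
    then show ?thesis
      using psd_on_map[OF _ psd_on_tensor[OF assms(1) finite_words[OF assms(1)] \<rho> Suc.IH], of "\<lambda>xs. (hd xs, tl xs)" "words (Suc n) I"]
      by simp
  qed
  also have "?this \<longleftrightarrow> ?case"
    by (intro psd_on_cong) (auto simp: words_def length_Suc_conv tensor_power_Suc)
  finally show ?case .
qed

lemma ent_tensor_power:
  assumes [simp]: "finite I" and \<rho>: "psd_on I \<rho>" "(\<Sum>x\<in>I. \<rho> x x) = 1"
  shows "ent (words n I) (tensor_power n \<rho>) = real n * ent I \<rho>"
proof (induction n)
  case 0
  have "ent {[] :: 'a list} (\<lambda>x y. of_real 1) = entropy_fun 1" by (rule ent_unit) auto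
  then show ?case by (simp add: tensor_power_def[abs_def] entropy_fun_def)
next
  case (Suc n)
  have "ent (words (Suc n) I) (tensor_power (Suc n) \<rho>) =
     ent (I \<times> words n I) (\<lambda>x y. tensor_power (Suc n) \<rho> (fst x # snd x) (fst y # snd y))"
    by (rule ent_reindex[OF bij_words_Cons, symmetric]) simp
  also have "\<dots> = ent (I \<times> words n I) (\<lambda>x y. \<rho> (fst x) (fst y) * tensor_power n \<rho> (snd x) (snd y))"
    by (simp add: tensor_power_Suc)
  also have "\<dots> = ent (words n I) (tensor_power n \<rho>) + ent I \<rho>"
    by (subst ent_tensor[OF _ _ \<rho>(1) psd_on_tensor_power[OF _ \<rho>(1)]])
      (auto simp: \<rho>(2) trace_tensor_power)
  finally show ?case by (simp add: Suc.IH algebra_simps)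
qed

lemma bij_words_zip: "bij_betw (\<lambda>x. zip (fst x) (snd x)) (words n I \<times> words n J) (words n (I \<times> J))"
proof (rule bij_betw_byWitness[where f'="\<lambda>xs. (map fst xs, map snd xs)"])
  show "(\<lambda>x. zip (fst x) (snd x)) ` (words n I \<times> words n J) \<subseteq> words n (I \<times> J)"
    by (fastforce simp: words_def dest: set_zip_leftD set_zip_rightD)
  show "(\<lambda>xs. (map fst xs, map snd xs)) ` words n (I \<times> J) \<subseteq> words n I \<times> words n J"
    by (fastforce simp: words_def)
qed (auto simp: words_def zip_map_fst_snd)

text \<open>The \<open>n\<close> digits in base \<open>d\<close>, most significant first, so that
  position \<open>t\<close> belongs to copy \<open>t\<close>.\<close>

definition digits :: "nat \<Rightarrow> nat \<Rightarrow> nat \<Rightarrow> nat list" where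
  "digits d n = index_dec (replicate n d)"

lemma valid_index_replicate: "valid_index (replicate n d) xs \<longleftrightarrow> xs \<in> words n {..<d}"
  by (auto simp: valid_index_def words_def list_all2_conv_all_nth in_set_conv_nth subset_iff)

lemma digits_words: "a < d ^ n \<Longrightarrow> digits d n a \<in> words n {..<d}"
  using valid_index_dec[of a "replicate n d"] by (simp add: digits_def valid_index_replicate)

lemma enc_digits: "a < d ^ n \<Longrightarrow> index_enc (replicate n d) (digits d n a) = a"
  using valid_index_dec[of a "replicate n d"] by (simp add: digits_def)

lemma digits_enc: "xs \<in> words n {..<d} \<Longrightarrow> digits d n (index_enc (replicate n d) xs) = xs"
  by (simp add: digits_def valid_index_replicate)

lemma bij_digits: "bij_betw (digits d n) {..<d ^ n} (words n {..<d})"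
  by (rule bij_betw_byWitness[where f'="index_enc (replicate n d)"])
    (auto simp: digits_enc enc_digits digits_words valid_index_replicate
      dest!: index_enc_less[of "replicate n d", unfolded valid_index_replicate])

lemma sum_digits_prod:
  fixes f :: "nat \<Rightarrow> nat \<Rightarrow> complex"
  shows "(\<Sum>a<d ^ n. \<Prod>t<n. f t (digits d n a ! t)) = (\<Prod>t<n. \<Sum>x<d. f t x)"
  using sum.reindex_bij_betw[OF bij_digits[of d n], of "\<lambda>xs. \<Prod>t<n. f t (xs ! t)"] by (simp add: sum_words_prod)

lemma sum_pair_digits_prod:
  fixes f :: "nat \<Rightarrow> nat \<times> nat \<Rightarrow> complex"
  shows "(\<Sum>y\<in>{..<d ^ n} \<times> {..<d' ^ n}. \<Prod>t<n. f t (digits d n (fst y) ! t, digits d' n (snd y) ! t)) =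
    (\<Prod>t<n. \<Sum>x\<in>{..<d} \<times> {..<d'}. f t x)"
proof -
  have bij: "bij_betw ((\<lambda>x. zip (fst x) (snd x)) \<circ> map_prod (digits d n) (digits d' n)) ({..<d ^ n} \<times> {..<d' ^ n})
      (words n ({..<d} \<times> {..<d'}))"
    by (intro bij_betw_trans[OF _ bij_words_zip] bij_betw_map_prod bij_digits)
  have len: "length (digits d n a) = n" if "a < d ^ n" for a d
    using digits_words[OF that] by (simp add: words_def)
  have "(\<Sum>y\<in>{..<d ^ n} \<times> {..<d' ^ n}. \<Prod>t<n. f t (digits d n (fst y) ! t, digits d' n (snd y) ! t)) =
      (\<Sum>xs\<in>words n ({..<d} \<times> {..<d'}). \<Prod>t<n. f t (xs ! t))"
    unfolding sum.reindex_bij_betw[OF bij, symmetric] by (intro sum.cong prod.cong refl) (auto simp: len)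
  then show ?thesis by (simp add: sum_words_prod)
qed

section \<open>Kronecker powers and regrouped powers in digit coordinates\<close>

lemma kron_power_Suc: "kron_power \<rho> (Suc n) = \<rho> \<otimes>\<^sub>m kron_power \<rho> n"
  by (simp add: kron_power_def)

lemma kron_power_dim:
  "dim_row (kron_power \<rho> n) = dim_row \<rho> ^ n" "dim_col (kron_power \<rho> n) = dim_col \<rho> ^ n"
  by (induction n) (simp_all add: kron_power_Suc, simp_all add: kron_power_def)

lemma kron_power_index:
  assumes \<rho>: "\<rho> \<in> carrier_mat (dA * (dC * dB)) (dA * (dC * dB))"
  shows "valid_index (concat (replicate n [dA, dC, dB])) zs \<Longrightarrow> valid_index (concat (replicate n [dA, dC, dB])) zs' \<Longrightarrow>
    kron_power \<rho> n $$ (index_enc (concat (replicate n [dA, dC, dB])) zs, index_enc (concat (replicate n [dA, dC, dB])) zs') =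
    (\<Prod>t<n. \<rho> $$ (zs ! (3 * t) * (dC * dB) + (zs ! (3 * t + 1) * dB + zs ! (3 * t + 2)),
                   zs' ! (3 * t) * (dC * dB) + (zs' ! (3 * t + 1) * dB + zs' ! (3 * t + 2))))"
proof (induction n arbitrary: zs zs')
  case 0
  then show ?case by (simp add: kron_power_def)
next
  case (Suc n)
  let ?ds = "concat (replicate n [dA, dC, dB])"
  have pl: "prod_list ?ds = (dA * (dC * dB)) ^ n"
    by (induction n) (simp_all add: mult_ac)
  have "\<exists>z0 z1 z2 ws. zs = z0 # z1 # z2 # ws \<and> z0 < dA \<and> z1 < dC \<and> z2 < dB \<and> valid_index ?ds ws"
    if "valid_index (concat (replicate (Suc n) [dA, dC, dB])) zs" for zs
    using that by (auto simp: valid_index_def list_all2_Cons2)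
  then obtain z0 z1 z2 ws z0' z1' z2' ws' where
    z: "zs = z0 # z1 # z2 # ws" "z0 < dA" "z1 < dC" "z2 < dB" "valid_index ?ds ws" and
    z': "zs' = z0' # z1' # z2' # ws'" "z0' < dA" "z1' < dC" "z2' < dB" "valid_index ?ds ws'"
    using Suc.prems by metis
  let ?e = "z0 * (dC * dB) + (z1 * dB + z2)" and ?e' = "z0' * (dC * dB) + (z1' * dB + z2')"
  have enc: "index_enc (concat (replicate (Suc n) [dA, dC, dB])) (y0 # y1 # y2 # ys) =
      (y0 * (dC * dB) + (y1 * dB + y2)) * (dA * (dC * dB)) ^ n + index_enc ?ds ys" for y0 y1 y2 ys
    by (simp add: pl algebra_simps)
  have lt: "index_enc ?ds ws < (dA * (dC * dB)) ^ n" "index_enc ?ds ws' < (dA * (dC * dB)) ^ n"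
    using index_enc_less[OF z(5)] index_enc_less[OF z'(5)] by (simp_all add: pl)
  have "kron_power \<rho> (Suc n) $$ (index_enc (concat (replicate (Suc n) [dA, dC, dB])) zs, index_enc (concat (replicate (Suc n) [dA, dC, dB])) zs') =
     \<rho> $$ (?e, ?e') * kron_power \<rho> n $$ (index_enc ?ds ws, index_enc ?ds ws')"
    unfolding z(1) z'(1) enc kron_power_Suc
    using kron_index[of ?e \<rho> ?e' "index_enc ?ds ws" "kron_power \<rho> n" "index_enc ?ds ws'"] \<rho> lt z z'
    by (simp add: kron_power_dim mixed_radix_less)
  then show ?case
    unfolding Suc.IH[OF z(5) z'(5)] by (simp add: z(1) z'(1) prod.lessThan_Suc_shift numeral_3_eq_3 numeral_2_eq_2 del: prod.lessThan_Suc)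
qed

lemma tripartite_power_index:
  assumes \<rho>: "\<rho> \<in> carrier_mat (dA * (dC * dB)) (dA * (dC * dB))"
    and a: "a < dA ^ n" "a' < dA ^ n" and c: "c < dC ^ n" "c' < dC ^ n" and b: "b < dB ^ n" "b' < dB ^ n"
  shows "tripartite_power dA dC dB \<rho> n $$ (a * (dC ^ n * dB ^ n) + (c * dB ^ n + b), a' * (dC ^ n * dB ^ n) + (c' * dB ^ n + b')) =
    (\<Prod>t<n. \<rho> $$ (digits dA n a ! t * (dC * dB) + (digits dC n c ! t * dB + digits dB n b ! t),
                   digits dA n a' ! t * (dC * dB) + (digits dC n c' ! t * dB + digits dB n b' ! t)))"
proof -
  define ds where "ds = concat (replicate n [dA, dC, dB])"
  define p where "p = map (\<lambda>k. 3 * k) [0..<n] @ map (\<lambda>k. 3 * k + 1) [0..<n] @ map (\<lambda>k. 3 * k + 2) [0..<n]"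
  have len: "length ds = 3 * n" unfolding ds_def by (induction n) auto
  have ds: "ds ! (3 * t) = dA" "ds ! (3 * t + 1) = dC" "ds ! (3 * t + 2) = dB" if "t < n" for t
  proof -
    have "concat (replicate n [dA, dC, dB]) ! (3 * t) = dA \<and> concat (replicate n [dA, dC, dB]) ! (3 * t + 1) = dC
      \<and> concat (replicate n [dA, dC, dB]) ! (3 * t + 2) = dB"
      using that by (induction n arbitrary: t) (auto simp: less_Suc_eq_0_disj numeral_3_eq_3 numeral_2_eq_2)
    then show "ds ! (3 * t) = dA" "ds ! (3 * t + 1) = dC" "ds ! (3 * t + 2) = dB" by (simp_all add: ds_def)
  qed
  have dsp: "map ((!) ds) p = replicate n dA @ replicate n dC @ replicate n dB"
  proof -
    have "map (\<lambda>k. ds ! (3 * k)) [0..<n] = replicate n dA" "map (\<lambda>k. ds ! (3 * k + 1)) [0..<n] = replicate n dC"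
      "map (\<lambda>k. ds ! (3 * k + 2)) [0..<n] = replicate n dB"
      using ds by (auto intro!: nth_equalityI)
    then show ?thesis by (simp add: p_def o_def)
  qed
  have plds: "prod_list ds = dA ^ n * (dC ^ n * dB ^ n)"
    unfolding ds_def by (induction n) (simp_all add: mult_ac)
  \<comment> \<open>The three blocks of \<open>p\<close> are the residue classes modulo 3.\<close>
  have dist: "distinct p" unfolding p_def by (auto simp: distinct_map inj_on_def) presburger+
  have lp: "length p = 3 * n" by (simp add: p_def)
  let ?ys = "\<lambda>a c b. digits dA n a @ digits dC n c @ digits dB n b"
  let ?zs = "\<lambda>a c b. map (\<lambda>l. the (map_of (zip p (?ys a c b)) l)) [0..<length ds]"
  have zs: "index_enc (map ((!) ds) p) (?ys a c b) = a * (dC ^ n * dB ^ n) + (c * dB ^ n + b)"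
      "valid_index (map ((!) ds) p) (?ys a c b)"
      "\<And>t. t < n \<Longrightarrow> ?zs a c b ! (3 * t) = digits dA n a ! t"
      "\<And>t. t < n \<Longrightarrow> ?zs a c b ! (3 * t + 1) = digits dC n c ! t"
      "\<And>t. t < n \<Longrightarrow> ?zs a c b ! (3 * t + 2) = digits dB n b ! t"
      "valid_index ds (?zs a c b)"
    if "a < dA ^ n" "c < dC ^ n" "b < dB ^ n" for a c b
  proof -
    note w = digits_words[OF that(1)] digits_words[OF that(2)] digits_words[OF that(3)]
    have l: "length (digits dA n a) = n" "length (digits dC n c) = n" "length (digits dB n b) = n"
      using w by (auto simp: words_def)
    show "index_enc (map ((!) ds) p) (?ys a c b) = a * (dC ^ n * dB ^ n) + (c * dB ^ n + b)"
      unfolding dsp by (simp add: index_enc_append l enc_digits that)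
    show "valid_index (map ((!) ds) p) (?ys a c b)"
      unfolding dsp by (simp add: valid_index_append l valid_index_replicate w)
    have m: "map_of (zip p (?ys a c b)) (p ! i) = Some (?ys a c b ! i)" if "i < 3 * n" for i
      by (rule map_of_zip_nth) (use that dist lp l in auto)
    have z: "?zs a c b ! (p ! i) = ?ys a c b ! i" if "i < 3 * n" "p ! i < 3 * n" for i
      using m[OF that(1)] that(2) by (simp add: len)
    show z0: "?zs a c b ! (3 * t) = digits dA n a ! t" if "t < n" for t
      using z[of t] that l by (simp add: p_def nth_append)
    show z1: "?zs a c b ! (3 * t + 1) = digits dC n c ! t" if "t < n" for t
      using z[of "n + t"] that l by (simp add: p_def nth_append)
    show z2: "?zs a c b ! (3 * t + 2) = digits dB n b ! t" if "t < n" for t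
      using z[of "n + n + t"] that l by (simp add: p_def nth_append)
    show "valid_index ds (?zs a c b)"
      unfolding valid_index_def list_all2_conv_all_nth
    proof (intro conjI allI impI)
      show "length (?zs a c b) = length ds" by simp
      fix i assume "i < length (?zs a c b)"
      then have i: "i < 3 * n" by (simp add: len)
      then have t: "i div 3 < n" by simp
      have "i = 3 * (i div 3) \<or> i = 3 * (i div 3) + 1 \<or> i = 3 * (i div 3) + 2" by presburger
      then show "?zs a c b ! i < ds ! i"
        using ds[OF t] z0[OF t] z1[OF t] z2[OF t] words_nth[OF w(1) t] words_nth[OF w(2) t] words_nth[OF w(3) t]
        by (metis lessThan_iff)
    qed
  qed
  note Z = zs[OF a(1) c(1) b(1)] and Z' = zs[OF a(2) c(2) b(2)]
  have "tripartite_power dA dC dB \<rho> n $$ (a * (dC ^ n * dB ^ n) + (c * dB ^ n + b), a' * (dC ^ n * dB ^ n) + (c' * dB ^ n + b')) =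
    kron_power \<rho> n $$ (index_enc ds (?zs a c b), index_enc ds (?zs a' c' b'))"
    unfolding tripartite_power_def ds_def[symmetric] p_def[symmetric] Z(1)[symmetric] Z'(1)[symmetric]
    by (rule permute_systems_index[OF Z(2) Z'(2)]) (simp add: dsp plds)
  also have "\<dots> = (\<Prod>t<n. \<rho> $$ (?zs a c b ! (3 * t) * (dC * dB) + (?zs a c b ! (3 * t + 1) * dB + ?zs a c b ! (3 * t + 2)),
       ?zs a' c' b' ! (3 * t) * (dC * dB) + (?zs a' c' b' ! (3 * t + 1) * dB + ?zs a' c' b' ! (3 * t + 2))))"
    using kron_power_index[OF \<rho>] Z(6) Z'(6) unfolding ds_def by blast
  also have "\<dots> = (\<Prod>t<n. \<rho> $$ (digits dA n a ! t * (dC * dB) + (digits dC n c ! t * dB + digits dB n b ! t),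
                   digits dA n a' ! t * (dC * dB) + (digits dC n c' ! t * dB + digits dB n b' ! t)))"
    by (intro prod.cong refl) (simp only: Z Z' lessThan_iff)
  finally show ?thesis .
qed

lemma tripartite_power_carrier:
  "tripartite_power dA dC dB \<rho> n \<in> carrier_mat (dA ^ n * (dC ^ n * dB ^ n)) (dA ^ n * (dC ^ n * dB ^ n))"
proof -
  have "prod_list (concat (replicate n [dA, dC, dB])) = dA ^ n * (dC ^ n * dB ^ n)"
    by (induction n) (simp_all add: mult_ac)
  then show ?thesis unfolding tripartite_power_def by (metis permute_systems_carrier)
qed

text \<open>Regroups coordinates of n-fold systems into the list of the \<open>n\<close> single-copy
  coordinates. The systems of the protocol are encoded as numbers, as matrices require; the
  environment is never part of a matrix here and remains a list.\<close>

definition copies :: "nat \<Rightarrow> nat \<Rightarrow> nat \<Rightarrow> nat \<Rightarrow> (nat \<times> 'e list) \<times> (nat \<times> nat) \<Rightarrow> ((nat \<times> 'e) \<times> (nat \<times> nat)) list" where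
  "copies dA dC dB n x = zip (zip (digits dB n (fst (fst x))) (snd (fst x)))
     (zip (digits dA n (fst (snd x))) (digits dC n (snd (snd x))))"

lemma bij_copies:
  "bij_betw (copies dA dC dB n) (({..<dB ^ n} \<times> words n E) \<times> ({..<dA ^ n} \<times> {..<dC ^ n}))
     (words n (({..<dB} \<times> E) \<times> ({..<dA} \<times> {..<dC})))"
proof -
  have "bij_betw ((\<lambda>x. zip (fst x) (snd x)) \<circ> (map_prod ((\<lambda>x. zip (fst x) (snd x)) \<circ> map_prod (digits dB n) id)
      ((\<lambda>x. zip (fst x) (snd x)) \<circ> map_prod (digits dA n) (digits dC n))))
      (({..<dB ^ n} \<times> words n E) \<times> ({..<dA ^ n} \<times> {..<dC ^ n}))
      (words n (({..<dB} \<times> E) \<times> ({..<dA} \<times> {..<dC})))"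
    by (intro bij_betw_trans[OF _ bij_words_zip] bij_betw_map_prod bij_digits bij_betw_id)
  also have "?this \<longleftrightarrow> ?thesis"
    by (intro bij_betw_cong) (auto simp: copies_def)
  finally show ?thesis .
qed

lemma copies_nth:
  assumes "b < dB ^ n" "length e = n" "a < dA ^ n" "c < dC ^ n" "t < n"
  shows "copies dA dC dB n ((b, e), (a, c)) ! t = ((digits dB n b ! t, e ! t), (digits dA n a ! t, digits dC n c ! t))"
  using digits_words[OF assms(1)] digits_words[OF assms(3)] digits_words[OF assms(4)] assms
  by (simp add: copies_def words_def)

text \<open>The one-shot bound is applied to the tensor power of a single-copy extension. Each of
  the four entropies is then \<open>n\<close> times its single-copy value, while the loss of 4 bits
  does not grow with \<open>n\<close>.\<close>

theorem key_distillable_bound: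
  fixes \<kappa> :: "(nat \<times> 'e) \<times> (nat \<times> nat) \<Rightarrow> (nat \<times> 'e) \<times> (nat \<times> nat) \<Rightarrow> complex"
  assumes key: "key_distillable dA dC dB X \<epsilon> n m"
    and X: "X \<in> carrier_mat (dA * (dC * dB)) (dA * (dC * dB))"
    and E[simp]: "finite E" and \<kappa>: "psd_on (({..<dB} \<times> E) \<times> ({..<dA} \<times> {..<dC})) \<kappa>"
    and tr: "(\<Sum>x\<in>({..<dB} \<times> E) \<times> ({..<dA} \<times> {..<dC}). \<kappa> x x) = 1"
    and ext: "\<And>a c b a' c' b'. a < dA \<Longrightarrow> c < dC \<Longrightarrow> b < dB \<Longrightarrow> a' < dA \<Longrightarrow> c' < dC \<Longrightarrow> b' < dB \<Longrightarrow>
      (\<Sum>e\<in>E. \<kappa> ((b, e), (a, c)) ((b', e), (a', c'))) = X $$ (a * (dC * dB) + (c' * dB + b), a' * (dC * dB) + (c * dB + b'))"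
  defines "Y \<equiv> {..<dA} \<times> {..<dC}"
  shows "(1 - 7 * \<epsilon>) * real m - 4 \<le> real n *
    (ent (E \<times> Y) (\<lambda>x y. \<Sum>b<dB. \<kappa> ((b, fst x), snd x) ((b, fst y), snd y)) - ent (({..<dB} \<times> E) \<times> Y) \<kappa>
      + ent ({..<dB} \<times> E) (ptrace Y \<kappa>) - ent E (\<lambda>e e'. \<Sum>b<dB. ptrace Y \<kappa> (b, e) (b, e')))"
proof -
  define I where "I = ({..<dB} \<times> E) \<times> Y"
  define Yn where "Yn = {..<dA ^ n} \<times> {..<dC ^ n}"
  define L :: "(nat \<times> 'e list) \<times> (nat \<times> nat) \<Rightarrow> _" where "L = copies dA dC dB n"
  define \<Omega> where "\<Omega> = (\<lambda>x y. tensor_power n \<kappa> (L x) (L y))"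
  define \<kappa>1 where "\<kappa>1 = (\<lambda>x y. \<Sum>b<dB. \<kappa> ((b, fst x), snd x) ((b, fst y), snd y))"
  define \<kappa>3 where "\<kappa>3 = (\<lambda>e e'. \<Sum>b<dB. ptrace Y \<kappa> (b, e) (b, e'))"
  have [simp]: "finite Y" "finite Yn" "finite I" by (simp_all add: Y_def Yn_def I_def)
  have \<kappa>': "psd_on I \<kappa>" and tr': "(\<Sum>x\<in>I. \<kappa> x x) = 1" using \<kappa> tr by (simp_all add: I_def Y_def)
  have L: "bij_betw L (({..<dB ^ n} \<times> words n E) \<times> Yn) (words n I)"
    unfolding L_def Yn_def I_def Y_def by (rule bij_copies)
  have Omega: "\<Omega> ((b, e), (a, c)) ((b', e'), (a', c')) = (\<Prod>t<n. \<kappa> ((digits dB n b ! t, e ! t), (digits dA n a ! t, digits dC n c ! t))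
       ((digits dB n b' ! t, e' ! t), (digits dA n a' ! t, digits dC n c' ! t)))"
    if "b < dB ^ n" "e \<in> words n E" "a < dA ^ n" "c < dC ^ n" "b' < dB ^ n" "e' \<in> words n E" "a' < dA ^ n" "c' < dC ^ n"
    for b e a c b' e' a' c'
    unfolding \<Omega>_def tensor_power_def L_def
    using that by (intro prod.cong refl) (auto simp: copies_nth words_def)
  have psd: "psd_on (({..<dB ^ n} \<times> words n E) \<times> Yn) \<Omega>"
    unfolding \<Omega>_def using L by (intro psd_on_map[OF _ psd_on_tensor_power[OF _ \<kappa>']]) (auto simp: bij_betw_def)
  have trace: "(\<Sum>x\<in>({..<dB ^ n} \<times> words n E) \<times> Yn. \<Omega> x x) = 1"
    unfolding \<Omega>_def using sum.reindex_bij_betw[OF L, of "\<lambda>x. tensor_power n \<kappa> x x"] by (simp add: trace_tensor_power tr')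
  have entI: "ent (({..<dB ^ n} \<times> words n E) \<times> Yn) \<Omega> = real n * ent I \<kappa>"
    unfolding \<Omega>_def by (subst ent_reindex[OF L]) (simp_all add: ent_tensor_power \<kappa>' tr')
  have psd1: "psd_on (E \<times> Y) \<kappa>1"
    unfolding \<kappa>1_def by (intro psd_on_sum psd_on_map[OF _ \<kappa>']) (auto simp: I_def)
  have trI: "(\<Sum>b<dB. \<Sum>e\<in>E. \<Sum>y\<in>Y. \<kappa> ((b, e), y) ((b, e), y)) = 1"
    using tr' by (simp add: I_def sum.cartesian_product')
  have tr1: "(\<Sum>x\<in>E \<times> Y. \<kappa>1 x x) = 1"
  proof -
    have "(\<Sum>x\<in>E \<times> Y. \<kappa>1 x x) = (\<Sum>b<dB. \<Sum>x\<in>E \<times> Y. \<kappa> ((b, fst x), snd x) ((b, fst x), snd x))"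
      unfolding \<kappa>1_def by (rule sum.swap)
    also have "\<dots> = 1" using trI by (simp add: sum.cartesian_product')
    finally show ?thesis .
  qed
  have psd2: "psd_on ({..<dB} \<times> E) (ptrace Y \<kappa>)" using \<kappa>' by (intro psd_on_ptrace) (auto simp: I_def)
  have tr2: "(\<Sum>x\<in>{..<dB} \<times> E. ptrace Y \<kappa> x x) = 1"
    using trI by (simp add: ptrace_def sum.cartesian_product')
  have psd3: "psd_on E \<kappa>3"
    unfolding \<kappa>3_def by (intro psd_on_sum psd_on_map[OF _ psd2]) auto
  have tr3: "(\<Sum>e\<in>E. \<kappa>3 e e) = 1"
    unfolding \<kappa>3_def using tr2 by (subst sum.swap) (simp add: sum.cartesian_product')
  have ent1: "ent (words n E \<times> Yn) (\<lambda>x y. \<Sum>b<dB ^ n. \<Omega> ((b, fst x), snd x) ((b, fst y), snd y)) = real n * ent (E \<times> Y) \<kappa>1"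
  proof -
    define M where "M = (\<lambda>x :: 'e list \<times> nat \<times> nat. zip (fst x) (zip (digits dA n (fst (snd x))) (digits dC n (snd (snd x)))))"
    have "bij_betw ((\<lambda>x. zip (fst x) (snd x)) \<circ> map_prod id ((\<lambda>x. zip (fst x) (snd x)) \<circ> map_prod (digits dA n) (digits dC n)))
       (words n E \<times> Yn) (words n (E \<times> Y))"
      unfolding Y_def Yn_def
      by (intro bij_betw_trans[OF _ bij_words_zip] bij_betw_map_prod bij_digits bij_betw_id)
    also have "?this \<longleftrightarrow> bij_betw M (words n E \<times> Yn) (words n (E \<times> Y))"
      by (intro bij_betw_cong) (auto simp: M_def)
    finally have M: "bij_betw M (words n E \<times> Yn) (words n (E \<times> Y))" .
    have Mn: "M (e, (a, c)) ! t = (e ! t, (digits dA n a ! t, digits dC n c ! t))"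
      if "e \<in> words n E" "a < dA ^ n" "c < dC ^ n" "t < n" for e a c t
      using digits_words[OF that(2)] digits_words[OF that(3)] that by (simp add: M_def words_def)
    have "ent (words n E \<times> Yn) (\<lambda>x y. \<Sum>b<dB ^ n. \<Omega> ((b, fst x), snd x) ((b, fst y), snd y)) =
       ent (words n E \<times> Yn) (\<lambda>x y. tensor_power n \<kappa>1 (M x) (M y))"
    proof (rule ent_cong)
      fix x y assume "x \<in> words n E \<times> Yn" "y \<in> words n E \<times> Yn"
      then obtain e a c e' a' c' where x: "x = (e, (a, c))" "e \<in> words n E" "a < dA ^ n" "c < dC ^ n"
        and y: "y = (e', (a', c'))" "e' \<in> words n E" "a' < dA ^ n" "c' < dC ^ n"
        by (auto simp: Yn_def)
      have "(\<Sum>b<dB ^ n. \<Omega> ((b, fst x), snd x) ((b, fst y), snd y)) =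
         (\<Sum>b<dB ^ n. \<Prod>t<n. \<kappa> ((digits dB n b ! t, e ! t), (digits dA n a ! t, digits dC n c ! t))
           ((digits dB n b ! t, e' ! t), (digits dA n a' ! t, digits dC n c' ! t)))"
        using x y by (intro sum.cong refl) (simp add: Omega)
      also have "\<dots> = (\<Prod>t<n. \<Sum>b<dB. \<kappa> ((b, e ! t), (digits dA n a ! t, digits dC n c ! t))
           ((b, e' ! t), (digits dA n a' ! t, digits dC n c' ! t)))"
        by (rule sum_digits_prod)
      also have "\<dots> = tensor_power n \<kappa>1 (M x) (M y)"
        unfolding tensor_power_def using x y by (intro prod.cong refl) (simp add: Mn \<kappa>1_def)
      finally show "(\<Sum>b<dB ^ n. \<Omega> ((b, fst x), snd x) ((b, fst y), snd y)) = tensor_power n \<kappa>1 (M x) (M y)" .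
    qed simp
    also have "\<dots> = real n * ent (E \<times> Y) \<kappa>1"
      by (subst ent_reindex[OF M]) (simp_all add: ent_tensor_power psd1 tr1)
    finally show ?thesis .
  qed
  have ptr: "ptrace Yn \<Omega> (b, e) (b', e') = (\<Prod>t<n. ptrace Y \<kappa> (digits dB n b ! t, e ! t) (digits dB n b' ! t, e' ! t))"
    if "b < dB ^ n" "e \<in> words n E" "b' < dB ^ n" "e' \<in> words n E" for b e b' e'
  proof -
    have "ptrace Yn \<Omega> (b, e) (b', e') = (\<Sum>y\<in>Yn. \<Prod>t<n. \<kappa> ((digits dB n b ! t, e ! t), (digits dA n (fst y) ! t, digits dC n (snd y) ! t))
       ((digits dB n b' ! t, e' ! t), (digits dA n (fst y) ! t, digits dC n (snd y) ! t)))"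
      unfolding ptrace_def using that by (intro sum.cong refl) (auto simp: Yn_def Omega)
    also have "\<dots> = (\<Prod>t<n. \<Sum>y\<in>Y. \<kappa> ((digits dB n b ! t, e ! t), y) ((digits dB n b' ! t, e' ! t), y))"
      unfolding Y_def Yn_def by (rule sum_pair_digits_prod)
    finally show ?thesis by (simp add: ptrace_def)
  qed
  have ent2: "ent ({..<dB ^ n} \<times> words n E) (ptrace Yn \<Omega>) = real n * ent ({..<dB} \<times> E) (ptrace Y \<kappa>)"
  proof -
    define M where "M = (\<lambda>x :: nat \<times> 'e list. zip (digits dB n (fst x)) (snd x))"
    have "bij_betw ((\<lambda>x. zip (fst x) (snd x)) \<circ> map_prod (digits dB n) id)
       ({..<dB ^ n} \<times> words n E) (words n ({..<dB} \<times> E))"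
      by (intro bij_betw_trans[OF _ bij_words_zip] bij_betw_map_prod bij_digits bij_betw_id)
    also have "?this \<longleftrightarrow> bij_betw M ({..<dB ^ n} \<times> words n E) (words n ({..<dB} \<times> E))"
      by (intro bij_betw_cong) (auto simp: M_def)
    finally have M: "bij_betw M ({..<dB ^ n} \<times> words n E) (words n ({..<dB} \<times> E))" .
    have Mn: "M (b, e) ! t = (digits dB n b ! t, e ! t)"
      if "e \<in> words n E" "b < dB ^ n" "t < n" for e b t
      using digits_words[OF that(2)] that by (simp add: M_def words_def)
    have "ent ({..<dB ^ n} \<times> words n E) (ptrace Yn \<Omega>) =
        ent ({..<dB ^ n} \<times> words n E) (\<lambda>x y. tensor_power n (ptrace Y \<kappa>) (M x) (M y))"
    proof (rule ent_cong)
      fix x y assume "x \<in> {..<dB ^ n} \<times> words n E" "y \<in> {..<dB ^ n} \<times> words n E"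
      then show "ptrace Yn \<Omega> x y = tensor_power n (ptrace Y \<kappa>) (M x) (M y)"
        unfolding tensor_power_def by (cases x; cases y) (auto simp: ptr Mn intro!: prod.cong)
    qed simp
    also have "\<dots> = real n * ent ({..<dB} \<times> E) (ptrace Y \<kappa>)"
      by (subst ent_reindex[OF M]) (simp_all add: ent_tensor_power psd2 tr2)
    finally show ?thesis .
  qed
  have ent3: "ent (words n E) (\<lambda>e e'. \<Sum>b<dB ^ n. ptrace Yn \<Omega> (b, e) (b, e')) = real n * ent E \<kappa>3"
  proof -
    have "ent (words n E) (\<lambda>e e'. \<Sum>b<dB ^ n. ptrace Yn \<Omega> (b, e) (b, e')) = ent (words n E) (tensor_power n \<kappa>3)"
    proof (rule ent_cong)
      fix e e' assume "e \<in> words n E" "e' \<in> words n E"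
      then have "(\<Sum>b<dB ^ n. ptrace Yn \<Omega> (b, e) (b, e')) =
         (\<Sum>b<dB ^ n. \<Prod>t<n. ptrace Y \<kappa> (digits dB n b ! t, e ! t) (digits dB n b ! t, e' ! t))"
        by (intro sum.cong refl) (simp add: ptr)
      also have "\<dots> = tensor_power n \<kappa>3 e e'"
        unfolding tensor_power_def \<kappa>3_def by (rule sum_digits_prod)
      finally show "(\<Sum>b<dB ^ n. ptrace Yn \<Omega> (b, e) (b, e')) = tensor_power n \<kappa>3 e e'" .
    qed simp
    then show ?thesis by (simp add: ent_tensor_power psd3 tr3)
  qed
  obtain P \<gamma> sA sB eC where P: "is_oneway_LOCC (dA ^ n) (dC ^ n) (dB ^ n) (2 ^ m * sA) eC (2 ^ m * sB) P"
    "is_private_state m sA sB \<gamma>"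
    "trace_norm (marginal [2 ^ m * sA, eC, 2 ^ m * sB] [0, 2]
            (apply_protocol (2 ^ m * sA) eC (2 ^ m * sB) P (tripartite_power dA dC dB X n)) - \<gamma>) \<le> \<epsilon>"
    using key unfolding key_distillable_def by blast
  have ext': "(\<Sum>e\<in>words n E. \<Omega> ((b, e), (a, c)) ((b', e), (a', c'))) =
      tripartite_power dA dC dB X n $$ (a * (dC ^ n * dB ^ n) + (c' * dB ^ n + b), a' * (dC ^ n * dB ^ n) + (c * dB ^ n + b'))"
    if h: "a < dA ^ n" "c < dC ^ n" "b < dB ^ n" "a' < dA ^ n" "c' < dC ^ n" "b' < dB ^ n" for a c b a' c' b'
  proof -
    have "(\<Sum>e\<in>words n E. \<Omega> ((b, e), (a, c)) ((b', e), (a', c'))) =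
      (\<Sum>e\<in>words n E. \<Prod>t<n. \<kappa> ((digits dB n b ! t, e ! t), (digits dA n a ! t, digits dC n c ! t))
       ((digits dB n b' ! t, e ! t), (digits dA n a' ! t, digits dC n c' ! t)))"
      using h by (intro sum.cong refl) (simp add: Omega)
    also have "\<dots> = (\<Prod>t<n. \<Sum>e\<in>E. \<kappa> ((digits dB n b ! t, e), (digits dA n a ! t, digits dC n c ! t))
       ((digits dB n b' ! t, e), (digits dA n a' ! t, digits dC n c' ! t)))"
      by (rule sum_words_prod)
    also have "\<dots> = tripartite_power dA dC dB X n $$ (a * (dC ^ n * dB ^ n) + (c' * dB ^ n + b), a' * (dC ^ n * dB ^ n) + (c * dB ^ n + b'))"
      unfolding tripartite_power_index[OF X h(1) h(4) h(5) h(2) h(3) h(6)]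
    proof (intro prod.cong refl ext)
      fix t assume t: "t \<in> {..<n}"
      have lt: "digits d n x ! t < d" if "x < d ^ n" for x d
        using words_nth[OF digits_words[OF that], of t] t by simp
      show "digits dA n a ! t < dA" "digits dC n c ! t < dC" "digits dB n b ! t < dB"
        "digits dA n a' ! t < dA" "digits dC n c' ! t < dC" "digits dB n b' ! t < dB"
        using h by (auto intro: lt)
    qed
    finally show ?thesis .
  qed
  have "(1 - 7 * \<epsilon>) * real m - 4 \<le>
    ent (words n E \<times> Yn) (\<lambda>x y. \<Sum>b<dB ^ n. \<Omega> ((b, fst x), snd x) ((b, fst y), snd y)) - ent (({..<dB ^ n} \<times> words n E) \<times> Yn) \<Omega>
      + ent ({..<dB ^ n} \<times> words n E) (ptrace Yn \<Omega>) - ent (words n E) (\<lambda>e e'. \<Sum>b<dB ^ n. ptrace Yn \<Omega> (b, e) (b, e'))"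
    unfolding Yn_def
    by (rule one_shot_key_bound[OF P(1,2) tripartite_power_carrier P(3) finite_words[OF E] psd[unfolded Yn_def] trace[unfolded Yn_def] ext'])
  also have "\<dots> = real n * (ent (E \<times> Y) \<kappa>1 - ent I \<kappa> + ent ({..<dB} \<times> E) (ptrace Y \<kappa>) - ent E \<kappa>3)"
    unfolding ent1 ent2 ent3 entI by (simp add: algebra_simps)
  finally show ?thesis unfolding \<kappa>1_def \<kappa>3_def I_def .
qed

section \<open>The rate bound\<close>

lemma is_stateD:
  assumes "is_state n \<rho>"
  shows "\<rho> \<in> carrier_mat n n" "psd_on {..<n} (\<lambda>i j. \<rho> $$ (i, j))" "(\<Sum>i<n. \<rho> $$ (i, i)) = 1"
  using assms psd_imp_psd_on[of n \<rho>] by (auto simp: is_state_def psd_def mat_trace_def)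

lemma bij_mixed_radix_3:
  "bij_betw (\<lambda>x. fst x * (d * e) + (fst (snd x) * e + snd (snd x))) ({..<n} \<times> {..<d} \<times> {..<e}) {..<n * d * e :: nat}"
proof -
  have "bij_betw ((\<lambda>x. fst x * (d * e) + snd x) \<circ> map_prod id (\<lambda>x. fst x * e + snd x)) ({..<n} \<times> {..<d} \<times> {..<e}) {..<n * (d * e)}"
    by (intro bij_betw_trans[OF _ bij_betw_mixed_radix] bij_betw_map_prod bij_betw_id bij_betw_mixed_radix)
  then show ?thesis by (simp add: o_def case_prod_beta map_prod_def mult.assoc)
qed

definition state3 :: "nat \<Rightarrow> nat \<Rightarrow> complex mat \<Rightarrow> nat \<times> nat \<times> nat \<Rightarrow> nat \<times> nat \<times> nat \<Rightarrow> complex" where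
  "state3 d e \<omega> x y = \<omega> $$ (fst x * (d * e) + (fst (snd x) * e + snd (snd x)), fst y * (d * e) + (fst (snd y) * e + snd (snd y)))"

lemma state3:
  assumes "is_state (n * d * e) \<omega>"
  shows "psd_on ({..<n} \<times> {..<d} \<times> {..<e}) (state3 d e \<omega>)"
    and "ent ({..<n} \<times> {..<d} \<times> {..<e}) (state3 d e \<omega>) = vn_entropy \<omega>"
    and "(\<Sum>x\<in>{..<n} \<times> {..<d} \<times> {..<e}. state3 d e \<omega> x x) = 1"
proof -
  note \<omega> = is_stateD[OF assms] and bij = bij_mixed_radix_3[of d e n]
  show "psd_on ({..<n} \<times> {..<d} \<times> {..<e}) (state3 d e \<omega>)"
    unfolding state3_def using bij by (intro psd_on_map[OF _ \<omega>(2)]) (auto simp: bij_betw_def)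
  show "ent ({..<n} \<times> {..<d} \<times> {..<e}) (state3 d e \<omega>) = vn_entropy \<omega>"
    unfolding state3_def using ent_reindex[OF bij, of "\<lambda>i j. \<omega> $$ (i, j)"] ent_mat[OF \<omega>(1)] by simp
  show "(\<Sum>x\<in>{..<n} \<times> {..<d} \<times> {..<e}. state3 d e \<omega> x x) = 1"
    unfolding state3_def using sum.reindex_bij_betw[OF bij, of "\<lambda>i. \<omega> $$ (i, i)"] \<omega>(3) by simp
qed

text \<open>Strong subadditivity after moving E between the other two systems. It supplies the
  nonnegative bound that the limiting argument asks for.\<close>

lemma cond_mutual_info_nonneg:
  assumes \<omega>: "is_state (n * d * e) \<omega>"
  shows "0 \<le> cond_mutual_info n d e \<omega>"
proof -
  define \<rho> where "\<rho> = (\<lambda>x y. state3 d e \<omega> (fst (fst x), snd x, snd (fst x)) (fst (fst y), snd y, snd (fst y)))"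
  let ?\<rho>EB = "\<lambda>x y. \<Sum>a<n. \<rho> ((a, fst x), snd x) ((a, fst y), snd y)"
  have "{..<d} \<noteq> {}"
    using state3(3)[OF \<omega>] by (metis Times_empty sum.empty zero_neq_one)
  have f: "bij_betw (\<lambda>x :: (nat \<times> nat) \<times> nat. (fst (fst x), snd x, snd (fst x))) (({..<n} \<times> {..<e}) \<times> {..<d}) ({..<n} \<times> {..<d} \<times> {..<e})"
    by (rule bij_betw_byWitness[where f'="\<lambda>x. ((fst x, snd (snd x)), fst (snd x))"]) auto
  have g: "bij_betw prod.swap ({..<e} \<times> {..<d}) ({..<d} \<times> {..<e})"
    by (rule bij_betw_byWitness[where f'=prod.swap]) auto
  have psd: "psd_on (({..<n} \<times> {..<e}) \<times> {..<d}) \<rho>"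
    unfolding \<rho>_def using f by (intro psd_on_map[OF _ state3(1)[OF \<omega>]]) (auto simp: bij_betw_def)
  have "ent (({..<n} \<times> {..<e}) \<times> {..<d}) \<rho> = vn_entropy \<omega>"
    unfolding \<rho>_def using ent_reindex[OF f, of "state3 d e \<omega>"] by (simp add: state3(2)[OF \<omega>])
  moreover have "ent {..<e} (ptrace {..<d} ?\<rho>EB) = vn_entropy (marginal [n, d, e] [2] \<omega>)"
    unfolding ent_mat[OF marginal_carrier(4)[of n d e \<omega>], symmetric]
    by (rule ent_cong) (auto simp: ptrace_def \<rho>_def state3_def marginal_2 intro: sum.swap)
  moreover have "ent ({..<n} \<times> {..<e}) (ptrace {..<d} \<rho>) = vn_entropy (marginal [n, d, e] [0, 2] \<omega>)"
    unfolding ent_mat_pair[OF marginal_carrier(1)[of n d e \<omega>], symmetric]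
    by (rule ent_cong) (auto simp: ptrace_def \<rho>_def state3_def marginal_02)
  moreover have "ent ({..<e} \<times> {..<d}) ?\<rho>EB = vn_entropy (marginal [n, d, e] [1, 2] \<omega>)"
  proof -
    have "ent ({..<e} \<times> {..<d}) ?\<rho>EB = ent ({..<e} \<times> {..<d}) (\<lambda>x y. (\<lambda>x y. marginal [n, d, e] [1, 2] \<omega> $$ (fst x * e + snd x, fst y * e + snd y)) (prod.swap x) (prod.swap y))"
      by (rule ent_cong) (auto simp: \<rho>_def state3_def marginal_12 simp del: One_nat_def)
    then show ?thesis
      unfolding ent_mat_pair[OF marginal_carrier(2)[of n d e \<omega>], symmetric]
        ent_reindex[OF g finite_cartesian_product[OF finite_lessThan finite_lessThan], symmetric] .
  qed
  ultimately show ?thesis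
    using strong_subadditivity[OF _ _ _ \<open>{..<d} \<noteq> {}\<close> psd] by (simp add: cond_mutual_info_def)
qed

(* The product of \<sigma> on C_A A and \<omega> on C_B B E, indexed by ((b, e), (a, c)), where c is the pair of
   c div n on C_A and c mod n on C_B. *)
definition joint_extension :: "nat \<Rightarrow> nat \<Rightarrow> nat \<Rightarrow> complex mat \<Rightarrow> complex mat \<Rightarrow>
    (nat \<times> nat) \<times> (nat \<times> nat) \<Rightarrow> (nat \<times> nat) \<times> (nat \<times> nat) \<Rightarrow> complex" where
  "joint_extension n d e \<sigma> \<omega> x y =
     \<sigma> $$ (snd (snd x) div n * d + fst (snd x), snd (snd y) div n * d + fst (snd y)) *
     state3 d e \<omega> (snd (snd x) mod n, fst x) (snd (snd y) mod n, fst y)"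

text \<open>The factor \<open>\<sigma>\<close> lies entirely in Y and is uncorrelated with B and E.
  Its entropy occurs once with each sign, so I(Y:B|E) reduces to the conditional mutual information
  of \<omega> alone.\<close>

lemma joint_extension:
  assumes \<sigma>: "is_state (n * d) \<sigma>" and \<omega>: "is_state (n * d * e) \<omega>"
  defines "\<kappa> \<equiv> joint_extension n d e \<sigma> \<omega>" and "E \<equiv> {..<e}" and "Y \<equiv> {..<d} \<times> {..<n * n}"
  shows "psd_on (({..<d} \<times> E) \<times> Y) \<kappa>"
    and "(\<Sum>x\<in>({..<d} \<times> E) \<times> Y. \<kappa> x x) = 1"
    and "ent (E \<times> Y) (\<lambda>x y. \<Sum>b<d. \<kappa> ((b, fst x), snd x) ((b, fst y), snd y)) - ent (({..<d} \<times> E) \<times> Y) \<kappa>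
      + ent ({..<d} \<times> E) (ptrace Y \<kappa>) - ent E (\<lambda>e e'. \<Sum>b<d. ptrace Y \<kappa> (b, e) (b, e')) = cond_mutual_info n d e \<omega>"
proof -
  define s where "s = (\<lambda>x y. \<sigma> $$ (fst x * d + snd x, fst y * d + snd y))"
  define m where "m = (\<lambda>x y. marginal [n, d, e] [0, 2] \<omega> $$ (fst x * e + snd x, fst y * e + snd y))"
  define f where "f = (\<lambda>x :: (nat \<times> nat) \<times> (nat \<times> nat). ((snd (snd x) div n, fst (snd x)), (snd (snd x) mod n, fst x)))"
  define g where "g = (\<lambda>x :: nat \<times> (nat \<times> nat). ((snd (snd x) div n, fst (snd x)), (snd (snd x) mod n, fst x)))"
  have div_mod: "c div n < n" "c mod n < n" if "c < n * n" for c
  proof -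
    have "n > 0" using that by (cases n) auto
    then show "c div n < n" "c mod n < n" using that by (simp_all add: less_mult_imp_div_less)
  qed
  have f: "bij_betw f (({..<d} \<times> E) \<times> Y) (({..<n} \<times> {..<d}) \<times> ({..<n} \<times> ({..<d} \<times> E)))"
    by (rule bij_betw_byWitness[where f'="\<lambda>x. (snd (snd x), (snd (fst x), fst (fst x) * n + fst (snd x)))"])
      (auto simp: f_def E_def Y_def div_mod mixed_radix_less)
  have g: "bij_betw g (E \<times> Y) (({..<n} \<times> {..<d}) \<times> ({..<n} \<times> E))"
    by (rule bij_betw_byWitness[where f'="\<lambda>x. (snd (snd x), (snd (fst x), fst (fst x) * n + fst (snd x)))"])
      (auto simp: g_def E_def Y_def div_mod mixed_radix_less)
  have \<kappa>: "\<kappa> = (\<lambda>x y. s (fst (f x)) (fst (f y)) * state3 d e \<omega> (snd (f x)) (snd (f y)))"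
    by (simp add: \<kappa>_def joint_extension_def s_def f_def fun_eq_iff)
  note \<sigma>' = is_stateD[OF \<sigma>] and w = state3[OF \<omega>]
  have s: "psd_on ({..<n} \<times> {..<d}) s" "ent ({..<n} \<times> {..<d}) s = vn_entropy \<sigma>" "(\<Sum>x\<in>{..<n} \<times> {..<d}. s x x) = 1"
  proof -
    show "psd_on ({..<n} \<times> {..<d}) s"
      unfolding s_def using bij_betw_mixed_radix[of d n] by (intro psd_on_map[OF _ \<sigma>'(2)]) (auto simp: bij_betw_def)
    show "ent ({..<n} \<times> {..<d}) s = vn_entropy \<sigma>" unfolding s_def by (rule ent_mat_pair[OF \<sigma>'(1)])
    show "(\<Sum>x\<in>{..<n} \<times> {..<d}. s x x) = 1"
      using \<sigma>'(3) by (simp add: s_def sum_mixed_radix sum.cartesian_product')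
  qed
  have m: "psd_on ({..<n} \<times> E) m" "ent ({..<n} \<times> E) m = vn_entropy (marginal [n, d, e] [0, 2] \<omega>)" "(\<Sum>x\<in>{..<n} \<times> E. m x x) = 1"
  proof -
    have m_eq: "m x y = (\<Sum>b<d. state3 d e \<omega> (fst x, b, snd x) (fst y, b, snd y))"
      if "x \<in> {..<n} \<times> E" "y \<in> {..<n} \<times> E" for x y
      using that by (auto simp: m_def E_def state3_def marginal_02)
    have "psd_on ({..<n} \<times> E) (\<lambda>x y. \<Sum>b<d. state3 d e \<omega> (fst x, b, snd x) (fst y, b, snd y))"
      by (intro psd_on_sum psd_on_map[OF _ w(1)]) (auto simp: E_def)
    also have "?this \<longleftrightarrow> psd_on ({..<n} \<times> E) m" by (rule psd_on_cong) (simp only: m_eq)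
    finally show "psd_on ({..<n} \<times> E) m" .
    show "ent ({..<n} \<times> E) m = vn_entropy (marginal [n, d, e] [0, 2] \<omega>)"
      unfolding m_def E_def by (rule ent_mat_pair[OF marginal_carrier(1)])
    have "(\<Sum>x\<in>{..<n} \<times> E. m x x) = (\<Sum>c<n. \<Sum>k<e. \<Sum>b<d. state3 d e \<omega> (c, b, k) (c, b, k))"
      by (simp add: m_eq sum.cartesian_product' E_def)
    also have "\<dots> = (\<Sum>c<n. \<Sum>b<d. \<Sum>k<e. state3 d e \<omega> (c, b, k) (c, b, k))"
      by (intro sum.cong refl sum.swap)
    also have "\<dots> = 1" using w(3) by (simp add: sum.cartesian_product')
    finally show "(\<Sum>x\<in>{..<n} \<times> E. m x x) = 1" .
  qed
  have "psd_on (({..<n} \<times> {..<d}) \<times> ({..<n} \<times> {..<d} \<times> E)) (\<lambda>x y. s (fst x) (fst y) * state3 d e \<omega> (snd x) (snd y))"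
    by (rule psd_on_tensor) (use s w in \<open>auto simp: E_def\<close>)
  from psd_on_map[OF _ this, of f] show "psd_on (({..<d} \<times> E) \<times> Y) \<kappa>"
    unfolding \<kappa> using f by (auto simp: bij_betw_def E_def)
  have "(\<Sum>x\<in>({..<d} \<times> E) \<times> Y. \<kappa> x x) =
    (\<Sum>x\<in>({..<n} \<times> {..<d}) \<times> ({..<n} \<times> {..<d} \<times> E). s (fst x) (fst x) * state3 d e \<omega> (snd x) (snd x))"
    unfolding \<kappa> by (rule sum.reindex_bij_betw[OF f])
  also have "\<dots> = (\<Sum>x\<in>{..<n} \<times> {..<d}. s x x) * (\<Sum>x\<in>{..<n} \<times> {..<d} \<times> E. state3 d e \<omega> x x)"
    unfolding sum_product by (simp only: sum.cartesian_product' fst_conv snd_conv)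
  also have "\<dots> = 1" using s w by (simp add: E_def)
  finally show "(\<Sum>x\<in>({..<d} \<times> E) \<times> Y. \<kappa> x x) = 1" .
  have e0: "ent (({..<d} \<times> E) \<times> Y) \<kappa> = vn_entropy \<omega> + vn_entropy \<sigma>"
  proof -
    have "ent (({..<d} \<times> E) \<times> Y) \<kappa> = ent (({..<n} \<times> {..<d}) \<times> ({..<n} \<times> {..<d} \<times> E)) (\<lambda>x y. s (fst x) (fst y) * state3 d e \<omega> (snd x) (snd y))"
      unfolding \<kappa> by (rule ent_reindex[OF f]) (simp add: E_def)
    also have "\<dots> = vn_entropy \<omega> + vn_entropy \<sigma>"
      by (subst ent_tensor) (use s w in \<open>auto simp: E_def\<close>)
    finally show ?thesis .
  qed
  have e1: "ent (E \<times> Y) (\<lambda>x y. \<Sum>b<d. \<kappa> ((b, fst x), snd x) ((b, fst y), snd y)) =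
      vn_entropy (marginal [n, d, e] [0, 2] \<omega>) + vn_entropy \<sigma>"
  proof -
    have "ent (E \<times> Y) (\<lambda>x y. \<Sum>b<d. \<kappa> ((b, fst x), snd x) ((b, fst y), snd y)) =
       ent (E \<times> Y) (\<lambda>x y. s (fst (g x)) (fst (g y)) * m (snd (g x)) (snd (g y)))"
      by (rule ent_cong) (auto simp: E_def Y_def \<kappa> f_def g_def m_def state3_def marginal_02 div_mod sum_distrib_left)
    also have "\<dots> = ent (({..<n} \<times> {..<d}) \<times> ({..<n} \<times> E)) (\<lambda>x y. s (fst x) (fst y) * m (snd x) (snd y))"
      by (rule ent_reindex[OF g]) (simp add: E_def)
    also have "\<dots> = vn_entropy (marginal [n, d, e] [0, 2] \<omega>) + vn_entropy \<sigma>"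
      by (subst ent_tensor) (use s m in \<open>auto simp: E_def\<close>)
    finally show ?thesis .
  qed
  have ptr: "ptrace Y \<kappa> (b, k) (b', k') = (\<Sum>c<n. state3 d e \<omega> (c, b, k) (c, b', k'))" for b k b' k'
  proof -
    have "ptrace Y \<kappa> (b, k) (b', k') = (\<Sum>a<d. \<Sum>c1<n. \<Sum>c2<n. s (c1, a) (c1, a) * state3 d e \<omega> (c2, b, k) (c2, b', k'))"
      unfolding ptrace_def Y_def \<kappa> by (simp add: f_def sum.cartesian_product' sum_mixed_radix cong: sum.cong_simp)
    also have "\<dots> = (\<Sum>a<d. \<Sum>c1<n. s (c1, a) (c1, a)) * (\<Sum>c2<n. state3 d e \<omega> (c2, b, k) (c2, b', k'))"
      by (simp only: sum_distrib_left[symmetric] sum_distrib_right[symmetric])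
    also have "(\<Sum>a<d. \<Sum>c1<n. s (c1, a) (c1, a)) = 1"
      using s(3) by (subst sum.swap) (simp add: sum.cartesian_product')
    finally show ?thesis by simp
  qed
  have e2: "ent ({..<d} \<times> E) (ptrace Y \<kappa>) = vn_entropy (marginal [n, d, e] [1, 2] \<omega>)"
    unfolding ent_mat_pair[OF marginal_carrier(2)[of n d e \<omega>], symmetric] E_def
    by (rule ent_cong) (auto simp: ptr state3_def marginal_12 simp del: One_nat_def)
  have e3: "ent E (\<lambda>e e'. \<Sum>b<d. ptrace Y \<kappa> (b, e) (b, e')) = vn_entropy (marginal [n, d, e] [2] \<omega>)"
    unfolding ent_mat[OF marginal_carrier(4)[of n d e \<omega>], symmetric] E_def
    by (rule ent_cong) (auto simp: ptr state3_def marginal_2 intro: sum.swap)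
  show "ent (E \<times> Y) (\<lambda>x y. \<Sum>b<d. \<kappa> ((b, fst x), snd x) ((b, fst y), snd y)) - ent (({..<d} \<times> E) \<times> Y) \<kappa>
      + ent ({..<d} \<times> E) (ptrace Y \<kappa>) - ent E (\<lambda>e e'. \<Sum>b<d. ptrace Y \<kappa> (b, e) (b, e')) = cond_mutual_info n d e \<omega>"
    unfolding e0 e1 e2 e3 by (simp add: cond_mutual_info_def)
qed

lemma permute_systems_swap_index:
  assumes "a < d" "a' < d" "c < n" "c' < n"
  shows "permute_systems [n, d] [1, 0] \<rho> $$ (a * n + c, a' * n + c') = \<rho> $$ (c * d + a, c' * d + a')"
  using permute_systems_index[of "[n, d]" "[1, 0]" "[a, c]" "[a', c']" \<rho>] assms
  by (simp add: numeral_2_eq_2)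

lemma partial_transpose_fst_index:
  assumes "c < n" "c' < n" "a < d" "a' < d"
  shows "partial_transpose_fst n d \<rho> $$ (c * d + a, c' * d + a') = \<rho> $$ (c' * d + a, c * d + a')"
  using assms by (simp add: partial_transpose_fst_def mixed_radix_less)

text \<open>Charlie's number has one digit for each of his two systems, so exchanging
  \<open>c\<close> and \<open>c'\<close> transposes both systems at once. This undoes the two
  partial transposes and leaves the original states.\<close>

lemma joint_extension_extends:
  assumes \<rho>: "\<rho> \<in> carrier_mat (n * d) (n * d)" and ext: "marginal [n, d, e] [0, 1] \<omega> = partial_transpose_fst n d \<rho>"
    and h: "a < d" "c < n * n" "b < d" "a' < d" "c' < n * n" "b' < d"
  shows "(\<Sum>k<e. joint_extension n d e (partial_transpose_fst n d \<rho>) \<omega> ((b, k), (a, c)) ((b', k), (a', c'))) =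
    (permute_systems [n, d] [1, 0] \<rho> \<otimes>\<^sub>m \<rho>) $$ (a * (n * n * d) + (c' * d + b), a' * (n * n * d) + (c * d + b'))"
proof -
  have n: "n > 0" using h(2) by (cases n) auto
  obtain c1 c2 where c: "c = c1 * n + c2" "c1 < n" "c2 < n"
    using h(2) n by (metis div_mod_decomp less_mult_imp_div_less mod_less_divisor)
  obtain c1' c2' where c': "c' = c1' * n + c2'" "c1' < n" "c2' < n"
    using h(5) n by (metis div_mod_decomp less_mult_imp_div_less mod_less_divisor)
  have "(\<Sum>k<e. joint_extension n d e (partial_transpose_fst n d \<rho>) \<omega> ((b, k), (a, c)) ((b', k), (a', c'))) =
     partial_transpose_fst n d \<rho> $$ (c1 * d + a, c1' * d + a') * marginal [n, d, e] [0, 1] \<omega> $$ (c2 * d + b, c2' * d + b')"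
    using c c' h by (simp add: joint_extension_def state3_def marginal_01 sum_distrib_left del: One_nat_def)
  also have "\<dots> = \<rho> $$ (c1' * d + a, c1 * d + a') * \<rho> $$ (c2' * d + b, c2 * d + b')"
    unfolding ext using c c' h by (simp add: partial_transpose_fst_index)
  also have "\<dots> = permute_systems [n, d] [1, 0] \<rho> $$ (a * n + c1', a' * n + c1) * \<rho> $$ (c2' * d + b, c2 * d + b')"
    using c c' h by (simp add: permute_systems_swap_index del: One_nat_def)
  also have "\<dots> = (permute_systems [n, d] [1, 0] \<rho> \<otimes>\<^sub>m \<rho>) $$
      ((a * n + c1') * dim_row \<rho> + (c2' * d + b), (a' * n + c1) * dim_col \<rho> + (c2 * d + b'))"
    using \<rho> c c' h permute_systems_carrier[of "[n, d]" "[1, 0]" \<rho>]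
      mixed_radix_less[of a d c1' n, unfolded mult.commute[of d n]] mixed_radix_less[of a' d c1 n, unfolded mult.commute[of d n]]
    by (intro kron_index[symmetric]) (auto simp: mixed_radix_less)
  also have "(a * n + c1') * dim_row \<rho> + (c2' * d + b) = a * (n * n * d) + (c' * d + b)"
    using \<rho> by (simp add: c' algebra_simps)
  also have "(a' * n + c1) * dim_col \<rho> + (c2 * d + b') = a' * (n * n * d) + (c * d + b')"
    using \<rho> by (simp add: c algebra_simps)
  finally show ?thesis .
qed

theorem key_distillable_le_cond_mutual_info:
  assumes \<rho>: "is_PPT_state n d \<rho>" and \<omega>: "is_state (n * d * e) \<omega>"
    and ext: "marginal [n, d, e] [0, 1] \<omega> = partial_transpose_fst n d \<rho>"
    and key: "key_distillable d (n * n) d (permute_systems [n, d] [1, 0] \<rho> \<otimes>\<^sub>m \<rho>) \<epsilon> k m"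
  shows "(1 - 7 * \<epsilon>) * real m - 4 \<le> real k * cond_mutual_info n d e \<omega>"
proof -
  have car: "\<rho> \<in> carrier_mat (n * d) (n * d)" using \<rho> by (simp add: is_PPT_state_def is_state_def psd_def)
  \<comment> \<open>The PPT property gives positivity, and the trace is kept because a partial
    transpose fixes the diagonal.\<close>
  have \<sigma>: "is_state (n * d) (partial_transpose_fst n d \<rho>)"
  proof -
    have "mat_trace (partial_transpose_fst n d \<rho>) = (\<Sum>i<n * d. \<rho> $$ (i, i))"
      by (simp add: mat_trace_def partial_transpose_fst_def)
    also have "\<dots> = 1" using is_stateD(3)[of "n * d" \<rho>] \<rho> by (simp add: is_PPT_state_def)
    finally show ?thesis using \<rho> by (simp add: is_PPT_state_def is_state_def)
  qed
  have X: "permute_systems [n, d] [1, 0] \<rho> \<otimes>\<^sub>m \<rho> \<in> carrier_mat (d * ((n * n) * d)) (d * ((n * n) * d))"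
    using car permute_systems_carrier[of "[n, d]" "[1, 0]" \<rho>] by (intro carrier_matI) (auto simp: mult_ac)
  show ?thesis
    using key_distillable_bound[OF key X finite_lessThan joint_extension(1)[OF \<sigma> \<omega>] joint_extension(2)[OF \<sigma> \<omega>]
        joint_extension_extends[OF car ext]]
    unfolding joint_extension(3)[OF \<sigma> \<omega>] .
qed

text \<open>The additive constant vanishes after division by \<open>n\<close>, and the factor
  \<open>1 - 7 * \<epsilon>\<close> is removed by the infimum over \<epsilon>.\<close>

lemma key_repeater_rate_le:
  assumes v: "0 \<le> v" and key: "\<And>\<epsilon> n m. key_distillable dA dC dB \<rho> \<epsilon> n m \<Longrightarrow> (1 - 7 * \<epsilon>) * real m - 4 \<le> real n * v"
  shows "key_repeater_rate dA dC dB \<rho> \<le> ereal v"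
proof (rule ereal_le_epsilon2)
  fix \<delta> :: real assume \<delta>: "0 < \<delta>"
  \<comment> \<open>With this choice (v + \<delta>)(1 - 7 \<epsilon>) = v + \<delta>/2, which
    exceeds v, and 1 - 7 \<epsilon> is at least 1/2.\<close>
  define \<epsilon> where "\<epsilon> = \<delta> / (14 * (v + \<delta>))"
  have \<epsilon>: "0 < \<epsilon>" using v \<delta> by (simp add: \<epsilon>_def)
  have "\<epsilon> \<le> 1 / 14" using v \<delta> by (simp add: \<epsilon>_def field_simps)
  then have pos: "0 < 1 - 7 * \<epsilon>" by simp
  have le: "v / (1 - 7 * \<epsilon>) \<le> v + \<delta>"
  proof -
    have "v \<le> (v + \<delta>) * (1 - 7 * \<epsilon>)" using v \<delta> by (simp add: \<epsilon>_def field_simps)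
    then show ?thesis using pos by (simp add: pos_divide_le_eq)
  qed
  have "key_repeater_rate dA dC dB \<rho> \<le> limsup (\<lambda>n. Sup {ereal (real m / real n) | m. key_distillable dA dC dB \<rho> \<epsilon> n m})"
    unfolding key_repeater_rate_def using \<epsilon> by (intro INF_lower) simp
  also have "\<dots> \<le> limsup (\<lambda>n. ereal ((v + 4 / real n) / (1 - 7 * \<epsilon>)))"
  proof (rule Limsup_mono, rule eventually_sequentiallyI[of 1], rule Sup_least, clarify)
    fix n m assume n: "1 \<le> n" and "key_distillable dA dC dB \<rho> \<epsilon> n m"
    from key[OF this(2)] have "(1 - 7 * \<epsilon>) * real m \<le> real n * v + 4" by simp
    then have "real m \<le> (real n * v + 4) / (1 - 7 * \<epsilon>)" using pos by (simp add: pos_le_divide_eq mult.commute)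
    then have "real m / real n \<le> (real n * v + 4) / (1 - 7 * \<epsilon>) / real n" by (rule divide_right_mono) simp
    also have "\<dots> = (v + 4 / real n) / (1 - 7 * \<epsilon>)" using n by (simp add: field_simps)
    finally show "ereal (real m / real n) \<le> ereal ((v + 4 / real n) / (1 - 7 * \<epsilon>))" by simp
  qed
  also have "\<dots> = ereal (v / (1 - 7 * \<epsilon>))"
  proof (rule lim_imp_Limsup)
    have "(\<lambda>n. (v + 4 / real n) / (1 - 7 * \<epsilon>)) \<longlonglongrightarrow> (v + 0) / (1 - 7 * \<epsilon>)"
      using pos by (intro tendsto_intros lim_const_over_n) auto
    then show "(\<lambda>n. ereal ((v + 4 / real n) / (1 - 7 * \<epsilon>))) \<longlonglongrightarrow> ereal (v / (1 - 7 * \<epsilon>))" by simp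
  qed simp
  also have "\<dots> \<le> ereal v + ereal \<delta>" using le by simp
  finally show "key_repeater_rate dA dC dB \<rho> \<le> ereal v + ereal \<delta>" .
qed

theorem corollary11:
  fixes \<rho> :: "complex mat" and dC dX :: nat
  assumes "is_PPT_state dC dX \<rho>"
  shows "key_repeater_rate dX (dC * dC) dX (permute_systems [dC, dX] [1, 0] \<rho> \<otimes>\<^sub>m \<rho>)
           \<le> 4 * squashed_entanglement dC dX (partial_transpose_fst dC dX \<rho>)"
proof -
  let ?K = "key_repeater_rate dX (dC * dC) dX (permute_systems [dC, dX] [1, 0] \<rho> \<otimes>\<^sub>m \<rho>)"
  \<comment> \<open>With the factor 4 moved to the rate, the bound is a plain lower bound on every
    member of the set whose infimum is taken.\<close>
  have "?K / 4 \<le> ereal (1/2 * cond_mutual_info dC dX dE \<omega>)"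
    if \<omega>: "is_state (dC * dX * dE) \<omega>" and ext: "marginal [dC, dX, dE] [0, 1] \<omega> = partial_transpose_fst dC dX \<rho>" for dE \<omega>
  proof -
    let ?v = "cond_mutual_info dC dX dE \<omega>"
    have v: "0 \<le> ?v" by (rule cond_mutual_info_nonneg[OF \<omega>])
    have "?K \<le> ereal ?v"
      using key_distillable_le_cond_mutual_info[OF assms \<omega> ext] by (rule key_repeater_rate_le[OF v])
    \<comment> \<open>The infimum runs over half of \<open>?v\<close>, so factor 2 would suffice for
      equality; the remaining factor 2 is covered by \<open>0 \<le> ?v\<close>.\<close>
    also have "\<dots> \<le> 4 * ereal (1/2 * ?v)" using v by simp
    finally show ?thesis by (simp add: ereal_divide_le_pos)
  qed
  then have "?K / 4 \<le> squashed_entanglement dC dX (partial_transpose_fst dC dX \<rho>)"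
    unfolding squashed_entanglement_def by (intro Inf_greatest) auto
  then show ?thesis by (simp add: ereal_divide_le_pos)
qed

end
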